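(* There is no toric Fano manifold $X$ of dimension $n\le 4$ whose Mabuchi constant satisfies $M_X=1$. Hence for each toric Fano $n$-fold $X$ (smooth) with $n\le 4$, $X$ is relatively Ding stable if and only if $X$ is uniformly relatively Ding stable.
   Context: A Fano polytope is an $n$-dimensional lattice polytope $P\subset\mathbf{R}^n$ (lattice $\mathbf{Z}^n$) that is Delzant, contains the origin in its interior, and is reflexive, i.e. its dual $P^\vee=\{y\in\mathbf{R}^n\mid \langle x,y\rangle\ge -1 \text{ for all } x\in P\}$ is again a lattice polytope. Isomorphism classes of Fano polytopes (under the action of $GL(n,\mathbf{Z})$) correspond bijectively to isomorphism classes of $n$-dimensional toric Fano manifolds $X_P$ with the anticanonical polarization; $P$ is the moment polytope of $(X_P,-K_{X_P})$. Let $\mathrm{vol}(P)=\int_P dx$ (Lebesgue measure). The potential function $\theta_P$ of the extremal K\"ahler vector field is the unique affine function on $\mathbf{R}^n$ with $\int_P\theta_P\,dx=0$ and $\int_P x_i(1-\theta_P(x))\,dx=0$ for $i=1,\dots,n$. Mabuchi constant: for a Fano manifold $X$ with maximal algebraic torus $T\subset\mathrm{Aut}^0(X)$ and maximal compact torus $S$ of $T$, it is $M_X=\max_X\mathrm{pr}_\omega(1-e^{F_\omega})$, where $\omega$ is any $S$-invariant K\"ahler form in $c_1(X)$, $F_\omega$ is its Ricci potential ($\mathrm{Ric}(\omega)-\omega=\frac{\sqrt{-1}}{2\pi}\partial\overline{\partial}F_\omega$, $\int_X(1-e^{F_\omega})\omega^n=0$), and $\mathrm{pr}_\omega$ is the $L^2$-orthogonal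 projection from $S$-invariant real functions onto the space of functions $\phi$ with $\int_X\phi\,\omega^n=0$ whose Hamiltonian vector field lies in $\mathrm{Lie}(S)$; it does not depend on $\omega$. For a toric Fano manifold $X=X_P$ it is given by $M_{X_P}=\max_P\theta_P$. A rational PL convex function on $P$ is a convex function $f\colon P\to\mathbf{R}$ of the form $f=\max\{\ell_1,\dots,\ell_m\}$ with each $\ell_k$ a rational affine function. For such $f$ put $$D_v^{NA}(f)=-f(0)+\frac{1}{\mathrm{vol}(P)}\int_P f(x)(1-\theta_P(x))\,dx,$$ $$J_T^{NA}(f)=\inf_{\ell}\left(\frac{1}{\mathrm{vol}(P)}\int_P(f(x)+\ell(x))\,dx-\min_P(f+\ell)\right),$$ where $\ell$ runs over all affine functions on $\mathbf{R}^n$. The toric Fano manifold $X=X_P$ is: - relatively Ding semistable if $D_v^{NA}(f)\ge 0$ for every rational PL convex function $f$ on $P$; - relatively Ding stable if it is relatively Ding semistable and, for rational PL convex $f$, $D_v^{NA}(f)=0$ if and only if $f$ is affine; - uniformly relatively Ding stable if there exists $\delta>0$ such that $D_v^{NA}(f)\ge\delta J_T^{NA}(f)$ for every rational PL convex function $f$ on $P$. *)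

theory Defs
  imports "HOL-Analysis.Analysis"
begin

section \<open>Lattice polytopes and Fano polytopes\<close>

definition int_lattice :: "(real ^ 'n) set" where
  "int_lattice = {x. \<forall>i. x $ i \<in> \<int>}"

definition lattice_basis :: "('n::finite \<Rightarrow> real ^ 'n) \<Rightarrow> bool" where
  "lattice_basis u \<longleftrightarrow>
     range u \<subseteq> int_lattice \<and>
     (\<forall>w \<in> int_lattice. \<exists>!c :: 'n \<Rightarrow> int. w = (\<Sum>i\<in>UNIV. of_int (c i) *\<^sub>R u i))"

definition lattice_polytope :: "(real ^ 'n) set \<Rightarrow> bool" where
  "lattice_polytope P \<longleftrightarrow> (\<exists>V. finite V \<and> V \<subseteq> int_lattice \<and> P = convex hull V)"

text \<open>
  At every vertex there are exactly \<open>n\<close> edges, and these are generated by the members of a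
  \<open>\<int>\<close>-basis of the lattice. (Members of a lattice basis are automatically primitive and pairwise
  non-parallel, so the edges listed on the right-hand side are pairwise distinct.)
\<close>
definition delzant :: "(real ^ 'n::finite) set \<Rightarrow> bool" where
  "delzant P \<longleftrightarrow>
     (\<forall>v. v extreme_point_of P \<longrightarrow>
       (\<exists>u t. lattice_basis u \<and> (\<forall>i. t i > 0) \<and>
          {E. E edge_of P \<and> v \<in> E} = range (\<lambda>i. closed_segment v (v + t i *\<^sub>R u i))))"

definition dual_polytope :: "(real ^ 'n::finite) set \<Rightarrow> (real ^ 'n) set" where
  "dual_polytope P = {y. \<forall>x\<in>P. x \<bullet> y \<ge> -1}"

text \<open>
  Fano polytopes stand for toric Fano manifolds with their anticanonical polarization:
  \<open>P\<close> is the moment polytope of \<open>(X\<^sub>P, -K)\<close>. Full-dimensionality is implied by the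
  origin being an interior point.
\<close>
definition fano_polytope :: "(real ^ 'n::finite) set \<Rightarrow> bool" where
  "fano_polytope P \<longleftrightarrow>
     lattice_polytope P \<and> delzant P \<and> 0 \<in> interior P \<and> lattice_polytope (dual_polytope P)"

section \<open>The extremal potential and the Mabuchi constant\<close>

definition affine_fun :: "(real ^ 'n::finite \<Rightarrow> real) \<Rightarrow> bool" where
  "affine_fun l \<longleftrightarrow> (\<exists>a b. l = (\<lambda>x. a \<bullet> x + b))"

definition rational_affine_fun :: "(real ^ 'n::finite \<Rightarrow> real) \<Rightarrow> bool" where
  "rational_affine_fun l \<longleftrightarrow>
     (\<exists>a b. (\<forall>i. a $ i \<in> \<rat>) \<and> b \<in> \<rat> \<and> l = (\<lambda>x. a \<bullet> x + b))"

definition vol :: "(real ^ 'n::finite) set \<Rightarrow> real" where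
  "vol P = measure lborel P"

definition extremal_potential :: "(real ^ 'n::finite) set \<Rightarrow> real ^ 'n \<Rightarrow> real" where
  "extremal_potential P =
     (THE \<theta>. affine_fun \<theta> \<and> (LINT x:P|lborel. \<theta> x) = 0 \<and>
        (\<forall>i. (LINT x:P|lborel. x $ i * (1 - \<theta> x)) = 0))"

text \<open>
  For a toric Fano manifold the Mabuchi constant is the maximum of the extremal potential on
  the moment polytope; the supremum is attained, as \<open>P\<close> is compact.
\<close>
definition mabuchi_constant :: "(real ^ 'n::finite) set \<Rightarrow> real" where
  "mabuchi_constant P = (SUP x\<in>P. extremal_potential P x)"

section \<open>Relative Ding stability\<close>

text \<open>
  Functions on \<open>P\<close> are represented by total functions of which only the values on \<open>P\<close> matter.
\<close>
definition rational_PL_convex :: "(real ^ 'n::finite) set \<Rightarrow> (real ^ 'n \<Rightarrow> real) \<Rightarrow> bool" where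
  "rational_PL_convex P f \<longleftrightarrow>
     convex_on P f \<and>
     (\<exists>L. finite L \<and> L \<noteq> {} \<and> (\<forall>l\<in>L. rational_affine_fun l) \<and>
        (\<forall>x\<in>P. f x = Max ((\<lambda>l. l x) ` L)))"

definition affine_fun_on :: "(real ^ 'n::finite) set \<Rightarrow> (real ^ 'n \<Rightarrow> real) \<Rightarrow> bool" where
  "affine_fun_on P f \<longleftrightarrow> (\<exists>l. affine_fun l \<and> (\<forall>x\<in>P. f x = l x))"

definition D_NA :: "(real ^ 'n::finite) set \<Rightarrow> (real ^ 'n \<Rightarrow> real) \<Rightarrow> real" where
  "D_NA P f = - f 0 + 1 / vol P * (LINT x:P|lborel. f x * (1 - extremal_potential P x))"

text \<open>
  The infimum over affine functions is over a set of reals bounded below by \<open>0\<close> (an average is at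
  least the minimum), and the inner infimum is a minimum.
\<close>
definition J_NA :: "(real ^ 'n::finite) set \<Rightarrow> (real ^ 'n \<Rightarrow> real) \<Rightarrow> real" where
  "J_NA P f =
     (INF l\<in>{l. affine_fun l}.
        1 / vol P * (LINT x:P|lborel. f x + l x) - (INF x\<in>P. f x + l x))"

definition relatively_Ding_semistable :: "(real ^ 'n::finite) set \<Rightarrow> bool" where
  "relatively_Ding_semistable P \<longleftrightarrow> (\<forall>f. rational_PL_convex P f \<longrightarrow> D_NA P f \<ge> 0)"

definition relatively_Ding_stable :: "(real ^ 'n::finite) set \<Rightarrow> bool" where
  "relatively_Ding_stable P \<longleftrightarrow>
     relatively_Ding_semistable P \<and>
     (\<forall>f. rational_PL_convex P f \<longrightarrow> (D_NA P f = 0 \<longleftrightarrow> affine_fun_on P f))"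

definition uniformly_relatively_Ding_stable :: "(real ^ 'n::finite) set \<Rightarrow> bool" where
  "uniformly_relatively_Ding_stable P \<longleftrightarrow>
     (\<exists>\<delta>>0. \<forall>f. rational_PL_convex P f \<longrightarrow> D_NA P f \<ge> \<delta> * J_NA P f)"

end

theory Submission
  imports Defs "HOL-Library.List_Lexorder"
begin

text \<open>
  A Fano polytope \<open>P\<close> has Mabuchi constant 1 iff the affine function \<open>g = 1 - \<theta>\<close> is nonnegative on \<open>P\<close>
  and vanishes at a vertex; as \<open>g\<close> is determined up to a factor by its moments, which are integral after
  scaling, this is a finite linear algebra test for each polytope. In coordinates adapted to a vertex
  that minimizes the sum of the facet normals, the normals are integer vectors whose sum has
  nonnegative coordinates, the level \<open>-\<Sigma> w\<^sub>i\<close> of a normal \<open>w\<close> is at least \<open>-1\<close>, and it equals \<open>-1\<close> only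
  for the normals at the vertex itself, so that only finitely many normals occur. All smooth Fano
  polytopes of dimension at most four are found by growing the vertex set across one open ridge at a
  time, and the moments are computed from a pulling triangulation.

  Away from Mabuchi constant 1, testing semistability against a rational approximation of \<open>max 0 (-g)\<close>
  shows that \<open>g\<close> is bounded below by a positive constant, and subtracting from a convex function an
  affine function that supports it at the origin turns \<open>D\<close> into an average against \<open>g\<close>.
\<close>

section \<open>The search algorithm\<close>

text \<open>The n normals at the special vertex contribute n to the sum of all entries, which is
  nonnegative, so the levels of the other normals add up to at most n. The far end of edge j bounds
  entry j of every normal off the special vertex that does not enter across that edge. Off the star
  all entries are therefore at least minus the level, hence at most n - 2 times the level; this is
  the origin of \<open>m\<close>, the rate at which unspent level can still raise a coordinate. No
  classification is proved. For a given polytope, soundness needs one branch of the search that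
  never leaves it, and a pruning rule is justified by showing that this branch survives it. Branches
  that belong to no polytope do no harm as long as their checks succeed too. Sorting exploits the
  freedom in enumerating the edges at the special vertex. The check requires g to be nonzero at
  every vertex, so it never decides a sign. Moments enter through a homogeneous system only, so the
  constant in the simplex integrals has to be positive but is never evaluated.\<close>

text \<open>
  The program runs by rewriting, where conditional expressions are expensive; it therefore branches
  with auxiliary functions that match on Booleans.
\<close>

fun dot :: "int list \<Rightarrow> int list \<Rightarrow> int" where
  "dot (a # x) (b # y) = a * b + dot x y"
| "dot [] y = 0"
| "dot (a # x) [] = 0"

fun vadd :: "int list \<Rightarrow> int list \<Rightarrow> int list" where
  "vadd (a # x) (b # y) = (a + b) # vadd x y"
| "vadd [] y = []"
| "vadd (a # x) [] = []"

fun axpy :: "int \<Rightarrow> int list \<Rightarrow> int list \<Rightarrow> int list" where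
  "axpy c (a # x) (b # y) = (c * a + b) # axpy c x y"
| "axpy c [] y = []"
| "axpy c (a # x) [] = []"

fun vneg :: "int list \<Rightarrow> int list" where
  "vneg [] = []"
| "vneg (a # x) = (- a) # vneg x"

fun smul :: "int \<Rightarrow> int list \<Rightarrow> int list" where
  "smul c [] = []"
| "smul c (a # x) = (c * a) # smul c x"

fun vsum :: "int list \<Rightarrow> int" where
  "vsum [] = 0"
| "vsum (a # x) = a + vsum x"

fun zeros :: "int list \<Rightarrow> int list" where
  "zeros [] = []"
| "zeros (a # x) = 0 # zeros x"

fun app :: "'a list \<Rightarrow> 'a list \<Rightarrow> 'a list" where
  "app [] ys = ys"
| "app (x # xs) ys = x # app xs ys"

fun both :: "bool \<Rightarrow> bool \<Rightarrow> bool" where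
  "both True b = b"
| "both False b = False"

fun either :: "bool \<Rightarrow> bool \<Rightarrow> bool" where
  "either True b = True"
| "either False b = b"

fun cons_if :: "bool \<Rightarrow> 'a \<Rightarrow> 'a list \<Rightarrow> 'a list" where
  "cons_if True x xs = x # xs"
| "cons_if False x xs = xs"

fun mem :: "int \<Rightarrow> int list \<Rightarrow> bool" where
  "mem i [] = False"
| "mem i (j # js) = either (i = j) (mem i js)"

fun leq :: "int list \<Rightarrow> int list \<Rightarrow> bool" where
  "leq [] [] = True"
| "leq (a # x) (b # y) = both (a = b) (leq x y)"
| "leq [] (b # y) = False"
| "leq (a # x) [] = False"

fun has :: "int list \<Rightarrow> int list list \<Rightarrow> bool" where
  "has r [] = False"
| "has r (r' # ks) = either (leq r r') (has r ks)"

fun toggle_if :: "bool \<Rightarrow> int list \<Rightarrow> int list list \<Rightarrow> int list list \<Rightarrow> int list list" where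
  "toggle_if True r ks ks' = ks"
| "toggle_if False r ks ks' = r # ks'"

text \<open>A ridge lies on two vertices, so keeping track of the open ones amounts to a symmetric
  difference: the second occurrence cancels the first.\<close>

fun toggle :: "int list \<Rightarrow> int list list \<Rightarrow> int list list" where
  "toggle r [] = [r]"
| "toggle r (r' # ks) = toggle_if (leq r r') r' ks (toggle r ks)"

fun toggles :: "int list list \<Rightarrow> int list list \<Rightarrow> int list list" where
  "toggles [] ks = ks"
| "toggles (r # rs) ks = toggles rs (toggle r ks)"

fun drops :: "int list \<Rightarrow> int list \<Rightarrow> int list list" where
  "drops p [] = []"
| "drops p (i # l) = app p l # drops (app p [i]) l"

text \<open>The words \<open>facet\<close> and \<open>ridge\<close> belong to the dual polytope: a
  facet is a vertex of the moment polytope with the indices of the normals tight there, a ridge is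
  an edge. An item pairs the index of a normal with the edge direction dual to it at some vertex;
  the same type also holds an index with its normal, or a level with a neighbour. A ridge entry
  consists of the indices along the edge, the items of these normals, the direction of the edge and
  the vertex that it leaves.\<close>

type_synonym item = "int \<times> int list"
type_synonym facet = "int list \<times> int list"
type_synonym ridge = "int list \<times> item list \<times> int list \<times> int list"

text \<open>A tree keeps the terms shallow. The cuts rebuild it with \<open>node\<close>, which
  drops emptied branches, so that \<open>CE\<close> at the root signals that no candidate is
  left.\<close>

datatype cands = CE | CL "int list" | CN cands cands

text \<open>
  A state \<open>St W k fs ks es cs B s\<close> holds the known normals \<open>W\<close> with their indices, the next index \<open>k\<close>, the
  known vertices \<open>fs\<close> with the sorted indices of their normals, the open ridges \<open>ks\<close> (those on just one
  known vertex), the data \<open>es\<close> for crossing them, the candidates \<open>cs\<close> for further normals, and the sums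
  \<open>B\<close> of all entries and \<open>s\<close> of the rows of \<open>W\<close>. Both sums have to end up nonnegative, which prunes the
  candidates.
\<close>

datatype state =
  St "item list" int "facet list" "int list list" "ridge list" cands int "int list"

text \<open>A known normal that is not assigned to the new vertex must pair to at least 0 with it:
  pairings are integers, and -1 is reserved for the tight normals, whose indices are in
  \<open>r\<close>.\<close>

fun ok_all :: "int list \<Rightarrow> int list \<Rightarrow> item list \<Rightarrow> bool" and ok_next :: "bool \<Rightarrow> int list \<Rightarrow> int list \<Rightarrow> item list \<Rightarrow> bool" where
  "ok_all r v [] = True"
| "ok_all r v ((i, w) # W) = ok_next (either (0 \<le> dot w v) (mem i r)) r v W"
| "ok_next True r v W = ok_all r v W"
| "ok_next False r v W = False"

section \<open>Pruning by sums and levels\<close>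

fun nonneg2 :: "int \<Rightarrow> int list \<Rightarrow> int list \<Rightarrow> bool" where
  "nonneg2 c (a # x) (b # y) = both (0 \<le> a + b + c) (nonneg2 c x y)"
| "nonneg2 c [] y = True"
| "nonneg2 c (a # x) [] = True"

fun nonneg1 :: "int \<Rightarrow> int list \<Rightarrow> bool" where
  "nonneg1 c [] = True"
| "nonneg1 c (a # x) = both (0 \<le> a + c) (nonneg1 c x)"

text \<open>A flag \<open>True\<close> means that two consecutive edges of the star have equal keys;
  the entries of the total sum then have to be nonincreasing.\<close>

fun ties_ok :: "bool list \<Rightarrow> int list \<Rightarrow> bool" where
  "ties_ok (t # ts) (a # b # s) = both (either (\<not> t) (b \<le> a)) (ties_ok ts (b # s))"
| "ties_ok [] s = True"
| "ties_ok (t # ts) [] = True"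
| "ties_ok (t # ts) [a] = True"

fun node :: "cands \<Rightarrow> cands \<Rightarrow> cands" where
  "node CE b = b"
| "node a CE = a"
| "node a b = CN a b"

fun tip_if :: "bool \<Rightarrow> int list \<Rightarrow> cands" where
  "tip_if True c = CL c"
| "tip_if False c = CE"

fun level_cut :: "int list \<Rightarrow> cands \<Rightarrow> cands" where
  "level_cut v CE = CE"
| "level_cut v (CL c) = tip_if (0 \<le> dot c v) c"
| "level_cut v (CN a b) = node (level_cut v a) (level_cut v b)"

text \<open>Here \<open>B\<close> is what is left of the budget once \<open>c\<close> has been
  charged. The normals still to come have total level at most \<open>B\<close>, so they raise a
  coordinate by at most \<open>m * B\<close>.\<close>

fun budget_ok :: "int \<Rightarrow> int \<Rightarrow> int list \<Rightarrow> int list \<Rightarrow> bool" where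
  "budget_ok m B s c = both (0 \<le> B) (nonneg2 (m * B) s c)"

fun budget_cut :: "int \<Rightarrow> int \<Rightarrow> int list \<Rightarrow> cands \<Rightarrow> cands" where
  "budget_cut m B s CE = CE"
| "budget_cut m B s (CL c) = tip_if (budget_ok m (B + vsum c) s c) c"
| "budget_cut m B s (CN a b) = node (budget_cut m B s a) (budget_cut m B s b)"

fun known :: "int list \<Rightarrow> item list \<Rightarrow> bool" where
  "known x [] = False"
| "known x ((k, w) # W) = either (leq x w) (known x W)"

fun known_cut :: "item list \<Rightarrow> cands \<Rightarrow> cands" where
  "known_cut W CE = CE"
| "known_cut W (CL c) = tip_if (\<not> known c W) c"
| "known_cut W (CN a b) = node (known_cut W a) (known_cut W b)"

text \<open>Without candidates the known normals are all the normals, so the exact conditions on the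
  total sum apply; otherwise only the estimate by the remaining budget does.\<close>

fun sum_ok :: "int \<Rightarrow> bool list \<Rightarrow> cands \<Rightarrow> int \<Rightarrow> int list \<Rightarrow> bool" where
  "sum_ok m ts CE B s = both (nonneg1 0 s) (ties_ok ts s)"
| "sum_ok m ts (CL c) B s = nonneg1 (m * B) s"
| "sum_ok m ts (CN a b) B s = nonneg1 (m * B) s"

section \<open>Crossing a ridge\<close>

fun insert_if :: "bool \<Rightarrow> item \<Rightarrow> item \<Rightarrow> item list \<Rightarrow> item list \<Rightarrow> item list" where
  "insert_if True x y l l' = x # y # l"
| "insert_if False x y l l' = y # l'"

fun insert_item :: "int \<Rightarrow> int list \<Rightarrow> item list \<Rightarrow> item list" where
  "insert_item i u [] = [(i, u)]"
| "insert_item i u ((j, u') # l) = insert_if (i < j) (i, u) (j, u') l (insert_item i u l)"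

text \<open>Exchange of dual bases along an edge: the direction dual to a normal that stays is
  corrected by the multiple of \<open>u\<close> that makes it orthogonal to the entering normal
  \<open>w\<close>, which pairs to -1 with \<open>u\<close>.\<close>

fun pivot :: "int list \<Rightarrow> int list \<Rightarrow> item list \<Rightarrow> item list" where
  "pivot w u [] = []"
| "pivot w u ((i, x) # l) = (i, axpy (dot w x) u x) # pivot w u l"

fun ids :: "item list \<Rightarrow> int list" where
  "ids [] = []"
| "ids ((i, x) # l) = i # ids l"

fun ridge_list :: "int list \<Rightarrow> item list \<Rightarrow> item list \<Rightarrow> ridge list" where
  "ridge_list v p [] = []"
| "ridge_list v p ((i, u) # l) =
    (app (ids p) (ids l), app p l, u, v) # ridge_list v (app p [(i, u)]) l"

text \<open>Entries of ridges that have been closed in the meantime are discarded only when they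
  reach the front. The list may thus contain stale entries, but its head is always open.\<close>

fun next_open :: "int list list \<Rightarrow> ridge list \<Rightarrow> ridge list"
  and next_if :: "bool \<Rightarrow> int list list \<Rightarrow> ridge \<Rightarrow> ridge list \<Rightarrow> ridge list" where
  "next_open ks [] = []"
| "next_open ks ((r, x) # es) = next_if (has r ks) ks (r, x) es"
| "next_if True ks e es = e # es"
| "next_if False ks e es = next_open ks es"

fun settle :: "item list \<Rightarrow> int \<Rightarrow> facet list \<Rightarrow> int list list \<Rightarrow> ridge list \<Rightarrow> cands \<Rightarrow> int \<Rightarrow> int list \<Rightarrow> state" where
  "settle W k fs ks es cs B s = St W k fs ks (next_open ks es) cs B s"

fun grow :: "item list \<Rightarrow> int \<Rightarrow> facet list \<Rightarrow> int list list \<Rightarrow> ridge list \<Rightarrow> cands \<Rightarrow> int \<Rightarrow> int list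
    \<Rightarrow> int list \<Rightarrow> item list \<Rightarrow> state" where
  "grow W k fs ks es cs B s v l =
    settle W k ((ids l, v) # fs) (toggles (drops [] (ids l)) ks) (app (ridge_list v [] l) es) cs B s"

fun select_old :: "int list \<Rightarrow> item list \<Rightarrow> item list" where
  "select_old u [] = []"
| "select_old u ((i, w) # W) = cons_if (dot w u = - 1) (i, w) (select_old u W)"

fun select_new :: "int list \<Rightarrow> cands \<Rightarrow> int list list \<Rightarrow> int list list" where
  "select_new u CE acc = acc"
| "select_new u (CL w) acc = cons_if (dot w u = - 1) w acc"
| "select_new u (CN a b) acc = select_new u a (select_new u b acc)"

fun check_vertex :: "int list \<Rightarrow> item list \<Rightarrow> int \<Rightarrow> int list \<Rightarrow> int list
    \<Rightarrow> (int \<times> int list \<times> int list) list \<Rightarrow> (int \<times> int list \<times> int list) list" where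
  "check_vertex r W i w v rest = cons_if (ok_all (i # r) v W) (i, w, v) rest"

fun check_old :: "int list \<Rightarrow> int list \<Rightarrow> int list \<Rightarrow> item list \<Rightarrow> item list \<Rightarrow> (int \<times> int list \<times> int list) list" where
  "check_old r u v W [] = []"
| "check_old r u v W ((i, w) # ws) =
    check_vertex r W i w (axpy (dot w v + 1) u v) (check_old r u v W ws)"

fun check_new :: "int list \<Rightarrow> int list \<Rightarrow> int list \<Rightarrow> item list \<Rightarrow> int \<Rightarrow> int list list \<Rightarrow> (int \<times> int list \<times> int list) list" where
  "check_new r u v W k [] = []"
| "check_new r u v W k (w # ws) =
    check_vertex r W k w (axpy (dot w v + 1) u v) (check_new r u v W k ws)"

fun grow_if :: "bool \<Rightarrow> item list \<Rightarrow> int \<Rightarrow> facet list \<Rightarrow> int list list \<Rightarrow> ridge list \<Rightarrow> cands \<Rightarrow> int \<Rightarrow> int list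
    \<Rightarrow> item list \<Rightarrow> int list \<Rightarrow> int \<Rightarrow> int list \<Rightarrow> int list \<Rightarrow> state list \<Rightarrow> state list" where
  "grow_if True W k fs ks es cs B s l u i w v rest =
    grow W k fs ks es cs B s v (insert_item i (vneg u) (pivot w u l)) # rest"
| "grow_if False W k fs ks es cs B s l u i w v rest = rest"

fun grow_ok :: "int \<Rightarrow> bool list \<Rightarrow> item list \<Rightarrow> int \<Rightarrow> facet list \<Rightarrow> int list list \<Rightarrow> ridge list \<Rightarrow> cands \<Rightarrow> int \<Rightarrow> int list
    \<Rightarrow> item list \<Rightarrow> int list \<Rightarrow> int \<Rightarrow> int list \<Rightarrow> int list \<Rightarrow> state list \<Rightarrow> state list" where
  "grow_ok m ts W k fs ks es cs B s l u i w v rest =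
    grow_if (sum_ok m ts cs B s) W k fs ks es cs B s l u i w v rest"

fun olds :: "int \<Rightarrow> bool list \<Rightarrow> item list \<Rightarrow> int \<Rightarrow> facet list \<Rightarrow> int list list \<Rightarrow> ridge list \<Rightarrow> cands \<Rightarrow> int \<Rightarrow> int list
    \<Rightarrow> item list \<Rightarrow> int list \<Rightarrow> (int \<times> int list \<times> int list) list \<Rightarrow> state list \<Rightarrow> state list" where
  "olds m ts W k fs ks es cs B s l u [] rest = rest"
| "olds m ts W k fs ks es cs B s l u ((i, w, v) # ws) rest =
    grow_ok m ts W k fs ks es (level_cut v cs) B s l u i w v (olds m ts W k fs ks es cs B s l u ws rest)"

fun new_if :: "bool \<Rightarrow> int \<Rightarrow> bool list \<Rightarrow> item list \<Rightarrow> int \<Rightarrow> facet list \<Rightarrow> int list list \<Rightarrow> ridge list \<Rightarrow> cands \<Rightarrow> int \<Rightarrow> int list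
    \<Rightarrow> item list \<Rightarrow> int list \<Rightarrow> int \<Rightarrow> int list \<Rightarrow> int list \<Rightarrow> state list \<Rightarrow> state list" where
  "new_if True m ts W k fs ks es cs B s l u i w v rest =
    grow_ok m ts ((i, w) # W) (k + 1) fs ks es (budget_cut m B s (level_cut v cs)) B s l u i w v rest"
| "new_if False m ts W k fs ks es cs B s l u i w v rest = rest"

fun new_budget :: "int \<Rightarrow> bool list \<Rightarrow> item list \<Rightarrow> int \<Rightarrow> facet list \<Rightarrow> int list list \<Rightarrow> ridge list \<Rightarrow> cands \<Rightarrow> int \<Rightarrow> int list
    \<Rightarrow> item list \<Rightarrow> int list \<Rightarrow> int \<Rightarrow> int list \<Rightarrow> int list \<Rightarrow> state list \<Rightarrow> state list" where
  "new_budget m ts W k fs ks es cs B s l u i w v rest =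
    new_if (0 \<le> B) m ts W k fs ks es cs B s l u i w v rest"

fun news :: "int \<Rightarrow> bool list \<Rightarrow> item list \<Rightarrow> int \<Rightarrow> facet list \<Rightarrow> int list list \<Rightarrow> ridge list \<Rightarrow> cands \<Rightarrow> int \<Rightarrow> int list
    \<Rightarrow> item list \<Rightarrow> int list \<Rightarrow> (int \<times> int list \<times> int list) list \<Rightarrow> state list" where
  "news m ts W k fs ks es cs B s l u [] = []"
| "news m ts W k fs ks es cs B s l u ((i, w, v) # ws) =
    new_budget m ts W k fs ks es cs (B + vsum w) (vadd s w) l u i w v (news m ts W k fs ks es cs B s l u ws)"

text \<open>The normal that enters across the edge pairs to -1 with the direction \<open>u\<close>.
  If it is already known, only the vertex is new; otherwise it is a candidate, receives the index
  \<open>k\<close> and is charged to the budget.\<close>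

fun children :: "int \<Rightarrow> bool list \<Rightarrow> item list \<Rightarrow> int \<Rightarrow> facet list \<Rightarrow> int list list \<Rightarrow> ridge list \<Rightarrow> cands \<Rightarrow> int \<Rightarrow> int list
    \<Rightarrow> ridge \<Rightarrow> state list" where
  "children m ts W k fs ks es cs B s (r, l, u, v) =
    olds m ts W k fs ks es cs B s l u (check_old r u v W (select_old u W))
      (news m ts W k fs ks es cs B s l u (check_new r u v W k (select_new u cs [])))"

section \<open>Second moments of a face\<close>

fun madd :: "int list list \<Rightarrow> int list list \<Rightarrow> int list list" where
  "madd (a # M) (b # N) = vadd a b # madd M N"
| "madd [] N = []"
| "madd (a # M) [] = []"

fun msmul :: "int \<Rightarrow> int list list \<Rightarrow> int list list" where
  "msmul c [] = []"
| "msmul c (a # M) = smul c a # msmul c M"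

fun outer :: "int list \<Rightarrow> int list \<Rightarrow> int list list" where
  "outer [] y = []"
| "outer (a # x) y = smul a y # outer x y"

fun mzeros :: "int list \<Rightarrow> int list \<Rightarrow> int list list" where
  "mzeros y [] = []"
| "mzeros y (a # x) = zeros y # mzeros y x"

fun remove_if :: "bool \<Rightarrow> int \<Rightarrow> int list \<Rightarrow> int list \<Rightarrow> int list" where
  "remove_if True j l l' = l"
| "remove_if False j l l' = j # l'"

fun remove_id :: "int \<Rightarrow> int list \<Rightarrow> int list" where
  "remove_id i [] = []"
| "remove_id i (j # l) = remove_if (i = j) j l (remove_id i l)"

fun link_if :: "bool \<Rightarrow> int \<Rightarrow> int list \<Rightarrow> int list \<Rightarrow> facet list \<Rightarrow> facet list" where
  "link_if True i l v fs = (remove_id i l, v) # fs"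
| "link_if False i l v fs = fs"

fun link :: "int \<Rightarrow> facet list \<Rightarrow> facet list" where
  "link i [] = []"
| "link i ((l, v) # fs) = link_if (mem i l) i l v (link i fs)"

fun homogenize :: "facet list \<Rightarrow> facet list" where
  "homogenize [] = []"
| "homogenize ((l, v) # fs) = (l, app v [1]) # homogenize fs"

fun opp_if :: "bool \<Rightarrow> int \<Rightarrow> facet list \<Rightarrow> (int \<times> facet list) list \<Rightarrow> (int \<times> facet list) list" where
  "opp_if True c fs rest = rest"
| "opp_if False c fs rest = (c, fs) # rest"

text \<open>The facets of a face that avoid its apex \<open>v\<close> belong to normals outside
  \<open>l\<close>, and \<open>dot w v + 1\<close> is the lattice distance of the apex from such a
  facet. The apex carries a final homogeneous entry 1, which \<open>dot\<close> ignores because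
  \<open>w\<close> is shorter. Normals that miss the face, or that already define it, produce an
  empty link.\<close>

fun opposite :: "int list \<Rightarrow> int list \<Rightarrow> facet list \<Rightarrow> item list \<Rightarrow> (int \<times> facet list) list" where
  "opposite l v fs [] = []"
| "opposite l v fs ((i, w) # W) = opp_if (mem i l) (dot w v + 1) (link i fs) (opposite l v fs W)"

fun simplex_term :: "int \<Rightarrow> int list \<Rightarrow> int list \<Rightarrow> int list list \<Rightarrow> int list list" where
  "simplex_term D s v Q = msmul D (madd (outer s s) (madd Q (outer v v)))"

text \<open>
  The second moments of a face, up to a common factor: a pulling triangulation cones the facets off the
  first vertex \<open>v\<close>, and a simplex of normalized volume \<open>D\<close> with vertex sum \<open>s\<close> contributes
  \<open>D (s s\<^sup>T + \<Sum> v v\<^sup>T)\<close>.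
\<close>

fun pulling :: "nat \<Rightarrow> item list \<Rightarrow> facet list \<Rightarrow> int \<Rightarrow> int list \<Rightarrow> int list list \<Rightarrow> int list list \<Rightarrow> int list list"
  and pullings :: "nat \<Rightarrow> item list \<Rightarrow> (int \<times> facet list) list \<Rightarrow> int \<Rightarrow> int list \<Rightarrow> int list list \<Rightarrow> int list list \<Rightarrow> int list list" where
  "pulling d W [] D s Q acc = acc"
| "pulling 0 W ((l, v) # fs) D s Q acc = madd (simplex_term D (vadd s v) v Q) acc"
| "pulling (Suc d) W ((l, v) # fs) D s Q acc =
    pullings d W (opposite l v fs W) D (vadd s v) (madd Q (outer v v)) acc"
| "pullings d W [] D s Q acc = acc"
| "pullings d W ((c, fs) # gs) D s Q acc = pullings d W gs D s Q (pulling d W fs (D * c) s Q acc)"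

section \<open>The kernel of the moment matrix\<close>

fun find_if :: "bool \<Rightarrow> int list list \<Rightarrow> int \<Rightarrow> int list \<Rightarrow> int list list \<Rightarrow> (int \<times> int list \<times> int list list) option
    \<Rightarrow> (int \<times> int list \<times> int list list) option" where
  "find_if True acc a r rs later = later"
| "find_if False acc a r rs later = Some (a, r, app acc rs)"

fun find_pivot :: "int list list \<Rightarrow> int list list \<Rightarrow> (int \<times> int list \<times> int list list) option" where
  "find_pivot acc [] = None"
| "find_pivot acc ([] # rs) = None"
| "find_pivot acc ((a # r) # rs) = find_if (a = 0) acc a r rs (find_pivot ((a # r) # acc) rs)"

fun div_if :: "bool \<Rightarrow> int \<Rightarrow> int list option \<Rightarrow> int list option" where
  "div_if True q (Some r) = Some (q # r)"
| "div_if True q None = None"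
| "div_if False q r = None"

fun div_check :: "int \<Rightarrow> int \<Rightarrow> int \<Rightarrow> int list option \<Rightarrow> int list option" where
  "div_check c a q r = div_if (q * c = a) q r"

fun exact_div :: "int \<Rightarrow> int list \<Rightarrow> int list option" where
  "exact_div c [] = Some []"
| "exact_div c (a # x) = div_check c a (a div c) (exact_div c x)"

fun the_or :: "'a \<Rightarrow> 'a option \<Rightarrow> 'a" where
  "the_or x None = x"
| "the_or x (Some y) = y"

fun reduce :: "int \<Rightarrow> int list \<Rightarrow> int list" where
  "reduce c x = the_or x (exact_div c x)"

text \<open>Fraction-free elimination in the manner of Bareiss: \<open>c\<close> is the previous
  pivot, by which the new rows are expected to be divisible. As \<open>reduce\<close> divides only
  where all entries allow it, correctness does not rest on this expectation.\<close>

fun eliminate :: "int \<Rightarrow> int \<Rightarrow> int list \<Rightarrow> int list list \<Rightarrow> int list list" where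
  "eliminate c a r [] = []"
| "eliminate c a r ([] # rs) = eliminate c a r rs"
| "eliminate c a r ((b # x) # rs) = reduce c (axpy (- b) r (smul a x)) # eliminate c a r rs"

fun back_if :: "bool \<Rightarrow> int \<Rightarrow> int \<Rightarrow> int \<Rightarrow> int list \<Rightarrow> int list" where
  "back_if True q a d z = (- q) # z"
| "back_if False q a d z = (- d) # smul a z"

fun back_check :: "int \<Rightarrow> int \<Rightarrow> int \<Rightarrow> int list \<Rightarrow> int list" where
  "back_check q a d z = back_if (q * a = d) q a d z"

fun back_subst :: "int \<Rightarrow> int list \<Rightarrow> int list option \<Rightarrow> int list option" where
  "back_subst a r None = None"
| "back_subst a r (Some z) = Some (back_check (dot r z div a) a (dot r z) z)"

text \<open>A column without a pivot gives \<open>None\<close>, which counts as a failed check.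
  After \<open>n\<close> pivots one unknown is left free and set to 1; back substitution multiplies
  by a pivot only where the division by it is not exact.\<close>

fun kernel :: "nat \<Rightarrow> int \<Rightarrow> int list list \<Rightarrow> int list option"
  and kernel_pivot :: "nat \<Rightarrow> int \<Rightarrow> (int \<times> int list \<times> int list list) option \<Rightarrow> int list option" where
  "kernel 0 c rs = Some [1]"
| "kernel (Suc n) c rs = kernel_pivot n c (find_pivot [] rs)"
| "kernel_pivot n c None = None"
| "kernel_pivot n c (Some (a, r, rs)) = back_subst a r (kernel n a (eliminate c a r rs))"

fun nonzero_on :: "int list \<Rightarrow> facet list \<Rightarrow> bool" where
  "nonzero_on z [] = True"
| "nonzero_on z ((l, v) # fs) = both (dot v z \<noteq> 0) (nonzero_on z fs)"

fun kernel_check :: "facet list \<Rightarrow> int list option \<Rightarrow> bool" where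
  "kernel_check fs None = False"
| "kernel_check fs (Some z) = nonzero_on z fs"

text \<open>The last row belongs to the constant function and is removed by \<open>butlast\<close>:
  the moments of g against the coordinates vanish, but its mean does not. The remaining rows
  determine g up to a factor, which is all that the test for zeros at the vertices needs.\<close>

fun moment_check :: "nat \<Rightarrow> item list \<Rightarrow> facet list \<Rightarrow> bool" where
  "moment_check n W [] = False"
| "moment_check n W ((l, v) # fs) = kernel_check ((l, v) # fs)
    (kernel n 1 (butlast (pulling n W ((l, v) # fs) 1 (zeros v) (mzeros v v) (mzeros v v))))"

text \<open>The argument \<open>d\<close> bounds the number of crossings along a branch. Exhausting
  it yields \<open>False\<close>, so the value 50 supplied by \<open>start_if\<close> is harmless
  for soundness.\<close>

fun search :: "nat \<Rightarrow> int \<Rightarrow> bool list \<Rightarrow> nat \<Rightarrow> state list \<Rightarrow> bool" where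
  "search n m ts d [] = True"
| "search n m ts d (St W k fs ks [] cs B s # sts) =
    both (moment_check n W (homogenize fs)) (search n m ts d sts)"
| "search n m ts 0 (St W k fs ks (e # es) cs B s # sts) = False"
| "search n m ts (Suc d) (St W k fs ks (e # es) cs B s # sts) =
    both (search n m ts d (children m ts W k fs ks es cs B s e)) (search n m ts (Suc d) sts)"

section \<open>Possible neighbours and far normals of given level\<close>

fun lows :: "(bool \<times> int) list \<Rightarrow> int" where
  "lows [] = 0"
| "lows ((f, a) # bs) = a + lows bs"

fun cons_all :: "int \<Rightarrow> int list list \<Rightarrow> int list list \<Rightarrow> int list list" where
  "cons_all a [] acc = acc"
| "cons_all a (x # xs) acc = (a # x) # cons_all a xs acc"

fun nil_if :: "bool \<Rightarrow> int list list" where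
  "nil_if True = [[]]"
| "nil_if False = []"

text \<open>The flag \<open>True\<close> prescribes an entry, \<open>False\<close> bounds it below.
  Since the total is fixed, the lower bounds of the later entries bound the current one above, which
  makes the enumeration finite.\<close>

fun bounded_vecs :: "(bool \<times> int) list \<Rightarrow> int \<Rightarrow> int list list"
  and bounded_heads :: "(bool \<times> int) list \<Rightarrow> int \<Rightarrow> int list \<Rightarrow> int list list" where
  "bounded_vecs [] S = nil_if (S = 0)"
| "bounded_vecs ((True, a) # bs) S = cons_all a (bounded_vecs bs (S - a)) []"
| "bounded_vecs ((False, a) # bs) S = bounded_heads bs S [a..S - lows bs]"
| "bounded_heads bs S [] = []"
| "bounded_heads bs S (a # as) = cons_all a (bounded_vecs bs (S - a)) (bounded_heads bs S as)"

text \<open>Two edges may lead to the same normal, which then has entry -1 in both coordinates; this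
  forces equal levels. For distinct normals of equal level the quotient would be 0, so -1 covers
  both cases.\<close>

fun low :: "bool \<Rightarrow> int \<Rightarrow> int \<Rightarrow> int" where
  "low True k l = - 1"
| "low False k l = - (l div (k + 1))"

text \<open>Once position \<open>i\<close> has been passed, the index is set beyond the end of the
  list, so that no further entry is prescribed.\<close>

fun nbr_bounds :: "int \<Rightarrow> nat \<Rightarrow> int list \<Rightarrow> (bool \<times> int) list" where
  "nbr_bounds l i [] = []"
| "nbr_bounds l 0 (k # ks) = (True, - 1) # nbr_bounds l (Suc (length ks)) ks"
| "nbr_bounds l (Suc i) (k # ks) = (False, low (k = l) k l) # nbr_bounds l i ks"

fun nbr_cands :: "int list \<Rightarrow> nat \<Rightarrow> int list \<Rightarrow> int list list list" where
  "nbr_cands ks i [] = []"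
| "nbr_cands ks i (l # ls) = bounded_vecs (nbr_bounds l i ks) (- l) # nbr_cands ks (Suc i) ls"

fun far_bounds :: "int \<Rightarrow> int list \<Rightarrow> (bool \<times> int) list" where
  "far_bounds l [] = []"
| "far_bounds l (k # ks) = (False, - (l div (k + 1))) # far_bounds l ks"

fun far_cands :: "int list \<Rightarrow> int list \<Rightarrow> int list list" where
  "far_cands ks [] = []"
| "far_cands ks (l # ls) = app (bounded_vecs (far_bounds l ks) (- l)) (far_cands ks ls)"

text \<open>
  The neighbours of the special vertex are sorted by level, then by \<open>weight\<close>, then by column sum, and
  remaining ties by the coordinates of the total sum, to break the symmetry under permutations.
\<close>

fun weight :: "int list \<Rightarrow> int" where
  "weight [] = 0"
| "weight (a # x) = (10 + a) * (a * a) + weight x"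

text \<open>Unless they coincide, each of two neighbours has to be nonnegative at the vertex across
  the edge of the other. The flag is this inequality for \<open>x\<close>; the one for
  \<open>y\<close> is evaluated here.\<close>

fun compatible :: "bool \<Rightarrow> nat \<Rightarrow> int \<Rightarrow> int list \<Rightarrow> int list \<Rightarrow> int \<Rightarrow> bool" where
  "compatible True i k x y l = either (0 \<le> (y ! i) * (k + 1) + l) (leq x y)"
| "compatible False i k x y l = leq x y"

fun compatible_cut :: "nat \<Rightarrow> int \<Rightarrow> int list \<Rightarrow> int \<Rightarrow> int \<Rightarrow> int list list \<Rightarrow> int list list" where
  "compatible_cut i k x l a [] = []"
| "compatible_cut i k x l a (y # ys) =
    cons_if (compatible (0 \<le> a * (l + 1) + k) i k x y l) y (compatible_cut i k x l a ys)"

fun compatible_cuts :: "nat \<Rightarrow> int \<Rightarrow> int list \<Rightarrow> nat \<Rightarrow> int list \<Rightarrow> int list list list \<Rightarrow> int list list list" where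
  "compatible_cuts i k x j (l # ls) (X # Xs) =
    compatible_cut i k x l (x ! j) X # compatible_cuts i k x (Suc j) ls Xs"
| "compatible_cuts i k x j [] Xs = []"
| "compatible_cuts i k x j (l # ls) [] = []"

fun weight_le :: "bool \<Rightarrow> int list \<Rightarrow> int list \<Rightarrow> bool" where
  "weight_le True x y = (weight x \<le> weight y)"
| "weight_le False x y = True"

fun ordered :: "int \<Rightarrow> int list \<Rightarrow> item list \<Rightarrow> bool" where
  "ordered k x [] = True"
| "ordered k x ((l, w) # c) = weight_le (l = k) w x"

section \<open>Enumeration of the stars\<close>

type_synonym partial = "int list list list \<times> item list \<times> int \<times> int list"

text \<open>The three flags stand for the order among equal levels, the repetition of an earlier
  neighbour, and a level within the budget. A repeated neighbour is one and the same normal, so it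
  is neither charged nor added again.\<close>

fun extend_if :: "bool \<Rightarrow> bool \<Rightarrow> bool \<Rightarrow> nat \<Rightarrow> int \<Rightarrow> int list \<Rightarrow> int list list list \<Rightarrow> item list \<Rightarrow> int \<Rightarrow> int list
    \<Rightarrow> int list \<Rightarrow> partial list \<Rightarrow> partial list" where
  "extend_if True True b i k ls Xs c B s x rest =
    (compatible_cuts i k x (Suc i) ls Xs, (k, x) # c, B, s) # rest"
| "extend_if True False True i k ls Xs c B s x rest =
    (compatible_cuts i k x (Suc i) ls Xs, (k, x) # c, B - k, vadd s x) # rest"
| "extend_if True False False i k ls Xs c B s x rest = rest"
| "extend_if False a b i k ls Xs c B s x rest = rest"

fun extend :: "nat \<Rightarrow> int \<Rightarrow> int list \<Rightarrow> int list list list \<Rightarrow> item list \<Rightarrow> int \<Rightarrow> int list \<Rightarrow> int list list \<Rightarrow> partial list" where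
  "extend i k ls Xs c B s [] = []"
| "extend i k ls Xs c B s (x # xs) =
    extend_if (ordered k x c) (known x c) (k \<le> B) i k ls Xs c B s x (extend i k ls Xs c B s xs)"

fun extensions :: "nat \<Rightarrow> int \<Rightarrow> int list \<Rightarrow> partial \<Rightarrow> partial list" where
  "extensions i k ls ([], c, B, s) = []"
| "extensions i k ls (X # Xs, c, B, s) = extend i k ls Xs c B s X"

fun finals :: "int \<Rightarrow> partial list \<Rightarrow> (item list \<times> int \<times> int list) list" where
  "finals m [] = []"
| "finals m ((Xs, c, B, s) # ps) = cons_if (nonneg1 (m * B) s) (c, B, s) (finals m ps)"

fun stars :: "int \<Rightarrow> nat \<Rightarrow> int list \<Rightarrow> partial list \<Rightarrow> (item list \<times> int \<times> int list) list" where
  "stars m i [] ps = finals m ps"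
| "stars m i (k # ks) [] = []"
| "stars m i (k # ks) (p # ps) = app (stars m (Suc i) ks (extensions i k ks p)) (stars m i (k # ks) ps)"

text \<open>Summed over the neighbours, this gives one number per coordinate, and renumbering the
  edges merely permutes these numbers. Any other function of the entries would be an equally sound
  key.\<close>

fun column_terms :: "int list \<Rightarrow> int list" where
  "column_terms [] = []"
| "column_terms (a # x) = (a + 3) * a # column_terms x"

fun col_sums :: "int list \<Rightarrow> item list \<Rightarrow> int list" where
  "col_sums acc [] = acc"
| "col_sums acc ((k, w) # c) = col_sums (vadd (column_terms w) acc) c"

fun tie_cons :: "bool \<Rightarrow> bool list option \<Rightarrow> bool list option" where
  "tie_cons t None = None"
| "tie_cons t (Some ts) = Some (t # ts)"

fun tie_if :: "bool \<Rightarrow> bool \<Rightarrow> bool \<Rightarrow> bool list option \<Rightarrow> bool list option" where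
  "tie_if False b t r = tie_cons False r"
| "tie_if True True t r = None"
| "tie_if True False t r = tie_cons t r"

text \<open>The result \<open>None\<close> reports an arrangement that contradicts the sorting, so
  that the star is skipped. A flag is set where even the column sums agree and the total sum has to
  decide.\<close>

fun ties :: "item list \<Rightarrow> int list \<Rightarrow> bool list option" where
  "ties ((k, w) # (k', w') # c) (a # b # x) =
    tie_if (both (k = k') (weight w = weight w')) (a < b) (a = b) (ties ((k', w') # c) (b # x))"
| "ties [] x = Some []"
| "ties [p] x = Some []"
| "ties (p # q # c) [] = Some []"
| "ties (p # q # c) [a] = Some []"

fun add_nbrs :: "int \<Rightarrow> item list \<Rightarrow> item list \<Rightarrow> item list \<times> int"
  and add_nbr_if :: "bool \<Rightarrow> int \<Rightarrow> item list \<Rightarrow> int list \<Rightarrow> item list \<Rightarrow> item list \<times> int" where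
  "add_nbrs i W [] = (W, i)"
| "add_nbrs i W ((k, w) # c) = add_nbr_if (known w W) i W w c"
| "add_nbr_if True i W w c = add_nbrs i W c"
| "add_nbr_if False i W w c = add_nbrs (i + 1) ((i, w) # W) c"

fun start_if :: "bool \<Rightarrow> nat \<Rightarrow> int \<Rightarrow> bool list \<Rightarrow> item list \<Rightarrow> int \<Rightarrow> int \<Rightarrow> int list \<Rightarrow> item list \<Rightarrow> int list \<Rightarrow> cands \<Rightarrow> bool" where
  "start_if True n m ts W k B s F v cs =
    search n m ts 50 [St W k [(ids F, v)] (drops [] (ids F)) (ridge_list v [] F) cs B s]"
| "start_if False n m ts W k B s F v cs = True"

fun start_sum :: "nat \<Rightarrow> int \<Rightarrow> bool list \<Rightarrow> item list \<times> int \<Rightarrow> int \<Rightarrow> int list \<Rightarrow> item list \<Rightarrow> int list \<Rightarrow> cands \<Rightarrow> bool" where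
  "start_sum n m ts (W, k) B s F v cs = start_if (sum_ok m ts cs B s) n m ts W k B s F v cs"

fun start_ties :: "nat \<Rightarrow> int \<Rightarrow> bool list option \<Rightarrow> item list \<times> int \<Rightarrow> int \<Rightarrow> int list \<Rightarrow> item list \<Rightarrow> int list \<Rightarrow> cands \<Rightarrow> bool" where
  "start_ties n m None Wk B s F v cs = True"
| "start_ties n m (Some ts) (W, k) B s F v cs =
    start_sum n m ts (W, k) B s F v (known_cut W (budget_cut m B s cs))"

fun start_star :: "nat \<Rightarrow> int \<Rightarrow> item list \<Rightarrow> int list \<Rightarrow> cands \<Rightarrow> int \<Rightarrow> int list \<Rightarrow> item list \<Rightarrow> bool" where
  "start_star n m F v cs B s c =
    start_ties n m (ties c (col_sums (zeros s) c)) (add_nbrs (int n) F c) B s F v cs"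

fun start_stars :: "nat \<Rightarrow> int \<Rightarrow> item list \<Rightarrow> int list \<Rightarrow> cands \<Rightarrow> (item list \<times> int \<times> int list) list \<Rightarrow> bool" where
  "start_stars n m F v cs [] = True"
| "start_stars n m F v cs ((c, B, s) # ps) = both (start_star n m F v cs B s (rev c)) (start_stars n m F v cs ps)"

fun pair_up :: "cands list \<Rightarrow> cands list" where
  "pair_up (a # b # l) = CN a b # pair_up l"
| "pair_up [a] = [a]"
| "pair_up [] = []"

fun balance :: "nat \<Rightarrow> cands list \<Rightarrow> cands" where
  "balance d [] = CE"
| "balance d [a] = a"
| "balance 0 (a # b # l) = CN a (balance 0 (b # l))"
| "balance (Suc d) (a # b # l) = balance d (pair_up (a # b # l))"

fun tips :: "int list list \<Rightarrow> cands list" where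
  "tips [] = []"
| "tips (x # xs) = CL x # tips xs"

definition unit :: "nat \<Rightarrow> nat \<Rightarrow> int list" where
  "unit n i = map (\<lambda>j. if i = j then 1 else 0) [0..<n]"

text \<open>The special vertex has all coordinates -1 and its normals are the unit vectors, which
  start the budget at \<open>n\<close> and the partial sum at (1, ..., 1). A normal off the star has
  positive level, at most \<open>n\<close> minus the sum of the distinct levels of the neighbours;
  distinct ones, because equal levels may stem from a single normal.\<close>

definition level_check :: "nat \<Rightarrow> int list \<Rightarrow> bool" where
  "level_check n ks =
    start_stars n (int (n - 2)) (map (\<lambda>i. (int i, unit n i)) [0..<n]) (map (\<lambda>i. - 1) [0..<n])
      (balance 20 (tips (far_cands ks [1..int n - sum_list (remdups ks)])))
      (stars (int (n - 2)) 0 ks [(nbr_cands ks 0 ks, [], int n, map (\<lambda>i. 1) [0..<n])])"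

text \<open>Nondecreasing lists that continue after the value \<open>p\<close>. Only a change of
  value is charged to \<open>b\<close>, because neighbours of equal level may coincide.\<close>

fun levels :: "nat \<Rightarrow> int \<Rightarrow> int \<Rightarrow> int list list" where
  "levels 0 p b = [[]]"
| "levels (Suc n) p b =
    map ((#) p) (levels n p b) @ concat (map (\<lambda>a. map ((#) a) (levels n a (b - a))) [p + 1..b])"

definition all_levels :: "nat \<Rightarrow> int list list" where
  "all_levels n = concat (map (\<lambda>a. map ((#) a) (levels (n - 1) a (int n - a))) [0..int n])"

section \<open>Soundness of the search\<close>

lemma app_append [simp]: "app = (@)"
proof (intro ext)
  show "app xs ys = xs @ ys" for xs ys :: "'a list"
    by (induction xs) auto
qed

lemma both_conj [simp]: "both a b \<longleftrightarrow> a \<and> b"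
  by (cases a) auto

lemma either_disj [simp]: "either a b \<longleftrightarrow> a \<or> b"
  by (cases a) auto

lemma cons_if_eq [simp]: "cons_if b x xs = (if b then x # xs else xs)"
  by (cases b) auto

lemma mem_iff [simp]: "mem i l \<longleftrightarrow> i \<in> set l"
  by (induction l) auto

lemma leq_iff [simp]: "leq x y \<longleftrightarrow> x = y"
  by (induction x y rule: leq.induct) auto

lemma has_iff [simp]: "has r ks \<longleftrightarrow> r \<in> set ks"
  by (induction ks) auto

lemma ids_map [simp]: "ids l = map fst l"
  by (induction l rule: ids.induct) auto

lemma known_iff [simp]: "known x W \<longleftrightarrow> x \<in> snd ` set W"
  by (induction x W rule: known.induct) auto

lemma vsum_sum_list [simp]: "vsum x = sum_list x"
  by (induction x) auto

lemma length_vadd [simp]: "length (vadd x y) = min (length x) (length y)"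
  by (induction x y rule: vadd.induct) auto

lemma nth_vadd: "i < length x \<Longrightarrow> i < length y \<Longrightarrow> vadd x y ! i = x ! i + y ! i"
proof (induction x y arbitrary: i rule: vadd.induct)
  case (1 a x b y)
  then show ?case by (cases i) auto
qed auto

lemma toggle_eq: "toggle r ks = (if r \<in> set ks then remove1 r ks else ks @ [r])"
proof (induction ks)
  case (Cons a ks)
  then show ?case by (cases "r = a") auto
qed simp

lemma set_toggle: "distinct ks \<Longrightarrow> set (toggle r ks) = (if r \<in> set ks then set ks - {r} else insert r (set ks))"
  by (auto simp: toggle_eq)

lemma distinct_toggle: "distinct ks \<Longrightarrow> distinct (toggle r ks)"
  by (auto simp: toggle_eq)

lemma toggles:
  assumes "distinct rs" "distinct ks"
  shows "distinct (toggles rs ks) \<and> set (toggles rs ks) = (set ks - set rs) \<union> (set rs - set ks)"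
  using assms
proof (induction rs arbitrary: ks)
  case (Cons r rs)
  have d: "distinct (toggle r ks)" using Cons.prems by (simp add: distinct_toggle)
  then show ?case
    using Cons.IH[OF _ d] Cons.prems by (auto simp: set_toggle split: if_splits)
qed simp

text \<open>The ways to split a list around one element, in a form general enough to serve as the
  induction step for both \<open>set_drops\<close> and \<open>set_ridge_list\<close>.\<close>

lemma splits_Cons:
  "{f a x b | a x b. y # l = a @ x # b} = insert (f [] y l) {f (y # a) x b | a x b. l = a @ x # b}"
proof -
  have "(\<exists>a x b. z = f a x b \<and> y # l = a @ x # b) \<longleftrightarrow>
      z = f [] y l \<or> (\<exists>a x b. z = f (y # a) x b \<and> l = a @ x # b)" for z
  proof
    assume "\<exists>a x b. z = f a x b \<and> y # l = a @ x # b"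
    then obtain a x b where *: "z = f a x b" "y # l = a @ x # b" by blast
    show "z = f [] y l \<or> (\<exists>a x b. z = f (y # a) x b \<and> l = a @ x # b)"
      using * by (cases a) auto
  next
    assume "z = f [] y l \<or> (\<exists>a x b. z = f (y # a) x b \<and> l = a @ x # b)"
    then show "\<exists>a x b. z = f a x b \<and> y # l = a @ x # b"
    proof
      assume "z = f [] y l"
      then have "z = f [] y l \<and> y # l = [] @ y # l" by simp
      then show ?thesis by blast
    next
      assume "\<exists>a x b. z = f (y # a) x b \<and> l = a @ x # b"
      then obtain a x b where "z = f (y # a) x b" "l = a @ x # b" by blast
      then have "z = f (y # a) x b \<and> y # l = (y # a) @ x # b" by simp
      then show ?thesis by blast
    qed
  qed
  then show ?thesis by blast
qed

lemma set_drops: "set (drops p l) = {p @ a @ b | a i b. l = a @ i # b}"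
proof (induction p l rule: drops.induct)
  case (2 p i l)
  have "set (drops p (i # l)) = insert (p @ [] @ l) {p @ (i # a) @ b | a j b. l = a @ j # b}"
    unfolding drops.simps list.set app_append 2[unfolded app_append] append_assoc append.simps ..
  also have "\<dots> = {p @ a @ b | a j b. i # l = a @ j # b}"
    by (rule splits_Cons[symmetric])
  finally show ?case .
qed simp

lemma distinct_drops: "distinct l \<Longrightarrow> distinct (drops p l)"
proof (induction p l rule: drops.induct)
  case (2 p i l)
  have "p @ l \<notin> set (drops (p @ [i]) l)"
  proof
    assume "p @ l \<in> set (drops (p @ [i]) l)"
    then have "\<exists>a b. l = i # a @ b" unfolding set_drops by auto
    with 2(2) show False by auto
  qed
  then show ?case using 2 by simp
qed simp

lemma set_ridge_list:
  "set (ridge_list v p l) = {(map fst (p @ a @ b), p @ a @ b, snd x, v) | a x b. l = a @ x # b}"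
proof (induction v p l rule: ridge_list.induct)
  case (2 v p i u l)
  have "set (ridge_list v p ((i, u) # l)) =
      insert (map fst (p @ [] @ l), p @ [] @ l, snd (i, u), v)
        {(map fst (p @ ((i, u) # a) @ b), p @ ((i, u) # a) @ b, snd x, v) | a x b. l = a @ x # b}"
    unfolding ridge_list.simps list.set app_append 2[unfolded app_append] append_assoc append.simps ids_map map_append snd_conv ..
  also have "\<dots> = {(map fst (p @ a @ b), p @ a @ b, snd x, v) | a x b. (i, u) # l = a @ x # b}"
    by (rule splits_Cons[symmetric])
  finally show ?case .
qed simp

section \<open>Candidates and the children of a state\<close>

fun cand_set :: "cands \<Rightarrow> int list set" where
  "cand_set CE = {}"
| "cand_set (CL c) = {c}"
| "cand_set (CN a b) = cand_set a \<union> cand_set b"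

lemma cand_set_node [simp]: "cand_set (node a b) = cand_set a \<union> cand_set b"
  by (induction a b rule: node.induct) auto

lemma cand_set_tip_if [simp]: "cand_set (tip_if b c) = (if b then {c} else {})"
  by (cases b) auto

lemma cand_set_level_cut [simp]: "cand_set (level_cut v cs) = {c \<in> cand_set cs. 0 \<le> dot c v}"
  by (induction cs) auto

lemma cand_set_budget_cut [simp]:
  "cand_set (budget_cut m B s cs) = {c \<in> cand_set cs. budget_ok m (B + sum_list c) s c}"
  by (induction cs) (auto simp del: budget_ok.simps)

lemma cand_set_known_cut [simp]: "cand_set (known_cut W cs) = cand_set cs - snd ` set W"
  by (induction cs) auto

lemma ok_all_iff: "ok_all r v W \<longleftrightarrow> (\<forall>(i, w) \<in> set W. 0 \<le> dot w v \<or> i \<in> set r)"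
  and "ok_next b r v W \<longleftrightarrow> b \<and> (\<forall>(i, w) \<in> set W. 0 \<le> dot w v \<or> i \<in> set r)"
  by (induction r v W and b r v W rule: ok_all_ok_next.induct) auto

lemma nonneg1_iff: "nonneg1 c x \<longleftrightarrow> (\<forall>i < length x. 0 \<le> x ! i + c)"
  by (induction c x rule: nonneg1.induct) (auto simp: less_Suc_eq_0_disj)

lemma nonneg2_iff: "length x = length y \<Longrightarrow> nonneg2 c x y \<longleftrightarrow> (\<forall>i < length x. 0 \<le> x ! i + y ! i + c)"
  by (induction c x y rule: nonneg2.induct) (auto simp: less_Suc_eq_0_disj)

lemma set_select_old [simp]: "set (select_old u W) = {(i, w) \<in> set W. dot w u = - 1}"
  by (induction u W rule: select_old.induct) auto

lemma set_select_new [simp]: "set (select_new u cs acc) = {w \<in> cand_set cs. dot w u = - 1} \<union> set acc"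
  by (induction u cs acc rule: select_new.induct) auto

text \<open>The point of the ray from \<open>v\<close> in direction \<open>u\<close> at which
  \<open>w\<close> becomes tight, provided that \<open>w\<close> pairs to -1 with
  \<open>u\<close>.\<close>

definition nbr :: "int list \<Rightarrow> int list \<Rightarrow> int list \<Rightarrow> int list" where
  "nbr v u w = axpy (dot w v + 1) u v"

lemma set_check_old [simp]:
  "set (check_old r u v W ws) = {(i, w, nbr v u w) | i w. (i, w) \<in> set ws \<and> ok_all (i # r) (nbr v u w) W}"
  by (induction r u v W ws rule: check_old.induct) (auto simp: nbr_def)

lemma set_check_new [simp]:
  "set (check_new r u v W k ws) = {(k, w, nbr v u w) | w. w \<in> set ws \<and> ok_all (k # r) (nbr v u w) W}"
  by (induction r u v W k ws rule: check_new.induct) (auto simp: nbr_def)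

lemma subset_grow_if: "set rest \<subseteq> set (grow_if b W k fs ks es cs B s l u i w v rest)"
  by (cases b) (auto simp del: grow.simps)

lemma subset_new_if: "set rest \<subseteq> set (new_if b m ts W k fs ks es cs B s l u i w v rest)"
  using subset_grow_if by (cases b) (simp_all del: grow_if.simps)

lemma subset_olds: "set rest \<subseteq> set (olds m ts W k fs ks es cs B s l u ws rest)"
proof (induction ws)
  case (Cons y ws)
  obtain i w v where y: "y = (i, w, v)" by (cases y) auto
  show ?case
    unfolding y olds.simps grow_ok.simps using Cons.IH subset_grow_if by (rule subset_trans)
qed simp

lemma mem_olds:
  assumes "(i, w, x) \<in> set ws" "sum_ok m ts (level_cut x cs) B s"
  shows "grow W k fs ks es (level_cut x cs) B s x (insert_item i (vneg u) (pivot w u l))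
    \<in> set (olds m ts W k fs ks es cs B s l u ws rest)"
  using assms
proof (induction ws)
  case (Cons y ws)
  obtain i' w' v' where y: "y = (i', w', v')" by (cases y) auto
  show ?case
  proof (cases "y = (i, w, x)")
    case True
    then show ?thesis using Cons.prems(2) by (simp del: grow.simps)
  next
    case False
    then have "(i, w, x) \<in> set ws" using Cons.prems by auto
    from Cons.IH[OF this Cons.prems(2)] show ?thesis
      unfolding y olds.simps grow_ok.simps by (rule subsetD[OF subset_grow_if])
  qed
qed simp

lemma mem_news:
  assumes "(i, w, x) \<in> set ws" "0 \<le> B + sum_list w"
    "sum_ok m ts (budget_cut m (B + sum_list w) (vadd s w) (level_cut x cs)) (B + sum_list w) (vadd s w)"
  shows "grow ((i, w) # W) (k + 1) fs ks es (budget_cut m (B + sum_list w) (vadd s w) (level_cut x cs))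
      (B + sum_list w) (vadd s w) x (insert_item i (vneg u) (pivot w u l))
    \<in> set (news m ts W k fs ks es cs B s l u ws)"
  using assms
proof (induction ws)
  case (Cons y ws)
  obtain i' w' v' where y: "y = (i', w', v')" by (cases y) auto
  show ?case
  proof (cases "y = (i, w, x)")
    case True
    then show ?thesis using Cons.prems(2,3) by (simp del: grow.simps)
  next
    case False
    then have "(i, w, x) \<in> set ws" using Cons.prems by auto
    from Cons.IH[OF this Cons.prems(2,3)] show ?thesis
      unfolding y news.simps new_budget.simps by (rule subsetD[OF subset_new_if])
  qed
qed simp

lemma mem_children_old:
  assumes "(i, w) \<in> set W" "dot w u = - 1" "ok_all (i # r) (nbr v u w) W"
    "sum_ok m ts (level_cut (nbr v u w) cs) B s"
  shows "grow W k fs ks es (level_cut (nbr v u w) cs) B s (nbr v u w) (insert_item i (vneg u) (pivot w u l))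
    \<in> set (children m ts W k fs ks es cs B s (r, l, u, v))"
  unfolding children.simps using assms by (intro mem_olds) auto

lemma mem_children_new:
  assumes "w \<in> cand_set cs" "dot w u = - 1" "ok_all (k # r) (nbr v u w) W" "0 \<le> B + sum_list w"
    "sum_ok m ts (budget_cut m (B + sum_list w) (vadd s w) (level_cut (nbr v u w) cs)) (B + sum_list w) (vadd s w)"
  shows "grow ((k, w) # W) (k + 1) fs ks es (budget_cut m (B + sum_list w) (vadd s w) (level_cut (nbr v u w) cs))
      (B + sum_list w) (vadd s w) (nbr v u w) (insert_item k (vneg u) (pivot w u l))
    \<in> set (children m ts W k fs ks es cs B s (r, l, u, v))"
proof -
  have *: "(k, w, nbr v u w) \<in> set (check_new r u v W k (select_new u cs []))"
    using assms by auto
  show ?thesis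
    unfolding children.simps by (rule subsetD[OF subset_olds mem_news[OF * assms(4,5)]])
qed


text \<open>A sorted index list is a canonical name for a set of known normals: by
  \<open>named_unique\<close> and \<open>named_inj\<close>, comparing lists decides equality of
  ridges.\<close>

definition named :: "item list \<Rightarrow> int list \<Rightarrow> int list set \<Rightarrow> bool" where
  "named W l S \<longleftrightarrow> sorted_wrt (<) l \<and> set l = fst ` {p \<in> set W. snd p \<in> S} \<and> S \<subseteq> snd ` set W"

definition naming :: "item list \<Rightarrow> bool" where
  "naming W \<longleftrightarrow> distinct (map fst W) \<and> distinct (map snd W)"

lemma naming_fst: "naming W \<Longrightarrow> (i, w) \<in> set W \<Longrightarrow> (i, w') \<in> set W \<Longrightarrow> w = w'"
  unfolding naming_def by (metis eq_key_imp_eq_value)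

lemma naming_snd:
  assumes "naming W" "(i, w) \<in> set W" "(j, w) \<in> set W"
  shows "i = j"
proof -
  have "inj_on snd (set W)" using assms by (simp add: naming_def distinct_map)
  from inj_onD[OF this _ assms(2,3)] show ?thesis by simp
qed

lemma sorted_less_unique:
  fixes l l' :: "int list"
  assumes "sorted_wrt (<) l" "sorted_wrt (<) l'" "set l = set l'"
  shows "l = l'"
  using assms by (metis strict_sorted_equal)

lemma named_unique: "named W l S \<Longrightarrow> named W l' S \<Longrightarrow> l = l'"
  unfolding named_def by (metis sorted_less_unique)

lemma named_inj:
  assumes "naming W" "named W l S" "named W l S'"
  shows "S = S'"
proof -
  have "S \<subseteq> S'" if S: "named W l S" "named W l S'" for S S'
  proof
    fix w assume "w \<in> S"
    then have "w \<in> snd ` set W" using S(1) by (auto simp: named_def)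
    then obtain i where i: "(i, w) \<in> set W" by auto
    then have "i \<in> set l" using S(1) \<open>w \<in> S\<close> by (force simp: named_def)
    then obtain w' where "(i, w') \<in> set W" "w' \<in> S'" using S(2) by (auto simp: named_def)
    then show "w \<in> S'" using naming_fst[OF assms(1) i] by simp
  qed
  then show ?thesis using assms by blast
qed

lemma named_weaken:
  assumes "named W l S" "w \<notin> snd ` set W"
  shows "named ((k, w) # W) l S"
proof -
  have "w \<notin> S" using assms by (auto simp: named_def)
  then have "{p \<in> set ((k, w) # W). snd p \<in> S} = {p \<in> set W. snd p \<in> S}" by auto
  with assms(1) show ?thesis unfolding named_def by auto
qed

text \<open>An item list records the dual vectors of the members of \<open>S\<close> at the vertex \<open>v\<close>.\<close>
definition items :: "(int list \<Rightarrow> int list \<Rightarrow> int list) \<Rightarrow> item list \<Rightarrow> item list \<Rightarrow> int list \<Rightarrow> int list set \<Rightarrow> bool" where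
  "items U W l v S \<longleftrightarrow> named W (map fst l) S \<and> (\<forall>(i, u) \<in> set l. \<exists>w. (i, w) \<in> set W \<and> w \<in> S \<and> u = U v w)"

lemma items_weaken: "items U W l v S \<Longrightarrow> w \<notin> snd ` set W \<Longrightarrow> items U ((k, w) # W) l v S"
  unfolding items_def using named_weaken by fastforce

lemma insert_item_fst:
  "i \<notin> fst ` set l \<Longrightarrow> sorted_wrt (<) (map fst l) \<Longrightarrow> sorted_wrt (<) (map fst (insert_item i u l))"
  "set (insert_item i u l) = insert (i, u) (set l)"
proof -
  have if_simp: "insert_if b x y l l' = (if b then x # y # l else y # l')" for b x y l l'
    by (cases b) auto
  show 2: "set (insert_item i u l) = insert (i, u) (set l)" for l
    by (induction l) (auto simp: if_simp split: if_splits)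
  show "i \<notin> fst ` set l \<Longrightarrow> sorted_wrt (<) (map fst l) \<Longrightarrow> sorted_wrt (<) (map fst (insert_item i u l))"
    by (induction l) (force simp: if_simp 2)+
qed

lemma pivot_eq: "pivot w u l = map (\<lambda>(i, x). (i, axpy (dot w x) u x)) l"
  by (induction w u l rule: pivot.induct) auto

text \<open>The combinatorics of the polytope in integer coordinates: \<open>V\<close> are the
  normals, \<open>VS\<close> the vertices, \<open>T v\<close> the normals tight at \<open>v\<close>,
  and \<open>U v w\<close> the edge direction at \<open>v\<close> dual to \<open>w\<close>. By
  \<open>ridge_unique\<close> an edge contains at most one vertex besides \<open>v\<close>; by
  \<open>connected\<close> a nonempty set of vertices that has, with each member, a second vertex on
  each of its edges is already everything.\<close>

locale fan =
  fixes n :: nat and V VS :: "int list set" and U :: "int list \<Rightarrow> int list \<Rightarrow> int list"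
    and T :: "int list \<Rightarrow> int list set"
  assumes T_eq: "T v = {w \<in> V. dot w v = - 1}"
    and finite_V: "finite V"
    and length_V: "w \<in> V \<Longrightarrow> length w = n"
    and T_nonneg: "v \<in> VS \<Longrightarrow> w \<in> V \<Longrightarrow> w \<notin> T v \<Longrightarrow> 0 \<le> dot w v"
    and card_T: "v \<in> VS \<Longrightarrow> card (T v) = n"
    and U_dual: "v \<in> VS \<Longrightarrow> w \<in> T v \<Longrightarrow> y \<in> T v \<Longrightarrow> dot y (U v w) = (if y = w then 1 else 0)"
    and nbr_ex: "v \<in> VS \<Longrightarrow> w \<in> T v \<Longrightarrow> \<exists>x\<in>V. dot x (U v w) = - 1 \<and> nbr v (U v w) x \<in> VS \<and>
        T (nbr v (U v w) x) = insert x (T v - {w}) \<and> U (nbr v (U v w) x) x = vneg (U v w) \<and>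
        (\<forall>y\<in>T v - {w}. U (nbr v (U v w) x) y = axpy (dot x (U v y)) (U v w) (U v y))"
    and ridge_unique: "v \<in> VS \<Longrightarrow> v1 \<in> VS \<Longrightarrow> v2 \<in> VS \<Longrightarrow> w \<in> T v \<Longrightarrow> v1 \<noteq> v \<Longrightarrow> v2 \<noteq> v \<Longrightarrow>
        T v - {w} \<subseteq> T v1 \<Longrightarrow> T v - {w} \<subseteq> T v2 \<Longrightarrow> v1 = v2"
    and connected: "S \<subseteq> VS \<Longrightarrow> S \<noteq> {} \<Longrightarrow>
        (\<And>v w. v \<in> S \<Longrightarrow> w \<in> T v \<Longrightarrow> \<exists>v'\<in>S. v' \<noteq> v \<and> T v - {w} \<subseteq> T v') \<Longrightarrow> S = VS"
begin

lemma T_sub: "T v \<subseteq> V"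
  by (auto simp: T_eq)

lemma finite_T: "finite (T v)"
  using finite_V T_sub finite_subset by blast

text \<open>All vertices have the same number of tight normals, so a ridge of \<open>v\<close> that
  is contained in \<open>T v'\<close> is a ridge of \<open>v'\<close> as well.\<close>

lemma ridge_cases:
  assumes "v \<in> VS" "v' \<in> VS" "w \<in> T v" "T v - {w} \<subseteq> T v'"
  obtains y where "y \<in> T v'" "T v - {w} = T v' - {y}"
proof -
  have "card (T v - {w}) = n - 1" using assms card_T by (simp add: finite_T)
  moreover have "0 < n" using assms card_T finite_T by (metis card_gt_0_iff empty_iff)
  ultimately have "card (T v' - (T v - {w})) = 1"
    using assms card_T[of v'] by (subst card_Diff_subset) (auto simp: finite_T)
  then obtain y where y: "T v' - (T v - {w}) = {y}" by (auto simp: card_1_singleton_iff)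
  then have "y \<in> T v'" by blast
  moreover have "T v - {w} = T v' - {y}" using y assms(4) by blast
  ultimately show ?thesis by (rule that)
qed

end


text \<open>The set \<open>K\<close> consists of the normals known from the start, later those of
  the star. For all others the last two assumptions bound the coordinates by the level, which is
  what makes the partial sums useful for pruning.\<close>

locale fan_search = fan +
  fixes K :: "int list set" and m :: int and ts :: "bool list"
  assumes K_sub: "K \<subseteq> V"
    and m_nonneg: "0 \<le> m"
    and total_nonneg: "i < n \<Longrightarrow> 0 \<le> (\<Sum>w\<in>V. w ! i)"
    and total_ties: "ties_ok ts (map (\<lambda>i. \<Sum>w\<in>V. w ! i) [0..<n])"
    and far_sum: "w \<in> V - K \<Longrightarrow> sum_list w \<le> 0"
    and far_coord: "w \<in> V - K \<Longrightarrow> i < n \<Longrightarrow> w ! i \<le> m * - sum_list w"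
begin

section \<open>Bounds on partial sums\<close>

definition partial_sum :: "int list set \<Rightarrow> int list" where
  "partial_sum X = map (\<lambda>i. \<Sum>w\<in>X. w ! i) [0..<n]"

lemma sum_list_V: "w \<in> V \<Longrightarrow> sum_list w = (\<Sum>i<n. w ! i)"
  using length_V[of w] by (simp add: sum_list_sum_nth atLeast0LessThan)

lemma total_sum_nonneg: "0 \<le> (\<Sum>w\<in>V. sum_list w)"
proof -
  have "(\<Sum>w\<in>V. sum_list w) = (\<Sum>i<n. \<Sum>w\<in>V. w ! i)"
    using sum_list_V by (subst sum.swap) (simp cong: sum.cong)
  also have "\<dots> \<ge> 0" by (intro sum_nonneg total_nonneg) auto
  finally show ?thesis .
qed

text \<open>Outside \<open>X\<close> the entry sums are nonpositive and the grand total is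
  nonnegative, so the entry sums over \<open>X\<close> are at least the total level outside
  \<open>X\<close>. A coordinate gains from outside at most \<open>m\<close> times that
  level.\<close>

lemma known_bounds:
  assumes "K \<subseteq> X" "X \<subseteq> V"
  shows "0 \<le> (\<Sum>w\<in>X. sum_list w)"
    and "i < n \<Longrightarrow> 0 \<le> (\<Sum>w\<in>X. w ! i) + m * (\<Sum>w\<in>X. sum_list w)"
proof -
  have fin: "finite X" "finite (V - X)" using assms finite_V finite_subset by auto
  have split: "(\<Sum>w\<in>V. f w) = (\<Sum>w\<in>X. f w) + (\<Sum>w\<in>V - X. f w)" for f :: "int list \<Rightarrow> int"
    using assms(2) finite_V by (simp add: sum.subset_diff add.commute)
  have "(\<Sum>w\<in>V - X. sum_list w) \<le> 0"
    using assms far_sum by (intro sum_nonpos) auto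
  then show "0 \<le> (\<Sum>w\<in>X. sum_list w)"
    using total_sum_nonneg split[of sum_list] by simp
  assume i: "i < n"
  have "(\<Sum>w\<in>V - X. w ! i) \<le> (\<Sum>w\<in>V - X. m * - sum_list w)"
    using assms far_coord i by (intro sum_mono) auto
  also have "\<dots> = m * - (\<Sum>w\<in>V - X. sum_list w)"
    by (simp add: sum_negf sum_distrib_left)
  also have "\<dots> \<le> m * (\<Sum>w\<in>X. sum_list w)"
    using total_sum_nonneg split[of sum_list] by (intro mult_left_mono m_nonneg) auto
  finally show "0 \<le> (\<Sum>w\<in>X. w ! i) + m * (\<Sum>w\<in>X. sum_list w)"
    using total_nonneg[OF i] split[of "\<lambda>w. w ! i"] by simp
qed

lemma sum_ok_known:
  assumes "K \<subseteq> X" "X \<subseteq> V" "V - X \<subseteq> cand_set cs"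
  shows "sum_ok m ts cs (\<Sum>w\<in>X. sum_list w) (partial_sum X)"
proof (cases cs)
  case CE
  then have "X = V" using assms by auto
  then show ?thesis
    using CE total_nonneg total_ties by (auto simp: nonneg1_iff partial_sum_def)
qed (use known_bounds[OF assms(1,2)] in \<open>auto simp: nonneg1_iff partial_sum_def\<close>)

lemma partial_sum_insert:
  assumes "finite X" "w \<notin> X" "length w = n"
  shows "vadd (partial_sum X) w = partial_sum (insert w X)"
  using assms by (intro nth_equalityI) (auto simp: partial_sum_def nth_vadd)

lemma budget_ok_known:
  assumes "K \<subseteq> X" "X \<subseteq> V" "c \<in> V - X"
  shows "budget_ok m ((\<Sum>w\<in>X. sum_list w) + sum_list c) (partial_sum X) c"
proof -
  have fin: "finite X" using assms finite_V finite_subset by auto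
  have "K \<subseteq> insert c X" "insert c X \<subseteq> V" using assms by auto
  note kb = known_bounds[OF this]
  show ?thesis
    using kb assms fin length_V[of c]
    by (auto simp: nonneg2_iff partial_sum_def sum.insert algebra_simps)
qed

text \<open>The state is part of the actual fan, not merely a consistent guess. An open ridge has
  exactly one known vertex, and a ridge of a known vertex is open or has a second known vertex. The
  entries \<open>es\<close> cover all open ridges but may include closed ones except at the head;
  the candidates include every normal that is not yet known.\<close>

definition inv :: "state \<Rightarrow> bool" where
  "inv st \<longleftrightarrow> (case st of St W k fs ks es cs B s \<Rightarrow>
    naming W \<and> (\<forall>(i, w) \<in> set W. i < k \<and> w \<in> V) \<and> K \<subseteq> snd ` set W \<and>
    fs \<noteq> [] \<and> (\<forall>(l, v) \<in> set fs. v \<in> VS \<and> named W l (T v)) \<and>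
    distinct ks \<and>
    (\<forall>r\<in>set ks. (\<exists>v\<in>snd ` set fs. \<exists>w\<in>T v. named W r (T v - {w}) \<and>
        (\<forall>v'\<in>snd ` set fs. T v - {w} \<subseteq> T v' \<longrightarrow> v' = v)) \<and> r \<in> fst ` set es) \<and>
    (\<forall>v\<in>snd ` set fs. \<forall>w\<in>T v. (\<exists>v'\<in>snd ` set fs. v' \<noteq> v \<and> T v - {w} \<subseteq> T v') \<or>
        (\<exists>r\<in>set ks. named W r (T v - {w}))) \<and>
    (\<forall>(r, l, u, v)\<in>set es. v \<in> snd ` set fs \<and> r = map fst l \<and>
        (\<exists>w\<in>T v. u = U v w \<and> items U W l v (T v - {w}))) \<and>
    (es \<noteq> [] \<longrightarrow> fst (hd es) \<in> set ks) \<and>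
    V - snd ` set W \<subseteq> cand_set cs \<and>
    B = (\<Sum>w\<in>snd ` set W. sum_list w) \<and> s = partial_sum (snd ` set W))"

definition complete :: "item list \<Rightarrow> facet list \<Rightarrow> bool" where
  "complete W fs \<longleftrightarrow> naming W \<and> snd ` set W \<subseteq> V \<and> (\<forall>(l, v) \<in> set fs. named W l (T v)) \<and> snd ` set fs = VS"

section \<open>Preservation of the invariant\<close>

lemma next_open:
  "set (next_open ks es) \<subseteq> set es"
  "fst ` set es \<inter> set ks \<subseteq> fst ` set (next_open ks es)"
  "next_open ks es \<noteq> [] \<Longrightarrow> fst (hd (next_open ks es)) \<in> set ks"
proof -
  have next_if: "next_if b ks e es = (if b then e # es else next_open ks es)" for b ks e es
    by (cases b) auto
  show "set (next_open ks es) \<subseteq> set es"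
    by (induction es) (auto simp: next_if split: if_splits)
  show "fst ` set es \<inter> set ks \<subseteq> fst ` set (next_open ks es)"
  proof (induction es)
    case (Cons e es)
    obtain r x where e: "e = (r, x)" by (cases e)
    have "fst ` set (e # es) = insert r (fst ` set es)" by (simp add: e)
    with Cons show ?case by (cases "r \<in> set ks") (auto simp: e next_if simp del: image_insert)
  qed simp
  show "next_open ks es \<noteq> [] \<Longrightarrow> fst (hd (next_open ks es)) \<in> set ks"
    by (induction es) (auto simp: next_if split: if_splits)
qed

lemma named_split:
  assumes "naming W" "named W l S" "(i, w) \<in> set W" "w \<in> S" "l = a @ i # b"
  shows "named W (a @ b) (S - {w})"
proof -
  have l: "sorted_wrt (<) l" "set l = fst ` {p \<in> set W. snd p \<in> S}" "S \<subseteq> snd ` set W"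
    using assms(2) by (simp_all add: named_def)
  have "fst ` {p \<in> set W. snd p \<in> S - {w}} = fst ` {p \<in> set W. snd p \<in> S} - {i}"
  proof (intro set_eqI iffI)
    fix j assume "j \<in> fst ` {p \<in> set W. snd p \<in> S - {w}}"
    then obtain w' where w': "(j, w') \<in> set W" "w' \<in> S" "w' \<noteq> w" by auto
    then have "j \<noteq> i" using naming_fst[OF assms(1,3), of w'] by blast
    with w' show "j \<in> fst ` {p \<in> set W. snd p \<in> S} - {i}" by force
  next
    fix j assume "j \<in> fst ` {p \<in> set W. snd p \<in> S} - {i}"
    then obtain w' where w': "(j, w') \<in> set W" "w' \<in> S" "j \<noteq> i" by auto
    then have "w' \<noteq> w" using naming_snd[OF assms(1,3), of j] by blast
    with w' show "j \<in> fst ` {p \<in> set W. snd p \<in> S - {w}}" by force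
  qed
  moreover have "sorted_wrt (<) (a @ b)" "set (a @ b) = set l - {i}"
    using l(1) unfolding assms(5) by (auto simp: sorted_wrt_append)
  moreover have "S - {w} \<subseteq> snd ` set W" using l(3) by blast
  ultimately show ?thesis
    unfolding named_def l(2) by simp
qed

lemma named_mem:
  assumes "named W l S" "w \<in> S"
  obtains i a b where "(i, w) \<in> set W" "l = a @ i # b"
proof -
  have "w \<in> snd ` set W" using assms by (auto simp: named_def)
  then obtain i where i: "(i, w) \<in> set W" by auto
  then have "i \<in> fst ` {p \<in> set W. snd p \<in> S}" using assms(2) by force
  then have "i \<in> set l" using assms(1) by (simp add: named_def)
  then obtain a b where "l = a @ i # b" by (blast dest: split_list)
  with i show ?thesis by (rule that)
qed

lemma items_split:
  assumes "naming W" "items U W l v S" "l = a @ z # b"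
  obtains y where "y \<in> S" "(fst z, y) \<in> set W" "snd z = U v y" "items U W (a @ b) v (S - {y})"
proof -
  from assms obtain y where y: "y \<in> S" "(fst z, y) \<in> set W" "snd z = U v y"
    unfolding items_def by fastforce
  have n: "named W (map fst (a @ b)) (S - {y})"
    using named_split[OF assms(1) _ y(2,1), of "map fst l" "map fst a" "map fst b"] assms
    by (simp add: items_def)
  have "\<exists>w. (i, w) \<in> set W \<and> w \<in> S - {y} \<and> u = U v w" if "(i, u) \<in> set (a @ b)" for i u
  proof -
    have "(i, u) \<in> set l" using that assms(3) by auto
    then obtain w where w: "(i, w) \<in> set W" "w \<in> S" "u = U v w"
      using assms(2) by (auto simp: items_def)
    have "sorted_wrt (<) (map fst l)" using assms(2) by (simp add: items_def named_def)
    then have "i \<noteq> fst z"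
      using that assms(3) by (auto simp: sorted_wrt_append)
    then have "w \<noteq> y" using naming_snd[OF assms(1) w(1), of "fst z"] y(2) by blast
    with w show ?thesis by blast
  qed
  then have "\<forall>(i, u)\<in>set (a @ b). \<exists>w. (i, w) \<in> set W \<and> w \<in> S - {y} \<and> u = U v w" by blast
  with n have "items U W (a @ b) v (S - {y})" unfolding items_def by (rule conjI)
  from that[OF y this] show ?thesis .
qed

lemma set_drops_named:
  assumes "naming W" "named W l S"
  shows "set (drops [] l) = {r. \<exists>y\<in>S. named W r (S - {y})}"
proof (intro set_eqI iffI)
  fix r assume "r \<in> set (drops [] l)"
  then have "\<exists>a i b. r = a @ b \<and> l = a @ i # b" unfolding set_drops append_Nil by simp
  then obtain a i b where r: "r = a @ b" "l = a @ i # b" by (elim exE conjE)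
  from r(2) have "i \<in> set l" by simp
  then have "i \<in> fst ` {p \<in> set W. snd p \<in> S}" using assms(2) unfolding named_def by simp
  then obtain y where y: "(i, y) \<in> set W" "y \<in> S" by auto
  have "named W r (S - {y})" using named_split[OF assms y r(2)] r(1) by simp
  with y(2) show "r \<in> {r. \<exists>y\<in>S. named W r (S - {y})}" by blast
next
  fix r assume "r \<in> {r. \<exists>y\<in>S. named W r (S - {y})}"
  then obtain y where y: "y \<in> S" "named W r (S - {y})" by blast
  obtain i a b where i: "(i, y) \<in> set W" "l = a @ i # b" by (rule named_mem[OF assms(2) y(1)])
  have "r = a @ b"
    using named_unique[OF y(2) named_split[OF assms i(1) y(1) i(2)]] .
  with i(2) show "r \<in> set (drops [] l)" unfolding set_drops append_Nil by blast
qed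

end

context fan_search begin

text \<open>The cases of a known and a new normal are treated together by carrying all names over
  from \<open>W0\<close> to \<open>W\<close>. The core is that toggling the ridges of the new vertex
  is correct: one that was open had a single known vertex and is closed now, while one that was not
  open lies on no known vertex at all.\<close>

lemma inv_grow:
  assumes inv: "inv (St W0 k0 fs ks ((r, l, u, v) # es) cs0 B0 s0)"
    and w: "w \<in> T v" "u = U v w"
    and x: "x \<in> V" "nbr v u x \<in> VS" "T (nbr v u x) = insert x (T v - {w})" "x \<notin> T v"
      "U (nbr v u x) x = vneg u" "\<forall>y\<in>T v - {w}. U (nbr v u x) y = axpy (dot x (U v y)) u (U v y)"
    and l: "items U W0 l v (T v - {w})"
    and W: "(W = W0 \<and> k = k0 \<and> (i, x) \<in> set W0) \<or> (W = (k0, x) # W0 \<and> k = k0 + 1 \<and> i = k0 \<and> x \<notin> snd ` set W0)"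
    and cs: "V - snd ` set W \<subseteq> cand_set cs"
    and B: "B = (\<Sum>w\<in>snd ` set W. sum_list w)" and s: "s = partial_sum (snd ` set W)"
  shows "inv (grow W k fs ks es cs B s (nbr v u x) (insert_item i (vneg u) (pivot x u l)))"
proof -
  define v' l' F where "v' = nbr v u x" and "l' = insert_item i (vneg u) (pivot x u l)" and "F = snd ` set fs"
  have W0: "naming W0" "\<forall>(i, w) \<in> set W0. i < k0 \<and> w \<in> V" "K \<subseteq> snd ` set W0"
    and fs0: "fs \<noteq> []" "\<forall>(l, v) \<in> set fs. v \<in> VS \<and> named W0 l (T v)"
    and ks: "distinct ks" "\<And>r. r \<in> set ks \<Longrightarrow> \<exists>v\<in>F. \<exists>w\<in>T v. named W0 r (T v - {w}) \<and>
        (\<forall>v'\<in>F. T v - {w} \<subseteq> T v' \<longrightarrow> v' = v)"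
      "\<And>r'. r' \<in> set ks \<Longrightarrow> r' = r \<or> r' \<in> fst ` set es"
    and kc: "\<And>v w. v \<in> F \<Longrightarrow> w \<in> T v \<Longrightarrow> (\<exists>v'\<in>F. v' \<noteq> v \<and> T v - {w} \<subseteq> T v') \<or>
        (\<exists>r\<in>set ks. named W0 r (T v - {w}))"
    and es: "v \<in> F" "r = map fst l" "r \<in> set ks"
      "\<forall>(r, l, u, v)\<in>set es. v \<in> F \<and> r = map fst l \<and> (\<exists>w\<in>T v. u = U v w \<and> items U W0 l v (T v - {w}))"
    using inv unfolding inv_def F_def by auto
  have up: "named W0 r' S \<Longrightarrow> named W r' S" "items U W0 l'' v'' S \<Longrightarrow> items U W l'' v'' S" for r' S l'' v''
    using W named_weaken items_weaken by blast+
  have naming: "naming W"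
  proof -
    have "k0 \<notin> fst ` set W0" using W0(2) by auto
    then show ?thesis using W W0(1) by (auto simp: naming_def)
  qed
  have Wk: "\<forall>(i, w) \<in> set W. i < k \<and> w \<in> V" using W W0(2) x(1) by fastforce
  have K: "K \<subseteq> snd ` set W" using W W0 by auto
  have ix: "(i, x) \<in> set W" using W by auto
  have F: "v'' \<in> VS" "T v'' \<subseteq> snd ` set W" if "v'' \<in> F" for v''
  proof -
    obtain l where l: "(l, v'') \<in> set fs" using \<open>v'' \<in> F\<close> by (auto simp: F_def)
    with fs0(2) show "v'' \<in> VS" by blast
    from l fs0(2) have "named W l (T v'')" using up(1) by blast
    then show "T v'' \<subseteq> snd ` set W" by (simp add: named_def)
  qed
  have R: "named W r (T v - {w})" using up l es(2) by (simp add: items_def)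
  have only: "v'' = v" if v'': "v'' \<in> F" "T v - {w} \<subseteq> T v''" for v''
  proof -
    obtain v1 w1 where 1: "v1 \<in> F" "named W0 r (T v1 - {w1})" "\<forall>v'\<in>F. T v1 - {w1} \<subseteq> T v' \<longrightarrow> v' = v1"
      using ks(2)[OF es(3)] by blast
    have "T v1 - {w1} = T v - {w}" by (rule named_inj[OF naming up(1)[OF 1(2)] R])
    with 1 v'' es(1) show ?thesis by (metis Diff_subset)
  qed
  \<comment> \<open>The only known vertex on the crossed ridge is \<open>v\<close>, but
    \<open>x\<close> is tight at the new vertex and not at \<open>v\<close>.\<close>
  have v'_not: "v' \<notin> F"
  proof
    assume "v' \<in> F"
    then have "v' = v" using only[of v'] x(3) by (auto simp: v'_def)
    then show False using x(3,4) by (auto simp: v'_def)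
  qed
  have Tv': "T v' = insert x (T v - {w})" and v'_VS: "v' \<in> VS" using x by (auto simp: v'_def)
  have i_not: "i \<notin> fst ` set l"
  proof
    assume "i \<in> fst ` set l"
    then obtain y where "(i, y) \<in> set W" "y \<in> T v" using up(2)[OF l] by (force simp: items_def named_def)
    then show False using naming_fst[OF naming ix, of y] x(4) by blast
  qed
  have l': "items U W l' v' (T v')"
  proof -
    have lW: "items U W l v (T v - {w})" by (rule up(2)[OF l])
    have fst_pivot: "map fst (pivot x u l) = map fst l" by (simp add: pivot_eq comp_def case_prod_beta)
    have nl: "sorted_wrt (<) (map fst l)" "set (map fst l) = fst ` {p \<in> set W. snd p \<in> T v - {w}}"
      "T v - {w} \<subseteq> snd ` set W"
      using lW by (simp_all add: items_def named_def)
    have set_pivot: "fst ` set (pivot x u l) = set (map fst l)"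
      using fst_pivot by (metis set_map)
    have "sorted_wrt (<) (map fst l')"
      unfolding l'_def
    proof (rule insert_item_fst(1))
      show "i \<notin> fst ` set (pivot x u l)" using set_pivot i_not by simp
      show "sorted_wrt (<) (map fst (pivot x u l))" using nl(1) fst_pivot by simp
    qed
    moreover have "set (map fst l') = fst ` {p \<in> set W. snd p \<in> T v'}"
    proof -
      have *: "j = i" if "(j, x) \<in> set W" for j by (rule naming_snd[OF naming that ix])
      have **: "p = (i, x)" if "p \<in> set W" "snd p = x" for p
        using *[of "fst p"] that by (cases p) simp
      have "{p \<in> set W. snd p \<in> T v'} = insert (i, x) {p \<in> set W. snd p \<in> T v - {w}}"
      proof (intro set_eqI iffI)
        fix p assume "p \<in> {p \<in> set W. snd p \<in> T v'}"
        then have p: "p \<in> set W" "snd p = x \<or> snd p \<in> T v - {w}" by (simp_all add: Tv')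
        show "p \<in> insert (i, x) {p \<in> set W. snd p \<in> T v - {w}}"
        proof (cases "snd p = x")
          case True
          from **[OF p(1) True] show ?thesis by simp
        next
          case False
          with p show ?thesis by simp
        qed
      next
        fix p assume "p \<in> insert (i, x) {p \<in> set W. snd p \<in> T v - {w}}"
        then show "p \<in> {p \<in> set W. snd p \<in> T v'}"
        proof (rule insertE)
          assume "p = (i, x)"
          then show ?thesis by (simp add: Tv' ix)
        next
          assume "p \<in> {p \<in> set W. snd p \<in> T v - {w}}"
          then show ?thesis by (simp add: Tv')
        qed
      qed
      moreover have "set (map fst l') = insert i (fst ` set (pivot x u l))"
        by (simp add: l'_def insert_item_fst(2))
      ultimately show ?thesis using set_pivot nl(2) by simp
    qed
    moreover have "T v' \<subseteq> snd ` set W" using nl(3) image_eqI[OF _ ix, of x snd] unfolding Tv' by simp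
    moreover have "\<exists>y. (j, y) \<in> set W \<and> y \<in> T v' \<and> u' = U v' y" if "(j, u') \<in> set l'" for j u'
    proof -
      from that consider "j = i" "u' = vneg u" | z where "(j, z) \<in> set l" "u' = axpy (dot x z) u z"
        by (auto simp: l'_def insert_item_fst(2) pivot_eq)
      then show ?thesis
      proof cases
        case 1
        then show ?thesis using ix Tv' x(5) by (auto simp: v'_def)
      next
        case 2
        then obtain y where "(j, y) \<in> set W" "y \<in> T v - {w}" "z = U v y"
          using lW by (auto simp: items_def)
        with 2 x(6) Tv' show ?thesis by (auto simp: v'_def)
      qed
    qed
    ultimately show ?thesis unfolding items_def named_def by blast
  qed
  then have nl': "named W (map fst l') (T v')" by (simp add: items_def)
  define RK where "RK = set (drops [] (map fst l'))"
  have RK: "RK = {r. \<exists>y\<in>T v'. named W r (T v' - {y})}"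
    unfolding RK_def by (rule set_drops_named[OF naming nl'])
  define ks' where "ks' = toggles (drops [] (map fst l')) ks"
  have "distinct (drops [] (map fst l'))"
    using nl' by (intro distinct_drops) (simp add: named_def strict_sorted_iff)
  from toggles[OF this ks(1)] have ks': "distinct ks'" "set ks' = (set ks - RK) \<union> (RK - set ks)"
    by (auto simp: ks'_def RK_def)
  define es' where "es' = ridge_list v' [] l' @ es"
  have RK_es: "RK \<subseteq> fst ` set es'"
  proof
    fix r' assume "r' \<in> RK"
    then obtain a j b where r': "r' = a @ b" "map fst l' = a @ j # b"
      unfolding RK_def set_drops append_Nil by blast
    then obtain a' z b' where "l' = a' @ z # b'" "map fst a' = a" "map fst b' = b"
      by (auto simp: map_eq_append_conv map_eq_Cons_conv)
    then have "(r', a' @ b', snd z, v') \<in> set (ridge_list v' [] l')"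
      using r'(1) unfolding set_ridge_list append_Nil by fastforce
    then show "r' \<in> fst ` set es'" by (force simp: es'_def)
  qed
  have es'_ok: "\<forall>(r, l, u, v)\<in>set es'. v \<in> insert v' F \<and> r = map fst l \<and> (\<exists>w\<in>T v. u = U v w \<and> items U W l v (T v - {w}))"
  proof -
    have "\<exists>w\<in>T v'. u' = U v' w \<and> items U W l'' v' (T v' - {w})" "v'' = v'" "r' = map fst l''"
      if in_ridge: "(r', l'', u', v'') \<in> set (ridge_list v' [] l')" for r' l'' u' v''
    proof -
      from in_ridge obtain a z b where *: "r' = map fst (a @ b)" "l'' = a @ b" "u' = snd z" "v'' = v'" "l' = a @ z # b"
        unfolding set_ridge_list append_Nil by blast
      from items_split[OF naming l' *(5)] show "\<exists>w\<in>T v'. u' = U v' w \<and> items U W l'' v' (T v' - {w})"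
        using * by metis
      show "v'' = v'" "r' = map fst l''" using * by auto
    qed
    then show ?thesis using es(4) up(2) unfolding es'_def by fastforce
  qed
  have ki: "(\<exists>v\<in>insert v' F. \<exists>w\<in>T v. named W r (T v - {w}) \<and> (\<forall>v''\<in>insert v' F. T v - {w} \<subseteq> T v'' \<longrightarrow> v'' = v)) \<and>
      r \<in> fst ` set es'" if r': "r \<in> set ks'" for r
  proof (cases "r \<in> RK")
    case True
    then obtain y where y: "y \<in> T v'" "named W r (T v' - {y})" by (auto simp: RK)
    \<comment> \<open>A known vertex on a ridge that is not open has a second known vertex on it;
      together with the new vertex these would be three.\<close>
    have "v'' = v'" if v'': "v'' \<in> F" "T v' - {y} \<subseteq> T v''" for v''
    proof -
      obtain w1 where w1: "w1 \<in> T v''" "T v' - {y} = T v'' - {w1}"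
        by (rule ridge_cases[OF v'_VS F(1)[OF v''(1)] y(1) v''(2)])
      from kc[OF v''(1) w1(1)] show ?thesis
      proof
        assume "\<exists>v2\<in>F. v2 \<noteq> v'' \<and> T v'' - {w1} \<subseteq> T v2"
        then obtain v2 where v2: "v2 \<in> F" "v2 \<noteq> v''" "T v'' - {w1} \<subseteq> T v2" by blast
        have "v'' \<noteq> v'" using v'_not v'' by blast
        then have "v' = v2"
          using ridge_unique[OF F(1)[OF v''(1)] v'_VS F(1)[OF v2(1)] w1(1)] v2 w1(2) by auto
        then show ?thesis using v2 v'_not by blast
      next
        assume "\<exists>r\<in>set ks. named W0 r (T v'' - {w1})"
        then obtain r' where "r' \<in> set ks" "named W r' (T v'' - {w1})" using up by blast
        moreover have "r' = r" using named_unique calculation(2) y(2) w1(2) by metis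
        ultimately show ?thesis using r' True ks'(2) by blast
      qed
    qed
    with y True RK_es show ?thesis by blast
  next
    case False
    then have rks: "r \<in> set ks" using r' ks' by blast
    then obtain v1 w1 where 1: "v1 \<in> F" "w1 \<in> T v1" "named W r (T v1 - {w1})"
      "\<forall>v'\<in>F. T v1 - {w1} \<subseteq> T v' \<longrightarrow> v' = v1"
      using ks(2) up by blast
    have "\<not> T v1 - {w1} \<subseteq> T v'"
    proof
      assume "T v1 - {w1} \<subseteq> T v'"
      from ridge_cases[OF F(1)[OF 1(1)] v'_VS 1(2) this] show False
        using 1(3) False RK by (metis (mono_tags, lifting) mem_Collect_eq)
    qed
    moreover have "r \<in> fst ` set es'"
    proof -
      \<comment> \<open>The only entry taken off the list is that of the crossed ridge, and this
        ridge is closed now.\<close>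
      have "r \<noteq> map fst l"
      proof
        assume "r = map fst l"
        then have "named W r (T v' - {x})" using R es(2) Tv' x(4) by (simp add: Diff_insert_absorb insert_absorb)
        then show False using False RK Tv' by blast
      qed
      then show ?thesis using ks(3)[OF rks] es(2) by (auto simp: es'_def)
    qed
    ultimately show ?thesis using 1 by blast
  qed
  have kc': "(\<exists>v''\<in>insert v' F. v'' \<noteq> v1 \<and> T v1 - {w1} \<subseteq> T v'') \<or> (\<exists>r\<in>set ks'. named W r (T v1 - {w1}))"
    if v1: "v1 \<in> insert v' F" "w1 \<in> T v1" for v1 w1
  proof (cases "v1 = v'")
    case True
    obtain a j b where "(j, w1) \<in> set W" "map fst l' = a @ j # b"
      by (rule named_mem[OF nl', of w1]) (use v1 True in auto)
    from named_split[OF naming nl' this(1) _ this(2)] v1 True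
    obtain r' where r': "named W r' (T v1 - {w1})" by blast
    then have "r' \<in> RK" using v1 True by (auto simp: RK)
    show ?thesis
    proof (cases "r' \<in> set ks")
      case True': True
      then obtain v2 w2 where 2: "v2 \<in> F" "named W0 r' (T v2 - {w2})" using ks(2)[of r'] by blast
      have "T v2 - {w2} = T v1 - {w1}" by (rule named_inj[OF naming up(1)[OF 2(2)] r'])
      then have "T v1 - {w1} \<subseteq> T v2" by blast
      moreover have "v2 \<noteq> v1" using 2(1) True v'_not by blast
      ultimately show ?thesis using 2(1) by blast
    next
      case False
      then show ?thesis using \<open>r' \<in> RK\<close> ks'(2) r' by blast
    qed
  next
    case False
    then have v1F: "v1 \<in> F" using v1 by blast
    from kc[OF this v1(2)] show ?thesis
    proof
      assume "\<exists>r\<in>set ks. named W0 r (T v1 - {w1})"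
      then obtain r' where "r' \<in> set ks" "named W0 r' (T v1 - {w1})" by blast
      then have r': "r' \<in> set ks" "named W r' (T v1 - {w1})" using up(1) by simp_all
      show ?thesis
      proof (cases "r' \<in> RK")
        case True
        then obtain y where "named W r' (T v' - {y})" unfolding RK by blast
        from named_inj[OF naming this r'(2)] have "T v1 - {w1} \<subseteq> T v'" by blast
        moreover have "v' \<noteq> v1" using \<open>v1 \<noteq> v'\<close> by simp
        ultimately show ?thesis by simp
      next
        case False
        then have "r' \<in> set ks'" using r'(1) ks'(2) by simp
        with r'(2) show ?thesis by (intro disjI2 bexI)
      qed
    next
      assume "\<exists>v''\<in>F. v'' \<noteq> v1 \<and> T v1 - {w1} \<subseteq> T v''"
      then show ?thesis by simp
    qed
  qed
  have fs': "\<forall>(l, v) \<in> set ((map fst l', v') # fs). v \<in> VS \<and> named W l (T v)"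
  proof -
    have "v \<in> VS \<and> named W l (T v)" if "(l, v) \<in> set fs" for l v
      using fs0(2) that up(1)[of l "T v"] by blast
    then show ?thesis using nl' v'_VS by auto
  qed
  have snd_fs': "snd ` set ((map fst l', v') # fs) = insert v' F" by (simp add: F_def)
  have eq: "grow W k fs ks es cs B s v' l' = St W k ((map fst l', v') # fs) ks' (next_open ks' es') cs B s"
    by (simp add: ks'_def es'_def)
  have open_ok: "r \<in> fst ` set (next_open ks' es')" if "r \<in> set ks'" for r
    using conjunct2[OF ki[OF that]] next_open(2)[of es' ks'] that by (simp add: subset_eq)
  have es'_ok': "\<forall>(r, l, u, v)\<in>set (next_open ks' es'). v \<in> insert v' F \<and> r = map fst l \<and>
      (\<exists>w\<in>T v. u = U v w \<and> items U W l v (T v - {w}))"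
    using es'_ok next_open(1)[of ks' es'] by (meson subsetD)
  have c1: "(map fst l', v') # fs \<noteq> []" by simp
  have c2: "\<forall>r\<in>set ks'. (\<exists>v\<in>insert v' F. \<exists>w\<in>T v. named W r (T v - {w}) \<and>
      (\<forall>v''\<in>insert v' F. T v - {w} \<subseteq> T v'' \<longrightarrow> v'' = v)) \<and> r \<in> fst ` set (next_open ks' es')"
    using conjunct1[OF ki] open_ok by (intro ballI conjI)
  have c3: "\<forall>v\<in>insert v' F. \<forall>w\<in>T v. (\<exists>v''\<in>insert v' F. v'' \<noteq> v \<and> T v - {w} \<subseteq> T v'') \<or>
      (\<exists>r\<in>set ks'. named W r (T v - {w}))"
    by (intro ballI kc')
  have c4: "next_open ks' es' \<noteq> [] \<longrightarrow> fst (hd (next_open ks' es')) \<in> set ks'"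
    by (intro impI next_open(3))
  have "inv (grow W k fs ks es cs B s v' l')"
    unfolding eq inv_def state.case snd_fs'
    by (intro conjI naming Wk K c1 fs' ks'(1) c2 c3 es'_ok' c4 cs B s)
  then show ?thesis by (simp only: v'_def l'_def)
qed

text \<open>The child is dictated by the fan: \<open>nbr_ex\<close> supplies the normal that enters
  across the ridge, and every test is a necessary condition that the fan satisfies.\<close>

lemma inv_children:
  assumes inv: "inv (St W k fs ks ((r, l, u, v) # es) cs B s)"
  shows "\<exists>st \<in> set (children m ts W k fs ks es cs B s (r, l, u, v)). inv st"
proof -
  have W: "naming W" "\<forall>(i, w) \<in> set W. i < k \<and> w \<in> V" "K \<subseteq> snd ` set W"
    and e: "v \<in> snd ` set fs" "\<exists>w\<in>T v. u = U v w \<and> items U W l v (T v - {w})" "r = map fst l"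
    and fs: "\<forall>(l, v) \<in> set fs. v \<in> VS \<and> named W l (T v)"
    and cs: "V - snd ` set W \<subseteq> cand_set cs"
    and Bs: "B = (\<Sum>w\<in>snd ` set W. sum_list w)" "s = partial_sum (snd ` set W)"
    using inv unfolding inv_def by auto
  obtain w where w: "w \<in> T v" "u = U v w" "items U W l v (T v - {w})" using e(2) by blast
  have v: "v \<in> VS" using e(1) fs by auto
  obtain x where x: "x \<in> V" "dot x u = - 1" "nbr v u x \<in> VS" "T (nbr v u x) = insert x (T v - {w})"
    "U (nbr v u x) x = vneg u" "\<forall>y\<in>T v - {w}. U (nbr v u x) y = axpy (dot x (U v y)) u (U v y)"
    using nbr_ex[OF v w(1)] w(2) by blast
  \<comment> \<open>The entering normal pairs to -1 with \<open>u\<close>, whereas the normals tight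
    at \<open>v\<close> pair to 0 or 1.\<close>
  have xT: "x \<notin> T v" using U_dual[OF v w(1), of x] x(2) w(2) by (auto split: if_splits)
  have WV: "snd ` set W \<subseteq> V" using W(2) by auto
  have r: "set r = fst ` {p \<in> set W. snd p \<in> T v - {w}}"
    using w(3) e(3) by (simp add: items_def named_def)
  have nonneg: "0 \<le> dot c (nbr v u x)" if "c \<in> V" "c \<notin> T (nbr v u x)" for c
    by (rule T_nonneg[OF x(3) that])
  have ok: "ok_all (j # r) (nbr v u x) W" if j: "(j, x) \<in> set W \<or> x \<notin> snd ` set W" for j
    unfolding ok_all_iff
  proof (clarify)
    fix i c assume ic: "(i, c) \<in> set W" "i \<notin> set (j # r)"
    have "c \<notin> T v - {w}" using ic r by force
    moreover have "c \<noteq> x"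
    proof
      assume "c = x"
      then have "x \<in> snd ` set W" using ic(1) by force
      then have "i = j" using j naming_snd[OF W(1)] ic(1) \<open>c = x\<close> by blast
      then show False using ic(2) by simp
    qed
    ultimately have "c \<notin> T (nbr v u x)" using x(4) by simp
    moreover have "c \<in> V" using W(2) ic(1) by auto
    ultimately show "0 \<le> dot c (nbr v u x)" by (rule nonneg[rotated])
  qed
  show ?thesis
  proof (cases "x \<in> snd ` set W")
    case True
    then obtain i where i: "(i, x) \<in> set W" by auto
    define cs' where "cs' = level_cut (nbr v u x) cs"
    have cs': "V - snd ` set W \<subseteq> cand_set cs'"
    proof
      fix c assume c: "c \<in> V - snd ` set W"
      have "T (nbr v u x) \<subseteq> snd ` set W"
        using x(4) True w(3) by (auto simp: items_def named_def)
      then have "0 \<le> dot c (nbr v u x)" using c nonneg by blast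
      then show "c \<in> cand_set cs'" using c cs by (auto simp: cs'_def)
    qed
    have "sum_ok m ts cs' B s"
      unfolding Bs by (rule sum_ok_known[OF W(3) WV cs'])
    moreover have "ok_all (i # r) (nbr v u x) W" using ok[of i] i by blast
    ultimately have "grow W k fs ks es cs' B s (nbr v u x) (insert_item i (vneg u) (pivot x u l))
        \<in> set (children m ts W k fs ks es cs B s (r, l, u, v))"
      unfolding cs'_def by (intro mem_children_old[OF i x(2)])
    moreover have "inv (grow W k fs ks es cs' B s (nbr v u x) (insert_item i (vneg u) (pivot x u l)))"
      by (rule inv_grow[OF inv w(1,2) x(1,3,4) xT x(5,6) w(3) _ cs' Bs]) (use i in simp)
    ultimately show ?thesis by blast
  next
    case False
    define B' s' cs' where "B' = B + sum_list x" and "s' = vadd s x"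
      and "cs' = budget_cut m B' s' (level_cut (nbr v u x) cs)"
    have fin: "finite (snd ` set W)" by simp
    have X: "K \<subseteq> snd ` set ((k, x) # W)" "snd ` set ((k, x) # W) \<subseteq> V"
      using W(3) WV x(1) by auto
    have B': "B' = (\<Sum>w\<in>snd ` set ((k, x) # W). sum_list w)"
      using False by (simp add: B'_def Bs)
    have s': "s' = partial_sum (snd ` set ((k, x) # W))"
      using partial_sum_insert[OF fin False length_V[OF x(1)]] by (simp add: s'_def Bs)
    have cs': "V - snd ` set ((k, x) # W) \<subseteq> cand_set cs'"
    proof
      fix c assume c: "c \<in> V - snd ` set ((k, x) # W)"
      have "T (nbr v u x) \<subseteq> snd ` set ((k, x) # W)"
        using x(4) w(3) by (auto simp: items_def named_def)
      then have "0 \<le> dot c (nbr v u x)" using c nonneg by blast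
      moreover have "budget_ok m (B' + sum_list c) s' c"
        unfolding B' s' by (rule budget_ok_known[OF X c])
      ultimately show "c \<in> cand_set cs'" using c cs by (auto simp: cs'_def simp del: budget_ok.simps)
    qed
    have "sum_ok m ts cs' B' s'"
      unfolding B' s' by (rule sum_ok_known[OF X cs'])
    moreover have "0 \<le> B'" unfolding B' by (rule known_bounds(1)[OF X])
    moreover have "x \<in> cand_set cs" using False x(1) cs by blast
    ultimately have "grow ((k, x) # W) (k + 1) fs ks es cs' B' s' (nbr v u x) (insert_item k (vneg u) (pivot x u l))
        \<in> set (children m ts W k fs ks es cs B s (r, l, u, v))"
      unfolding cs'_def B'_def s'_def by (intro mem_children_new[OF _ x(2) ok]) (use False in simp_all)
    moreover have "inv (grow ((k, x) # W) (k + 1) fs ks es cs' B' s' (nbr v u x) (insert_item k (vneg u) (pivot x u l)))"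
      by (rule inv_grow[OF inv w(1,2) x(1,3,4) xT x(5,6) w(3) _ cs' B' s']) (use False in simp)
    ultimately show ?thesis by blast
  qed
qed

text \<open>Every open ridge has an entry, so an empty list of entries leaves no ridge open, and
  connectedness yields all vertices.\<close>

lemma inv_closed:
  assumes "inv (St W k fs ks [] cs B s)"
  shows "complete W fs" "fs \<noteq> []"
proof -
  have *: "naming W" "\<forall>(i, w) \<in> set W. i < k \<and> w \<in> V" "fs \<noteq> []"
      "\<forall>(l, v) \<in> set fs. v \<in> VS \<and> named W l (T v)" "ks = []"
    and closed: "\<forall>v\<in>snd ` set fs. \<forall>w\<in>T v. (\<exists>v'\<in>snd ` set fs. v' \<noteq> v \<and> T v - {w} \<subseteq> T v') \<or>
        (\<exists>r\<in>set ks. named W r (T v - {w}))"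
    using assms unfolding inv_def by auto
  have "snd ` set fs = VS"
  proof (rule connected)
    show "snd ` set fs \<subseteq> VS" "snd ` set fs \<noteq> {}" using *(3,4) by auto
    show "\<exists>v'\<in>snd ` set fs. v' \<noteq> v \<and> T v - {w} \<subseteq> T v'" if "v \<in> snd ` set fs" "w \<in> T v" for v w
      using bspec[OF bspec[OF closed that(1)] that(2)] *(5) by simp
  qed
  with * show "complete W fs" "fs \<noteq> []" unfolding complete_def by auto
qed

lemma search_sound:
  assumes "search n m ts d sts" "st \<in> set sts" "inv st"
  shows "\<exists>W fs. complete W fs \<and> fs \<noteq> [] \<and> moment_check n W (homogenize fs)"
proof -
  define found where "found \<longleftrightarrow> (\<exists>W fs. complete W fs \<and> fs \<noteq> [] \<and> moment_check n W (homogenize fs))"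
  have "\<forall>sts st. search n m ts d sts \<longrightarrow> st \<in> set sts \<longrightarrow> inv st \<longrightarrow> found" for d
  proof (induction d)
    case 0
    have "search n m ts 0 sts \<longrightarrow> st \<in> set sts \<longrightarrow> inv st \<longrightarrow> found" for sts st
    proof (induction sts)
      case (Cons a sts)
      obtain W k fs ks es cs B s where a: "a = St W k fs ks es cs B s" by (cases a)
      then show ?case
        using Cons inv_closed[of W k fs ks cs B s] by (cases es) (auto simp: found_def)
    qed simp
    then show ?case by blast
  next
    case (Suc d)
    have "search n m ts (Suc d) sts \<longrightarrow> st \<in> set sts \<longrightarrow> inv st \<longrightarrow> found" for sts st
    proof (induction sts)
      case (Cons a sts)
      obtain W k fs ks es cs B s where a: "a = St W k fs ks es cs B s" by (cases a)
      show ?case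
      proof (cases es)
        case Nil
        then show ?thesis using Cons a inv_closed[of W k fs ks cs B s] by (auto simp: found_def)
      next
        case es: (Cons e es')
        obtain r l u v where e: "e = (r, l, u, v)" by (cases e) auto
        show ?thesis
        proof (intro impI)
          assume s: "search n m ts (Suc d) (a # sts)" "st \<in> set (a # sts)" "inv st"
          have "search n m ts d (children m ts W k fs ks es' cs B s (r, l, u, v))" "search n m ts (Suc d) sts"
            using s(1) unfolding a es e search.simps both_conj by blast+
          then show found
            using Suc.IH Cons.IH s(2,3) inv_children[of W k fs ks r l u v es' cs B s]
            unfolding a es e by (metis set_ConsD)
        qed
      qed
    qed simp
    then show ?case by blast
  qed
  with assms show ?thesis unfolding found_def by blast
qed

end

section \<open>The star of a special vertex\<close>

context fan_search
begin

lemma ridge_list_valid: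
  assumes "naming W" "items U W l v (T v)"
  shows "\<forall>(r, l', u, v')\<in>set (ridge_list v [] l). v' = v \<and> r = map fst l' \<and>
      (\<exists>w\<in>T v. u = U v w \<and> items U W l' v (T v - {w}))"
    and "set (drops [] (map fst l)) \<subseteq> fst ` set (ridge_list v [] l)"
proof -
  have "\<exists>w\<in>T v. u = U v w \<and> items U W l' v (T v - {w})" "v' = v" "r = map fst l'"
    if e: "(r, l', u, v') \<in> set (ridge_list v [] l)" for r l' u v'
  proof -
    from e obtain a z b where *: "r = map fst (a @ b)" "l' = a @ b" "u = snd z" "v' = v" "l = a @ z # b"
      unfolding set_ridge_list append_Nil by blast
    from items_split[OF assms *(5)] show "\<exists>w\<in>T v. u = U v w \<and> items U W l' v (T v - {w})"
      using * by metis
    show "v' = v" "r = map fst l'" using * by auto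
  qed
  then show "\<forall>(r, l', u, v')\<in>set (ridge_list v [] l). v' = v \<and> r = map fst l' \<and>
      (\<exists>w\<in>T v. u = U v w \<and> items U W l' v (T v - {w}))" by fastforce
  show "set (drops [] (map fst l)) \<subseteq> fst ` set (ridge_list v [] l)"
  proof
    fix r assume "r \<in> set (drops [] (map fst l))"
    then obtain a j b where r: "r = a @ b" "map fst l = a @ j # b"
      unfolding set_drops append_Nil by blast
    then obtain a' z b' where "l = a' @ z # b'" "map fst a' = a" "map fst b' = b"
      by (auto simp: map_eq_append_conv map_eq_Cons_conv)
    then have "(r, a' @ b', snd z, v) \<in> set (ridge_list v [] l)"
      using r(1) unfolding set_ridge_list append_Nil by fastforce
    then show "r \<in> fst ` set (ridge_list v [] l)" by force
  qed
qed

end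

section \<open>Coordinates of integer lists and enumeration of bounded vectors\<close>

lemma dot_sum: "length x = n \<Longrightarrow> length y = n \<Longrightarrow> dot x y = (\<Sum>i<n. x ! i * y ! i)"
proof (induction x y arbitrary: n rule: dot.induct)
  case (1 a x b y)
  then obtain k where "n = Suc k" by (cases n) auto
  with 1 show ?case by (simp add: sum.lessThan_Suc_shift del: sum.lessThan_Suc)
qed auto

lemma length_axpy [simp]: "length (axpy c x y) = min (length x) (length y)"
  by (induction c x y rule: axpy.induct) auto

lemma nth_axpy: "i < length x \<Longrightarrow> i < length y \<Longrightarrow> axpy c x y ! i = c * x ! i + y ! i"
proof (induction c x y arbitrary: i rule: axpy.induct)
  case (1 c a x b y)
  then show ?case by (cases i) auto
qed auto

lemma length_unit [simp]: "length (unit n i) = n"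
  by (simp add: unit_def)

lemma nth_unit [simp]: "j < n \<Longrightarrow> unit n i ! j = (if i = j then 1 else 0)"
  by (simp add: unit_def)

lemma sum_list_unit: "i < n \<Longrightarrow> sum_list (unit n i) = 1"
  by (simp add: sum_list_sum_nth)

lemma unit_inj: "unit n i = unit n j \<Longrightarrow> i < n \<Longrightarrow> i = j"
  by (metis nth_unit zero_neq_one)

lemma set_cons_all [simp]: "set (cons_all a xs acc) = (#) a ` set xs \<union> set acc"
  by (induction a xs acc rule: cons_all.induct) auto

lemma nil_if_eq [simp]: "nil_if b = (if b then [[]] else [])"
  by (cases b) auto

lemma set_bounded_heads: "set (bounded_heads bs S as) = (\<Union>a\<in>set as. (#) a ` set (bounded_vecs bs (S - a)))"
  by (induction as) auto

lemma lows_sum: "lows bs = (\<Sum>b\<leftarrow>bs. snd b)"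
  by (induction bs rule: lows.induct) auto

lemma mem_bounded_vecs:
  "list_all2 (\<lambda>(f, a) x. a \<le> x \<and> (f \<longrightarrow> x = a)) bs xs \<Longrightarrow> xs \<in> set (bounded_vecs bs (sum_list xs))"
proof (induction rule: list_all2_induct)
  case (Cons b bs x xs)
  obtain f a where b: "b = (f, a)" by (cases b)
  have "lows bs \<le> sum_list xs"
    unfolding lows_sum using Cons(2)
    by (induction rule: list_all2_induct) auto
  then show ?case
    using Cons b by (cases f) (auto simp: set_bounded_heads intro!: bexI[of _ x])
qed simp

lemma low_eq: "low b k l = (if b then - 1 else - (l div (k + 1)))"
  by (cases b) auto

lemma list_all2_nbr_bounds:
  assumes "length x = length ks" "\<And>j. j < length ks \<Longrightarrow> j = i \<Longrightarrow> x ! j = - 1"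
    "\<And>j. j < length ks \<Longrightarrow> j \<noteq> i \<Longrightarrow> low (ks ! j = l) (ks ! j) l \<le> x ! j"
  shows "list_all2 (\<lambda>(f, a) x. a \<le> x \<and> (f \<longrightarrow> x = a)) (nbr_bounds l i ks) x"
  using assms
proof (induction l i ks arbitrary: x rule: nbr_bounds.induct)
  case (2 l k ks)
  then obtain a y where x: "x = a # y" by (cases x) auto
  have "list_all2 (\<lambda>(f, a) x. a \<le> x \<and> (f \<longrightarrow> x = a)) (nbr_bounds l (Suc (length ks)) ks) y"
    using 2(2) 2(4)[of "Suc _"] by (intro 2(1)) (auto simp: x)
  then show ?case using 2(3)[of 0] by (simp add: x)
next
  case (3 l i k ks)
  then obtain a y where x: "x = a # y" by (cases x) auto
  have "list_all2 (\<lambda>(f, a) x. a \<le> x \<and> (f \<longrightarrow> x = a)) (nbr_bounds l i ks) y"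
    using 3(2) 3(3,4)[of "Suc _"] by (intro 3(1)) (auto simp: x)
  then show ?case using 3(4)[of 0] by (simp add: x)
qed simp

lemma list_all2_far_bounds:
  assumes "length x = length ks" "\<And>j. j < length ks \<Longrightarrow> - (l div (ks ! j + 1)) \<le> x ! j"
  shows "list_all2 (\<lambda>(f, a) x. a \<le> x \<and> (f \<longrightarrow> x = a)) (far_bounds l ks) x"
  using assms
proof (induction l ks arbitrary: x rule: far_bounds.induct)
  case (2 l k ks)
  then obtain a y where x: "x = a # y" by (cases x) auto
  have "list_all2 (\<lambda>(f, a) x. a \<le> x \<and> (f \<longrightarrow> x = a)) (far_bounds l ks) y"
    using 2(2) 2(3)[of "Suc _"] by (intro 2(1)) (auto simp: x)
  then show ?case using 2(3)[of 0] by (simp add: x)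
qed simp

lemma set_far_cands: "set (far_cands ks ls) = (\<Union>l\<in>set ls. set (bounded_vecs (far_bounds l ks) (- l)))"
  by (induction ls) auto

lemma cand_set_balance: "cand_set (balance d l) = \<Union> (cand_set ` set l)"
proof (induction d l rule: balance.induct)
  case (4 d a b l)
  have "\<Union> (cand_set ` set (pair_up l)) = \<Union> (cand_set ` set l)" for l
    by (induction l rule: pair_up.induct) auto
  with 4 show ?case by (simp add: Un_assoc)
qed auto

lemma set_tips: "set (tips xs) = CL ` set xs"
  by (induction xs) auto

lemma mem_compatible_cut:
  "y \<in> set (compatible_cut i k x l a ys) \<longleftrightarrow>
     y \<in> set ys \<and> (x = y \<or> 0 \<le> a * (l + 1) + k \<and> 0 \<le> (y ! i) * (k + 1) + l)"
proof -
  have "compatible b i k x y l \<longleftrightarrow> x = y \<or> b \<and> 0 \<le> (y ! i) * (k + 1) + l" for b y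
    by (cases b) auto
  then show ?thesis by (induction ys) auto
qed

lemma compatible_cuts_nth:
  "length ls = length Xs \<Longrightarrow> length (compatible_cuts i k x j ls Xs) = length Xs \<and>
    (\<forall>q < length Xs. compatible_cuts i k x j ls Xs ! q = compatible_cut i k x (ls ! q) (x ! (j + q)) (Xs ! q))"
proof (induction i k x j ls Xs rule: compatible_cuts.induct)
  case (1 i k x j l ls X Xs)
  then show ?case by (auto simp: nth_Cons split: nat.splits)
qed auto

lemma ordered_eq: "ordered k x c = (c = [] \<or> fst (hd c) = k \<longrightarrow> c = [] \<or> weight (snd (hd c)) \<le> weight x)"
proof -
  have "weight_le b u v = (b \<longrightarrow> weight u \<le> weight v)" for b u v by (cases b) auto
  then show ?thesis by (cases c) auto
qed

lemma mem_extend: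
  assumes "x \<in> set xs" "ordered k x c" "x \<in> snd ` set c \<or> k \<le> B"
  shows "(compatible_cuts i k x (Suc i) ls Xs, (k, x) # c, if x \<in> snd ` set c then B else B - k,
      if x \<in> snd ` set c then s else vadd s x) \<in> set (extend i k ls Xs c B s xs)"
proof -
  have eq: "extend_if a b d i k ls Xs c B s x rest =
      (if a \<and> b then (compatible_cuts i k x (Suc i) ls Xs, (k, x) # c, B, s) # rest
       else if a \<and> d then (compatible_cuts i k x (Suc i) ls Xs, (k, x) # c, B - k, vadd s x) # rest
       else rest)" for a b d x rest
    by (cases a; cases b; cases d) auto
  show ?thesis
    using assms(1)
  proof (induction xs)
    case (Cons y xs)
    show ?case
    proof (cases "x = y")
      case True
      then show ?thesis using assms(2,3) by (auto simp: eq simp del: ordered.simps)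
    next
      case False
      then show ?thesis using Cons by (simp add: eq del: ordered.simps)
    qed
  qed simp
qed

lemma mem_finals: "(Xs, c, B, s) \<in> set ps \<Longrightarrow> nonneg1 (m * B) s \<Longrightarrow> (c, B, s) \<in> set (finals m ps)"
  by (induction m ps rule: finals.induct) auto

lemma mem_stars_step:
  "p \<in> set ps \<Longrightarrow> q \<in> set (stars m (Suc i) ks (extensions i k ks p)) \<Longrightarrow> q \<in> set (stars m i (k # ks) ps)"
  by (induction ps) auto

text \<open>The budget counts every value other than \<open>p\<close> once, so the sum runs over a
  set. After a step to a new value \<open>k\<close>, sortedness keeps \<open>p\<close> from
  occurring again.\<close>

lemma levels_mem:
  "length ks = d \<Longrightarrow> sorted (p # ks) \<Longrightarrow> \<Sum> (set ks - {p}) \<le> b \<Longrightarrow> 0 \<le> p \<Longrightarrow> ks \<in> set (levels d p b)"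
proof (induction d arbitrary: ks p b)
  case (Suc d)
  from Suc.prems(1) obtain k r where ks: "ks = k # r" by (cases ks) auto
  show ?case
  proof (cases "k = p")
    case True
    have "set ks - {p} = set r - {p}" by (simp add: ks True)
    then have "r \<in> set (levels d p b)" using Suc.IH[of r p b] Suc.prems by (simp add: ks)
    then show ?thesis by (simp add: ks True)
  next
    case False
    then have k: "p < k" "0 \<le> k" using Suc.prems by (auto simp: ks)
    then have "p \<notin> set r" using Suc.prems by (auto simp: ks)
    have "\<Sum> (set ks - {p}) = \<Sum> (insert k (set r - {k}))"
      using False \<open>p \<notin> set r\<close> by (intro arg_cong[of _ _ \<Sum>]) (auto simp: ks)
    also have "\<dots> = k + \<Sum> (set r - {k})" by (subst sum.insert) auto
    finally have s: "\<Sum> (set r - {k}) \<le> b - k" using Suc.prems(3) by simp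
    have "0 \<le> \<Sum> (set r - {k})" using Suc.prems(2,4) by (intro sum_nonneg) (auto simp: ks)
    then have "k \<le> b" using s by simp
    moreover have "r \<in> set (levels d k (b - k))"
      using Suc.IH[OF _ _ s k(2)] Suc.prems by (simp add: ks)
    ultimately show ?thesis using k by (auto simp: ks)
  qed
qed simp

lemma all_levels_mem:
  assumes "length ks = n" "n \<noteq> 0" "sorted ks" "\<And>k. k \<in> set ks \<Longrightarrow> 0 \<le> k" "\<Sum> (set ks) \<le> int n"
  shows "ks \<in> set (all_levels n)"
proof -
  obtain k r where ks: "ks = k # r" using assms by (cases ks) auto
  have "\<Sum> (set ks) = k + \<Sum> (set r - {k})"
    by (simp add: ks sum.insert_remove)
  then have s: "\<Sum> (set r - {k}) \<le> int n - k" using assms(5) by simp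
  have "0 \<le> \<Sum> (set r - {k})" using assms(4) by (intro sum_nonneg) (auto simp: ks)
  then have "k \<le> int n" using s by simp
  moreover have "r \<in> set (levels (n - 1) k (int n - k))"
    by (rule levels_mem[OF _ _ s]) (use assms in \<open>auto simp: ks\<close>)
  ultimately show ?thesis using assms(4)[of k] by (auto simp: all_levels_def ks)
qed

lemma sum_list_remdups: "sum_list (remdups ks) = \<Sum> (set ks)"
  by (metis distinct_remdups set_remdups distinct_sum_list_conv_Sum)

text \<open>The special vertex in its own coordinates: its normals are the unit vectors, and each
  pairs to -1 with it.\<close>

definition origin :: "nat \<Rightarrow> int list" where
  "origin n = map (\<lambda>i. - 1) [0..<n]"

lemma length_origin [simp]: "length (origin n) = n"
  by (simp add: origin_def)

lemma nth_origin [simp]: "i < n \<Longrightarrow> origin n ! i = - 1"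
  by (simp add: origin_def)

lemma dot_origin: "length x = n \<Longrightarrow> dot x (origin n) = - sum_list x"
  by (simp add: dot_sum sum_list_sum_nth atLeast0LessThan sum_negf)

definition col_sum :: "nat \<Rightarrow> (nat \<Rightarrow> int list) \<Rightarrow> nat \<Rightarrow> int" where
  "col_sum n nb i = (\<Sum>j<n. (nb j ! i + 3) * nb j ! i)"

text \<open>A fan in the coordinates of its special vertex. The normal \<open>nb i\<close> enters
  across the edge of coordinate \<open>i\<close>, and several edges may share one. The conditions
  \<open>nb_sorted\<close> record how the edges have been enumerated.\<close>

locale star_fan = fan +
  fixes nb :: "nat \<Rightarrow> int list"
  assumes n_pos: "0 < n"
    and zero_notin: "map (\<lambda>i. 0) [0..<n] \<notin> V"
    and origin_VS: "origin n \<in> VS"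
    and T_origin: "T (origin n) = unit n ` {..<n}"
    and U_origin: "i < n \<Longrightarrow> U (origin n) (unit n i) = unit n i"
    and total_nonneg: "i < n \<Longrightarrow> 0 \<le> (\<Sum>w\<in>V. w ! i)"
    and nb_V: "i < n \<Longrightarrow> nb i \<in> V"
    and nb_nth: "i < n \<Longrightarrow> nb i ! i = - 1"
    and nb_VS: "i < n \<Longrightarrow> nbr (origin n) (unit n i) (nb i) \<in> VS"
    and nb_T: "i < n \<Longrightarrow> T (nbr (origin n) (unit n i) (nb i)) = insert (nb i) (T (origin n) - {unit n i})"
    and nb_sorted: "Suc i < n \<Longrightarrow> sum_list (nb (Suc i)) \<le> sum_list (nb i)"
      "Suc i < n \<Longrightarrow> sum_list (nb (Suc i)) = sum_list (nb i) \<Longrightarrow> weight (nb i) \<le> weight (nb (Suc i))"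
      "Suc i < n \<Longrightarrow> sum_list (nb (Suc i)) = sum_list (nb i) \<Longrightarrow> weight (nb i) = weight (nb (Suc i)) \<Longrightarrow>
        col_sum n nb (Suc i) \<le> col_sum n nb i"
      "Suc i < n \<Longrightarrow> sum_list (nb (Suc i)) = sum_list (nb i) \<Longrightarrow> weight (nb i) = weight (nb (Suc i)) \<Longrightarrow>
        col_sum n nb (Suc i) = col_sum n nb i \<Longrightarrow> (\<Sum>w\<in>V. w ! Suc i) \<le> (\<Sum>w\<in>V. w ! i)"
begin

definition lev :: "nat \<Rightarrow> int" where
  "lev i = - sum_list (nb i)"

definition nbset :: "nat \<Rightarrow> int list set" where
  "nbset i = nb ` {..<i}"

definition K :: "int list set" where
  "K = T (origin n) \<union> nbset n"

lemma length_nb [simp]: "i < n \<Longrightarrow> length (nb i) = n"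
  by (rule length_V[OF nb_V])

lemma nb_notin: "i < n \<Longrightarrow> nb i \<notin> T (origin n)"
  using nb_nth[of i] by (auto simp: T_origin split: if_splits)

lemma lev_nonneg: "i < n \<Longrightarrow> 0 \<le> lev i"
  using T_nonneg[OF origin_VS nb_V nb_notin, of i] dot_origin[of "nb i" n] by (simp add: lev_def)

lemma dot_nbr:
  assumes "i < n" "length x = n"
  shows "dot x (nbr (origin n) (unit n i) (nb i)) = - sum_list x + x ! i * (lev i + 1)"
proof -
  let ?v = "nbr (origin n) (unit n i) (nb i)"
  have nth: "?v ! j = (lev i + 1) * (if i = j then 1 else 0) - 1" if "j < n" for j
    using that assms(1) dot_origin[of "nb i" n] by (simp add: nbr_def nth_axpy lev_def)
  have "dot x ?v = (\<Sum>j<n. x ! j * ?v ! j)"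
    using assms by (simp add: dot_sum nbr_def)
  also have "\<dots> = (\<Sum>j<n. (if i = j then x ! j * (lev i + 1) else 0) - x ! j)"
    by (intro sum.cong) (auto simp: nth algebra_simps)
  also have "\<dots> = x ! i * (lev i + 1) - (\<Sum>j<n. x ! j)"
    using assms(1) by (simp add: sum_subtractf)
  finally show ?thesis using assms(2) by (simp add: sum_list_sum_nth atLeast0LessThan)
qed

text \<open>The vertex across edge \<open>i\<close> has all coordinates -1 except the one of index
  \<open>i\<close>, which is the level of \<open>nb i\<close>. The inequality is the nonnegativity
  of \<open>x\<close> at this vertex.\<close>

lemma coord_bound:
  assumes "i < n" "x \<in> V" "x \<notin> T (origin n)" "x \<noteq> nb i"
  shows "0 \<le> x ! i * (lev i + 1) - sum_list x"
  using T_nonneg[OF nb_VS[OF assms(1)] assms(2)] nb_T[OF assms(1)] assms dot_nbr[OF assms(1) length_V[OF assms(2)]]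
  by simp

lemma level_nonneg: "x \<in> V \<Longrightarrow> x \<notin> T (origin n) \<Longrightarrow> sum_list x \<le> 0"
  using T_nonneg[OF origin_VS] dot_origin[OF length_V] by fastforce

lemma far_low:
  assumes "i < n" "x \<in> V" "x \<notin> T (origin n)" "x \<noteq> nb i"
  shows "- (- sum_list x div (lev i + 1)) \<le> x ! i"
proof -
  have "- x ! i * (lev i + 1) \<le> - sum_list x" using coord_bound[OF assms] by simp
  then have "- x ! i \<le> - sum_list x div (lev i + 1)"
    using lev_nonneg[OF assms(1)] by (metis add_nonneg_pos zdiv_mono1 nonzero_mult_div_cancel_right less_irrefl zero_less_one)
  then show ?thesis by simp
qed

text \<open>By \<open>coord_bound\<close> all entries are at least minus the level. At level 0 they
  would be nonnegative with sum 0, which leaves only the zero vector. At positive level the other n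
  - 1 entries bound the remaining one by n - 2 times the level.\<close>

lemma far:
  assumes "x \<in> V - K"
  shows "sum_list x \<le> - 1" and "i < n \<Longrightarrow> x ! i \<le> int (n - 2) * - sum_list x"
proof -
  have x: "x \<in> V" "x \<notin> T (origin n)" "\<And>i. i < n \<Longrightarrow> x \<noteq> nb i"
    using assms by (auto simp: K_def nbset_def)
  have len: "length x = n" by (rule length_V[OF x(1)])
  have sum_nth: "sum_list x = (\<Sum>i<n. x ! i)" using len by (simp add: sum_list_sum_nth atLeast0LessThan)
  have le0: "sum_list x \<le> 0" by (rule level_nonneg[OF x(1,2)])
  have low: "sum_list x \<le> x ! i" if "i < n" for i
  proof -
    have "- sum_list x div (lev i + 1) \<le> - sum_list x div 1"
      using le0 lev_nonneg[OF that] by (intro zdiv_mono2) auto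
    then show ?thesis using far_low[OF that x(1,2) x(3)[OF that]] by simp
  qed
  have "sum_list x \<noteq> 0"
  proof
    assume 0: "sum_list x = 0"
    then have "\<forall>i\<in>{..<n}. x ! i = 0"
      using low sum_nth by (intro sum_nonneg_0[of "{..<n}" "(!) x"] ballI) auto
    then have "x = map (\<lambda>i. 0) [0..<n]" using len by (intro nth_equalityI) auto
    then show False using x(1) zero_notin by simp
  qed
  then show le1: "sum_list x \<le> - 1" using le0 by simp
  assume i: "i < n"
  have "(\<Sum>j\<in>{..<n} - {i}. x ! j) \<ge> (\<Sum>j\<in>{..<n} - {i}. sum_list x)"
    using low by (intro sum_mono) auto
  moreover have "sum_list x = x ! i + (\<Sum>j\<in>{..<n} - {i}. x ! j)"
    unfolding sum_nth using i by (intro sum.remove) auto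
  ultimately have *: "x ! i \<le> sum_list x - (int n - 1) * sum_list x"
    using i by (simp add: card_Diff_subset of_nat_diff)
  show "x ! i \<le> int (n - 2) * - sum_list x"
  \<comment> \<open>For \<open>n = 1\<close> the truncated subtraction gives the factor 0, and the
    claim is that the only entry is nonpositive.\<close>
  proof (cases "n = 1")
    case True
    then show ?thesis using * le1 by simp
  next
    case False
    then have "int (n - 2) = int n - 2" using n_pos by simp
    then show ?thesis using * by (simp add: algebra_simps)
  qed
qed


section \<open>The enumeration of stars reaches the given star\<close>

definition tot :: "nat \<Rightarrow> int" where
  "tot i = (\<Sum>w\<in>V. w ! i)"

definition known_set :: "nat \<Rightarrow> int list set" where
  "known_set i = T (origin n) \<union> nbset i"

definition bud :: "nat \<Rightarrow> int" where
  "bud i = (\<Sum>w\<in>known_set i. sum_list w)"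

definition psum :: "nat \<Rightarrow> int list" where
  "psum i = map (\<lambda>q. \<Sum>w\<in>known_set i. w ! q) [0..<n]"

definition chosen :: "nat \<Rightarrow> item list" where
  "chosen i = rev (map (\<lambda>j. (lev j, nb j)) [0..<i])"

text \<open>The partial star on the branch of the given fan: its first \<open>i\<close> neighbours,
  latest first, together with lists that still contain the remaining ones.\<close>

definition matches :: "nat \<Rightarrow> partial \<Rightarrow> bool" where
  "matches i p \<longleftrightarrow> (\<exists>Xs. p = (Xs, chosen i, bud i, psum i) \<and> length Xs = n - i \<and>
     (\<forall>q < n - i. nb (i + q) \<in> set (Xs ! q)))"

lemma known_set_sub: "i \<le> n \<Longrightarrow> known_set i \<subseteq> V"
  using T_sub nb_V by (auto simp: known_set_def nbset_def)

lemma finite_known [simp]: "finite (known_set i)"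
  by (simp add: known_set_def nbset_def finite_T)

lemma known_set_n: "known_set n = K"
  by (simp add: known_set_def K_def)

lemma sum_total: "0 \<le> (\<Sum>w\<in>V. sum_list w)"
proof -
  have "(\<Sum>w\<in>V. sum_list w) = (\<Sum>w\<in>V. \<Sum>i<n. w ! i)"
    using length_V by (intro sum.cong) (auto simp: sum_list_sum_nth atLeast0LessThan)
  also have "\<dots> = (\<Sum>i<n. \<Sum>w\<in>V. w ! i)" by (rule sum.swap)
  also have "\<dots> \<ge> 0" by (intro sum_nonneg total_nonneg) auto
  finally show ?thesis .
qed

lemma bud_nonneg:
  assumes "i \<le> n"
  shows "0 \<le> bud i"
proof -
  have "(\<Sum>w\<in>V. sum_list w) = bud i + (\<Sum>w\<in>V - known_set i. sum_list w)"
    unfolding bud_def using known_set_sub[OF assms] finite_V by (simp add: sum.subset_diff add.commute)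
  moreover have "(\<Sum>w\<in>V - known_set i. sum_list w) \<le> 0"
    by (intro sum_nonpos level_nonneg) (auto simp: known_set_def)
  ultimately show ?thesis using sum_total by simp
qed

lemma known_set_Suc: "known_set (Suc i) = insert (nb i) (known_set i)"
  by (auto simp: known_set_def nbset_def less_Suc_eq)

lemma nb_in_known: "i < n \<Longrightarrow> nb i \<in> known_set i \<longleftrightarrow> nb i \<in> snd ` set (chosen i)"
  using nb_notin[of i] by (force simp: known_set_def nbset_def chosen_def)

lemma bud_Suc: "i < n \<Longrightarrow> bud (Suc i) = (if nb i \<in> snd ` set (chosen i) then bud i else bud i - lev i)"
  using nb_in_known[of i] by (simp add: bud_def known_set_Suc insert_absorb lev_def)

lemma psum_Suc:
  assumes "i < n"
  shows "psum (Suc i) = (if nb i \<in> snd ` set (chosen i) then psum i else vadd (psum i) (nb i))"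
proof -
  have "vadd (psum i) (nb i) = psum (Suc i)" if "nb i \<notin> known_set i"
    using that assms by (intro nth_equalityI) (auto simp: psum_def nth_vadd known_set_Suc)
  moreover have "psum (Suc i) = psum i" if "nb i \<in> known_set i"
    using that by (simp add: psum_def known_set_Suc insert_absorb)
  ultimately show ?thesis using nb_in_known[OF assms] by metis
qed

text \<open>The compatibility cuts keep the true neighbours by \<open>coord_bound\<close>, applied
  to each pair in both directions. A repeated neighbour leaves budget and sum unchanged because
  \<open>known_set\<close> is a set.\<close>

lemma matches_step:
  assumes i: "i < n" and p: "matches i p"
  shows "\<exists>p' \<in> set (extensions i (lev i) (map lev [Suc i..<n]) p). matches (Suc i) p'"
proof -
  obtain Xs where Xs: "p = (Xs, chosen i, bud i, psum i)" "length Xs = n - i"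
    "\<And>q. q < n - i \<Longrightarrow> nb (i + q) \<in> set (Xs ! q)"
    using p by (auto simp: matches_def)
  then obtain X Ys where X: "Xs = X # Ys" using i by (cases Xs) auto
  have nb_X: "nb i \<in> set X" using Xs(3)[of 0] i by (simp add: X)
  have ord: "ordered (lev i) (nb i) (chosen i)"
  proof (cases i)
    case (Suc j)
    then have "hd (chosen i) = (lev j, nb j)" "chosen i \<noteq> []" by (simp_all add: chosen_def)
    then show ?thesis using nb_sorted(2)[of j] i Suc by (auto simp: ordered_eq lev_def)
  qed (simp add: chosen_def)
  have fits: "nb i \<in> snd ` set (chosen i) \<or> lev i \<le> bud i"
    using bud_nonneg[of "Suc i"] bud_Suc[OF i] i by (simp split: if_splits)
  define Zs where "Zs = compatible_cuts i (lev i) (nb i) (Suc i) (map lev [Suc i..<n]) Ys"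
  have "length (map lev [Suc i..<n]) = length Ys" using Xs(2) X i by simp
  from compatible_cuts_nth[OF this, of i "lev i" "nb i" "Suc i"]
  have Zs: "length Zs = length Ys" "\<And>q. q < length Ys \<Longrightarrow>
      Zs ! q = compatible_cut i (lev i) (nb i) (map lev [Suc i..<n] ! q) (nb i ! (Suc i + q)) (Ys ! q)"
    by (auto simp: Zs_def)
  have "nb (Suc i + q) \<in> set (Zs ! q)" if q: "q < n - Suc i" for q
  proof -
    define j where "j = Suc i + q"
    have j: "j < n" using q by (simp add: j_def)
    have len: "q < length Ys" using q Xs(2) X by simp
    have "nb j \<in> set (Ys ! q)" using Xs(3)[of "Suc q"] q by (simp add: X j_def)
    moreover have "nb i = nb j \<or> 0 \<le> nb i ! j * (lev j + 1) + lev i \<and> 0 \<le> nb j ! i * (lev i + 1) + lev j"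
      using coord_bound[OF j nb_V[OF i] nb_notin[OF i]] coord_bound[OF i nb_V[OF j] nb_notin[OF j]]
      by (auto simp: lev_def)
    moreover have "map lev [Suc i..<n] ! q = lev j" using q by (simp add: j_def)
    ultimately have "nb j \<in> set (Zs ! q)"
      unfolding Zs(2)[OF len] mem_compatible_cut by (simp add: j_def)
    then show ?thesis by (simp add: j_def)
  qed
  moreover have "length Zs = n - Suc i" using Zs(1) Xs(2) X by simp
  ultimately have "matches (Suc i) (Zs, chosen (Suc i), bud (Suc i), psum (Suc i))"
    unfolding matches_def by blast
  moreover have "(Zs, chosen (Suc i), bud (Suc i), psum (Suc i)) \<in> set (extensions i (lev i) (map lev [Suc i..<n]) p)"
    using mem_extend[OF nb_X ord fits, where ls = "map lev [Suc i..<n]" and Xs = Ys and s = "psum i" and i = i]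
    unfolding Xs(1) X extensions.simps Zs_def bud_Suc[OF i] psum_Suc[OF i]
    by (simp add: chosen_def)
  ultimately show ?thesis by blast
qed

lemma matches_final:
  assumes "i \<le> n" "p \<in> set ps" "matches i p" "nonneg1 (m * bud n) (psum n)"
  shows "(chosen n, bud n, psum n) \<in> set (stars m i (map lev [i..<n]) ps)"
  using assms(1-3)
proof (induction "n - i" arbitrary: i p ps)
  case 0
  then have "i = n" by simp
  with 0 show ?case using mem_finals[OF _ assms(4)] by (auto simp: matches_def)
next
  case (Suc d)
  then have i: "i < n" by simp
  from matches_step[OF i Suc.prems(3)] obtain p' where
    p': "p' \<in> set (extensions i (lev i) (map lev [Suc i..<n]) p)" "matches (Suc i) p'" by blast
  have "(chosen n, bud n, psum n) \<in> set (stars m (Suc i) (map lev [Suc i..<n]) (extensions i (lev i) (map lev [Suc i..<n]) p))"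
    by (rule Suc.hyps(1)[OF _ _ p']) (use Suc.hyps(2) i in auto)
  from mem_stars_step[OF Suc.prems(2) this] show ?case
    using i by (simp add: upt_conv_Cons)
qed

lemma nbr_cands_nth:
  "q < length ls \<Longrightarrow> nbr_cands ks i ls ! q = bounded_vecs (nbr_bounds (ls ! q) (i + q) ks) (- (ls ! q))"
  by (induction ks i ls arbitrary: q rule: nbr_cands.induct) (auto simp: nth_Cons split: nat.splits)

lemma length_nbr_cands [simp]: "length (nbr_cands ks i ls) = length ls"
  by (induction ks i ls rule: nbr_cands.induct) auto

lemma matches_start:
  "matches 0 (nbr_cands (map lev [0..<n]) 0 (map lev [0..<n]), [], int n, map (\<lambda>i. 1) [0..<n])"
proof -
  have inj: "inj_on (unit n) {..<n}" by (auto intro!: inj_onI dest: unit_inj)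
  have "bud 0 = int n"
    by (simp add: bud_def known_set_def nbset_def T_origin sum.reindex[OF inj] sum_list_unit)
  moreover have "psum 0 = map (\<lambda>i. 1) [0..<n]"
    by (simp add: psum_def known_set_def nbset_def T_origin sum.reindex[OF inj])
  moreover have "nb i \<in> set (nbr_cands (map lev [0..<n]) 0 (map lev [0..<n]) ! i)" if i: "i < n" for i
  proof -
    have "low (lev j = lev i) (lev j) (lev i) \<le> nb i ! j" if j: "j < n" "j \<noteq> i" for j
    proof (cases "nb i = nb j")
      case True
      then show ?thesis using nb_nth[OF j(1)] by (simp add: low_eq lev_def)
    next
      case False
      show ?thesis
      proof (cases "lev j = lev i")
        case True
        have "0 \<le> nb i ! j * (lev j + 1) + lev i"
          using coord_bound[OF j(1) nb_V[OF i] nb_notin[OF i] False] by (simp add: lev_def)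
        then have "0 \<le> (nb i ! j + 1) * (lev i + 1) - 1" by (simp add: True algebra_simps)
        then have "0 < (nb i ! j + 1) * (lev i + 1)" by simp
        then have "- 1 \<le> nb i ! j" using lev_nonneg[OF i] by (simp add: zero_less_mult_iff)
        then show ?thesis using True by (simp add: low_eq)
      next
        case False': False
        then show ?thesis
          using far_low[OF j(1) nb_V[OF i] nb_notin[OF i] False] by (simp add: low_eq lev_def)
      qed
    qed
    then have "list_all2 (\<lambda>(f, a) x. a \<le> x \<and> (f \<longrightarrow> x = a)) (nbr_bounds (lev i) i (map lev [0..<n])) (nb i)"
      using nb_nth[OF i] by (intro list_all2_nbr_bounds) (auto simp: i)
    from mem_bounded_vecs[OF this] show ?thesis using i by (simp add: nbr_cands_nth lev_def)
  qed
  ultimately show ?thesis by (simp add: matches_def chosen_def)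
qed

lemma start_star:
  assumes "level_check n (map lev [0..<n])" "nonneg1 (int (n - 2) * bud n) (psum n)"
  shows "start_star n (int (n - 2)) (map (\<lambda>i. (int i, unit n i)) [0..<n]) (origin n)
    (balance 20 (tips (far_cands (map lev [0..<n]) [1..int n - sum_list (remdups (map lev [0..<n]))])))
    (bud n) (psum n) (map (\<lambda>j. (lev j, nb j)) [0..<n])"
proof -
  have all: "(c, B, s) \<in> set ps \<Longrightarrow> start_stars n m F v cs ps \<Longrightarrow> start_star n m F v cs B s (rev c)" for c B s ps m F v cs
    by (induction n m F v cs ps rule: start_stars.induct) (auto simp del: start_star.simps)
  have "(chosen n, bud n, psum n) \<in> set (stars (int (n - 2)) 0 (map lev [0..<n])
      [(nbr_cands (map lev [0..<n]) 0 (map lev [0..<n]), [], int n, map (\<lambda>i. 1) [0..<n])])"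
    by (rule matches_final[OF _ _ matches_start assms(2)]) auto
  from all[OF this] assms(1) show ?thesis
    unfolding level_check_def origin_def chosen_def rev_rev_ident by blast
qed


section \<open>Sorting conventions and the initial state\<close>

lemma col_sums_nth:
  "\<forall>(k, w)\<in>set c. length w = length acc \<Longrightarrow> length (col_sums acc c) = length acc \<and>
    (\<forall>q < length acc. col_sums acc c ! q = acc ! q + (\<Sum>(k, w)\<leftarrow>c. (w ! q + 3) * w ! q))"
proof (induction acc c rule: col_sums.induct)
  case (2 acc k w c)
  have ct: "column_terms w = map (\<lambda>a. (a + 3) * a) w" for w by (induction w) auto
  have w: "length w = length acc" using 2(2) by simp
  then have len: "length (vadd (column_terms w) acc) = length acc" by (simp add: ct)
  have "length (col_sums (vadd (column_terms w) acc) c) = length acc \<and>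
    (\<forall>q < length acc. col_sums (vadd (column_terms w) acc) c ! q =
      vadd (column_terms w) acc ! q + (\<Sum>(k, w)\<leftarrow>c. (w ! q + 3) * w ! q))"
    using 2(1) 2(2) len by simp
  moreover have "vadd (column_terms w) acc ! q = (w ! q + 3) * w ! q + acc ! q" if "q < length acc" for q
    using that w by (simp add: nth_vadd ct)
  ultimately show ?case by simp
qed simp

lemma col_sums_eq:
  "col_sums (zeros (psum n)) (map (\<lambda>j. (lev j, nb j)) [0..<n]) = map (col_sum n nb) [0..<n]"
proof -
  have z: "zeros x = map (\<lambda>_. 0) x" for x by (induction x) auto
  have len: "length (zeros (psum n)) = n" by (simp add: z psum_def)
  have "\<forall>(k, w)\<in>set (map (\<lambda>j. (lev j, nb j)) [0..<n]). length w = length (zeros (psum n))"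
    using len by auto
  note c = col_sums_nth[OF this, unfolded len]
  show ?thesis
  proof (rule nth_equalityI)
    fix q assume "q < length (col_sums (zeros (psum n)) (map (\<lambda>j. (lev j, nb j)) [0..<n]))"
    then have q: "q < n" using c by simp
    have "zeros (psum n) ! q = 0" using q by (simp add: z psum_def)
    then show "col_sums (zeros (psum n)) (map (\<lambda>j. (lev j, nb j)) [0..<n]) ! q = map (col_sum n nb) [0..<n] ! q"
      using c q by (simp add: comp_def col_sum_def interv_sum_list_conv_sum_set_nat atLeast0LessThan)
  qed (use c in simp)
qed

lemma ties_sorted:
  assumes "a \<le> n"
  shows "\<exists>ts. ties (map (\<lambda>j. (lev j, nb j)) [a..<n]) (map (col_sum n nb) [a..<n]) = Some ts \<and>
    ties_ok ts (map tot [a..<n])"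
  using assms
proof (induction "n - a" arbitrary: a)
  case (Suc d)
  then have a: "a < n" by simp
  show ?case
  proof (cases "Suc a < n")
    case False
    then show ?thesis using a by (simp add: upt_conv_Cons)
  next
    case True
    obtain ts where ts: "ties (map (\<lambda>j. (lev j, nb j)) [Suc a..<n]) (map (col_sum n nb) [Suc a..<n]) = Some ts"
      "ties_ok ts (map tot [Suc a..<n])"
    proof -
      have "d = n - Suc a" "Suc a \<le> n" using Suc(2) True by simp_all
      from Suc(1)[OF this] that show thesis by blast
    qed
    have split: "[a..<n] = a # Suc a # [Suc (Suc a)..<n]" "[Suc a..<n] = Suc a # [Suc (Suc a)..<n]"
      using a True by (simp_all add: upt_conv_Cons)
    define eq where "eq \<longleftrightarrow> lev a = lev (Suc a) \<and> weight (nb a) = weight (nb (Suc a))"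
    have t: "ties (map (\<lambda>j. (lev j, nb j)) [a..<n]) (map (col_sum n nb) [a..<n]) =
        tie_if eq (col_sum n nb a < col_sum n nb (Suc a)) (col_sum n nb a = col_sum n nb (Suc a)) (Some ts)"
      using ts(1) unfolding split eq_def by simp
    show ?thesis
    proof (cases eq)
      case False
      then show ?thesis using t ts(2) unfolding split by simp
    next
      case True': True
      then have "col_sum n nb (Suc a) \<le> col_sum n nb a"
        using nb_sorted(3)[OF True] by (simp add: eq_def lev_def)
      then have nlt: "\<not> col_sum n nb a < col_sum n nb (Suc a)" by simp
      have "tot (Suc a) \<le> tot a" if "col_sum n nb a = col_sum n nb (Suc a)"
        using nb_sorted(4)[OF True] True' that by (simp add: eq_def lev_def tot_def)
      then show ?thesis using t ts(2) True' nlt unfolding split by simp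
    qed
  qed
qed simp

lemma add_nbrs_sound:
  assumes "naming W" "\<And>j w. (j, w) \<in> set W \<Longrightarrow> j < i"
  shows "naming (fst (add_nbrs i W c)) \<and> (\<forall>(j, w) \<in> set (fst (add_nbrs i W c)). j < snd (add_nbrs i W c)) \<and>
    snd ` set (fst (add_nbrs i W c)) = snd ` set W \<union> snd ` set c \<and> set W \<subseteq> set (fst (add_nbrs i W c))"
  using assms
proof (induction c arbitrary: i W)
  case (Cons p c)
  obtain k w where p: "p = (k, w)" by (cases p)
  show ?case
  proof (cases "w \<in> snd ` set W")
    case True
    then show ?thesis using Cons.IH[OF Cons.prems] by (auto simp: p)
  next
    case False
    have "i \<notin> fst ` set W" using Cons.prems(2) by force
    then have "naming ((i, w) # W)" using Cons.prems(1) False by (auto simp: naming_def)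
    moreover have "j < i + 1" if "(j, w') \<in> set ((i, w) # W)" for j w'
      using that Cons.prems(2)[of j w'] by auto
    ultimately show ?thesis using Cons.IH[of "(i, w) # W" "i + 1"] False by (auto simp: p)
  qed
qed auto

lemma bud_n: "bud n = int n - (\<Sum>w\<in>nbset n. - sum_list w)"
proof -
  have "bud n = (\<Sum>w\<in>T (origin n). sum_list w) + (\<Sum>w\<in>nbset n. sum_list w)"
    unfolding bud_def known_set_def
    by (rule sum.union_disjoint) (use nb_notin in \<open>auto simp: nbset_def finite_T\<close>)
  also have "(\<Sum>w\<in>T (origin n). sum_list w) = int n"
    using matches_start by (simp add: matches_def bud_def known_set_def nbset_def)
  finally show ?thesis by (simp add: sum_negf)
qed

text \<open>Distinct level values come from distinct neighbours, and levels are nonnegative.\<close>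

lemma sum_lev_le: "sum_list (remdups (map lev [0..<n])) \<le> (\<Sum>w\<in>nbset n. - sum_list w)"
proof -
  have "sum_list (remdups (map lev [0..<n])) = \<Sum> ((\<lambda>w. - sum_list w) ` nbset n)"
    by (simp add: sum_list_remdups nbset_def image_image lev_def[abs_def] atLeast0LessThan)
  then show ?thesis
    using sum_image_le[of "nbset n" "\<lambda>x. x" "\<lambda>w. - sum_list w"] lev_nonneg
    by (auto simp: nbset_def lev_def)
qed

lemma lev_all_levels: "map lev [0..<n] \<in> set (all_levels n)"
proof (rule all_levels_mem)
  show "sorted (map lev [0..<n])"
    unfolding sorted_iff_nth_Suc using nb_sorted(1) by (simp add: lev_def)
  show "\<Sum> (set (map lev [0..<n])) \<le> int n"
    using sum_lev_le bud_n bud_nonneg[of n] unfolding sum_list_remdups by linarith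
qed (use n_pos lev_nonneg in auto)

text \<open>The search starts from the special vertex alone, with the whole star among the known
  normals. What has to be verified is that this state satisfies the invariant and that the
  candidates contain every normal off the star.\<close>

lemma level_check_sound:
  assumes "level_check n (map lev [0..<n])"
  shows "\<exists>W fs. naming W \<and> snd ` set W \<subseteq> V \<and> (\<forall>(l, v) \<in> set fs. named W l (T v)) \<and> snd ` set fs = VS \<and>
    fs \<noteq> [] \<and> moment_check n W (homogenize fs)"
proof -
  obtain ts where ts: "ties (map (\<lambda>j. (lev j, nb j)) [0..<n]) (map (col_sum n nb) [0..<n]) = Some ts"
    "ties_ok ts (map tot [0..<n])"
    using ties_sorted[of 0] by auto
  interpret S: fan_search n V VS U T K "int (n - 2)" ts
  proof
    show "K \<subseteq> V" using known_set_sub[of n] by (simp add: known_set_n)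
    show "ties_ok ts (map (\<lambda>i. \<Sum>w\<in>V. w ! i) [0..<n])" using ts(2) by (simp add: tot_def[abs_def])
    show "sum_list w \<le> 0" if "w \<in> V - K" for w using far(1)[OF that] by simp
    show "w ! i \<le> int (n - 2) * - sum_list w" if "w \<in> V - K" "i < n" for w i by (rule far(2)[OF that])
  qed (use total_nonneg in auto)
  define F where "F = map (\<lambda>i. (int i, unit n i)) [0..<n]"
  define nbs where "nbs = map (\<lambda>j. (lev j, nb j)) [0..<n]"
  define W k where "W = fst (add_nbrs (int n) F nbs)" and "k = snd (add_nbrs (int n) F nbs)"
  have namF: "naming F"
    unfolding naming_def F_def by (auto simp: distinct_map comp_def intro!: inj_onI dest: unit_inj)
  have W: "naming W" "\<forall>(j, w) \<in> set W. j < k" "snd ` set W = K" "set F \<subseteq> set W"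
  proof -
    have "\<And>j w. (j, w) \<in> set F \<Longrightarrow> j < int n" by (auto simp: F_def)
    from add_nbrs_sound[OF namF this, where c = nbs]
    have a: "naming W" "\<forall>(j, w) \<in> set W. j < k" "snd ` set W = snd ` set F \<union> snd ` set nbs" "set F \<subseteq> set W"
      by (simp_all add: W_def k_def)
    then show "naming W" "\<forall>(j, w) \<in> set W. j < k" "set F \<subseteq> set W" by simp_all
    have "snd ` set F = T (origin n)" by (auto simp: F_def T_origin image_image)
    moreover have "snd ` set nbs = nbset n" by (auto simp: nbs_def nbset_def image_image)
    ultimately show "snd ` set W = K" using a(3) by (simp add: K_def)
  qed
  have ps: "psum n = S.partial_sum K" "bud n = (\<Sum>w\<in>K. sum_list w)"
    by (simp_all add: psum_def S.partial_sum_def bud_def known_set_n)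
  define CS where "CS = balance 20 (tips (far_cands (map lev [0..<n]) [1..int n - sum_list (remdups (map lev [0..<n]))]))"
  have CS: "V - K \<subseteq> cand_set CS"
  proof
    fix x assume x: "x \<in> V - K"
    then have x': "x \<in> V" "x \<notin> T (origin n)" "\<And>i. i < n \<Longrightarrow> x \<noteq> nb i" by (auto simp: K_def nbset_def)
    define l where "l = - sum_list x"
    have "1 \<le> l" using far(1)[OF x] by (simp add: l_def)
    moreover have "l \<le> int n - sum_list (remdups (map lev [0..<n]))"
    proof -
      have fK: "finite K" using finite_known[of n] by (simp add: known_set_n)
      have "0 \<le> (\<Sum>w\<in>insert x K. sum_list w)"
        by (rule S.known_bounds(1)) (use x S.K_sub in auto)
      then have "l \<le> bud n" using x fK by (simp add: ps(2) l_def)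
      also note bud_n
      finally have le: "l \<le> int n - (\<Sum>w\<in>nbset n. - sum_list w)" .
      with sum_lev_le show ?thesis by linarith
    qed
    moreover have "list_all2 (\<lambda>(f, a) x. a \<le> x \<and> (f \<longrightarrow> x = a)) (far_bounds l (map lev [0..<n])) x"
      using far_low[OF _ x'(1,2) x'(3)] length_V[OF x'(1)]
      by (intro list_all2_far_bounds) (auto simp: l_def)
    from mem_bounded_vecs[OF this] have "x \<in> set (bounded_vecs (far_bounds l (map lev [0..<n])) (- l))"
      by (simp add: l_def)
    ultimately have "x \<in> set (far_cands (map lev [0..<n]) [1..int n - sum_list (remdups (map lev [0..<n]))])"
      unfolding set_far_cands by (intro UN_I[of l]) auto
    then show "x \<in> cand_set CS"
      by (auto simp: CS_def cand_set_balance set_tips)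
  qed
  define cs where "cs = known_cut W (budget_cut (int (n - 2)) (bud n) (psum n) CS)"
  have cs: "V - snd ` set W \<subseteq> cand_set cs"
  proof
    fix x assume x: "x \<in> V - snd ` set W"
    then have "budget_ok (int (n - 2)) (bud n + sum_list x) (psum n) x"
      unfolding ps by (intro S.budget_ok_known) (use W(3) S.K_sub in auto)
    then show "x \<in> cand_set cs" using x CS W(3) by (auto simp: cs_def simp del: budget_ok.simps)
  qed
  have sum_ok: "sum_ok (int (n - 2)) ts cs (bud n) (psum n)"
    unfolding ps by (rule S.sum_ok_known) (use cs W(3) S.K_sub in auto)
  have nn: "nonneg1 (int (n - 2) * bud n) (psum n)"
    using S.known_bounds(2)[of K] S.K_sub by (auto simp: nonneg1_iff ps S.partial_sum_def)
  define st where "st = St W k [(ids F, origin n)] (drops [] (ids F)) (ridge_list (origin n) [] F) cs (bud n) (psum n)"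
  have "start_star n (int (n - 2)) F (origin n) CS (bud n) (psum n) nbs"
    using start_star[OF assms nn] by (simp only: F_def CS_def nbs_def)
  then have search: "search n (int (n - 2)) ts 50 [st]"
  proof -
    have W': "add_nbrs (int n) F nbs = (W, k)" by (simp add: W_def k_def)
    have t: "ties nbs (col_sums (zeros (psum n)) nbs) = Some ts"
      using ts(1) col_sums_eq by (simp add: nbs_def)
    assume "start_star n (int (n - 2)) F (origin n) CS (bud n) (psum n) nbs"
    then show ?thesis
      using sum_ok by (simp add: W' t st_def cs_def[symmetric])
  qed
  have itF: "items U W F (origin n) (T (origin n))"
  proof -
    have "fst ` {p \<in> set W. snd p \<in> T (origin n)} = fst ` set F"
    proof -
      have "p \<in> set F" if p: "p \<in> set W" "snd p \<in> T (origin n)" for p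
      proof -
        obtain i where i: "i < n" "snd p = unit n i" using p(2) by (auto simp: T_origin)
        then have iF: "(int i, unit n i) \<in> set F" by (auto simp: F_def)
        have "fst p = int i"
          by (rule naming_snd[OF W(1), of _ "unit n i"]) (use p(1) i iF W(4) in \<open>auto simp flip: i(2)\<close>)
        then show ?thesis using i iF by (cases p) auto
      qed
      moreover have "snd p \<in> T (origin n)" if "p \<in> set F" for p
        using that by (auto simp: F_def T_origin)
      ultimately show ?thesis using W(4) by blast
    qed
    moreover have "sorted_wrt (<) (map fst F)" by (simp add: F_def comp_def sorted_wrt_map)
    moreover have "T (origin n) \<subseteq> snd ` set W" using W(3) by (auto simp: K_def)
    moreover have "\<exists>w. (i, w) \<in> set W \<and> w \<in> T (origin n) \<and> u = U (origin n) w" if "(i, u) \<in> set F" for i u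
      using that W(4) U_origin by (force simp: F_def T_origin)
    ultimately show ?thesis unfolding items_def named_def by auto
  qed
  then have namedF: "named W (map fst F) (T (origin n))" by (simp add: items_def)
  have keys: "set (drops [] (ids F)) = {r. \<exists>y\<in>T (origin n). named W r (T (origin n) - {y})}"
    using S.set_drops_named[OF W(1) namedF] by simp
  have dist: "distinct (drops [] (ids F))"
    using namedF by (intro distinct_drops) (simp add: named_def strict_sorted_iff)
  note valid = S.ridge_list_valid[OF W(1) itF]
  have c1: "\<forall>r\<in>set (drops [] (ids F)). (\<exists>v\<in>snd ` set [(ids F, origin n)]. \<exists>w\<in>T v. named W r (T v - {w}) \<and>
      (\<forall>v'\<in>snd ` set [(ids F, origin n)]. T v - {w} \<subseteq> T v' \<longrightarrow> v' = v)) \<and>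
      r \<in> fst ` set (ridge_list (origin n) [] F)"
    using valid(2) keys by auto
  have c2: "\<forall>v\<in>snd ` set [(ids F, origin n)]. \<forall>w\<in>T v.
      (\<exists>v'\<in>snd ` set [(ids F, origin n)]. v' \<noteq> v \<and> T v - {w} \<subseteq> T v') \<or>
      (\<exists>r\<in>set (drops [] (ids F)). named W r (T v - {w}))"
  proof (intro ballI disjI2)
    fix v w assume v: "v \<in> snd ` set [(ids F, origin n)]" "w \<in> T v"
    then have w: "w \<in> T (origin n)" by simp
    obtain i a b where "(i, w) \<in> set W" "map fst F = a @ i # b" by (rule S.named_mem[OF namedF w])
    from S.named_split[OF W(1) namedF this(1) w this(2)]
    show "\<exists>r\<in>set (drops [] (ids F)). named W r (T v - {w})" using v w keys by auto
  qed
  have c3: "\<forall>(r, l, u, v)\<in>set (ridge_list (origin n) [] F). v \<in> snd ` set [(ids F, origin n)] \<and> r = map fst l \<and>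
      (\<exists>w\<in>T v. u = U v w \<and> items U W l v (T v - {w}))"
    using valid(1) by auto
  have c4: "ridge_list (origin n) [] F \<noteq> [] \<longrightarrow> fst (hd (ridge_list (origin n) [] F)) \<in> set (drops [] (ids F))"
  proof
    assume ne: "ridge_list (origin n) [] F \<noteq> []"
    obtain r l u v where e: "hd (ridge_list (origin n) [] F) = (r, l, u, v)" by (metis prod_cases4)
    then have "(r, l, u, v) \<in> set (ridge_list (origin n) [] F)" using ne hd_in_set by metis
    with valid(1) have "\<exists>w\<in>T (origin n). named W r (T (origin n) - {w})"
      unfolding items_def by fastforce
    then show "fst (hd (ridge_list (origin n) [] F)) \<in> set (drops [] (ids F))" using keys e by simp
  qed
  have c5: "\<forall>(l, v)\<in>set [(ids F, origin n)]. v \<in> VS \<and> named W l (T v)"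
    using origin_VS namedF by simp
  have c6: "\<forall>(i, w)\<in>set W. i < k \<and> w \<in> V" using W(2,3) S.K_sub by fastforce
  have c7: "K \<subseteq> snd ` set W" "[(ids F, origin n)] \<noteq> []" using W(3) by simp_all
  have c8: "bud n = (\<Sum>w\<in>snd ` set W. sum_list w)" "psum n = S.partial_sum (snd ` set W)"
    by (simp_all add: ps W(3))
  have "S.inv st"
    unfolding S.inv_def st_def state.case
    by (intro conjI W(1) c6 c7 c5 dist c1 c2 c3 c4 cs c8)
  from S.search_sound[OF search _ this] show ?thesis unfolding S.complete_def by auto
qed

end

section \<open>Moments of simplices\<close>

text \<open>Linear maps are compositions of maps with a vanishing coordinate, coordinate scalings,
  transpositions and elementary shears. Each is treated for an index type that is only assumed to be
  finite.\<close>

lemma measure_linear_image_finite: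
  fixes f :: "real^'n \<Rightarrow> real^'n"
  assumes "linear f" "S \<in> lmeasurable"
  shows "f ` S \<in> lmeasurable \<and> measure lebesgue (f ` S) = \<bar>det (matrix f)\<bar> * measure lebesgue S"
proof -
  have "\<forall>S \<in> lmeasurable. f ` S \<in> lmeasurable \<and> measure lebesgue (f ` S) = \<bar>det (matrix f)\<bar> * measure lebesgue S"
  proof (rule induct_linear_elementary[OF assms(1)])
    fix f g :: "real^'n \<Rightarrow> real^'n"
    assume lin: "linear f" "linear g"
      and f: "\<forall>S \<in> lmeasurable. f ` S \<in> lmeasurable \<and> measure lebesgue (f ` S) = \<bar>det (matrix f)\<bar> * measure lebesgue S"
      and g: "\<forall>S \<in> lmeasurable. g ` S \<in> lmeasurable \<and> measure lebesgue (g ` S) = \<bar>det (matrix g)\<bar> * measure lebesgue S"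
    show "\<forall>S \<in> lmeasurable. (f \<circ> g) ` S \<in> lmeasurable \<and>
        measure lebesgue ((f \<circ> g) ` S) = \<bar>det (matrix (f \<circ> g))\<bar> * measure lebesgue S"
      unfolding image_comp[symmetric] matrix_compose[OF lin(2,1)] det_mul abs_mult using f g by simp
  next
    fix f :: "real^'n \<Rightarrow> real^'n" and i
    assume 2: "linear f" "\<And>x. f x $ i = 0"
    have "\<not> inj f"
      using 2 by (metis linear_injective_imp_surjective one_neq_zero surjE vec_component)
    then have "det (matrix f) = 0" "negligible (f ` S)" for S
      using det_nz_iff_inj[OF 2(1)] negligible_linear_singular_image[OF 2(1)] by blast+
    then show "\<forall>S \<in> lmeasurable. f ` S \<in> lmeasurable \<and> measure lebesgue (f ` S) = \<bar>det (matrix f)\<bar> * measure lebesgue S"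
      by (simp add: negligible_iff_measure)
  next
    fix c :: "'n \<Rightarrow> real"
    let ?f = "\<lambda>x::real^'n. \<chi> i. c i * x $ i"
    have "matrix (\<lambda>x. \<chi> i. c i * x $ i) = (\<chi> i j. if i = j then c i else 0)"
      by (simp add: matrix_def axis_def vec_eq_iff)
    then have "det (matrix (\<lambda>x. \<chi> i. c i * x $ i)) = prod c UNIV"
      using det_diagonal[of "\<chi> i j. if i = j then c i else 0"] by simp
    then show "\<forall>S \<in> lmeasurable. ?f ` S \<in> lmeasurable \<and> measure lebesgue (?f ` S) = \<bar>det (matrix ?f)\<bar> * measure lebesgue S"
      by (simp add: measurable_stretch measure_stretch)
  next
    fix m k :: 'n
    let ?p = "Transposition.transpose m k"
    let ?f = "\<lambda>x::real^'n. \<chi> i. x $ ?p i"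
    have lin: "linear ?f" by (rule linearI) (simp_all add: vec_eq_iff)
    have box: "?f ` cbox a b = cbox (?f a) (?f b)" for a b
    proof -
      have "x \<in> ?f ` cbox a b" if "x \<in> cbox (?f a) (?f b)" for x
      proof (rule image_eqI)
        show "x = ?f (?f x)" by (simp add: vec_eq_iff)
        show "?f x \<in> cbox a b"
        proof (simp add: mem_box_cart, intro allI)
          fix i
          show "a $ i \<le> x $ ?p i \<and> x $ ?p i \<le> b $ i"
            using that[unfolded mem_box_cart, rule_format, of "?p i"] by simp
        qed
      qed
      then show ?thesis by (auto simp: mem_box_cart)
    qed
    have "matrix ?f = (\<chi> i. mat 1 $ ?p i)"
      by (simp add: matrix_def mat_def axis_def vec_eq_iff eq_commute)
    then have det: "\<bar>det (matrix ?f)\<bar> = 1"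
      by (simp add: det_permute_rows permutes_swap_id sign_def)
    have content: "measure lebesgue (?f ` cbox a b) = 1 * measure lebesgue (cbox a b)" for a b
    proof (cases "cbox a b = {}")
      case False
      then have ne: "cbox (?f a) (?f b) \<noteq> {}" using box by blast
      have "(\<Prod>i\<in>UNIV. b $ ?p i - a $ ?p i) = (\<Prod>i\<in>UNIV. b $ i - a $ i)"
        by (rule prod.reindex_bij_betw[of ?p UNIV UNIV "\<lambda>i. b $ i - a $ i"]) simp
      then show ?thesis
        unfolding box using False ne by (simp add: content_cbox_cart)
    qed simp
    show "\<forall>S \<in> lmeasurable. ?f ` S \<in> lmeasurable \<and> measure lebesgue (?f ` S) = \<bar>det (matrix ?f)\<bar> * measure lebesgue S"
    proof
      fix S :: "(real^'n) set"
      assume S: "S \<in> lmeasurable"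
      show "?f ` S \<in> lmeasurable \<and> measure lebesgue (?f ` S) = \<bar>det (matrix ?f)\<bar> * measure lebesgue S"
        using measure_linear_sufficient[OF lin S content] unfolding det abs_one by metis
    qed
  next
    fix m k :: 'n
    assume mk: "m \<noteq> k"
    let ?f = "\<lambda>x::real^'n. \<chi> i. if i = m then x $ m + x $ k else x $ i"
    have lin: "linear ?f" by (rule linearI) (auto simp: vec_eq_iff algebra_simps)
    have "matrix ?f = (\<chi> i. if i = m then row m (mat 1) + 1 *s row k (mat 1) else row i (mat 1))"
      by (auto simp: matrix_def mat_def axis_def vec_eq_iff row_def eq_commute)
    then have det: "det (matrix ?f) = 1"
      using det_row_operation[OF mk, of "mat 1" 1] by simp
    have content: "measure lebesgue (?f ` cbox a b) = 1 * measure lebesgue (cbox a b)" for a b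
    proof (cases "cbox a b = {}")
      case False
      \<comment> \<open>Moving the lower corner to 0 makes all coordinates in the box nonnegative,
        as the formula for sheared boxes requires.\<close>
      have "cbox a b = (+) a ` cbox 0 (b - a)"
        using cbox_translation[of a 0 "b - a"] by simp
      then have "?f ` cbox a b = (+) (?f a) ` ?f ` cbox 0 (b - a)"
        by (simp add: image_image linear_add[OF lin])
      then have "measure lebesgue (?f ` cbox a b) = measure lebesgue (?f ` cbox 0 (b - a))"
        by (simp add: measure_translation)
      also have "\<dots> = measure lebesgue (cbox 0 (b - a))"
        using False \<open>cbox a b = (+) a ` cbox 0 (b - a)\<close> mk by (intro measure_shear_interval) auto
      also have "\<dots> = measure lebesgue (cbox a b)"
        unfolding \<open>cbox a b = (+) a ` cbox 0 (b - a)\<close> by (rule measure_translation[symmetric])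
      finally show ?thesis by simp
    qed simp
    show "\<forall>S \<in> lmeasurable. ?f ` S \<in> lmeasurable \<and> measure lebesgue (?f ` S) = \<bar>det (matrix ?f)\<bar> * measure lebesgue S"
    proof
      fix S :: "(real^'n) set"
      assume S: "S \<in> lmeasurable"
      show "?f ` S \<in> lmeasurable \<and> measure lebesgue (?f ` S) = \<bar>det (matrix ?f)\<bar> * measure lebesgue S"
        using measure_linear_sufficient[OF lin S content] unfolding det abs_one by metis
    qed
  qed
  with assms(2) show ?thesis by blast
qed

text \<open>A measure is Lebesgue measure as soon as it is so on boxes, and the preimage of a box is
  its image under the inverse map.\<close>

lemma lborel_linear:
  fixes f :: "real^'n \<Rightarrow> real^'n"
  assumes "linear f" "det (matrix f) \<noteq> 0"
  shows "lborel = density (distr lborel borel f) (\<lambda>_. ennreal \<bar>det (matrix f)\<bar>)"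
proof (rule lborel_eqI)
  obtain g where g: "linear g" "g \<circ> f = id" "f \<circ> g = id"
    using assms by (metis det_nz_iff_inj linear_injective_isomorphism linear_injective_left_inverse
        linear_inverse_left)
  have fm: "f \<in> borel_measurable borel"
    using assms(1) by (intro borel_measurable_continuous_onI linear_continuous_on)
      (simp add: linear_conv_bounded_linear)
  have gf: "g (f x) = x" "f (g x) = x" for x
    using g by (auto simp: fun_eq_iff)
  have detg: "det (matrix f) * det (matrix g) = 1"
    using matrix_compose[OF g(1) assms(1)] g(3) by (metis det_I det_mul matrix_id_mat_1)
  fix l u :: "real^'n"
  assume lu: "\<And>b. b \<in> Basis \<Longrightarrow> l \<bullet> b \<le> u \<bullet> b"
  have "f -` box l u = g ` box l u" using gf by (auto simp: image_iff) metis
  then have "emeasure lborel (f -` box l u) = emeasure lebesgue (g ` box l u)"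
    using fm measurable_sets[OF fm, of "box l u"] by simp
  also have "\<dots> = ennreal (\<bar>det (matrix g)\<bar> * measure lebesgue (box l u))"
    using measure_linear_image_finite[OF g(1), of "box l u"] by (simp add: emeasure_eq_measure2)
  finally have "emeasure (density (distr lborel borel f) (\<lambda>_. ennreal \<bar>det (matrix f)\<bar>)) (box l u) =
      ennreal (\<bar>det (matrix f) * det (matrix g)\<bar> * measure lebesgue (box l u))"
    using fm by (simp add: emeasure_density nn_integral_cmult_indicator emeasure_distr abs_mult
        flip: ennreal_mult mult.assoc)
  also have "\<dots> = ennreal (measure lborel (box l u))" unfolding detg by simp
  also have "\<dots> = (\<Prod>b\<in>Basis. (u - l) \<bullet> b)"
    using lu by (simp add: measure_def emeasure_lborel_box prod_nonneg inner_diff_left)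
  finally show "emeasure (density (distr lborel borel f) (\<lambda>_. ennreal \<bar>det (matrix f)\<bar>)) (box l u) =
      (\<Prod>b\<in>Basis. (u - l) \<bullet> b)" .
qed simp


lemma LINT_eq_integral:
  fixes F :: "'a::euclidean_space \<Rightarrow> real"
  assumes "compact S" "continuous_on S F"
  shows "(LINT x:S|lborel. F x) = integral S F" "set_integrable lborel S F" "F integrable_on S"
proof -
  show "set_integrable lborel S F"
    unfolding set_integrable_def using assms by (rule borel_integrable_compact)
  then show "(LINT x:S|lborel. F x) = integral S F" "F integrable_on S"
    by (simp_all add: set_borel_integral_eq_integral)
qed

lemma integral_affine_image:
  fixes L :: "real^'n \<Rightarrow> real^'n" and F :: "real^'n \<Rightarrow> real"
  assumes L: "linear L" "det (matrix L) \<noteq> 0" and S: "compact S" and F: "continuous_on UNIV F"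
  shows "integral ((\<lambda>y. v + L y) ` S) F = \<bar>det (matrix L)\<bar> * integral S (\<lambda>y. F (v + L y))"
proof -
  let ?T = "\<lambda>y. v + L y"
  have contL: "continuous_on A L" for A
    using L(1) by (intro linear_continuous_on) (simp add: linear_conv_bounded_linear)
  have contT: "continuous_on A ?T" for A by (intro continuous_intros contL)
  have inj: "inj L" using det_nz_iff_inj[OF L(1)] L(2) by blast
  have cT: "compact (?T ` S)" by (rule compact_continuous_image[OF contT S])
  have [measurable]: "L \<in> borel_measurable borel" "?T \<in> borel_measurable borel" "F \<in> borel_measurable borel"
    using contL contT F by (auto intro: borel_measurable_continuous_onI)
  have [measurable]: "?T ` S \<in> sets borel" using cT by (simp add: borel_compact)
  define G where "G x = indicator (?T ` S) x *\<^sub>R F x" for x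
  have [measurable]: "G \<in> borel_measurable borel" unfolding G_def by measurable
  have ind: "G (?T y) = indicator S y *\<^sub>R F (?T y)" for y
    using inj by (auto simp: G_def indicator_def inj_eq)
  have "integral (?T ` S) F = (LINT x|lborel. G x)"
    using LINT_eq_integral(1)[OF cT continuous_on_subset[OF F]] by (simp add: set_lebesgue_integral_def G_def)
  also have "\<dots> = (LINT x|distr lborel borel ((+) v). G x)"
    by (simp add: lborel_distr_plus)
  also have "\<dots> = (LINT x|lborel. G (v + x))"
    by (rule integral_distr) simp_all
  also have "\<dots> = (LINT x|density (distr lborel borel L) (\<lambda>_. ennreal \<bar>det (matrix L)\<bar>). G (v + x))"
    using lborel_linear[OF L] by simp
  also have "\<dots> = (LINT x|distr lborel borel L. \<bar>det (matrix L)\<bar> *\<^sub>R G (v + x))"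
    by (rule integral_density) simp_all
  also have "\<dots> = (LINT y|lborel. \<bar>det (matrix L)\<bar> *\<^sub>R G (v + L y))"
    by (rule integral_distr) simp_all
  also have "\<dots> = \<bar>det (matrix L)\<bar> * (LINT y:S|lborel. F (?T y))"
    unfolding ind set_lebesgue_integral_def by simp
  also have "(LINT y:S|lborel. F (?T y)) = integral S (\<lambda>y. F (?T y))"
    by (intro LINT_eq_integral(1) S continuous_on_compose2[OF F contT]) simp
  finally show ?thesis .
qed

lemma integral_pos_interior:
  fixes F :: "'a::euclidean_space \<Rightarrow> real"
  assumes S: "compact S" and F: "continuous_on S F" and nonneg: "\<And>x. x \<in> S \<Longrightarrow> 0 \<le> F x"
    and x: "x \<in> interior S" "0 < F x"
  shows "0 < integral S F"
proof -
  have "isCont F x"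
    using continuous_on_interior[OF F x(1)] .
  then obtain d where d: "d > 0" "\<And>y. dist y x < d \<Longrightarrow> \<bar>F y - F x\<bar> < F x / 2"
    unfolding continuous_at_eps_delta dist_real_def using x(2) half_gt_zero by blast
  obtain e where e: "e > 0" "cball x e \<subseteq> S"
    using x(1) mem_interior_cball by blast
  let ?B = "cball x (min e (d / 2))"
  have B: "?B \<subseteq> S" "\<And>y. y \<in> ?B \<Longrightarrow> F x / 2 \<le> F y"
  proof -
    show "?B \<subseteq> S" using e by auto
    fix y assume "y \<in> ?B"
    then have "dist y x < d" using d(1) by (simp add: dist_commute)
    then show "F x / 2 \<le> F y" using d(2)[of y] by linarith
  qed
  have "integral ?B (\<lambda>_. F x / 2 * 1) = F x / 2 * measure lebesgue ?B"
    unfolding lmeasure_integral[OF lmeasurable_cball] by (rule integral_mult_right)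
  moreover have "0 < measure lebesgue ?B"
    using d(1) e(1) by (simp add: content_cball_pos)
  ultimately have "0 < integral ?B (\<lambda>_. F x / 2)"
    using x(2) by simp
  also have "\<dots> \<le> integral ?B F"
    using B by (intro integral_le LINT_eq_integral(3) continuous_on_subset[OF F]) auto
  also have "\<dots> \<le> integral S F"
    using B nonneg by (intro integral_subset_le LINT_eq_integral(3) S F continuous_on_subset[OF F]) auto
  finally show ?thesis .
qed


section \<open>Second moments of the barycentric coordinates\<close>

definition std_simplex :: "(real^'n::finite) set" where
  "std_simplex = {y. (\<forall>i. 0 \<le> y $ i) \<and> (\<Sum>i\<in>UNIV. y $ i) \<le> 1}"

text \<open>The barycentric coordinates of the standard simplex; \<open>None\<close> stands for the
  vertex 0.\<close>

definition bary :: "'n::finite option \<Rightarrow> real^'n \<Rightarrow> real" where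
  "bary a y = (case a of None \<Rightarrow> 1 - (\<Sum>i\<in>UNIV. y $ i) | Some i \<Rightarrow> y $ i)"

lemma std_simplex_bary: "std_simplex = {y. \<forall>a. 0 \<le> bary a y}"
  by (auto simp: std_simplex_def bary_def split: option.split)

lemma compact_std_simplex: "compact (std_simplex :: (real^'n) set)"
proof -
  have "std_simplex \<subseteq> cbox (0 :: real^'n) (\<chi> i. 1)"
  proof
    fix y :: "real^'n"
    assume "y \<in> std_simplex"
    then have y: "\<And>i. 0 \<le> y $ i" "(\<Sum>i\<in>UNIV. y $ i) \<le> 1" by (auto simp: std_simplex_def)
    have "y $ i \<le> 1" for i
      using y member_le_sum[of i UNIV "\<lambda>i. y $ i"] by auto
    then show "y \<in> cbox 0 (\<chi> i. 1)" using y by (auto simp: mem_box_cart)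
  qed
  moreover have "closed (std_simplex :: (real^'n) set)"
    unfolding std_simplex_def
    by (intro closed_Collect_conj closed_Collect_all closed_Collect_le continuous_intros)
  ultimately show ?thesis
    by (meson bounded_cbox bounded_subset compact_eq_bounded_closed)
qed

lemma continuous_bary: "continuous_on S (bary a)"
  unfolding bary_def by (cases a) (auto intro!: continuous_intros)

text \<open>Linear part of the affine involution that exchanges the vertices 0 and
  \<open>axis i 1\<close> of the standard simplex and fixes the others.\<close>

definition bary_swap :: "'n::finite \<Rightarrow> real^'n \<Rightarrow> real^'n" where
  "bary_swap i y = (\<chi> j. if j = i then - (\<Sum>k\<in>UNIV. y $ k) else y $ j)"

lemma linear_bary_swap: "linear (bary_swap i)"
  by (rule linearI) (auto simp: bary_swap_def vec_eq_iff sum.distrib scaleR_right.sum sum_distrib_left)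

lemma sum_bary_swap: "(\<Sum>k\<in>UNIV. bary_swap i y $ k) = - (y $ i)"
  by (simp add: bary_swap_def sum.remove[of UNIV i] if_distrib cong: if_cong)

lemma det_bary_swap: "\<bar>det (matrix (bary_swap i))\<bar> = 1"
proof -
  have "bary_swap i \<circ> bary_swap i = id"
    using sum_bary_swap[of i] by (auto simp: fun_eq_iff vec_eq_iff bary_swap_def)
  then have "matrix (bary_swap i) ** matrix (bary_swap i) = mat 1"
    by (metis linear_bary_swap matrix_compose matrix_id_mat_1)
  then have "det (matrix (bary_swap i)) * det (matrix (bary_swap i)) = 1"
    by (metis det_I det_mul)
  then show ?thesis by (auto simp: square_eq_1_iff)
qed

lemma bary_swap: "bary a (axis i 1 + bary_swap i y) = bary (Transposition.transpose None (Some i) a) y"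
proof (cases a)
  case None
  have "(\<Sum>k\<in>UNIV. axis i (1::real) $ k) = 1" by (simp add: axis_def)
  then show ?thesis using None sum_bary_swap[of i y] by (simp add: bary_def sum.distrib transpose_def)
next
  case (Some j)
  then show ?thesis by (auto simp: bary_def transpose_def axis_def bary_swap_def)
qed

lemma integral_bary_swap:
  fixes F :: "real^'n \<Rightarrow> real"
  assumes P: "compact {y. P y}" and F: "continuous_on UNIV F"
  shows "integral {y. P (axis i 1 + bary_swap i y)} (\<lambda>y. F (axis i 1 + bary_swap i y)) = integral {y. P y} F"
proof -
  let ?T = "\<lambda>y. axis i 1 + bary_swap i y"
  have inv: "?T (?T y) = y" for y
  proof (simp only: vec_eq_iff, intro allI)
    fix j
    have "bary (Some j) (?T (?T y)) = bary (Some j) y"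
      unfolding bary_swap by simp
    then show "?T (?T y) $ j = y $ j" by (simp add: bary_def)
  qed
  have cont: "continuous_on A ?T" for A
    by (intro continuous_intros linear_continuous_on) (simp add: linear_bary_swap linear_conv_bounded_linear[symmetric])
  have eq: "{y. P (?T y)} = ?T ` {y. P y}"
  proof (intro equalityI subsetI)
    fix y assume "y \<in> {y. P (?T y)}"
    then show "y \<in> ?T ` {y. P y}" using inv[of y] by (intro image_eqI[of _ _ "?T y"]) simp_all
  next
    fix y assume "y \<in> ?T ` {y. P y}"
    then show "y \<in> {y. P (?T y)}" using inv by auto
  qed
  have "integral (?T ` {y. P (?T y)}) F = integral {y. P (?T y)} (\<lambda>y. F (?T y))"
    using det_bary_swap[of i] unfolding eq
    by (subst integral_affine_image[OF linear_bary_swap _ compact_continuous_image[OF cont P] F]) auto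
  moreover have "?T ` {y. P (?T y)} = {y. P y}"
    unfolding eq image_image inv by simp
  ultimately show ?thesis by simp
qed

text \<open>By symmetry there are only two values, on and off the diagonal, and a bisection of the
  simplex relates them. The integrals themselves need not be computed.\<close>

definition bary_moment :: "'n::finite option \<Rightarrow> 'n option \<Rightarrow> real" where
  "bary_moment a b = integral (std_simplex :: (real^'n) set) (\<lambda>y. bary a y * bary b y)"

lemma bary_moment_swap:
  fixes i :: "'n::finite"
  shows "bary_moment (Transposition.transpose None (Some i) a) (Transposition.transpose None (Some i) b) = bary_moment a b"
proof -
  have "compact {y::real^'n. \<forall>a. 0 \<le> bary a y}"
    using compact_std_simplex by (simp add: std_simplex_bary)
  from integral_bary_swap[OF this, of "\<lambda>y. bary a y * bary b y" i]
  have "integral {y::real^'n. \<forall>c. 0 \<le> bary (Transposition.transpose None (Some i) c) y}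
      (\<lambda>y. bary (Transposition.transpose None (Some i) a) y * bary (Transposition.transpose None (Some i) b) y)
    = bary_moment a b"
    unfolding bary_moment_def std_simplex_bary bary_swap
    by (simp add: continuous_on_mult continuous_bary)
  moreover have "{y::real^'n. \<forall>c. 0 \<le> bary (Transposition.transpose None (Some i) c) y} = std_simplex"
    unfolding std_simplex_bary
  proof (intro Collect_cong iffI allI)
    fix y :: "real^'n" and c
    assume "\<forall>c. 0 \<le> bary (Transposition.transpose None (Some i) c) y"
    from this[rule_format, of "Transposition.transpose None (Some i) c"] show "0 \<le> bary c y" by simp
  qed simp
  ultimately show ?thesis unfolding bary_moment_def by simp
qed

lemma bary_moment_commute: "bary_moment a b = bary_moment b a"
  by (simp add: bary_moment_def mult.commute)

text \<open>Maps the simplex onto one of its halves by moving the vertex \<open>axis i 1\<close> to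
  the midpoint of the edge that joins it to 0.\<close>

definition halve :: "'n::finite \<Rightarrow> real^'n \<Rightarrow> real^'n" where
  "halve i y = (\<chi> j. (if j = i then 1/2 else 1) * y $ j)"

lemma linear_halve: "linear (halve i)"
  by (rule linearI) (auto simp: halve_def vec_eq_iff algebra_simps)

lemma det_halve: "det (matrix (halve i)) = 1/2"
proof -
  have "matrix (halve i) = (\<chi> j k. if j = k then (if j = i then 1/2 else 1) else 0)"
    by (auto simp: matrix_def halve_def axis_def vec_eq_iff)
  then have "det (matrix (halve i)) = (\<Prod>j\<in>UNIV. if j = i then 1/2 else 1)"
    using det_diagonal[of "\<chi> j k. if j = k then (if j = i then 1/2 else 1) else (0::real)"] by simp
  then show ?thesis by (simp add: prod.remove[of UNIV i])
qed

lemma bary_halve: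
  "bary a (halve i y) = (if a = None then bary None y + bary (Some i) y / 2 else if a = Some i then bary a y / 2 else bary a y)"
proof -
  have "(\<Sum>k\<in>UNIV. halve i y $ k) = (\<Sum>k\<in>UNIV. y $ k) - y $ i / 2"
    by (simp add: halve_def sum.remove[of UNIV i])
  then show ?thesis by (cases a) (auto simp: bary_def halve_def)
qed

lemma integral_halve:
  fixes i :: "'n::finite" and F :: "real^'n \<Rightarrow> real"
  assumes "continuous_on UNIV F"
  shows "integral {y \<in> std_simplex. bary (Some i) y \<le> bary None y} F = integral std_simplex (\<lambda>y. F (halve i y)) / 2"
proof -
  have "halve i ` std_simplex = {y \<in> std_simplex. bary (Some i) y \<le> bary None y}"
  proof (intro equalityI subsetI)
    fix y assume "y \<in> halve i ` std_simplex"
    then obtain x where x: "x \<in> std_simplex" "y = halve i x" by blast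
    then have "0 \<le> bary a x" for a by (simp add: std_simplex_bary)
    from this[of None] this[of "Some i"] this show "y \<in> {y \<in> std_simplex. bary (Some i) y \<le> bary None y}"
      unfolding x(2) by (auto simp: std_simplex_bary bary_halve)
  next
    fix y assume "y \<in> {y \<in> std_simplex. bary (Some i) y \<le> bary None y}"
    then have y: "\<And>a. 0 \<le> bary a y" "bary (Some i) y \<le> bary None y" by (auto simp: std_simplex_bary)
    let ?x = "\<chi> j. (if j = i then 2 else 1) * y $ j"
    have eq: "y = halve i ?x" by (simp add: halve_def vec_eq_iff)
    have "(\<Sum>k\<in>UNIV. ?x $ k) = (\<Sum>k\<in>UNIV. y $ k) + y $ i"
      by (simp add: sum.remove[of UNIV i])
    moreover have "0 \<le> y $ j" for j using y(1)[of "Some j"] by (simp add: bary_def)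
    ultimately have "?x \<in> std_simplex"
      using y(2) by (auto simp: std_simplex_def bary_def)
    with eq show "y \<in> halve i ` std_simplex" by blast
  qed
  then show ?thesis
    using integral_affine_image[OF linear_halve _ compact_std_simplex assms, of i 0] det_halve[of i] by simp
qed

lemma negligible_bary_eq: "negligible {y::real^'n. bary (Some i) y = bary None y}"
proof -
  have "{y::real^'n. bary (Some i) y = bary None y} = {y. (\<chi> j. if j = i then 2 else 1) \<bullet> y = 1}"
    by (auto simp: bary_def inner_vec_def sum.remove[of UNIV i])
  moreover have "(\<chi> j. if j = i then 2 else 1) \<noteq> (0 :: real^'n)"
    by (auto simp: vec_eq_iff intro!: exI[of _ i])
  ultimately show ?thesis by (simp add: negligible_hyperplane)
qed

text \<open>Let M be the common value on the diagonal and N the mixed moment. The hyperplane on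
  which the two coordinates agree bisects the simplex, and \<open>halve\<close> pulls each half back
  to the whole, after a swap in the case of the second. For the square of the coordinate of the
  vertex 0 the halves contribute (M + N + M/4)/2 and (M/4)/2; their sum is M, hence N = M/2.\<close>

lemma bary_moment_halve:
  fixes i :: "'n::finite"
  shows "bary_moment None (Some i) = bary_moment (None :: 'n option) None / 2"
proof -
  let ?A = "{y::real^'n. y \<in> std_simplex \<and> bary (Some i) y \<le> bary None y}"
  let ?B = "{y::real^'n. y \<in> std_simplex \<and> bary None y \<le> bary (Some i) y}"
  let ?f = "\<lambda>a y::real^'n. bary a y * bary a y"
  have cont: "continuous_on S (?f a)" for S a by (intro continuous_intros continuous_bary)
  have cA: "compact ?A" and cB: "compact ?B"
    using compact_Int_closed[OF compact_std_simplex closed_Collect_le[OF continuous_bary continuous_bary]]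
    by (simp_all add: Int_def)
  have std: "std_simplex = ?A \<union> ?B" by auto
  have int: "(\<lambda>y. bary a y * bary b y) integrable_on (std_simplex :: (real^'n) set)" for a b
    by (intro LINT_eq_integral(3) compact_std_simplex continuous_intros continuous_bary)
  have swap: "integral ?B (?f None) = integral ?A (?f (Some i))"
  proof -
    have eq: "{y::real^'n. axis i 1 + bary_swap i y \<in> std_simplex \<and>
      bary None (axis i 1 + bary_swap i y) \<le> bary (Some i) (axis i 1 + bary_swap i y)} = ?A"
      unfolding std_simplex_bary bary_swap mem_Collect_eq
    proof (intro Collect_cong conj_cong iffI allI)
      fix y :: "real^'n" and c
      assume "\<forall>c. 0 \<le> bary (Transposition.transpose None (Some i) c) y"
      from this[rule_format, of "Transposition.transpose None (Some i) c"] show "0 \<le> bary c y" by simp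
    qed simp_all
    show ?thesis
      using integral_bary_swap[OF cB cont, of i None, unfolded eq] unfolding bary_swap by simp
  qed
  have "integral (?A \<union> ?B) (?f None) = integral ?A (?f None) + integral ?B (?f None)"
    by (intro integral_Un negligible_subset[OF negligible_bary_eq[of i]] LINT_eq_integral(3) cA cB cont) auto
  then have "bary_moment (None :: 'n option) None = integral ?A (?f None) + integral ?B (?f None)"
    unfolding bary_moment_def std[symmetric] .
  also have "integral ?A (?f None) = integral std_simplex (\<lambda>y. ?f None (halve i y)) / 2"
    using integral_halve[OF cont, of i None] .
  also have "integral std_simplex (\<lambda>y. ?f None (halve i y)) =
      integral std_simplex (\<lambda>y. (?f None y + bary None y * bary (Some i) y) + ?f (Some i) y / 4)"
    by (rule arg_cong[of _ _ "integral std_simplex"]) (simp add: bary_halve field_simps fun_eq_iff)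
  also have "\<dots> = bary_moment (None :: 'n option) None + bary_moment None (Some i) + bary_moment (Some i) (Some i) / 4"
    unfolding bary_moment_def
    by (simp add: integral_add[OF integrable_add[OF int int] integrable_on_divide[OF int]] integral_add[OF int int])
  also have "bary_moment (Some i) (Some i) = bary_moment (None :: 'n option) None"
    using bary_moment_swap[of i None None] by simp
  also have "integral ?B (?f None) = integral std_simplex (\<lambda>y. ?f (Some i) (halve i y)) / 2"
    unfolding swap using integral_halve[OF cont, of i "Some i"] .
  also have "integral std_simplex (\<lambda>y. ?f (Some i) (halve i y)) = bary_moment (Some i) (Some i) / 4"
    unfolding bary_moment_def by (simp add: bary_halve)
  also have "bary_moment (Some i) (Some i) = bary_moment (None :: 'n option) None"
    using bary_moment_swap[of i None None] by simp
  finally show ?thesis by argo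
qed

text \<open>This is where the moment formula of a simplex comes from: every ordered pair of vertices
  counts once, which gives the product of the vertex sums, and every pair of equal vertices counts
  once more.\<close>

lemma bary_moment_eq:
  fixes a b :: "'n::finite option"
  shows "bary_moment a b = bary_moment (None :: 'n option) None / 2 * (if a = b then 2 else 1)"
proof -
  have d: "bary_moment a a = bary_moment (None :: 'n option) None" for a :: "'n option"
    using bary_moment_swap[of _ None None] by (cases a) auto
  have o: "bary_moment None (Some i) = bary_moment (None :: 'n option) None / 2" for i :: 'n
    by (rule bary_moment_halve)
  show ?thesis
  proof (cases "a = b")
    case False
    have "bary_moment (Some i) (Some j) = bary_moment None (Some j)" if "i \<noteq> j" for i j :: 'n
      using bary_moment_swap[of i None "Some j"] that by (simp add: transpose_def)
    moreover have "bary_moment (Some i) None = bary_moment (None :: 'n option) None / 2" for i :: 'n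
      unfolding bary_moment_commute[of "Some i" None] by (rule o)
    ultimately show ?thesis
      using False o by (cases a; cases b) auto
  next
    case True
    then show ?thesis using d[of b] by simp
  qed
qed

lemma bary_moment_pos: "0 < bary_moment (None :: 'n::finite option) None"
proof -
  let ?x = "\<chi> i. 1 / (2 * real CARD('n)) :: real^'n"
  have sum: "(\<Sum>i\<in>UNIV. ?x $ i) < 1" by simp
  have "open {y::real^'n. (\<forall>i. 0 < y $ i) \<and> (\<Sum>i\<in>UNIV. y $ i) < 1}"
    unfolding Collect_conj_eq Collect_all_eq
    by (intro open_Int open_INT open_Collect_less continuous_intros)
      (auto intro!: open_Collect_less continuous_intros)
  then have "?x \<in> interior std_simplex"
    using sum by (intro interiorI[of "{y. (\<forall>i. 0 < y $ i) \<and> (\<Sum>i\<in>UNIV. y $ i) < 1}"])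
      (auto simp: std_simplex_def less_imp_le)
  then show ?thesis
    unfolding bary_moment_def using sum
    by (intro integral_pos_interior[of _ _ ?x] compact_std_simplex continuous_intros continuous_bary) (auto simp: bary_def)
qed

section \<open>Pulling triangulations\<close>

lemma affine_funI: "(\<And>x. h x = a \<bullet> x + b) \<Longrightarrow> affine_fun h"
  unfolding affine_fun_def by blast

lemma affine_fun_const [simp]: "affine_fun (\<lambda>x. c)"
  by (rule affine_funI[of _ 0]) simp

lemma affine_fun_inner [simp]: "affine_fun (\<lambda>x. w \<bullet> x)"
  by (rule affine_funI[of _ w 0]) simp

lemma affine_fun_add:
  assumes "affine_fun g" "affine_fun h"
  shows "affine_fun (\<lambda>x. g x + h x)"
proof -
  obtain a b c d where "g = (\<lambda>x. a \<bullet> x + b)" "h = (\<lambda>x. c \<bullet> x + d)"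
    using assms by (auto simp: affine_fun_def)
  then show ?thesis by (intro affine_funI[of _ "a + c" "b + d"]) (simp add: inner_add_left)
qed

lemma affine_fun_cmult:
  assumes "affine_fun g"
  shows "affine_fun (\<lambda>x. c * g x)"
proof -
  obtain a b where "g = (\<lambda>x. a \<bullet> x + b)"
    using assms by (auto simp: affine_fun_def)
  then show ?thesis by (intro affine_funI[of _ "c *\<^sub>R a" "c * b"]) (simp add: distrib_left)
qed

lemma affine_fun_diff: "affine_fun g \<Longrightarrow> affine_fun h \<Longrightarrow> affine_fun (\<lambda>x. g x - h x)"
  using affine_fun_add[of g "\<lambda>x. - 1 * h x"] affine_fun_cmult[of h "- 1"] by simp

lemma affine_fun_sum: "(\<And>i. i \<in> I \<Longrightarrow> affine_fun (h i)) \<Longrightarrow> affine_fun (\<lambda>x. \<Sum>i\<in>I. h i x)"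
  by (induction I rule: infinite_finite_induct) (auto intro: affine_fun_add)

lemma affine_fun_continuous: "affine_fun h \<Longrightarrow> continuous_on S h"
  unfolding affine_fun_def by (auto intro!: continuous_intros)

lemma negligible_affine_zeros:
  assumes "affine_fun h" "h u \<noteq> 0"
  shows "negligible {x. h x = 0}"
proof -
  obtain a b where h: "h = (\<lambda>x. a \<bullet> x + b)" using assms(1) by (auto simp: affine_fun_def)
  have "{x. h x = 0} = {x. a \<bullet> x = - b}" by (auto simp: h)
  moreover have "a \<noteq> 0 \<or> - b \<noteq> 0" using assms(2) by (auto simp: h)
  ultimately show ?thesis by (simp only: negligible_hyperplane)
qed

lemma affine_fun_combination:
  assumes "affine_fun h" "finite I" "(\<Sum>i\<in>I. c i) = 1"
  shows "h (\<Sum>i\<in>I. c i *\<^sub>R p i) = (\<Sum>i\<in>I. c i * h (p i))"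
proof -
  obtain a b where h: "h = (\<lambda>x. a \<bullet> x + b)" using assms(1) by (auto simp: affine_fun_def)
  have "(\<Sum>i\<in>I. c i * h (p i)) = (\<Sum>i\<in>I. c i * (a \<bullet> p i)) + (\<Sum>i\<in>I. c i) * b"
    by (simp add: h distrib_left sum.distrib sum_distrib_right)
  then show ?thesis by (simp add: h assms(3) inner_sum_right)
qed

text \<open>The index type has no order, so triangularity refers to the enumeration
  \<open>e\<close>. A permutation other than the identity lowers some position, and there the factor
  of its term vanishes.\<close>

lemma det_triangular_enum:
  fixes A :: "real^'n^'n"
  assumes e: "bij_betw e {..<CARD('n)} (UNIV :: 'n set)"
    and low: "\<And>j k. k < j \<Longrightarrow> j < CARD('n) \<Longrightarrow> A $ e j $ e k = 0"
  shows "det A = (\<Prod>i\<in>UNIV. A $ i $ i)"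
proof -
  let ?N = "{..<CARD('n)}"
  define f where "f = inv_into ?N e"
  have fe: "f (e k) = k" if "k < CARD('n)" for k
    using e that by (simp add: f_def bij_betw_inv_into_left)
  have ef: "e (f i) = i" "f i < CARD('n)" for i
    using e bij_betw_inv_into_right[OF e, of i] bij_betw_apply[OF bij_betw_inv_into[OF e], of i] by (simp_all add: f_def)
  have zero: "of_int (sign p) * (\<Prod>i\<in>UNIV. A $ i $ p i) = 0" if p: "p permutes UNIV" "p \<noteq> id" for p
  proof -
    define q where "q k = (if k < CARD('n) then f (p (e k)) else k)" for k
    have "inj_on q ?N"
      using ef(1) fe permutes_inj[OF p(1)] by (auto simp: inj_on_def q_def) (metis fe injD lessThan_iff)
    moreover have "q ` ?N \<subseteq> ?N" using ef(2) by (auto simp: q_def)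
    ultimately have "bij_betw q ?N ?N" by (simp add: bij_betw_def endo_inj_surj)
    then have q: "q permutes ?N" by (rule bij_imp_permutes) (simp add: q_def)
    have "q \<noteq> id"
    proof
      assume "q = id"
      then have "q (f i) = f i" for i by simp
      then have "f (p i) = f i" for i unfolding q_def using ef by simp
      then have "p i = i" for i by (metis ef(1))
      with p(2) show False by auto
    qed
    then obtain j where j: "j < CARD('n)" "q j < j"
      using permutes_natset_ge[OF q] by (metis lessThan_iff not_le)
    then have "A $ e j $ p (e j) = 0"
      using low[of "q j" j] ef(1) by (simp add: q_def)
    then show ?thesis by (metis (mono_tags, lifting) UNIV_I finite mult_eq_0_iff prod_zero_iff)
  qed
  have "det A = (\<Sum>p\<in>{id}. of_int (sign p) * (\<Prod>i\<in>UNIV. A $ i $ p i))"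
    unfolding det_def
    by (rule sum.mono_neutral_right) (auto simp: finite_permutations permutes_id zero)
  then show ?thesis by simp
qed

text \<open>The geometric counterpart of \<open>fan\<close>, reduced to what a triangulation needs.
  By \<open>face_vertex\<close> a nonempty face contains a vertex; by \<open>separate\<close> one
  tight normal can be released while the other tight ones are kept, which amounts to moving along an
  edge.\<close>

locale simple_polytope =
  fixes V VS :: "(real^'n::finite) set"
  assumes finite_normals: "finite V"
    and bounded: "bounded {x. \<forall>w\<in>V. - 1 \<le> w \<bullet> x}"
    and vertex_ge: "v \<in> VS \<Longrightarrow> w \<in> V \<Longrightarrow> - 1 \<le> w \<bullet> v"
    and face_vertex: "S \<subseteq> V \<Longrightarrow> \<forall>w\<in>V. - 1 \<le> w \<bullet> x \<Longrightarrow> \<forall>w\<in>S. w \<bullet> x = - 1 \<Longrightarrow>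
        \<exists>v\<in>VS. \<forall>w\<in>S. w \<bullet> v = - 1"
    and card_tight: "v \<in> VS \<Longrightarrow> card {w\<in>V. w \<bullet> v = - 1} = CARD('n)"
    and unimodular: "v \<in> VS \<Longrightarrow> bij_betw f UNIV {w\<in>V. w \<bullet> v = - 1} \<Longrightarrow> \<bar>det (\<chi> i. f i :: real^'n^'n)\<bar> = 1"
    and separate: "v \<in> VS \<Longrightarrow> w \<in> V \<Longrightarrow> w \<bullet> v = - 1 \<Longrightarrow>
        \<exists>v'\<in>VS. w \<bullet> v' \<noteq> - 1 \<and> (\<forall>w'\<in>V - {w}. w' \<bullet> v = - 1 \<longrightarrow> w' \<bullet> v' = - 1)"
begin

text \<open>The list holds apexes with the normals of the facets opposite to them, latest first. The
  homogenized point (x, 1) is projected from each apex in turn: the multiple \<open>l\<close> of (a,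
  1) is subtracted for which the pairing with (w, 1) becomes 0. Without dividing by the last
  coordinate, everything stays affine in \<open>x\<close>.\<close>

fun resid :: "((real^'n) \<times> (real^'n)) list \<Rightarrow> real^'n \<Rightarrow> (real^'n) \<times> real" where
  "resid [] x = (x, 1)"
| "resid ((a, w) # A) x = (let (y, t) = resid A x; l = (w \<bullet> y + t) / (w \<bullet> a + 1) in (y - l *\<^sub>R a, t - l))"

definition slack :: "((real^'n) \<times> (real^'n)) list \<Rightarrow> real^'n \<Rightarrow> real^'n \<Rightarrow> real" where
  "slack A w x = w \<bullet> fst (resid A x) + snd (resid A x)"

definition ratio :: "((real^'n) \<times> (real^'n)) list \<Rightarrow> real^'n \<Rightarrow> real^'n \<Rightarrow> real^'n \<Rightarrow> real" where
  "ratio A a w x = slack A w x / (w \<bullet> a + 1)"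

text \<open>A cell of the subdivision obtained so far: nonnegative slacks after a projection mean
  that the point lies in the join of the apex with the facet opposite to it, relative to the face
  reached before.\<close>

fun region :: "((real^'n) \<times> (real^'n)) list \<Rightarrow> (real^'n) set" where
  "region [] = {x. \<forall>w\<in>V. - 1 \<le> w \<bullet> x}"
| "region (p # A) = {x \<in> region A. \<forall>w\<in>V. 0 \<le> slack (p # A) w x}"

text \<open>An apex lies on all facets chosen before it, which makes the matrix of pairings between
  normals and apexes triangular.\<close>

fun steps :: "((real^'n) \<times> (real^'n)) list \<Rightarrow> bool" where
  "steps [] = True"
| "steps ((a, w) # A) = (steps A \<and> a \<in> VS \<and> w \<in> V \<and> w \<bullet> a \<noteq> - 1 \<and> (\<forall>p\<in>set A. snd p \<bullet> a = - 1))"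

lemma slack_Nil [simp]: "slack [] w x = w \<bullet> x + 1"
  by (simp add: slack_def)

lemma resid_Cons: "fst (resid ((a, w) # A) x) = fst (resid A x) - ratio A a w x *\<^sub>R a"
  "snd (resid ((a, w) # A) x) = snd (resid A x) - ratio A a w x"
  by (simp_all add: ratio_def slack_def split_beta Let_def)

lemma slack_Cons: "slack ((a, w) # A) w' x = slack A w' x - ratio A a w x * (w' \<bullet> a + 1)"
  unfolding slack_def resid_Cons by (simp add: inner_diff_right algebra_simps)

lemma affine_resid: "affine_fun (\<lambda>x. w \<bullet> fst (resid A x))" "affine_fun (\<lambda>x. snd (resid A x))"
proof (induction A arbitrary: w)
  case (Cons p A)
  obtain a w' where p: "p = (a, w')" by fastforce
  have "affine_fun (\<lambda>x. (1 / (w' \<bullet> a + 1)) * (w' \<bullet> fst (resid A x) + snd (resid A x)))"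
    by (intro affine_fun_cmult affine_fun_add Cons.IH)
  then have r: "affine_fun (\<lambda>x. ratio A a w' x)"
    by (simp add: ratio_def slack_def)
  {
    case 1
    have "affine_fun (\<lambda>x. w \<bullet> fst (resid A x) - (w \<bullet> a) * ratio A a w' x)"
      by (intro affine_fun_cmult affine_fun_diff Cons.IH r)
    then show ?case
      unfolding p resid_Cons inner_diff_right inner_scaleR_right by (simp add: mult.commute)
  next
    case 2
    show ?case unfolding p resid_Cons by (intro affine_fun_diff Cons.IH r)
  }
qed simp_all

lemma affine_slack: "affine_fun (slack A w)"
  unfolding slack_def[abs_def] by (intro affine_fun_add affine_resid)

lemma affine_ratio: "affine_fun (ratio A a w)"
  using affine_fun_cmult[OF affine_slack, of "1 / (w \<bullet> a + 1)" A w] by (simp add: ratio_def[abs_def])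

lemma region_slack: "x \<in> region A \<Longrightarrow> w \<in> V \<Longrightarrow> 0 \<le> slack A w x"
  by (cases A) force+

lemma compact_region: "compact (region A)"
proof (induction A)
  case Nil
  have "{x. \<forall>w\<in>V. - 1 \<le> w \<bullet> x} = (\<Inter>w\<in>V. {x. - 1 \<le> w \<bullet> x})" by auto
  moreover have "closed (\<Inter>w\<in>V. {x. - 1 \<le> w \<bullet> x})"
    by (intro closed_INT ballI closed_Collect_le continuous_intros)
  ultimately show ?case using bounded by (simp add: compact_eq_bounded_closed)
next
  case (Cons p A)
  have "region (p # A) = region A \<inter> (\<Inter>w\<in>V. {x. 0 \<le> slack (p # A) w x})" by auto
  moreover have "closed (\<Inter>w\<in>V. {x. 0 \<le> slack (p # A) w x})"
    by (intro closed_INT ballI closed_Collect_le continuous_intros affine_fun_continuous affine_slack)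
  ultimately show ?case using Cons compact_Int_closed by metis
qed

lemma steps_pos: "steps ((a, w) # A) \<Longrightarrow> 0 < w \<bullet> a + 1"
  using vertex_ge[of a w] by force

lemma steps_V: "steps A \<Longrightarrow> p \<in> set A \<Longrightarrow> snd p \<in> V"
  by (induction A) auto

lemma steps_slack_zero: "steps A \<Longrightarrow> p \<in> set A \<Longrightarrow> slack A (snd p) x = 0"
proof (induction A)
  case (Cons q A)
  obtain a w where q: "q = (a, w)" by fastforce
  show ?case
  proof (cases "p = q")
    case True
    then show ?thesis using steps_pos[of a w A] Cons.prems unfolding q by (simp add: slack_Cons ratio_def)
  next
    case False
    then show ?thesis using Cons unfolding q by (simp add: slack_Cons)
  qed
qed simp

text \<open>The ratios are the barycentric coordinates of a point with respect to the chosen apexes.\<close>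
fun weights :: "((real^'n) \<times> (real^'n)) list \<Rightarrow> real^'n \<Rightarrow> real list" where
  "weights [] x = []"
| "weights ((a, w) # A) x = ratio A a w x # weights A x"

lemma length_weights [simp]: "length (weights A x) = length A"
  by (induction A) auto

lemma resid_sum:
  "fst (resid A x) = x - (\<Sum>k<length A. weights A x ! k *\<^sub>R fst (A ! k))"
  "snd (resid A x) = 1 - (\<Sum>k<length A. weights A x ! k)"
proof (induction A)
  case (Cons p A)
  obtain a w where p: "p = (a, w)" by fastforce
  {
    case 1
    show ?case unfolding p resid_Cons Cons(1) by (simp add: sum.lessThan_Suc_shift algebra_simps del: sum.lessThan_Suc)
  next
    case 2
    show ?case unfolding p resid_Cons Cons(2) by (simp add: sum.lessThan_Suc_shift algebra_simps del: sum.lessThan_Suc)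
  }
qed simp_all

lemma region_iff:
  "steps A \<Longrightarrow> x \<in> region A \<longleftrightarrow> (\<forall>k<length A. 0 \<le> weights A x ! k) \<and> (\<forall>w\<in>V. 0 \<le> slack A w x)"
proof (induction A)
  case Nil
  show ?case by (auto simp: algebra_simps)
next
  case (Cons p A)
  obtain a w where p: "p = (a, w)" by fastforce
  have IH: "x \<in> region A \<longleftrightarrow> (\<forall>k<length A. 0 \<le> weights A x ! k) \<and> (\<forall>w\<in>V. 0 \<le> slack A w x)"
    using Cons unfolding p by simp
  have a: "a \<in> VS" "w \<in> V" using Cons.prems unfolding p by simp_all
  have pos: "0 < w \<bullet> a + 1" using Cons.prems unfolding p by (rule steps_pos)
  have "(\<forall>w\<in>V. 0 \<le> slack A w x) \<longleftrightarrow> 0 \<le> ratio A a w x" if s: "\<forall>w'\<in>V. 0 \<le> slack (p # A) w' x"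
  proof
    assume "\<forall>w\<in>V. 0 \<le> slack A w x"
    then show "0 \<le> ratio A a w x" using a pos by (simp add: ratio_def)
  next
    assume r: "0 \<le> ratio A a w x"
    show "\<forall>w'\<in>V. 0 \<le> slack A w' x"
    proof
      fix w' assume w': "w' \<in> V"
      have "0 \<le> ratio A a w x * (w' \<bullet> a + 1)" using r vertex_ge[OF a(1) w'] by simp
      then show "0 \<le> slack A w' x" using s w' unfolding p slack_Cons by force
    qed
  qed
  then show ?case unfolding region.simps mem_Collect_eq IH unfolding p
    by (auto simp: All_less_Suc2)
qed

text \<open>Among the normals that are slack at the apex, one with the smallest ratio belongs to a
  facet through which the ray from the apex leaves the face, and subtracting this ratio keeps all
  other slacks nonnegative.\<close>

lemma region_cover:
  assumes "steps A" "a \<in> VS" "\<forall>p\<in>set A. snd p \<bullet> a = - 1" "\<exists>w\<in>V. w \<bullet> a \<noteq> - 1"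
  shows "region A = (\<Union>w\<in>{w\<in>V. w \<bullet> a \<noteq> - 1}. region ((a, w) # A))"
proof (intro equalityI subsetI)
  fix x assume x: "x \<in> region A"
  let ?W = "{w\<in>V. w \<bullet> a \<noteq> - 1}"
  obtain w where w: "w \<in> ?W" "\<And>w'. w' \<in> ?W \<Longrightarrow> ratio A a w x \<le> ratio A a w' x"
    using ex_min_if_finite[of "(\<lambda>w. ratio A a w x) ` ?W"] assms(4) finite_normals by (force simp: not_less)
  have "0 \<le> slack ((a, w) # A) w' x" if w': "w' \<in> V" for w'
  proof (cases "w' \<bullet> a = - 1")
    case True
    then show ?thesis using region_slack[OF x w'] by (simp add: slack_Cons)
  next
    case False
    then have "0 < w' \<bullet> a + 1" using vertex_ge[OF assms(2) w'] by simp
    moreover have "ratio A a w x \<le> ratio A a w' x" using w(2) False w' by simp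
    ultimately show ?thesis by (simp add: slack_Cons ratio_def[of A a w'] pos_le_divide_eq)
  qed
  then show "x \<in> (\<Union>w\<in>?W. region ((a, w) # A))" using w(1) x by auto
qed auto

text \<open>The residue (y, t) of a point of the cell satisfies all homogeneous inequalities, with
  equality for the chosen normals. For t > 0 the point y / t would lie on the empty face; for t
  \<le> 0 the vector y is a recession direction of a bounded polytope, so y and then t vanish. The
  points of the cell are thus affine combinations of at most n apexes.\<close>

lemma face_empty_negligible:
  assumes "steps A" "length A \<le> CARD('n)" "\<not> (\<exists>v\<in>VS. \<forall>p\<in>set A. snd p \<bullet> v = - 1)"
  shows "negligible (region A)"
proof -
  have zero: "fst (resid A x) = 0" "snd (resid A x) = 0" if x: "x \<in> region A" for x
  proof -
    let ?y = "fst (resid A x)" and ?t = "snd (resid A x)"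
    have s: "0 \<le> w \<bullet> ?y + ?t" if "w \<in> V" for w
      using region_slack[OF x that] by (simp add: slack_def)
    have z: "w \<bullet> ?y + ?t = 0" if "w \<in> snd ` set A" for w
      using steps_slack_zero[OF assms(1)] that by (force simp: slack_def)
    have sub: "snd ` set A \<subseteq> V" using steps_V[OF assms(1)] by auto
    have "\<not> 0 < ?t"
    proof
      assume t: "0 < ?t"
      define u where "u = (1 / ?t) *\<^sub>R ?y"
      have eq: "w \<bullet> u = (w \<bullet> ?y + ?t) / ?t - 1" for w
        using t by (simp add: u_def field_simps)
      have "\<forall>w\<in>V. - 1 \<le> w \<bullet> u" unfolding eq using s t by simp
      moreover have "\<forall>w\<in>snd ` set A. w \<bullet> u = - 1" unfolding eq using z by simp
      ultimately obtain v where "v \<in> VS" "\<forall>w\<in>snd ` set A. w \<bullet> v = - 1"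
        using face_vertex[OF sub, of u] by auto
      with assms(3) show False by auto
    qed
    then have ray: "w \<bullet> ?y \<ge> 0" "w \<bullet> ?y \<ge> - ?t" if "w \<in> V" for w using s[OF that] by auto
    obtain B where B: "\<And>u. \<forall>w\<in>V. - 1 \<le> w \<bullet> u \<Longrightarrow> norm u \<le> B"
      using bounded by (auto simp: bounded_iff)
    show y: "?y = 0"
    proof (rule ccontr)
      assume "?y \<noteq> 0"
      have "- 1 \<le> w \<bullet> (((\<bar>B\<bar> + 1) / norm ?y) *\<^sub>R ?y)" if "w \<in> V" for w
      proof -
        have "0 \<le> (\<bar>B\<bar> + 1) / norm ?y * (w \<bullet> ?y)" using ray(1)[OF that] by simp
        then show ?thesis by simp
      qed
      then have "norm (((\<bar>B\<bar> + 1) / norm ?y) *\<^sub>R ?y) \<le> B" by (intro B) blast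
      then show False using \<open>?y \<noteq> 0\<close> by simp
    qed
    show "?t = 0"
    proof (cases "V = {}")
      case True
      have "norm ((\<bar>B\<bar> + 1) *\<^sub>R (axis undefined 1 :: real^'n)) \<le> B" by (intro B) (simp add: True)
      then show ?thesis by simp
    next
      case False
      then show ?thesis using s y \<open>\<not> 0 < ?t\<close> by force
    qed
  qed
  \<comment> \<open>At most n homogenized apexes in dimension n + 1 have a nonzero vector orthogonal
    to them, the equation of the hyperplane sought.\<close>
  let ?S = "(\<lambda>k. (fst (A ! k), 1 :: real)) ` {..<length A}"
  have "dim ?S \<le> length A"
    using dim_le_card'[of ?S] card_image_le[of "{..<length A}" "\<lambda>k. (fst (A ! k), 1 :: real)"] by simp
  then have "dim ?S < DIM((real^'n) \<times> real)" using assms(2) by simp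
  then have "span ?S \<noteq> UNIV" by (metis dim_span dim_UNIV less_irrefl)
  then obtain h where h: "h \<noteq> 0" "\<And>u. u \<in> span ?S \<Longrightarrow> orthogonal h u"
    using orthogonal_to_subspace_exists[of ?S] \<open>dim ?S < _\<close> by metis
  have "region A \<subseteq> {x. fst h \<bullet> x = - snd h}"
  proof
    fix x assume x: "x \<in> region A"
    have a: "fst h \<bullet> fst (A ! k) + snd h = 0" if "k < length A" for k
      using h(2)[of "(fst (A ! k), 1)"] that span_base[of "(fst (A ! k), 1)" ?S]
      by (simp add: orthogonal_def inner_prod_def)
    have "fst h \<bullet> x + snd h = fst h \<bullet> (\<Sum>k<length A. weights A x ! k *\<^sub>R fst (A ! k)) +
        (\<Sum>k<length A. weights A x ! k) * snd h"
      using zero[OF x] unfolding resid_sum by simp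
    also have "\<dots> = (\<Sum>k<length A. weights A x ! k * (fst h \<bullet> fst (A ! k) + snd h))"
      by (simp add: distrib_left sum.distrib inner_sum_right sum_distrib_right)
    also have "\<dots> = 0" using a by simp
    finally show "x \<in> {x. fst h \<bullet> x = - snd h}" by simp
  qed
  moreover have "fst h \<noteq> 0 \<or> - snd h \<noteq> 0" using h(1) by (auto simp: prod_eq_iff)
  ultimately show ?thesis using negligible_hyperplane negligible_subset by blast
qed

lemma resid_vertex: "steps A \<Longrightarrow> \<forall>p\<in>set A. snd p \<bullet> v = - 1 \<Longrightarrow> resid A v = (v, 1)"
  by (induction A) (auto simp: split_beta)

text \<open>On the overlap the two ratios agree, since each is minimal. Their difference is affine
  and does not vanish at a point that lies on the facet of \<open>w\<close> and on all earlier ones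
  but not on that of \<open>w'\<close>; if a vertex of the smaller face is also on the latter,
  \<open>separate\<close> moves away from it.\<close>

lemma region_overlap:
  assumes A: "steps A" "length A < CARD('n)" and a: "a \<in> VS" "\<forall>p\<in>set A. snd p \<bullet> a = - 1"
    and w: "w \<in> V" "w \<bullet> a \<noteq> - 1" "w' \<in> V" "w' \<bullet> a \<noteq> - 1" "w \<noteq> w'"
  shows "negligible (region ((a, w) # A) \<inter> region ((a, w') # A))"
proof (cases "\<exists>v\<in>VS. \<forall>p\<in>set ((a, w) # A). snd p \<bullet> v = - 1")
  case False
  then have "negligible (region ((a, w) # A))"
    using A a w by (intro face_empty_negligible) auto
  then show ?thesis by (rule negligible_subset) blast
next
  case True
  then obtain v where v: "v \<in> VS" "w \<bullet> v = - 1" "\<forall>p\<in>set A. snd p \<bullet> v = - 1" by auto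
  \<comment> \<open>The normal \<open>w'\<close> is slack at the apex, whereas the earlier ones are
    tight there, so it is none of them and releasing it keeps them tight.\<close>
  have sub: "snd p \<in> V - {w'}" if "p \<in> set A" for p
    using steps_V[OF A(1) that] a(2) w(4) that by auto
  obtain u where u: "w \<bullet> u = - 1" "\<forall>p\<in>set A. snd p \<bullet> u = - 1" "w' \<bullet> u \<noteq> - 1"
  proof (cases "w' \<bullet> v = - 1")
    case True
    obtain v' where "w' \<bullet> v' \<noteq> - 1" "\<forall>x\<in>V - {w'}. x \<bullet> v = - 1 \<longrightarrow> x \<bullet> v' = - 1"
      using separate[OF v(1) w(3) True] by blast
    then show ?thesis using that[of v'] v sub w by blast
  qed (use v that in blast)
  define h where "h x = ratio A a w x - ratio A a w' x" for x
  have "h u \<noteq> 0"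
    using resid_vertex[OF A(1) u(2)] u w(4) by (simp add: h_def ratio_def slack_def)
  have "affine_fun h" unfolding h_def[abs_def] by (intro affine_fun_diff affine_ratio)
  have "h x = 0" if x: "x \<in> region ((a, w) # A) \<inter> region ((a, w') # A)" for x
  proof -
    have pos: "0 < w \<bullet> a + 1" "0 < w' \<bullet> a + 1" using vertex_ge[OF a(1)] w by force+
    have "0 \<le> slack ((a, w) # A) w' x" "0 \<le> slack ((a, w') # A) w x"
      using x w(1,3) region_slack by blast+
    then have "ratio A a w x * (w' \<bullet> a + 1) \<le> slack A w' x" "ratio A a w' x * (w \<bullet> a + 1) \<le> slack A w x"
      unfolding slack_Cons by simp_all
    then have "ratio A a w x \<le> ratio A a w' x" "ratio A a w' x \<le> ratio A a w x"
      unfolding ratio_def[of A a w' x] ratio_def[of A a w x] pos_le_divide_eq[OF pos(1)] pos_le_divide_eq[OF pos(2)] .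
    then show ?thesis by (simp add: h_def)
  qed
  then have "region ((a, w) # A) \<inter> region ((a, w') # A) \<subseteq> {x. h x = 0}" by blast
  with negligible_affine_zeros[OF \<open>affine_fun h\<close> \<open>h u \<noteq> 0\<close>] show ?thesis by (rule negligible_subset)
qed

lemma region_split:
  assumes A: "steps A" "length A < CARD('n)" and a: "a \<in> VS" "\<forall>p\<in>set A. snd p \<bullet> a = - 1"
    and H: "continuous_on UNIV (H :: real^'n \<Rightarrow> real)" "{w\<in>V. w \<bullet> a \<noteq> - 1} \<noteq> {}"
  shows "integral (region A) H = (\<Sum>w\<in>{w\<in>V. w \<bullet> a \<noteq> - 1}. integral (region ((a, w) # A)) H)"
proof -
  let ?W = "{w\<in>V. w \<bullet> a \<noteq> - 1}"
  have "(H has_integral (\<Sum>w\<in>?W. integral (region ((a, w) # A)) H)) (\<Union>w\<in>?W. region ((a, w) # A))"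
  proof (rule has_integral_UN)
    show "finite ?W" using finite_normals by simp
    show "pairwise (\<lambda>w w'. negligible (region ((a, w) # A) \<inter> region ((a, w') # A))) ?W"
      unfolding pairwise_def using region_overlap[OF A a] by blast
    show "(H has_integral integral (region ((a, w) # A)) H) (region ((a, w) # A))" for w
      by (intro integrable_integral LINT_eq_integral(3) compact_region continuous_on_subset[OF H(1)]) simp
  qed
  moreover have "region A = (\<Union>w\<in>?W. region ((a, w) # A))"
    using H(2) by (intro region_cover A a) blast
  ultimately show ?thesis by (simp only: integral_unique)
qed

end

context simple_polytope begin

section \<open>Cells that are simplices\<close>

lemma steps_nth: "steps A \<Longrightarrow> k < j \<Longrightarrow> j < length A \<Longrightarrow> snd (A ! j) \<bullet> fst (A ! k) = - 1"
proof (induction A arbitrary: j k)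
  case (Cons p A)
  obtain a w where p: "p = (a, w)" by fastforce
  obtain j' where j': "j = Suc j'" using Cons.prems by (cases j) auto
  show ?case
  proof (cases k)
    case 0
    then show ?thesis using Cons.prems unfolding p j' by (simp add: nth_mem)
  next
    case (Suc k')
    then show ?thesis using Cons unfolding p j' by simp
  qed
qed simp

lemma steps_nth_pos: "steps A \<Longrightarrow> k < length A \<Longrightarrow> 0 < snd (A ! k) \<bullet> fst (A ! k) + 1"
proof (induction A arbitrary: k)
  case (Cons p A)
  obtain a w where p: "p = (a, w)" by fastforce
  then show ?case using Cons steps_pos[of a w A] by (cases k) auto
qed simp

lemma UNIV_option_sum: "(\<Sum>c\<in>UNIV. h c) = h None + (\<Sum>i\<in>UNIV. h (Some i))" for h :: "'a::finite option \<Rightarrow> 'b::comm_monoid_add"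
  by (simp add: UNIV_option_conv sum.reindex)

text \<open>With n pairs chosen, the cell is the simplex spanned by \<open>v\<close> and the apexes.
  The normals at \<open>v\<close> form a unimodular matrix whose product with the edge matrix is
  triangular with the lattice distances on the diagonal, so their product is the normalized
  volume.\<close>

lemma region_simplex:
  fixes F G :: "real^'n \<Rightarrow> real"
  assumes A: "steps A" "length A = CARD('n)" and v: "v \<in> VS" "\<forall>p\<in>set A. snd p \<bullet> v = - 1"
    and aff: "affine_fun F" "affine_fun G"
  shows "integral (region A) (\<lambda>x. F x * G x) = bary_moment (None :: 'n option) None / 2 *
    (\<Prod>k<CARD('n). snd (A ! k) \<bullet> fst (A ! k) + 1) *
    ((F v + (\<Sum>k<CARD('n). F (fst (A ! k)))) * (G v + (\<Sum>k<CARD('n). G (fst (A ! k)))) + F v * G v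
      + (\<Sum>k<CARD('n). F (fst (A ! k)) * G (fst (A ! k))))"
proof -
  let ?N = "{..<CARD('n)}"
  have "card ?N = card (UNIV :: 'n set)" by simp
  then obtain e :: "nat \<Rightarrow> 'n" where e: "bij_betw e ?N UNIV"
    using finite_same_card_bij[of ?N "UNIV :: 'n set"] by auto
  define f where "f = inv_into ?N e"
  have fe: "f (e k) = k" if "k < CARD('n)" for k
    using e that by (simp add: f_def bij_betw_inv_into_left)
  have ef: "e (f i) = i" "f i < CARD('n)" for i
    using e bij_betw_inv_into_right[OF e, of i] bij_betw_apply[OF bij_betw_inv_into[OF e], of i] by (simp_all add: f_def)
  have bf: "bij_betw f UNIV ?N" unfolding f_def by (rule bij_betw_inv_into[OF e])
  define a where "a i = fst (A ! f i)" for i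
  define w where "w i = snd (A ! f i)" for i
  have wv: "w i \<bullet> v = - 1" "w i \<in> V" for i
    using v(2) steps_V[OF A(1)] ef(2)[of i] A(2) by (auto simp: w_def)
  have pos: "0 < w i \<bullet> a i + 1" for i
    using steps_nth_pos[OF A(1)] ef(2) A(2) by (simp add: a_def w_def)
  have low: "w (e j) \<bullet> a (e k) = - 1" if "k < j" "j < CARD('n)" for j k
    using steps_nth[OF A(1) that(1)] that A(2) by (simp add: a_def w_def fe)
  have "inj w"
  proof (rule injI, rule ccontr)
    have neq: "w i \<noteq> w j" if "f i < f j" for i j
    proof
      assume "w i = w j"
      then show False using low[OF that ef(2)] pos[of i] by (simp add: ef)
    qed
    fix i j assume "w i = w j" "i \<noteq> j"
    then have "f i \<noteq> f j" by (metis ef(1))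
    then show False using neq[of i j] neq[of j i] \<open>w i = w j\<close> by force
  qed
  have bw: "bij_betw w UNIV {w\<in>V. w \<bullet> v = - 1}"
    unfolding bij_betw_def
  proof
    show "inj w" by fact
    show "range w = {w\<in>V. w \<bullet> v = - 1}"
      by (rule card_subset_eq) (use finite_normals wv card_tight[OF v(1)] \<open>inj w\<close> in \<open>auto simp: card_image\<close>)
  qed
  let ?B = "\<chi> i. w i"
  have detB: "\<bar>det ?B\<bar> = 1" by (rule unimodular[OF v(1) bw])
  define L where "L y = (\<Sum>i\<in>UNIV. y $ i *\<^sub>R (a i - v))" for y :: "real^'n"
  define T where "T y = v + L y" for y
  have linL: "linear L"
    by (rule linearI) (auto simp: L_def scaleR_add_left sum.distrib scaleR_sum_right)
  have diff: "(\<Sum>k\<in>UNIV. w i $ k * (a j $ k - v $ k)) = w i \<bullet> a j + 1" for i j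
    using wv(1)[of i] by (simp add: inner_vec_def right_diff_distrib sum_subtractf)
  have "?B ** matrix L = (\<chi> i k. w i \<bullet> a k + 1)"
    by (simp add: matrix_matrix_mult_def matrix_def L_def axis_def vec_eq_iff if_distrib if_distribR diff cong: if_cong)
  moreover have "det (\<chi> i k. w i \<bullet> a k + 1 :: real^'n^'n) = (\<Prod>i\<in>UNIV. w i \<bullet> a i + 1)"
    by (subst det_triangular_enum[OF e]) (simp_all add: low)
  ultimately have "det ?B * det (matrix L) = (\<Prod>i\<in>UNIV. w i \<bullet> a i + 1)"
    by (metis det_mul)
  moreover have prod: "0 < (\<Prod>i\<in>UNIV. w i \<bullet> a i + 1)" by (intro prod_pos pos)
  ultimately have detL: "\<bar>det (matrix L)\<bar> = (\<Prod>i\<in>UNIV. w i \<bullet> a i + 1)"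
    using detB abs_mult[of "det ?B" "det (matrix L)"] by simp
  have detL0: "det (matrix L) \<noteq> 0" using prod detL by (metis abs_zero less_irrefl)
  have injL: "inj L" using det_nz_iff_inj[OF linL] detL0 by (rule iffD1)
  define \<mu> where "\<mu> x = (\<chi> i. weights A x ! f i)" for x
  note reindex = sum.reindex_bij_betw[OF bf]
  \<comment> \<open>The residue is tight for all n normals at \<open>v\<close>, which form a basis,
    and is therefore a multiple of (v, 1).\<close>
  have res: "fst (resid A x) = snd (resid A x) *\<^sub>R v" for x
  proof -
    let ?u = "fst (resid A x) - snd (resid A x) *\<^sub>R v"
    have "w i \<bullet> ?u = 0" for i
      using steps_slack_zero[OF A(1), of "A ! f i" x] ef(2)[of i] A(2) wv(1)[of i]
      by (simp add: slack_def w_def inner_diff_right)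
    then have "?B *v ?u = 0" by (simp add: vec_eq_iff matrix_vector_mult_def inner_vec_def)
    moreover have "inj ((*v) ?B)"
      using iffD1[OF det_nz_iff_inj[OF matrix_vector_mul_linear]] detB
      unfolding matrix_of_matrix_vector_mul by (metis abs_zero zero_neq_one)
    ultimately have "?u = 0" by (metis injD matrix_vector_mult_0_right)
    then show ?thesis by simp
  qed
  have sumres: "fst (resid A x) = x - (\<Sum>i\<in>UNIV. \<mu> x $ i *\<^sub>R a i)" "snd (resid A x) = 1 - (\<Sum>i\<in>UNIV. \<mu> x $ i)" for x
    unfolding resid_sum A(2) reindex[of "\<lambda>k. weights A x ! k *\<^sub>R fst (A ! k)", symmetric]
      reindex[of "\<lambda>k. weights A x ! k", symmetric] by (simp_all add: \<mu>_def a_def)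
  have T\<mu>: "T (\<mu> x) = x" for x
    using res[of x] unfolding sumres T_def L_def
    by (simp add: scaleR_diff_left scaleR_diff_right sum_subtractf scaleR_sum_left algebra_simps)
  \<comment> \<open>If every normal were tight at \<open>v\<close>, the ray in direction - v would
    stay in the polytope. A slack normal is needed to read off the sign of the coefficient of
    \<open>v\<close> from the slacks.\<close>
  have "\<exists>w\<in>V. w \<bullet> v \<noteq> - 1"
  proof (rule ccontr)
    assume "\<not> ?thesis"
    then have all: "w \<bullet> v = - 1" if "w \<in> V" for w using that by blast
    obtain B where B: "\<And>u. \<forall>w\<in>V. - 1 \<le> w \<bullet> u \<Longrightarrow> norm u \<le> B"
      using bounded by (auto simp: bounded_iff)
    have "v \<noteq> 0" using wv(1)[of undefined] by auto
    define c where "c = (\<bar>B\<bar> + 1) / norm v"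
    have "0 \<le> c" by (simp add: c_def)
    then have "norm ((- c) *\<^sub>R v) \<le> B" by (intro B ballI) (simp add: all)
    then show False using \<open>v \<noteq> 0\<close> by (simp add: c_def)
  qed
  then obtain w0 where w0: "w0 \<in> V" "0 < w0 \<bullet> v + 1" using vertex_ge[OF v(1)] by force
  have slack: "slack A w' x = snd (resid A x) * (w' \<bullet> v + 1)" for w' x
    unfolding slack_def res by (simp add: algebra_simps)
  have mem: "x \<in> region A \<longleftrightarrow> \<mu> x \<in> std_simplex" for x
  proof -
    have "(\<forall>w\<in>V. 0 \<le> slack A w x) \<longleftrightarrow> 0 \<le> snd (resid A x)"
    proof
      assume "\<forall>w\<in>V. 0 \<le> slack A w x"
      then have "0 \<le> snd (resid A x) * (w0 \<bullet> v + 1)" using w0(1) unfolding slack by blast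
      then show "0 \<le> snd (resid A x)" using w0(2) by (simp add: zero_le_mult_iff)
    next
      assume "0 \<le> snd (resid A x)"
      then show "\<forall>w\<in>V. 0 \<le> slack A w x" using vertex_ge[OF v(1)] by (force simp: slack)
    qed
    moreover have "(\<forall>k<length A. 0 \<le> weights A x ! k) \<longleftrightarrow> (\<forall>i. 0 \<le> \<mu> x $ i)"
      unfolding \<mu>_def A(2) by (simp, metis fe ef(2))
    ultimately show ?thesis
      unfolding region_iff[OF A(1)] by (simp add: std_simplex_def sumres)
  qed
  have "region A = T ` std_simplex"
  proof (intro equalityI subsetI)
    fix x assume "x \<in> region A"
    then show "x \<in> T ` std_simplex" using mem T\<mu>[of x] by (metis imageI)
  next
    fix x assume "x \<in> T ` std_simplex"
    then obtain y where y: "y \<in> std_simplex" "x = T y" by blast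
    have "T (\<mu> x) = T y" using T\<mu> y by simp
    then have "\<mu> x = y" using injL by (simp add: T_def inj_eq)
    then show "x \<in> region A" using mem y by simp
  qed
  moreover have cont: "continuous_on UNIV (\<lambda>x. F x * G x)"
    by (intro continuous_on_mult affine_fun_continuous aff)
  ultimately have int: "integral (region A) (\<lambda>x. F x * G x) =
      (\<Prod>i\<in>UNIV. w i \<bullet> a i + 1) * integral std_simplex (\<lambda>y. F (T y) * G (T y))"
    using integral_affine_image[OF linL detL0 compact_std_simplex cont, of v]
    by (simp add: detL T_def)
  define pt where "pt c = (case c of None \<Rightarrow> v | Some i \<Rightarrow> a i)" for c
  have Tpt: "T y = (\<Sum>c\<in>UNIV. bary c y *\<^sub>R pt c)" for y
    by (simp add: T_def L_def UNIV_option_sum pt_def bary_def algebra_simps sum_subtractf sum.distrib scaleR_sum_left)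
  have one: "(\<Sum>c\<in>UNIV. bary c y) = 1" for y :: "real^'n"
    by (simp add: UNIV_option_sum bary_def)
  have "integral std_simplex (\<lambda>y. F (T y) * G (T y)) =
      integral std_simplex (\<lambda>y. \<Sum>c\<in>UNIV. \<Sum>c'\<in>UNIV. (F (pt c) * G (pt c')) * (bary c y * bary c' y))"
    unfolding Tpt affine_fun_combination[OF aff(1) finite one] affine_fun_combination[OF aff(2) finite one] sum_product
    by (simp add: mult_ac)
  also have "\<dots> = (\<Sum>c\<in>UNIV. \<Sum>c'\<in>UNIV. (F (pt c) * G (pt c')) * bary_moment c c')"
    unfolding bary_moment_def
    by (subst integral_sum, (intro finite LINT_eq_integral(3) compact_std_simplex continuous_intros continuous_bary)+,
       rule sum.cong, simp, subst integral_sum, (intro finite LINT_eq_integral(3) compact_std_simplex continuous_intros continuous_bary)+, simp)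
  also have "\<dots> = bary_moment (None :: 'n option) None / 2 *
      ((\<Sum>c\<in>UNIV. \<Sum>c'\<in>UNIV. F (pt c) * G (pt c')) + (\<Sum>c\<in>UNIV. F (pt c) * G (pt c)))"
  proof -
    have "(F (pt c) * G (pt c')) * bary_moment c c' =
        bary_moment (None :: 'n option) None / 2 * (F (pt c) * G (pt c')) +
        (if c = c' then bary_moment (None :: 'n option) None / 2 * (F (pt c) * G (pt c)) else 0)" for c c'
      by (subst bary_moment_eq) simp
    then show ?thesis by (simp add: sum.distrib sum_distrib_left distrib_left)
  qed
  also have "(\<Sum>c\<in>UNIV. \<Sum>c'\<in>UNIV. F (pt c) * G (pt c')) = (F v + (\<Sum>i\<in>UNIV. F (a i))) * (G v + (\<Sum>i\<in>UNIV. G (a i)))"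
    unfolding sum_product[symmetric] by (simp add: UNIV_option_sum pt_def)
  also have "(\<Sum>c\<in>UNIV. F (pt c) * G (pt c)) = F v * G v + (\<Sum>i\<in>UNIV. F (a i) * G (a i))"
    by (simp add: UNIV_option_sum pt_def)
  finally show ?thesis
    unfolding int a_def w_def reindex[of "\<lambda>k. F (fst (A ! k))"] reindex[of "\<lambda>k. G (fst (A ! k))"]
      reindex[of "\<lambda>k. F (fst (A ! k)) * G (fst (A ! k))"]
      prod.reindex_bij_betw[OF bf, of "\<lambda>k. snd (A ! k) \<bullet> fst (A ! k) + 1"]
    by (simp add: mult_ac add_ac)
qed

end

section \<open>Verification of the moment condition\<close>

fun rdot :: "int list \<Rightarrow> real list \<Rightarrow> real" where
  "rdot (a # x) (b # y) = of_int a * b + rdot x y"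
| "rdot [] y = 0"
| "rdot (a # x) [] = 0"

lemma rdot_sum: "length x = length y \<Longrightarrow> rdot x y = (\<Sum>i<length x. of_int (x ! i) * y ! i)"
  by (induction x y rule: list_induct2) (simp_all add: sum.lessThan_Suc_shift del: sum.lessThan_Suc)

lemma rdot_of_int: "length x = length y \<Longrightarrow> rdot x (map (\<lambda>a. c * of_int a) y) = c * of_int (dot x y)"
  by (induction x y rule: list_induct2) (simp_all add: algebra_simps)

lemma length_smul [simp]: "length (smul c x) = length x"
  by (induction x) auto

lemma nth_smul [simp]: "i < length x \<Longrightarrow> smul c x ! i = c * x ! i"
  by (induction x arbitrary: i) (auto simp: nth_Cons' )

lemma rdot_smul: "rdot (smul c x) y = of_int c * rdot x y"
  by (induction x y rule: rdot.induct) (auto simp: algebra_simps)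

lemma rdot_vadd: "length x = length x' \<Longrightarrow> length x = length y \<Longrightarrow> rdot (vadd x x') y = rdot x y + rdot x' y"
  by (induction x x' arbitrary: y rule: list_induct2) (auto simp: algebra_simps Suc_length_conv)

lemma rdot_axpy: "length x = length x' \<Longrightarrow> length x = length y \<Longrightarrow> rdot (axpy c x x') y = of_int c * rdot x y + rdot x' y"
  by (induction x x' arbitrary: y rule: list_induct2) (auto simp: algebra_simps Suc_length_conv)

lemma exact_div_Some: "exact_div c x = Some y \<Longrightarrow> x = smul c y"
proof (induction x arbitrary: y)
  case (Cons a x)
  have div_if: "div_if b q r = (if b then map_option ((#) q) r else None)" for b q r
    by (cases b; cases r) auto
  show ?case using Cons by (auto simp: div_if mult.commute split: if_splits)
qed simp

lemma reduce_cases: "reduce c x = x \<or> x = smul c (reduce c x)"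
  by (cases "exact_div c x") (auto simp: exact_div_Some)

declare reduce.simps [simp del]

lemma length_reduce [simp]: "length (reduce c x) = length x"
  using reduce_cases[of c x] by (metis length_smul)

lemma rdot_reduce: "c \<noteq> 0 \<Longrightarrow> rdot x z = 0 \<Longrightarrow> rdot (reduce c x) z = 0"
  using reduce_cases[of c x] by (metis mult_eq_0_iff of_int_eq_0_iff rdot_smul)

lemma find_pivot_Some:
  "find_pivot acc rs = Some (a, r, rs') \<Longrightarrow> a \<noteq> 0 \<and> set ((a # r) # rs') = set rs \<union> set acc"
proof (induction acc rs rule: find_pivot.induct)
  case (3 acc b x rs)
  show ?case
  proof (cases "b = 0")
    case True
    then show ?thesis using 3 by auto
  next
    case False
    then show ?thesis using 3(2) by auto
  qed
qed auto

lemma set_eliminate: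
  "x \<in> set (eliminate c a r rs) \<Longrightarrow> \<exists>b y. b # y \<in> set rs \<and> x = reduce c (axpy (- b) r (smul a y))"
  by (induction c a r rs rule: eliminate.induct) auto

text \<open>What matters is that every real solution is a multiple of the computed vector.
  Elimination and reduction preserve the vanishing of the rows on the tail of a solution, and the
  pivot row then determines its head.\<close>

lemma kernel_sound:
  assumes "kernel n c rs = Some m" "c \<noteq> 0" "\<forall>r\<in>set rs. length r = Suc n"
  shows "length m = Suc n \<and> (\<forall>z. length z = Suc n \<longrightarrow> (\<forall>r\<in>set rs. rdot r z = 0) \<longrightarrow>
    (\<exists>t. z = map (\<lambda>a. t * of_int a) m))"
  using assms
proof (induction n arbitrary: c rs m)
  case 0
  then show ?case by (auto simp: length_Suc_conv)
next
  case (Suc n)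
  obtain a r rs' where p: "find_pivot [] rs = Some (a, r, rs')"
    using Suc.prems(1) by (cases "find_pivot [] rs") auto
  note piv = find_pivot_Some[OF p]
  obtain m' where m': "kernel n a (eliminate c a r rs') = Some m'" "m = back_check (dot r m' div a) a (dot r m') m'"
    using Suc.prems(1) unfolding kernel.simps p by (cases "kernel n a (eliminate c a r rs')") auto
  have lr: "length r = Suc n" using piv Suc.prems(3) by force
  have rows: "\<forall>x\<in>set (eliminate c a r rs'). length x = Suc n"
  proof
    fix x assume "x \<in> set (eliminate c a r rs')"
    then obtain b y where "b # y \<in> set rs'" "x = reduce c (axpy (- b) r (smul a y))" using set_eliminate by blast
    moreover from this have "b # y \<in> set rs" using piv by auto
    then have "length (b # y) = Suc (Suc n)" using Suc.prems(3) by blast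
    ultimately show "length x = Suc n" using lr by simp
  qed
  note IH = Suc.IH[OF m'(1) conjunct1[OF piv] rows]
  have m: "m = (if dot r m' div a * a = dot r m' then (- (dot r m' div a)) # m' else (- dot r m') # smul a m')"
    unfolding m'(2) by simp
  have "\<exists>t. z = map (\<lambda>a. t * of_int a) m" if z: "length z = Suc (Suc n)" "\<forall>r\<in>set rs. rdot r z = 0" for z
  proof -
    obtain z0 z' where z': "z = z0 # z'" "length z' = Suc n" using z(1) by (auto simp: length_Suc_conv)
    have ar: "of_int a * z0 + rdot r z' = 0" using z(2) piv unfolding z' by force
    have "rdot x z' = 0" if x: "x \<in> set (eliminate c a r rs')" for x
    proof -
      obtain b y where y: "b # y \<in> set rs'" "x = reduce c (axpy (- b) r (smul a y))" using set_eliminate x by blast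
      have by_row: "b # y \<in> set rs" using piv y(1) by auto
      then have "length (b # y) = Suc (Suc n)" using Suc.prems(3) by blast
      then have ly: "length y = Suc n" by simp
      have "of_int b * z0 + rdot y z' = 0" using bspec[OF z(2) by_row] unfolding z' by simp
      then have "of_int a * rdot y z' - of_int b * rdot r z' = 0"
        using ar by algebra
      then have "rdot (axpy (- b) r (smul a y)) z' = 0" using lr ly z' by (simp add: rdot_axpy rdot_smul)
      then show ?thesis unfolding y(2) by (rule rdot_reduce[OF Suc.prems(2)])
    qed
    then obtain t where t: "z' = map (\<lambda>a. t * of_int a) m'" using IH z'(2) by blast
    have d: "rdot r z' = t * of_int (dot r m')" unfolding t using lr IH by (simp add: rdot_of_int)
    have z0: "z0 = - t * of_int (dot r m') / of_int a"
      using ar piv unfolding d by (simp add: field_simps)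
    have smul_map: "smul a y = map ((*) a) y" for y by (induction y) auto
    show ?thesis
    proof (cases "dot r m' div a * a = dot r m'")
      case True
      then have "of_int (dot r m') = (of_int (dot r m' div a) * of_int a :: real)" by (metis of_int_mult)
      then show ?thesis using z0 piv True unfolding m z' t by (intro exI[of _ t]) (simp add: field_simps)
    next
      case False
      then show ?thesis using z0 piv unfolding m z' t smul_map by (intro exI[of _ "t / of_int a"]) (simp add: field_simps)
    qed
  qed
  moreover have "length m = Suc (Suc n)" using IH unfolding m by simp
  ultimately show ?case by blast
qed

lemma nonzero_on_iff: "nonzero_on z fs \<longleftrightarrow> (\<forall>v\<in>snd ` set fs. dot v z \<noteq> 0)"
  by (induction z fs rule: nonzero_on.induct) auto

section \<open>Moment matrices\<close>

definition square :: "nat \<Rightarrow> int list list \<Rightarrow> bool" where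
  "square N M \<longleftrightarrow> length M = N \<and> (\<forall>i<N. length (M ! i) = N)"

lemma length_zeros [simp]: "length (zeros x) = length x"
  by (induction x) auto

lemma rdot_zeros [simp]: "rdot (zeros x) y = 0"
  by (induction x arbitrary: y) (simp, case_tac y, auto)

lemma length_madd [simp]: "length (madd M M') = min (length M) (length M')"
  by (induction M M' rule: madd.induct) auto

lemma nth_madd [simp]: "i < length M \<Longrightarrow> i < length M' \<Longrightarrow> madd M M' ! i = vadd (M ! i) (M' ! i)"
  by (induction M M' arbitrary: i rule: madd.induct) (auto simp: nth_Cons')

lemma length_msmul [simp]: "length (msmul c M) = length M"
  by (induction M) auto

lemma nth_msmul [simp]: "i < length M \<Longrightarrow> msmul c M ! i = smul c (M ! i)"
  by (induction M arbitrary: i) (auto simp: nth_Cons')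

lemma length_outer [simp]: "length (outer x y) = length x"
  by (induction x) auto

lemma nth_outer [simp]: "i < length x \<Longrightarrow> outer x y ! i = smul (x ! i) y"
  by (induction x arbitrary: i) (auto simp: nth_Cons')

lemma length_mzeros [simp]: "length (mzeros y x) = length x"
  by (induction x) auto

lemma nth_mzeros [simp]: "i < length x \<Longrightarrow> mzeros y x ! i = zeros y"
  by (induction x arbitrary: i) (auto simp: nth_Cons')

lemma square_madd: "square N M \<Longrightarrow> square N M' \<Longrightarrow> square N (madd M M')"
  by (auto simp: square_def)

lemma square_outer: "length x = N \<Longrightarrow> square N (outer x x)"
  by (auto simp: square_def)

lemma square_msmul: "square N M \<Longrightarrow> square N (msmul c M)"
  by (auto simp: square_def)

lemma dot_append: "length w = length v \<Longrightarrow> dot w (v @ x) = dot w v"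
  by (induction w v rule: list_induct2) (cases x, auto)

lemma remove_id_sorted:
  "sorted_wrt (<) l \<Longrightarrow> set (remove_id i l) = set l - {i} \<and> sorted_wrt (<) (remove_id i l)"
proof (induction l)
  case (Cons j l)
  have remove_if: "remove_if b j l l' = (if b then l else j # l')" for b l'
    by (cases b) auto
  show ?case using Cons by (auto simp: remove_if)
qed simp

lemma set_link: "set (link i fs) = {(remove_id i l, v) | l v. (l, v) \<in> set fs \<and> i \<in> set l}"
proof (induction i fs rule: link.induct)
  case (2 i l v fs)
  have link_if: "link_if b i l v fs = (if b then (remove_id i l, v) # fs else fs)" for b fs
    by (cases b) auto
  show ?case using 2 by (auto simp: link_if)
qed simp

lemma set_homogenize: "set (homogenize fs) = (\<lambda>(l, v). (l, v @ [1])) ` set fs"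
  by (induction fs rule: homogenize.induct) auto

text \<open>The accumulator passes through the facets one after the other, so their contributions
  \<open>g\<close> add up; normals listed at the apex contribute nothing.\<close>

lemma pullings_opposite:
  assumes "\<And>i w acc. (i, w) \<in> set W' \<Longrightarrow> i \<notin> set l \<Longrightarrow> square N acc \<Longrightarrow>
      square N (pulling d W (link i fs) (D * (dot w v + 1)) s Q acc) \<and>
      (\<forall>j<N. rdot (pulling d W (link i fs) (D * (dot w v + 1)) s Q acc ! j) z = rdot (acc ! j) z + g w j)"
    and "square N acc"
  shows "square N (pullings d W (opposite l v fs W') D s Q acc) \<and>
    (\<forall>j<N. rdot (pullings d W (opposite l v fs W') D s Q acc ! j) z =
      rdot (acc ! j) z + (\<Sum>(i, w)\<leftarrow>W'. if i \<in> set l then 0 else g w j))"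
  using assms
proof (induction l v fs W' arbitrary: acc rule: opposite.induct)
  case (2 l v fs i w W')
  have opp_if: "opp_if b c fs r = (if b then r else (c, fs) # r)" for b c fs r
    by (cases b) auto
  show ?case
  proof (cases "i \<in> set l")
    case True
    then show ?thesis using 2 by (simp add: opp_if)
  next
    case False
    let ?acc = "pulling d W (link i fs) (D * (dot w v + 1)) s Q acc"
    have "square N ?acc \<and> (\<forall>j<N. rdot (?acc ! j) z = rdot (acc ! j) z + g w j)"
      using 2(2)[of i w acc] 2(3) False by simp
    moreover from this have "square N (pullings d W (opposite l v fs W') D s Q ?acc) \<and>
      (\<forall>j<N. rdot (pullings d W (opposite l v fs W') D s Q ?acc ! j) z =
        rdot (?acc ! j) z + (\<Sum>(i, w)\<leftarrow>W'. if i \<in> set l then 0 else g w j))"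
      using 2(1)[of ?acc] 2(2) by simp
    ultimately show ?thesis using False by (simp add: opp_if)
  qed
qed simp

text \<open>A fan of integer lists together with its geometric realization: \<open>Y\<close>
  realizes the normals, \<open>X\<close> the vertices, and \<open>coord\<close> reads integer
  coordinates off a point.\<close>

locale fan_model = fan n V VS U T + simple_polytope "Y ` V" "X ` VS"
  for n V VS U T and X Y :: "int list \<Rightarrow> real^'n::finite" +
  fixes coord :: "nat \<Rightarrow> real^'n \<Rightarrow> real"
  assumes n_card: "n = CARD('n)"
    and inj_Y: "inj_on Y V"
    and inner_dot: "w \<in> V \<Longrightarrow> v \<in> VS \<Longrightarrow> Y w \<bullet> X v = of_int (dot w v)"
    and length_VS: "v \<in> VS \<Longrightarrow> length v = n"
    and coord_X: "v \<in> VS \<Longrightarrow> i < n \<Longrightarrow> coord i (X v) = of_int (v ! i)"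
    and affine_coord: "i < n \<Longrightarrow> affine_fun (coord i)"
begin

text \<open>The index \<open>n\<close> stands for the constant 1, so that an affine function is a
  coefficient vector of length n + 1.\<close>

definition hcoord :: "nat \<Rightarrow> real^'n \<Rightarrow> real" where
  "hcoord i x = (if i < n then coord i x else 1)"

definition hval :: "real list \<Rightarrow> real^'n \<Rightarrow> real" where
  "hval z x = (\<Sum>i<Suc n. hcoord i x * z ! i)"

lemma affine_hcoord: "affine_fun (hcoord i)"
  by (cases "i < n") (auto simp: hcoord_def[abs_def] affine_coord)

lemma affine_hval: "affine_fun (hval z)"
  unfolding hval_def[abs_def] mult.commute[of "hcoord _ _"]
  by (intro affine_fun_sum affine_fun_cmult affine_hcoord)

lemma hcoord_X: "v \<in> VS \<Longrightarrow> i < Suc n \<Longrightarrow> hcoord i (X v) = of_int ((v @ [1]) ! i)"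
  using coord_X length_VS by (auto simp: hcoord_def nth_append)

lemma rdot_X: "v \<in> VS \<Longrightarrow> length z = Suc n \<Longrightarrow> rdot (v @ [1]) z = hval z (X v)"
  using length_VS by (simp add: rdot_sum hval_def hcoord_X del: sum.lessThan_Suc)

lemma tight_iff: "w \<in> V \<Longrightarrow> v \<in> VS \<Longrightarrow> Y w \<bullet> X v = - 1 \<longleftrightarrow> w \<in> T v"
  unfolding inner_dot T_eq by (metis (mono_tags, lifting) mem_Collect_eq of_int_1 of_int_eq_iff of_int_minus)

definition face :: "int list set \<Rightarrow> item list \<Rightarrow> facet list \<Rightarrow> bool" where
  "face S W fs \<longleftrightarrow> (\<forall>(l, x)\<in>set fs. \<exists>v\<in>VS. x = v @ [1] \<and> S \<subseteq> T v \<and> named W l (T v - S)) \<and>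
    (\<forall>v\<in>VS. S \<subseteq> T v \<longrightarrow> (\<exists>l. (l, v @ [1]) \<in> set fs))"

lemma named_mem_iff: "naming W \<Longrightarrow> named W l S \<Longrightarrow> (i, w) \<in> set W \<Longrightarrow> i \<in> set l \<longleftrightarrow> w \<in> S"
proof
  assume W: "naming W" "named W l S" "(i, w) \<in> set W"
  assume "i \<in> set l"
  then obtain w' where "(i, w') \<in> set W" "w' \<in> S" using W(2) by (auto simp: named_def)
  then show "w \<in> S" using naming_fst[OF W(1) W(3)] by simp
qed (force simp: named_def)

lemma named_remove:
  assumes "naming W" "named W l S" "(i, w) \<in> set W"
  shows "named W (remove_id i l) (S - {w})"
proof -
  have s: "set (remove_id i l) = set l - {i} \<and> sorted_wrt (<) (remove_id i l)"
    using assms(2) remove_id_sorted by (simp add: named_def)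
  have "set l - {i} = fst ` {p \<in> set W. snd p \<in> S - {w}}"
  proof (intro equalityI subsetI)
    fix j assume j: "j \<in> set l - {i}"
    then obtain x where x: "(j, x) \<in> set W" "x \<in> S" using assms(2) by (auto simp: named_def)
    have "x \<noteq> w"
    proof
      assume "x = w"
      then have "j = i" using naming_snd[OF assms(1) _ assms(3), of j] x(1) by simp
      then show False using j by simp
    qed
    then show "j \<in> fst ` {p \<in> set W. snd p \<in> S - {w}}" using x by force
  next
    fix j assume "j \<in> fst ` {p \<in> set W. snd p \<in> S - {w}}"
    then obtain x where x: "(j, x) \<in> set W" "x \<in> S" "x \<noteq> w" by auto
    have "j \<noteq> i"
    proof
      assume "j = i"
      then have "x = w" using naming_fst[OF assms(1) _ assms(3), of x] x(1) by simp
      then show False using x(3) by simp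
    qed
    moreover have "j \<in> set l" using named_mem_iff[OF assms(1,2) x(1)] x(2) by simp
    ultimately show "j \<in> set l - {i}" by simp
  qed
  then show ?thesis using s assms(2) unfolding named_def by auto
qed

lemma face_named:
  assumes "face S W fs" "v \<in> VS" "S \<subseteq> T v"
  shows "\<exists>l. (l, v @ [1]) \<in> set fs \<and> named W l (T v - S)"
proof -
  obtain l where l: "(l, v @ [1]) \<in> set fs" using assms unfolding face_def by blast
  have "\<forall>(l, x)\<in>set fs. \<exists>v\<in>VS. x = v @ [1] \<and> S \<subseteq> T v \<and> named W l (T v - S)"
    using assms(1) by (simp add: face_def)
  from bspec[OF this l] have "named W l (T v - S)" by auto
  with l show ?thesis by blast
qed

lemma face_link:
  assumes "naming W" "face S W fs" "(i, w) \<in> set W" "w \<notin> S"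
  shows "face (insert w S) W (link i fs)"
  unfolding face_def
proof (intro conjI ballI impI)
  fix p assume "p \<in> set (link i fs)"
  then obtain l x where p: "p = (remove_id i l, x)" "(l, x) \<in> set fs" "i \<in> set l" by (auto simp: set_link)
  obtain v where v: "v \<in> VS" "x = v @ [1]" "S \<subseteq> T v" "named W l (T v - S)"
    using assms(2) p(2) unfolding face_def by blast
  have "w \<in> T v - S" using named_mem_iff[OF assms(1) v(4) assms(3)] p(3) by simp
  moreover have "T v - insert w S = T v - S - {w}" by auto
  ultimately show "case p of (l, x) \<Rightarrow> \<exists>v\<in>VS. x = v @ [1] \<and> insert w S \<subseteq> T v \<and> named W l (T v - insert w S)"
    using v named_remove[OF assms(1) v(4) assms(3)] unfolding p(1) by auto
next
  fix v assume v: "v \<in> VS" "insert w S \<subseteq> T v"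
  then obtain l where l: "(l, v @ [1]) \<in> set fs" "named W l (T v - S)"
    using face_named[OF assms(2) v(1)] by auto
  have "i \<in> set l" using named_mem_iff[OF assms(1) l(2) assms(3)] v assms(4) by simp
  then show "\<exists>l. (l, v @ [1]) \<in> set (link i fs)" using l unfolding set_link by blast
qed

lemma link_Nil:
  assumes "naming W" "face S W fs" "(i, w) \<in> set W" "w \<in> S"
  shows "link i fs = []"
proof -
  have "i \<notin> set l" if l: "(l, x) \<in> set fs" for l x
  proof -
    obtain v where "named W l (T v - S)" using assms(2) l unfolding face_def by blast
    then show ?thesis using named_mem_iff[OF assms(1) _ assms(3)] assms(4) by blast
  qed
  then have "set (link i fs) = {}" unfolding set_link by blast
  then show ?thesis by simp
qed

lemma apex_iff: "v \<in> VS \<Longrightarrow> S \<subseteq> V \<Longrightarrow> snd ` set A = Y ` S \<Longrightarrow> (\<forall>p\<in>set A. snd p \<bullet> X v = - 1) \<longleftrightarrow> S \<subseteq> T v"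
proof -
  assume v: "v \<in> VS" "S \<subseteq> V" "snd ` set A = Y ` S"
  have "(\<forall>p\<in>set A. snd p \<bullet> X v = - 1) \<longleftrightarrow> (\<forall>u\<in>snd ` set A. u \<bullet> X v = - 1)" by simp
  also have "\<dots> \<longleftrightarrow> (\<forall>w\<in>S. Y w \<bullet> X v = - 1)" unfolding v(3) by simp
  also have "\<dots> \<longleftrightarrow> S \<subseteq> T v" using tight_iff v(1,2) by blast
  finally show ?thesis .
qed

lemma face_Nil_negligible:
  assumes "steps A" "snd ` set A = Y ` S" "S \<subseteq> V" "length A \<le> n" "\<And>v. v \<in> VS \<Longrightarrow> \<not> S \<subseteq> T v"
  shows "negligible (region A)"
  using assms apex_iff[OF _ assms(3,2)] n_card by (intro face_empty_negligible) auto

lemma facet_beyond: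
  assumes "v \<in> VS" "0 < n"
  shows "V - T v \<noteq> {}"
proof -
  obtain w where w: "w \<in> T v" using card_T[OF assms(1)] assms(2) by (metis card.empty equals0I less_irrefl)
  obtain x where x: "x \<in> V" "dot x (U v w) = - 1" using nbr_ex[OF assms(1) w] by blast
  have "x \<notin> T v" using U_dual[OF assms(1) w, of x] x(2) by (auto split: if_splits)
  then show ?thesis using x(1) by blast
qed

lemma rdot_sum_hcoord:
  assumes "length s = Suc n" "length z = Suc n" "\<And>j. j < Suc n \<Longrightarrow> of_int (s ! j) = (\<Sum>k<m. hcoord j (p k))"
  shows "rdot s z = (\<Sum>k<m. hval z (p k))"
proof -
  have "rdot s z = (\<Sum>j<Suc n. (\<Sum>k<m. hcoord j (p k)) * z ! j)"
    using assms by (simp add: rdot_sum del: sum.lessThan_Suc)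
  also have "\<dots> = (\<Sum>k<m. \<Sum>j<Suc n. hcoord j (p k) * z ! j)"
    unfolding sum_distrib_right by (rule sum.swap)
  finally show ?thesis unfolding hval_def .
qed

text \<open>The chain \<open>A\<close> explains the arguments of the program: \<open>D\<close> is
  the product of the lattice distances, \<open>s\<close> the sum of the apexes and \<open>Q\<close>
  the sum of their outer products. Rows are compared only after pairing with the fixed vector
  \<open>z\<close>, so that each becomes an integral of a coordinate times one affine
  function.\<close>

lemma pulling_integral:
  assumes W: "naming W" "snd ` set W \<subseteq> V" and z: "length z = Suc n"
    and A: "steps A" "snd ` set A = Y ` S" "S \<subseteq> V" "d + length A = n"
    and fs: "face S W fs"
    and D: "of_int D = (\<Prod>k<length A. snd (A ! k) \<bullet> fst (A ! k) + 1)"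
    and s: "length s = Suc n" "\<And>j. j < Suc n \<Longrightarrow> of_int (s ! j) = (\<Sum>k<length A. hcoord j (fst (A ! k)))"
    and Q: "square (Suc n) Q" "\<And>i. i < Suc n \<Longrightarrow> rdot (Q ! i) z = (\<Sum>k<length A. hcoord i (fst (A ! k)) * hval z (fst (A ! k)))"
    and acc: "square (Suc n) acc"
  shows "square (Suc n) (pulling d W fs D s Q acc) \<and> (\<forall>i<Suc n. rdot (pulling d W fs D s Q acc ! i) z =
    rdot (acc ! i) z + integral (region A) (\<lambda>x. hcoord i x * hval z x) / (bary_moment (None :: 'n option) None / 2))"
  using A fs D s Q acc
proof (induction d arbitrary: A S fs D s Q acc)
  case (0 A S fs D s Q acc)
  let ?K = "bary_moment (None :: 'n option) None / 2"
  have K: "?K \<noteq> 0" using bary_moment_pos[where 'n='n] by simp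
  show ?case
  proof (cases fs)
    case Nil
    then have "negligible (region A)"
      using 0 by (intro face_Nil_negligible[of A S]) (auto simp: face_def)
    then show ?thesis using 0 unfolding Nil by (simp add: integral_negligible)
  next
    case (Cons p fs')
    obtain l x where "p = (l, x)" by fastforce
    then obtain v where v: "p = (l, v @ [1])" "v \<in> VS" "S \<subseteq> T v"
      using 0(5) Cons unfolding face_def by auto
    let ?h = "v @ [1]"
    have h: "length ?h = Suc n" using length_VS[OF v(2)] by simp
    have P: "pulling 0 W fs D s Q acc = madd (simplex_term D (vadd s ?h) ?h Q) acc"
      unfolding Cons v(1) by simp
    have lA: "length A = CARD('n)" using 0(4) n_card by simp
    have "rdot (pulling 0 W fs D s Q acc ! i) z =
        rdot (acc ! i) z + integral (region A) (\<lambda>x. hcoord i x * hval z x) / ?K" if i: "i < Suc n" for i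
    proof -
      have int: "integral (region A) (\<lambda>x. hcoord i x * hval z x) = ?K *
        (\<Prod>k<CARD('n). snd (A ! k) \<bullet> fst (A ! k) + 1) *
        ((hcoord i (X v) + (\<Sum>k<CARD('n). hcoord i (fst (A ! k)))) * (hval z (X v) + (\<Sum>k<CARD('n). hval z (fst (A ! k))))
          + hcoord i (X v) * hval z (X v) + (\<Sum>k<CARD('n). hcoord i (fst (A ! k)) * hval z (fst (A ! k))))"
        using apex_iff[OF v(2) 0(3,2)] v
        by (intro region_simplex 0 lA affine_hcoord affine_hval) auto
      have "rdot (pulling 0 W fs D s Q acc ! i) z =
          of_int D * ((of_int (s ! i) + of_int (?h ! i)) * (rdot s z + rdot ?h z) + (rdot (Q ! i) z + of_int (?h ! i) * rdot ?h z))
          + rdot (acc ! i) z"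
        unfolding P using i h 0(7,9,11) z
        by (simp add: square_def rdot_vadd rdot_smul nth_vadd)
      also have "rdot s z = (\<Sum>k<length A. hval z (fst (A ! k)))"
        using 0(7) z 0(8) by (rule rdot_sum_hcoord)
      finally have "rdot (pulling 0 W fs D s Q acc ! i) z - rdot (acc ! i) z =
        (\<Prod>k<CARD('n). snd (A ! k) \<bullet> fst (A ! k) + 1) *
        ((hcoord i (X v) + (\<Sum>k<CARD('n). hcoord i (fst (A ! k)))) * (hval z (X v) + (\<Sum>k<CARD('n). hval z (fst (A ! k))))
          + hcoord i (X v) * hval z (X v) + (\<Sum>k<CARD('n). hcoord i (fst (A ! k)) * hval z (fst (A ! k))))"
        using 0(6) 0(8)[OF i] 0(10)[OF i] rdot_X[OF v(2) z] hcoord_X[OF v(2) i]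
        by (simp add: lA algebra_simps)
      also have "\<dots> = integral (region A) (\<lambda>x. hcoord i x * hval z x) / ?K"
        unfolding int mult.assoc using K by (rule nonzero_mult_div_cancel_left[symmetric])
      finally show ?thesis by simp
    qed
    moreover have "square (Suc n) (pulling 0 W fs D s Q acc)"
      unfolding P using h 0(7,9,11) by (auto intro!: square_madd square_msmul square_outer)
    ultimately show ?thesis by blast
  qed
next
  case (Suc d A S fs D s Q acc)
  let ?K = "bary_moment (None :: 'n option) None / 2"
  show ?case
  proof (cases fs)
    case Nil
    then have "negligible (region A)"
      using Suc.prems by (intro face_Nil_negligible[of A S]) (auto simp: face_def)
    then show ?thesis using Suc.prems unfolding Nil by (simp add: integral_negligible)
  next
    case (Cons p fs')
    obtain l x where "p = (l, x)" by fastforce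
    then obtain v where v: "p = (l, v @ [1])" "v \<in> VS" "S \<subseteq> T v" "named W l (T v - S)"
      using Suc.prems(5) Cons unfolding face_def by auto
    let ?h = "v @ [1]"
    have h: "length ?h = Suc n" using length_VS[OF v(2)] by simp
    have P: "pulling (Suc d) W fs D s Q acc = pullings d W (opposite l ?h fs' W) D (vadd s ?h) (madd Q (outer ?h ?h)) acc"
      unfolding Cons v(1) by simp
    let ?H = "\<lambda>j x. hcoord j x * hval z x"
    define I where "I w j = integral (region ((X v, Y w) # A)) (?H j) / ?K" for w j
    define g where "g w j = (if w \<in> S then 0 else I w j)" for w j
    have tight: "\<forall>p\<in>set A. snd p \<bullet> X v = - 1" using apex_iff[OF v(2) Suc.prems(3,2)] v(3) by simp
    have steps': "steps ((X v, Y w) # A)" if "w \<in> V" "w \<notin> T v" for w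
      using Suc.prems(1) v(2) that tight tight_iff[OF that(1) v(2)] by simp
    have main: "square (Suc n) (pullings d W (opposite l ?h fs' W) D (vadd s ?h) (madd Q (outer ?h ?h)) acc) \<and>
      (\<forall>j<Suc n. rdot (pullings d W (opposite l ?h fs' W) D (vadd s ?h) (madd Q (outer ?h ?h)) acc ! j) z =
        rdot (acc ! j) z + (\<Sum>(i, w)\<leftarrow>W. if i \<in> set l then 0 else g w j))"
    proof (rule pullings_opposite)
      fix i w acc'
      assume iw: "(i, w) \<in> set W" "i \<notin> set l" "square (Suc n) acc'"
      \<comment> \<open>The index \<open>i\<close> does not occur at the apex, so removing the apex
        from the list of vertices does not change the link.\<close>
      have link: "link i fs' = link i fs" using iw(2) unfolding Cons v(1) by simp
      have wV: "w \<in> V" using iw(1) W(2) by force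
      have dot: "dot w ?h = dot w v" using length_V[OF wV] length_VS[OF v(2)] by (simp add: dot_append)
      show "square (Suc n) (pulling d W (link i fs') (D * (dot w ?h + 1)) (vadd s ?h) (madd Q (outer ?h ?h)) acc') \<and>
        (\<forall>j<Suc n. rdot (pulling d W (link i fs') (D * (dot w ?h + 1)) (vadd s ?h) (madd Q (outer ?h ?h)) acc' ! j) z =
          rdot (acc' ! j) z + g w j)"
      proof (cases "w \<in> S")
        case True
        then show ?thesis unfolding link using link_Nil[OF W(1) Suc.prems(5) iw(1)] iw(3) by (simp add: g_def)
      next
        case False
        have wT: "w \<notin> T v" using named_mem_iff[OF W(1) v(4) iw(1)] iw(2) False by simp
        show ?thesis
          unfolding link g_def I_def if_not_P[OF False]
        proof (rule Suc.IH[of _ "insert w S"])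
          show "steps ((X v, Y w) # A)" using steps' wV wT .
          show "snd ` set ((X v, Y w) # A) = Y ` insert w S" using Suc.prems(2) by simp
          show "insert w S \<subseteq> V" using Suc.prems(3) wV by simp
          show "d + length ((X v, Y w) # A) = n" using Suc.prems(4) by simp
          show "face (insert w S) W (link i fs)" using face_link[OF W(1) Suc.prems(5) iw(1) False] .
          show "of_int (D * (dot w ?h + 1)) =
              (\<Prod>k<length ((X v, Y w) # A). snd (((X v, Y w) # A) ! k) \<bullet> fst (((X v, Y w) # A) ! k) + 1)"
            using Suc.prems(6) inner_dot[OF wV v(2)] dot
            by (simp add: prod.lessThan_Suc_shift mult.commute del: prod.lessThan_Suc)
          show "length (vadd s ?h) = Suc n" using Suc.prems(7) h by simp
          show "of_int (vadd s ?h ! j) = (\<Sum>k<length ((X v, Y w) # A). hcoord j (fst (((X v, Y w) # A) ! k)))"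
            if "j < Suc n" for j
            using Suc.prems(7) Suc.prems(8)[OF that] hcoord_X[OF v(2) that] h that
            by (simp add: sum.lessThan_Suc_shift nth_vadd del: sum.lessThan_Suc)
          show "square (Suc n) (madd Q (outer ?h ?h))"
            using Suc.prems(9) h by (intro square_madd square_outer)
          show "rdot (madd Q (outer ?h ?h) ! j) z =
              (\<Sum>k<length ((X v, Y w) # A). hcoord j (fst (((X v, Y w) # A) ! k)) * hval z (fst (((X v, Y w) # A) ! k)))"
            if "j < Suc n" for j
            using Suc.prems(9) Suc.prems(10)[OF that] hcoord_X[OF v(2) that] rdot_X[OF v(2) z] h that z
            by (simp add: square_def sum.lessThan_Suc_shift rdot_vadd rdot_smul del: sum.lessThan_Suc)
          show "square (Suc n) acc'" by (rule iw(3))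
        qed
      qed
    qed (rule Suc.prems(11))
    have sum: "(\<Sum>(i, w)\<leftarrow>W. if i \<in> set l then 0 else g w j) = integral (region A) (?H j) / ?K" for j
    proof -
      have "(\<Sum>(i, w)\<leftarrow>W. if i \<in> set l then 0 else g w j) = (\<Sum>w\<leftarrow>map snd W. if w \<in> T v then 0 else I w j)"
      proof -
        have "(case p of (i, w) \<Rightarrow> if i \<in> set l then 0 else g w j) = (if snd p \<in> T v then 0 else I (snd p) j)"
          if p: "p \<in> set W" for p
        proof -
          obtain i w where p': "p = (i, w)" by fastforce
          show ?thesis using named_mem_iff[OF W(1) v(4), of i w] p v(3) unfolding p' g_def by auto
        qed
        then show ?thesis unfolding map_map by (intro arg_cong[of _ _ sum_list] map_cong) auto
      qed
      also have "\<dots> = (\<Sum>w\<in>snd ` set W. if w \<in> T v then 0 else I w j)"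
        using W(1) by (subst sum_list_distinct_conv_sum_set) (auto simp: naming_def)
      also have "\<dots> = (\<Sum>w\<in>V. if w \<in> T v then 0 else I w j)"
      proof (rule sum.mono_neutral_left[OF finite_V W(2)], intro ballI)
        \<comment> \<open>A normal without an index that is slack at the apex is tight at no vertex
          of the face, because the tight normals there are all named. Its cell is negligible, so the
          sum may run over all normals.\<close>
        fix w assume w: "w \<in> V - snd ` set W"
        show "(if w \<in> T v then 0 else I w j) = 0"
        proof (cases "w \<in> T v")
          case False
          have "\<not> insert w S \<subseteq> T v'" if v': "v' \<in> VS" for v'
          proof
            assume s: "insert w S \<subseteq> T v'"
            then obtain l' where "named W l' (T v' - S)"
              using face_named[OF Suc.prems(5) v'] by auto
            then have "T v' - S \<subseteq> snd ` set W" by (simp add: named_def)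
            then have "w \<in> S" using w s by auto
            then show False using v(3) False by blast
          qed
          then have "negligible (region ((X v, Y w) # A))"
            using Suc.prems(2,3,4) w steps'[of w] False by (intro face_Nil_negligible[of _ "insert w S"]) auto
          then show ?thesis by (simp add: I_def integral_negligible)
        qed simp
      qed
      also have "\<dots> = (\<Sum>w\<in>V - T v. I w j)"
        by (rule sum.mono_neutral_cong_right[OF finite_V]) auto
      also have "\<dots> = (\<Sum>u\<in>Y ` (V - T v). integral (region ((X v, u) # A)) (?H j)) / ?K"
        unfolding I_def sum_divide_distrib by (subst sum.reindex[OF inj_on_subset[OF inj_Y]]) auto
      also have "Y ` (V - T v) = {u\<in>Y ` V. u \<bullet> X v \<noteq> - 1}"
        using tight_iff[OF _ v(2)] by auto
      also have "(\<Sum>u\<in>\<dots>. integral (region ((X v, u) # A)) (?H j)) = integral (region A) (?H j)"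
      proof (rule region_split[symmetric])
        show "steps A" "length A < CARD('n)" "X v \<in> X ` VS" using Suc.prems(1,4) n_card v(2) by auto
        show "\<forall>p\<in>set A. snd p \<bullet> X v = - 1" by (rule tight)
        show "continuous_on UNIV (?H j)" by (intro continuous_on_mult affine_fun_continuous affine_hcoord affine_hval)
        have "V - T v \<noteq> {}" using Suc.prems(4) by (intro facet_beyond v(2)) simp
        then show "{u\<in>Y ` V. u \<bullet> X v \<noteq> - 1} \<noteq> {}" using tight_iff[OF _ v(2)] by auto
      qed
      finally show ?thesis .
    qed
    show ?thesis unfolding P using main unfolding sum .
  qed
qed

lemma kernel_check_Some: "kernel_check fs r \<longleftrightarrow> (\<exists>m. r = Some m \<and> nonzero_on m fs)"
  by (cases r) auto

text \<open>The moment conditions make \<open>z\<close> a multiple of the kernel vector, which is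
  nonzero at every vertex; a zero of the affine function at one vertex thus forces the factor to be
  0.\<close>

lemma moment_check_sound:
  assumes W: "naming W" "snd ` set W \<subseteq> V" and fs: "\<forall>(l, v)\<in>set fs. named W l (T v)" "snd ` set fs = VS"
    and check: "moment_check n W (homogenize fs)" and z: "length z = Suc n" "v \<in> VS" "hval z (X v) = 0"
    and int: "\<And>i. i < n \<Longrightarrow> integral {x. \<forall>w\<in>V. - 1 \<le> Y w \<bullet> x} (\<lambda>x. coord i x * hval z x) = 0"
  shows "\<forall>a\<in>set z. a = 0"
proof -
  obtain l h fs' where hom: "homogenize fs = (l, h) # fs'"
    using check by (cases "homogenize fs") auto
  have "(l, h) \<in> set (homogenize fs)" using hom by simp
  then obtain v0 where v0: "h = v0 @ [1]" "v0 \<in> VS" using fs(2) unfolding set_homogenize by force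
  have h: "length h = Suc n" using v0 length_VS by simp
  let ?M = "pulling n W (homogenize fs) 1 (zeros h) (mzeros h h) (mzeros h h)"
  have zz: "square (Suc n) (mzeros h h)" using h by (simp add: square_def)
  have zeros_nth: "i < length x \<Longrightarrow> zeros x ! i = 0" for i x
    by (induction x arbitrary: i) (auto simp: nth_Cons')
  have face: "face {} W (homogenize fs)"
    using fs unfolding face_def set_homogenize by force
  define M where "M = ?M"
  have M: "square (Suc n) M \<and> (\<forall>i<Suc n. rdot (M ! i) z =
      rdot (mzeros h h ! i) z + integral (region []) (\<lambda>x. hcoord i x * hval z x) / (bary_moment (None :: 'n option) None / 2))"
    unfolding M_def by (rule pulling_integral[OF W z(1), of "[]" "{}"]) (use h zz face in \<open>simp_all add: zeros_nth\<close>)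
  obtain m where m: "kernel n 1 (butlast M) = Some m" "nonzero_on m (homogenize fs)"
    using check unfolding M_def hom moment_check.simps kernel_check_Some by blast
  have row: "\<exists>i<n. r = M ! i" if r: "r \<in> set (butlast M)" for r
  proof -
    obtain i where i: "i < length (butlast M)" "r = butlast M ! i" using r unfolding in_set_conv_nth by blast
    moreover have "length M = Suc n" using M by (simp add: square_def)
    ultimately show ?thesis by (intro exI[of _ i]) (simp add: nth_butlast)
  qed
  have "\<forall>r\<in>set (butlast M). length r = Suc n"
  proof
    fix r assume "r \<in> set (butlast M)"
    then obtain i where "i < n" "r = M ! i" using row by blast
    then show "length r = Suc n" using M by (simp add: square_def)
  qed
  note ker = kernel_sound[OF m(1) _ this]
  have "rdot r z = 0" if r: "r \<in> set (butlast M)" for r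
  proof -
    obtain i where i: "i < n" "r = M ! i" using row[OF r] by blast
    have "integral (region []) (\<lambda>x. hcoord i x * hval z x) = 0" using int[OF i(1)] i(1) by (simp add: hcoord_def)
    then show ?thesis using M i h by simp
  qed
  then have "\<forall>r\<in>set (butlast M). rdot r z = 0" by blast
  then obtain t where t: "z = map (\<lambda>a. t * of_int a) m" using ker z(1) by auto
  have lm: "length m = Suc n" using ker by simp
  have "rdot (v @ [1]) z = 0" using rdot_X[OF z(2,1)] z(3) by simp
  then have "t * of_int (dot (v @ [1]) m) = 0"
    unfolding t using lm length_VS[OF z(2)] by (simp add: rdot_of_int)
  moreover have "dot (v @ [1]) m \<noteq> 0"
    using m(2) z(2) fs(2) unfolding nonzero_on_iff set_homogenize by force
  ultimately have "t = 0" by simp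
  then show ?thesis unfolding t by auto
qed

end

section \<open>Vertices and facets of Fano polytopes\<close>

lemma int_lattice_inner: "x \<in> int_lattice \<Longrightarrow> y \<in> int_lattice \<Longrightarrow> x \<bullet> y \<in> \<int>"
  unfolding int_lattice_def inner_vec_def by (auto intro!: Ints_sum)

lemma int_lattice_combine:
  "x \<in> int_lattice \<Longrightarrow> y \<in> int_lattice \<Longrightarrow> x + y \<in> int_lattice"
  "x \<in> int_lattice \<Longrightarrow> c \<in> \<int> \<Longrightarrow> c *\<^sub>R x \<in> int_lattice"
  "x \<in> int_lattice \<Longrightarrow> - x \<in> int_lattice"
  unfolding int_lattice_def by auto

lemma det_Ints:
  fixes A :: "real^'n^'n"
  assumes "\<And>i j. A $ i $ j \<in> \<int>"
  shows "det A \<in> \<int>"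
  unfolding det_def by (intro Ints_sum Ints_mult Ints_prod assms) auto

lemma det_int_inverse:
  fixes A B :: "real^'n^'n"
  assumes "A ** B = mat 1" "\<And>i j. A $ i $ j \<in> \<int>" "\<And>i j. B $ i $ j \<in> \<int>"
  shows "\<bar>det A\<bar> = 1"
proof -
  obtain a b where ab: "det A = of_int a" "det B = of_int b"
    using det_Ints[of A] det_Ints[of B] assms by (auto elim!: Ints_cases)
  have "det A * det B = 1" using assms(1) by (metis det_I det_mul)
  then have "a * b = 1" unfolding ab by (metis of_int_eq_1_iff of_int_mult)
  then have "\<bar>a\<bar> = 1" by (metis abs_mult abs_one zmult_eq_1_iff abs_minus_cancel)
  then show ?thesis unfolding ab by (metis of_int_1 of_int_abs)
qed

text \<open>Expanding the standard unit vectors in \<open>u\<close> yields an integer left inverse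
  of the matrix with rows \<open>u i\<close>. It is a right inverse too, and its columns form the
  dual basis.\<close>

lemma lattice_basis_dual:
  fixes u :: "'n::finite \<Rightarrow> real^'n"
  assumes "lattice_basis u"
  shows "\<exists>d. (\<forall>i. d i \<in> int_lattice) \<and> (\<forall>i j. d i \<bullet> u j = (if i = j then 1 else 0)) \<and>
    (\<forall>x. x = (\<Sum>i\<in>UNIV. (d i \<bullet> x) *\<^sub>R u i)) \<and> (\<forall>x. x = (\<Sum>i\<in>UNIV. (x \<bullet> u i) *\<^sub>R d i))"
proof -
  have "\<exists>c :: 'n \<Rightarrow> int. axis k 1 = (\<Sum>i\<in>UNIV. of_int (c i) *\<^sub>R u i)" for k
  proof -
    have "axis k 1 \<in> int_lattice" by (simp add: int_lattice_def axis_def)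
    then show ?thesis using assms unfolding lattice_basis_def by (blast dest: ex1_implies_ex)
  qed
  then obtain c :: "'n \<Rightarrow> 'n \<Rightarrow> int" where c: "\<And>k. axis k 1 = (\<Sum>i\<in>UNIV. of_int (c k i) *\<^sub>R u i)"
    by metis
  define d where "d i = (\<chi> k. real_of_int (c k i))" for i
  let ?A = "\<chi> i. u i" and ?C = "\<chi> k i. real_of_int (c k i)"
  have "?C ** ?A = mat 1"
    unfolding matrix_matrix_mult_def mat_def
  proof (simp only: vec_eq_iff vec_lambda_beta, intro allI)
    fix k j
    show "(\<Sum>i\<in>UNIV. of_int (c k i) * u i $ j) = (if k = j then 1 else 0)"
      using arg_cong[OF c[of k], of "\<lambda>x. x $ j"] by (simp add: axis_def eq_commute)
  qed
  then have AC: "?A ** ?C = mat 1" by (simp only: matrix_left_right_inverse)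
  have du: "d i \<bullet> u j = (if i = j then 1 else 0)" for i j
  proof -
    have "(?A ** ?C) $ j $ i = (if j = i then 1 else 0)" unfolding AC by (simp add: mat_def)
    then show ?thesis
      by (auto simp: matrix_matrix_mult_def d_def inner_vec_def mult.commute eq_commute split: if_splits)
  qed
  have x1: "x = (\<Sum>i\<in>UNIV. (d i \<bullet> x) *\<^sub>R u i)" for x
  proof -
    have "x = (\<Sum>k\<in>UNIV. x $ k *\<^sub>R axis k 1)"
      using basis_expansion[of x] by (simp add: scalar_mult_eq_scaleR)
    also have "\<dots> = (\<Sum>k\<in>UNIV. \<Sum>i\<in>UNIV. (x $ k * of_int (c k i)) *\<^sub>R u i)"
      by (simp add: c scaleR_sum_right)
    also have "\<dots> = (\<Sum>i\<in>UNIV. \<Sum>k\<in>UNIV. (x $ k * of_int (c k i)) *\<^sub>R u i)"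
      by (rule sum.swap)
    also have "\<dots> = (\<Sum>i\<in>UNIV. (d i \<bullet> x) *\<^sub>R u i)"
      by (simp add: d_def inner_vec_def scaleR_sum_left mult.commute)
    finally show ?thesis .
  qed
  have x2: "x = (\<Sum>i\<in>UNIV. (x \<bullet> u i) *\<^sub>R d i)" for x
  proof -
    have "(x - (\<Sum>i\<in>UNIV. (x \<bullet> u i) *\<^sub>R d i)) \<bullet> u j = 0" for j
      by (simp add: inner_diff_left inner_sum_left du if_distrib cong: if_cong)
    then have "(x - (\<Sum>i\<in>UNIV. (x \<bullet> u i) *\<^sub>R d i)) \<bullet> y = 0" for y
      by (subst x1[of y]) (simp add: inner_sum_right)
    from this[of "x - (\<Sum>i\<in>UNIV. (x \<bullet> u i) *\<^sub>R d i)"] show ?thesis by simp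
  qed
  have "d i \<in> int_lattice" for i by (simp add: d_def int_lattice_def)
  then show ?thesis using du x1 x2 by (intro exI[of _ d] conjI allI)
qed

lemma open_segment_tight:
  assumes "x \<in> open_segment a b" "c \<le> w \<bullet> a" "c \<le> w \<bullet> b" "w \<bullet> x = c"
  shows "w \<bullet> a = c \<and> w \<bullet> b = c"
proof -
  obtain s where s: "0 < s" "s < 1" "x = (1 - s) *\<^sub>R a + s *\<^sub>R b"
    using assms(1) by (auto simp: in_segment)
  have "(1 - s) * (w \<bullet> a - c) + s * (w \<bullet> b - c) = 0"
    using assms(4) unfolding s(3) by (simp add: inner_add_right algebra_simps)
  moreover have "0 \<le> (1 - s) * (w \<bullet> a - c)" "0 \<le> s * (w \<bullet> b - c)" using s assms by auto
  ultimately have "(1 - s) * (w \<bullet> a - c) = 0" "s * (w \<bullet> b - c) = 0" by linarith+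
  then show ?thesis using s by simp
qed

lemma small_step:
  fixes x y :: "'a::real_inner"
  assumes "finite W" "\<And>w. w \<in> W \<Longrightarrow> c < w \<bullet> x \<or> c \<le> w \<bullet> x \<and> 0 \<le> w \<bullet> y"
  shows "\<exists>e>0. \<forall>w\<in>W. c \<le> w \<bullet> (x + e *\<^sub>R y)"
proof -
  have "\<forall>w\<in>W. \<forall>\<^sub>F e in at_right 0. c \<le> w \<bullet> (x + e *\<^sub>R y)"
  proof
    fix w assume w: "w \<in> W"
    show "\<forall>\<^sub>F e in at_right 0. c \<le> w \<bullet> (x + e *\<^sub>R y)"
    proof (cases "c < w \<bullet> x")
      case True
      have "((\<lambda>e. w \<bullet> (x + e *\<^sub>R y)) \<longlongrightarrow> w \<bullet> (x + 0 *\<^sub>R y)) (at_right 0)"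
        by (intro tendsto_intros)
      then have "\<forall>\<^sub>F e in at_right 0. c < w \<bullet> (x + e *\<^sub>R y)"
        using True by (intro order_tendstoD(1)) auto
      then show ?thesis by (rule eventually_mono) simp
    next
      case False
      then have "c \<le> w \<bullet> x" "0 \<le> w \<bullet> y" using assms(2)[OF w] by auto
      then have "c \<le> w \<bullet> (x + e *\<^sub>R y)" if "0 < e" for e
        using that by (simp add: inner_add_right add_increasing2)
      then show ?thesis by (auto simp: eventually_at_right_field intro: exI[of _ 1])
    qed
  qed
  then have "\<forall>\<^sub>F e in at_right 0. \<forall>w\<in>W. c \<le> w \<bullet> (x + e *\<^sub>R y)"
    by (rule eventually_ball_finite[OF assms(1)])
  then obtain b where "0 < b" "\<And>e. 0 < e \<Longrightarrow> e < b \<Longrightarrow> \<forall>w\<in>W. c \<le> w \<bullet> (x + e *\<^sub>R y)"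
    by (auto simp: eventually_at_right_field)
  then show ?thesis by (intro exI[of _ "b / 2"]) simp
qed

lemma extreme_point_no_step:
  assumes "x extreme_point_of S" "x + e *\<^sub>R z \<in> S" "x - e' *\<^sub>R z \<in> S" "0 < e" "0 < (e' :: real)"
  shows "z = 0"
proof (rule ccontr)
  assume z: "z \<noteq> 0"
  let ?s = "e / (e + e')"
  have s: "0 < ?s" "?s < 1" using assms(4,5) by auto
  have "(1 - s) *\<^sub>R (x + e *\<^sub>R z) + s *\<^sub>R (x - e' *\<^sub>R z) = x + ((1 - s) * e - s * e') *\<^sub>R z" for s
    by (simp add: algebra_simps)
  moreover have "(1 - ?s) * e - ?s * e' = 0" using assms(4,5) by (simp add: field_simps)
  ultimately have "x = (1 - ?s) *\<^sub>R (x + e *\<^sub>R z) + ?s *\<^sub>R (x - e' *\<^sub>R z)" by (metis add.right_neutral scaleR_zero_left)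
  moreover have "x + e *\<^sub>R z \<noteq> x - e' *\<^sub>R z"
  proof
    assume "x + e *\<^sub>R z = x - e' *\<^sub>R z"
    then have "(e + e') *\<^sub>R z = 0" by (simp add: algebra_simps add_eq_0_iff)
    then show False using z assms(4,5) by simp
  qed
  ultimately have "x \<in> open_segment (x + e *\<^sub>R z) (x - e' *\<^sub>R z)"
    using s by (auto simp: in_segment intro!: exI[of _ ?s])
  then show False using assms by (simp add: extreme_point_of_def)
qed

locale fano =
  fixes P :: "(real^'n::finite) set"
  assumes fano: "fano_polytope P"
begin

section \<open>Tight normals and edges at a vertex\<close>

definition normals :: "(real^'n) set" where
  "normals = {w. w extreme_point_of dual_polytope P}"

definition vertices :: "(real^'n) set" where
  "vertices = {v. v extreme_point_of P}"

definition tight :: "real^'n \<Rightarrow> (real^'n) set" where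
  "tight v = {w \<in> normals. w \<bullet> v = - 1}"

lemma lattice_polytope_extreme:
  fixes S :: "(real^'n) set"
  assumes "lattice_polytope S"
  shows "compact S" "convex S" "finite {x. x extreme_point_of S}" "{x. x extreme_point_of S} \<subseteq> int_lattice"
    "S = convex hull {x. x extreme_point_of S}"
proof -
  obtain L where L: "finite L" "L \<subseteq> int_lattice" "S = convex hull L"
    using assms by (auto simp: lattice_polytope_def)
  have sub: "{x. x extreme_point_of S} \<subseteq> L"
    using extreme_point_of_convex_hull unfolding L(3) by blast
  show "compact S" "convex S" unfolding L(3) using L(1) by (auto intro: finite_imp_compact_convex_hull)
  then show "S = convex hull {x. x extreme_point_of S}" by (rule Krein_Milman_Minkowski)
  show "finite {x. x extreme_point_of S}" "{x. x extreme_point_of S} \<subseteq> int_lattice"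
    using sub L finite_subset by blast+
qed

lemma lattice: "lattice_polytope P" "lattice_polytope (dual_polytope P)"
  and zero_interior: "0 \<in> interior P" and delzant: "delzant P"
  using fano by (simp_all add: fano_polytope_def)

lemmas polytope_P = lattice_polytope_extreme[OF lattice(1), folded vertices_def]
lemmas polytope_Q = lattice_polytope_extreme[OF lattice(2), folded normals_def]

lemma dual_eq: "dual_polytope P = convex hull normals"
  using polytope_Q(5) .

lemma P_ge: "x \<in> P \<Longrightarrow> w \<in> normals \<Longrightarrow> - 1 \<le> w \<bullet> x"
  unfolding normals_def extreme_point_of_def dual_polytope_def by (auto simp: inner_commute)

text \<open>A hyperplane separating a point from \<open>P\<close>, scaled suitably, is a member of
  the dual polytope and hence a convex combination of the normals, so some normal already excludes
  the point.\<close>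

lemma P_eq: "P = {x. \<forall>w\<in>normals. - 1 \<le> w \<bullet> x}"
proof (intro equalityI subsetI)
  fix x assume x: "x \<in> {x. \<forall>w\<in>normals. - 1 \<le> w \<bullet> x}"
  show "x \<in> P"
  proof (rule ccontr)
    assume "x \<notin> P"
    then obtain a b where ab: "a \<bullet> x < b" "\<forall>p\<in>P. b < a \<bullet> p"
      using separating_hyperplane_closed_point[OF polytope_P(2) compact_imp_closed[OF polytope_P(1)]] by blast
    have "b < 0" using ab(2) zero_interior interior_subset by force
    define y where "y = (- 1 / b) *\<^sub>R a"
    have "y \<in> dual_polytope P"
      unfolding dual_polytope_def
    proof (simp, intro ballI)
      fix p assume "p \<in> P"
      then have "b < a \<bullet> p" using ab(2) by blast
      moreover have "p \<bullet> y = - ((a \<bullet> p) / b)" by (simp add: y_def inner_commute)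
      ultimately show "- 1 \<le> p \<bullet> y" using \<open>b < 0\<close> by (simp add: divide_le_eq)
    qed
    moreover have "convex hull normals \<subseteq> {y. x \<bullet> y \<ge> - 1}"
      using x by (intro hull_minimal convex_halfspace_ge) (auto simp: inner_commute)
    ultimately have "- 1 \<le> x \<bullet> y" unfolding dual_eq by blast
    then show False using ab(1) \<open>b < 0\<close> unfolding y_def by (simp add: inner_commute field_simps)
  qed
qed (auto simp: P_ge)

lemma vertex_P: "v \<in> vertices \<Longrightarrow> v \<in> P"
  by (simp add: vertices_def extreme_point_of_def)

lemma normal_int: "w \<in> normals \<Longrightarrow> w \<in> int_lattice" and vertex_int: "v \<in> vertices \<Longrightarrow> v \<in> int_lattice"
  using polytope_P(4) polytope_Q(4) by blast+

lemma face_P: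
  assumes "S \<subseteq> normals"
  shows "{x \<in> P. \<forall>w\<in>S. w \<bullet> x = - 1} face_of P"
  unfolding face_of_def
proof (intro conjI ballI impI)
  have "{x \<in> P. \<forall>w\<in>S. w \<bullet> x = - 1} = P \<inter> (\<Inter>w\<in>S. {x. w \<bullet> x = - 1})" by auto
  then show "convex {x \<in> P. \<forall>w\<in>S. w \<bullet> x = - 1}"
    by (auto intro!: convex_Int convex_INT convex_hyperplane polytope_P)
  fix a b x assume "a \<in> P" "b \<in> P" and x: "x \<in> {x \<in> P. \<forall>w\<in>S. w \<bullet> x = - 1}" "x \<in> open_segment a b"
  have "w \<bullet> a = - 1 \<and> w \<bullet> b = - 1" if "w \<in> S" for w
    using x that assms by (intro open_segment_tight[OF x(2)] P_ge \<open>a \<in> P\<close> \<open>b \<in> P\<close>) auto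
  then show "a \<in> {x \<in> P. \<forall>w\<in>S. w \<bullet> x = - 1}" "b \<in> {x \<in> P. \<forall>w\<in>S. w \<bullet> x = - 1}"
    using \<open>a \<in> P\<close> \<open>b \<in> P\<close> by auto
qed auto

lemma face_has_vertex:
  assumes "S \<subseteq> normals" "x \<in> P" "\<forall>w\<in>S. w \<bullet> x = - 1"
  shows "\<exists>v\<in>vertices. \<forall>w\<in>S. w \<bullet> v = - 1"
proof -
  let ?F = "{x \<in> P. \<forall>w\<in>S. w \<bullet> x = - 1}"
  have F: "?F = P \<inter> (\<Inter>w\<in>S. {x. w \<bullet> x = - 1})" by auto
  have "compact ?F" unfolding F by (intro compact_Int_closed closed_INT ballI closed_hyperplane polytope_P)
  moreover have "convex ?F" using face_P[OF assms(1)] by (rule face_of_imp_convex)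
  ultimately obtain v where v: "v extreme_point_of ?F"
    using assms extreme_point_exists_convex[of ?F] by blast
  then have "v extreme_point_of P" using face_P[OF assms(1)] extreme_point_of_face by blast
  then show ?thesis using v by (auto simp: vertices_def extreme_point_of_def)
qed

lemma step_P:
  assumes v: "v \<in> vertices" and y: "\<forall>w\<in>tight v. 0 \<le> w \<bullet> y"
  shows "\<exists>e>0. v + e *\<^sub>R y \<in> P"
proof -
  have "- 1 < w \<bullet> v \<or> - 1 \<le> w \<bullet> v \<and> 0 \<le> w \<bullet> y" if "w \<in> normals" for w
    using y that P_ge[OF vertex_P[OF v] that] by (auto simp: tight_def)
  from small_step[OF polytope_Q(3) this] show ?thesis using P_eq by blast
qed

lemma tight_separates:
  assumes v: "v \<in> vertices" and z: "\<forall>w\<in>tight v. w \<bullet> z = 0"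
  shows "z = 0"
proof -
  obtain e where e: "e > 0" "v + e *\<^sub>R z \<in> P" using step_P[OF v, of z] z by auto
  obtain e' where e': "e' > 0" "v + e' *\<^sub>R (- z) \<in> P" using step_P[OF v, of "- z"] z by auto
  show ?thesis using e e' v by (intro extreme_point_no_step[of v P e z e']) (auto simp: vertices_def)
qed

text \<open>The cone of feasible directions at \<open>v\<close> is generated by the edges. Its
  section \<open>B\<close>, where the sum \<open>h\<close> of the tight normals equals 1, is compact
  and hence the hull of its extreme points. The tight normals that vanish on an extreme point
  determine it up to a factor, so they cut out a face of dimension one, which is one of the given
  edges.\<close>

lemma vertex_cone:
  assumes v: "v \<in> vertices" and u: "lattice_basis u" "\<forall>i. t i > 0"
    and edges: "{E. E edge_of P \<and> v \<in> E} = range (\<lambda>i. closed_segment v (v + t i *\<^sub>R u i))"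
    and d: "\<And>i j. d i \<bullet> u j = (if i = j then 1 else (0::real))"
    and y: "\<forall>w\<in>tight v. 0 \<le> w \<bullet> y"
  shows "0 \<le> d i \<bullet> y"
proof -
  let ?T = "tight v"
  have fin: "finite ?T" using polytope_Q(3) by (simp add: tight_def)
  define h where "h = (\<Sum>w\<in>?T. w)"
  have hz: "h \<bullet> z = (\<Sum>w\<in>?T. w \<bullet> z)" for z by (simp add: h_def inner_sum_left)
  define B where "B = {y. (\<forall>w\<in>?T. 0 \<le> w \<bullet> y) \<and> h \<bullet> y = 1}"
  \<comment> \<open>This map is injective because the tight normals separate vectors; the resulting
    lower bound for norms shows that the section is bounded.\<close>
  define A where "A y = (\<Sum>w\<in>?T. (w \<bullet> y) *\<^sub>R w)" for y
  have linA: "linear A"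
    by (rule linearI) (auto simp: A_def inner_add_right scaleR_add_left sum.distrib scaleR_sum_right)
  have "inj A"
  proof (rule linear_injective_0[OF linA, THEN iffD2], intro allI impI)
    fix y assume "A y = 0"
    moreover have "A y \<bullet> y = (\<Sum>w\<in>?T. (w \<bullet> y)\<^sup>2)"
      by (simp add: A_def inner_sum_left power2_eq_square)
    ultimately have "(\<Sum>w\<in>?T. (w \<bullet> y)\<^sup>2) = 0" by simp
    then have "\<forall>w\<in>?T. w \<bullet> y = 0" using fin by (simp add: sum_nonneg_eq_0_iff)
    then show "y = 0" by (rule tight_separates[OF v])
  qed
  then obtain C where C: "C > 0" "\<And>y. C * norm y \<le> norm (A y)"
    using linear_inj_bounded_below_pos[OF linA] by (metis mult.commute)
  have "norm y \<le> (\<Sum>w\<in>?T. norm w) / C" if y: "y \<in> B" for y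
  proof -
    have "C * norm y \<le> norm (A y)" by (rule C(2))
    also have "\<dots> \<le> (\<Sum>w\<in>?T. norm ((w \<bullet> y) *\<^sub>R w))" unfolding A_def by (rule norm_sum)
    also have "\<dots> \<le> (\<Sum>w\<in>?T. norm w)"
    proof (rule sum_mono)
      fix w assume w: "w \<in> ?T"
      have "w \<bullet> y \<le> (\<Sum>w\<in>?T. w \<bullet> y)" using y w fin by (intro member_le_sum) (auto simp: B_def)
      then have "\<bar>w \<bullet> y\<bar> \<le> 1" using y w hz[of y] by (simp add: B_def)
      then show "norm ((w \<bullet> y) *\<^sub>R w) \<le> norm w" by (simp add: mult_left_le_one_le)
    qed
    finally show ?thesis using C(1) by (simp add: field_simps)
  qed
  then have "bounded B" by (auto simp: bounded_iff)
  moreover have B_eq: "B = (\<Inter>w\<in>?T. {y. 0 \<le> w \<bullet> y}) \<inter> {y. h \<bullet> y = 1}" by (auto simp: B_def)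
  moreover have "closed B" unfolding B_eq by (intro closed_Int closed_INT ballI closed_halfspace_ge closed_hyperplane)
  ultimately have "compact B" by (simp add: compact_eq_bounded_closed)
  moreover have "convex B" unfolding B_eq by (intro convex_Int convex_INT convex_halfspace_ge convex_hyperplane)
  ultimately have hull: "B = convex hull {p. p extreme_point_of B}" by (rule Krein_Milman_Minkowski)
  have ext: "0 \<le> d i \<bullet> p" if p: "p extreme_point_of B" for p
  proof -
    have pB: "p \<in> B" using p by (simp add: extreme_point_of_def)
    define Z where "Z = {w\<in>?T. w \<bullet> p = 0}"
    have line: "z = (h \<bullet> z) *\<^sub>R p" if z: "\<forall>w\<in>Z. w \<bullet> z = 0" for z
    proof -
      define z' where "z' = z - (h \<bullet> z) *\<^sub>R p"
      have z0: "\<forall>w\<in>Z. w \<bullet> z' = 0" using z by (simp add: z'_def inner_diff_right Z_def)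
      have hz0: "h \<bullet> z' = 0" using pB by (simp add: z'_def inner_diff_right B_def)
      have step: "\<exists>e>0. p + e *\<^sub>R q \<in> B" if q: "\<forall>w\<in>Z. w \<bullet> q = 0" "h \<bullet> q = 0" for q
      proof -
        have "\<exists>e>0. \<forall>w\<in>?T. 0 \<le> w \<bullet> (p + e *\<^sub>R q)"
          using pB q by (intro small_step[OF fin]) (force simp: B_def Z_def)
        then show ?thesis using pB q(2) by (simp add: B_def inner_add_right)
      qed
      obtain e where e: "e > 0" "p + e *\<^sub>R z' \<in> B" using step[OF z0 hz0] by blast
      obtain e' where e': "e' > 0" "p + e' *\<^sub>R (- z') \<in> B" using step[of "- z'"] z0 hz0 by auto
      have "z' = 0" using extreme_point_no_step[OF p e(2) _ e(1) e'(1)] e'(2) by simp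
      then show ?thesis by (simp add: z'_def)
    qed
    have p0: "p \<noteq> 0" using pB by (auto simp: B_def)
    let ?E = "{x \<in> P. \<forall>w\<in>Z. w \<bullet> x = - 1}"
    have face: "?E face_of P" by (rule face_P) (auto simp: Z_def tight_def)
    have "\<forall>w\<in>?T. 0 \<le> w \<bullet> p" using pB by (simp add: B_def)
    then obtain e where e: "e > 0" "v + e *\<^sub>R p \<in> P" using step_P[OF v] by blast
    have Z: "w \<bullet> v = - 1" "w \<bullet> p = 0" if "w \<in> Z" for w using that by (simp_all add: Z_def tight_def)
    have vE: "v \<in> ?E" using vertex_P[OF v] Z by simp
    have eE: "v + e *\<^sub>R p \<in> ?E" using e Z by (simp add: inner_add_right)
    have "?E \<subseteq> affine hull {v, v + e *\<^sub>R p}"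
    proof
      fix x assume x: "x \<in> ?E"
      have "\<forall>w\<in>Z. w \<bullet> (x - v) = 0" using x Z by (simp add: inner_diff_right)
      then have eq: "x - v = (h \<bullet> (x - v)) *\<^sub>R p" by (rule line)
      define s where "s = h \<bullet> (x - v) / e"
      have "x - v = (s * e) *\<^sub>R p" using e(1) by (subst eq) (simp add: s_def)
      then have x_eq: "x = (1 - s) *\<^sub>R v + s *\<^sub>R (v + e *\<^sub>R p)" by (simp add: algebra_simps)
      show "x \<in> affine hull {v, v + e *\<^sub>R p}"
        unfolding x_eq by (intro mem_affine affine_affine_hull hull_inc) auto
    qed
    from aff_dim_subset[OF this] have "aff_dim ?E \<le> aff_dim {v, v + e *\<^sub>R p}" unfolding aff_dim_affine_hull .
    moreover have "aff_dim {v, v + e *\<^sub>R p} \<le> aff_dim ?E" by (rule aff_dim_subset) (use vE eE in auto)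
    ultimately have "aff_dim ?E = 1" using p0 e(1) by (simp add: aff_dim_2)
    then have "?E edge_of P" using face by (simp add: edge_of_def)
    then obtain k where k: "?E = closed_segment v (v + t k *\<^sub>R u k)" using edges vE by blast
    have "v + e *\<^sub>R p \<in> closed_segment v (v + t k *\<^sub>R u k)" using eE unfolding k .
    then obtain s where s: "0 \<le> s" "v + e *\<^sub>R p = (1 - s) *\<^sub>R v + s *\<^sub>R (v + t k *\<^sub>R u k)"
      unfolding in_segment by blast
    have "e *\<^sub>R p = (s * t k) *\<^sub>R u k" using s(2) by (simp add: algebra_simps)
    then have "d i \<bullet> (e *\<^sub>R p) = d i \<bullet> ((s * t k) *\<^sub>R u k)" by simp
    then have "e * (d i \<bullet> p) = (s * t k) * (d i \<bullet> u k)" by simp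
    also have "0 \<le> \<dots>" using s(1) u(2) by (simp add: d less_imp_le)
    finally show ?thesis using e(1) by (simp add: zero_le_mult_iff)
  qed
  have "B \<subseteq> {y. d i \<bullet> y \<ge> 0}"
    by (subst hull) (intro hull_minimal convex_halfspace_ge, auto intro: ext)
  moreover have "0 \<le> h \<bullet> y" unfolding hz using y by (intro sum_nonneg) auto
  moreover have "y = 0" if "h \<bullet> y = 0"
    using that y fin unfolding hz by (intro tight_separates[OF v]) (simp add: sum_nonneg_eq_0_iff)
  moreover have "(1 / (h \<bullet> y)) *\<^sub>R y \<in> B" if "0 < h \<bullet> y"
    using that y by (simp add: B_def)
  ultimately show ?thesis
  proof (cases "h \<bullet> y = 0")
    case False
    with \<open>0 \<le> h \<bullet> y\<close> have pos: "0 < h \<bullet> y" by simp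
    then have "0 \<le> d i \<bullet> ((1 / (h \<bullet> y)) *\<^sub>R y)"
      using \<open>B \<subseteq> _\<close> \<open>0 < h \<bullet> y \<Longrightarrow> _\<close> by blast
    then show ?thesis using pos by (simp add: zero_le_divide_iff)
  qed simp
qed

text \<open>The dual basis of the edge basis is exactly the set of tight normals. Scaled to pair to
  -1 with \<open>v\<close>, the vector \<open>d i\<close> lies in the dual polytope and is a convex
  combination of tight normals. Those in its support are multiples of \<open>d i\<close>, with an
  integer factor because they are lattice vectors, and the factor is 1 because they pair to -1 with
  a lattice point. Conversely, a tight normal has nonnegative integer coefficients with sum
  1.\<close>

lemma vertex_basis:
  assumes v: "v \<in> vertices"
  shows "\<exists>u d :: 'n \<Rightarrow> real^'n. (\<forall>i. u i \<in> int_lattice) \<and> (\<forall>i. d i \<in> int_lattice) \<and>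
    (\<forall>i j. d i \<bullet> u j = (if i = j then 1 else 0)) \<and>
    (\<forall>x. x = (\<Sum>i\<in>UNIV. (d i \<bullet> x) *\<^sub>R u i)) \<and> (\<forall>x. x = (\<Sum>i\<in>UNIV. (x \<bullet> u i) *\<^sub>R d i)) \<and>
    tight v = range d \<and> (\<forall>i. \<exists>t>0. v + t *\<^sub>R u i \<in> vertices)"
proof -
  obtain u t where u: "lattice_basis u" "\<forall>i. t i > 0"
    and edges: "{E. E edge_of P \<and> v \<in> E} = range (\<lambda>i. closed_segment v (v + t i *\<^sub>R u i))"
    using delzant v unfolding delzant_def vertices_def by blast
  obtain d where d': "\<forall>i. d i \<in> int_lattice" "\<forall>i j. d i \<bullet> u j = (if i = j then 1 else 0)"
    "\<forall>x. x = (\<Sum>i\<in>UNIV. (d i \<bullet> x) *\<^sub>R u i)" "\<forall>x. x = (\<Sum>i\<in>UNIV. (x \<bullet> u i) *\<^sub>R d i)"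
    using lattice_basis_dual[OF u(1)] by (elim exE conjE) (rule that; assumption)
  note d = d'[rule_format]
  have ui: "u i \<in> int_lattice" for i using u(1) by (auto simp: lattice_basis_def)
  have cone: "0 \<le> d i \<bullet> (x - v)" if "x \<in> P" for x i
    using that by (intro vertex_cone[OF v u edges d(2)]) (auto simp: tight_def inner_diff_right dest: P_ge)
  have edge: "v + t i *\<^sub>R u i \<in> vertices" for i
  proof -
    have "closed_segment v (v + t i *\<^sub>R u i) edge_of P" using edges by blast
    then have "closed_segment v (v + t i *\<^sub>R u i) face_of P" by (simp add: edge_of_def)
    then show ?thesis unfolding vertices_def mem_Collect_eq
      by (rule extreme_point_of_face[THEN iffD1, THEN conjunct1]) (simp add: extreme_point_of_segment)
  qed
  have nonneg: "0 \<le> w \<bullet> u i" if "w \<in> tight v" for w i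
  proof -
    have "- 1 \<le> w \<bullet> (v + t i *\<^sub>R u i)"
      using that vertex_P[OF edge] by (intro P_ge) (auto simp: tight_def)
    then have "0 \<le> t i * (w \<bullet> u i)" using that by (simp add: tight_def inner_add_right)
    then show ?thesis using u(2) by (simp add: zero_le_mult_iff) (metis less_le_not_le)
  qed
  have d_tight: "d i \<in> normals \<and> d i \<bullet> v = - 1" for i
  proof -
    have d0: "d i \<noteq> 0" using d(2)[of i i] by auto
    \<comment> \<open>As 0 is an interior point, a short negative multiple of \<open>d i\<close>
      belongs to \<open>P\<close>; the cone inequality for it shows that \<open>d i\<close> is
      negative at \<open>v\<close>.\<close>
    obtain e where e: "e > 0" "cball 0 e \<subseteq> P" using zero_interior mem_interior_cball by blast
    have "(- (e / norm (d i))) *\<^sub>R d i \<in> P" using e d0 by (intro subsetD[OF e(2)]) simp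
    then have "0 \<le> d i \<bullet> ((- (e / norm (d i))) *\<^sub>R d i - v)" by (rule cone)
    moreover have "0 < e / norm (d i) * (d i \<bullet> d i)" using e(1) d0 by simp
    ultimately have neg: "d i \<bullet> v < 0" by (simp add: inner_diff_right)
    define b where "b = - (d i \<bullet> v)"
    define y where "y = (1 / b) *\<^sub>R d i"
    have b: "0 < b" using neg by (simp add: b_def)
    have yv: "y \<bullet> v = - 1" using b by (simp add: y_def b_def)
    have "y \<in> dual_polytope P"
      unfolding dual_polytope_def
    proof (simp, intro ballI)
      fix x assume "x \<in> P"
      then have "- b \<le> d i \<bullet> x" using cone[of x i] by (simp add: b_def inner_diff_right)
      moreover have "x \<bullet> y = (d i \<bullet> x) / b" by (simp add: y_def inner_commute)
      ultimately show "- 1 \<le> x \<bullet> y" using b by (simp add: le_divide_eq)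
    qed
    then obtain c where c: "\<forall>w\<in>normals. 0 \<le> c w" "sum c normals = 1" "(\<Sum>w\<in>normals. c w *\<^sub>R w) = y"
      unfolding dual_eq convex_hull_finite[OF polytope_Q(3)] by blast
    \<comment> \<open>All normals are at least -1 at \<open>v\<close> and their combination
      \<open>y\<close> equals -1 there, so only tight normals have positive weight.\<close>
    have "(\<Sum>w\<in>normals. c w * (w \<bullet> v + 1)) = 0"
      using c yv by (simp add: distrib_left sum.distrib flip: c(3)) (simp add: inner_sum_left)
    moreover have "0 \<le> c w * (w \<bullet> v + 1)" if "w \<in> normals" for w
      using c(1) that P_ge[OF vertex_P[OF v] that] by simp
    ultimately have zero: "c w * (w \<bullet> v + 1) = 0" if "w \<in> normals" for w
      using that polytope_Q(3) by (simp add: sum_nonneg_eq_0_iff)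
    obtain w where w: "w \<in> normals" "c w \<noteq> 0"
      using c(2) by (metis sum.neutral zero_neq_one)
    have wt: "w' \<in> tight v" if "w' \<in> normals" "c w' \<noteq> 0" for w'
      using zero[OF that(1)] that by (simp add: tight_def)
    have "w \<bullet> u j = 0" if j: "j \<noteq> i" for j
    proof -
      have "(\<Sum>w\<in>normals. c w * (w \<bullet> u j)) = y \<bullet> u j" by (simp add: inner_sum_left flip: c(3))
      also have "\<dots> = 0" using j by (simp add: y_def d(2))
      finally have "(\<Sum>w\<in>normals. c w * (w \<bullet> u j)) = 0" .
      moreover have "0 \<le> c w' * (w' \<bullet> u j)" if "w' \<in> normals" for w'
        using nonneg[OF wt[OF that]] c(1) that by (cases "c w' = 0") auto
      ultimately have "c w * (w \<bullet> u j) = 0"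
        using w(1) polytope_Q(3) by (simp add: sum_nonneg_eq_0_iff)
      then show ?thesis using w(2) by simp
    qed
    then have "w = (w \<bullet> u i) *\<^sub>R d i"
      by (subst d(4)[of w]) (simp add: sum.remove[of UNIV i])
    moreover obtain k where k: "w \<bullet> u i = of_int k" using int_lattice_inner[OF normal_int[OF w(1)] ui] Ints_cases by metis
    moreover obtain m where m: "d i \<bullet> v = of_int m" using int_lattice_inner[OF d(1) vertex_int[OF v]] Ints_cases by metis
    ultimately have wk: "w = of_int k *\<^sub>R d i" by simp
    have "w \<bullet> v = - 1" using wt[OF w] by (simp add: tight_def)
    then have "of_int (k * m) = (- 1 :: real)" unfolding wk by (simp add: m)
    then have "k * m = - 1" by (metis of_int_eq_iff of_int_minus of_int_1)
    moreover have "0 \<le> k" using nonneg[OF wt[OF w], of i] k by simp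
    ultimately have "k = 1" by (metis abs_of_nonneg abs_minus_cancel abs_one zmult_eq_neg1_iff less_le_not_le zero_le_one neg_0_le_iff_le one_neq_zero order_antisym)
    then have "w = d i" using wk by simp
    then show ?thesis using w(1) \<open>w \<bullet> v = - 1\<close> by simp
  qed
  have "tight v \<subseteq> range d"
  proof
    fix w assume w: "w \<in> tight v"
    have "\<exists>k::int. w \<bullet> u i = of_int k" for i
      using int_lattice_inner[OF normal_int ui] w Ints_cases by (metis (no_types, lifting) mem_Collect_eq tight_def)
    then obtain k :: "'n \<Rightarrow> int" where k: "\<And>i. w \<bullet> u i = of_int (k i)" by metis
    have k0: "0 \<le> k i" for i using nonneg[OF w, of i] k by simp
    have w_eq: "w = (\<Sum>i\<in>UNIV. of_int (k i) *\<^sub>R d i)" using d(4)[of w] k by simp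
    have "w \<bullet> v = - 1" using w by (simp add: tight_def)
    then have "of_int (\<Sum>i\<in>UNIV. k i) = (1::real)"
      by (subst (asm) w_eq) (simp add: inner_sum_left d_tight sum_negf)
    then have one: "(\<Sum>i\<in>UNIV. k i) = 1" by (metis of_int_eq_1_iff)
    then obtain i where i: "k i \<noteq> 0" by (metis sum.neutral zero_neq_one)
    have "k i + (\<Sum>j\<in>UNIV - {i}. k j) = 1" using one by (simp add: sum.remove[of UNIV i])
    moreover have "0 \<le> (\<Sum>j\<in>UNIV - {i}. k j)" using k0 by (intro sum_nonneg) auto
    ultimately have ki: "k i = 1" "(\<Sum>j\<in>UNIV - {i}. k j) = 0" using k0[of i] i by linarith+
    then have "k j = 0" if "j \<noteq> i" for j
      using that k0 by (simp add: sum_nonneg_eq_0_iff)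
    then have "w = d i" by (subst w_eq) (simp add: sum.remove[of UNIV i] ki(1))
    then show "w \<in> range d" by simp
  qed
  moreover have "range d \<subseteq> tight v" using d_tight by (auto simp: tight_def)
  ultimately have "tight v = range d" by blast
  moreover have "\<exists>t>0. v + t *\<^sub>R u i \<in> vertices" for i using edge u(2) by blast
  ultimately show ?thesis using ui d by (intro exI[of _ u] exI[of _ d] conjI allI)
qed

text \<open>The direction of the edge at \<open>v\<close> along which \<open>w\<close> is released
  while the other tight normals stay tight.\<close>

definition dir :: "real^'n \<Rightarrow> real^'n \<Rightarrow> real^'n" where
  "dir v w = (SOME u. \<forall>y\<in>tight v. y \<bullet> u = (if y = w then 1 else 0))"

lemma dir_eqI:
  assumes "v \<in> vertices" "\<And>y. y \<in> tight v \<Longrightarrow> y \<bullet> u = (if y = w then 1 else 0)"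
  shows "dir v w = u"
proof -
  have "\<forall>y\<in>tight v. y \<bullet> dir v w = (if y = w then 1 else 0)"
    unfolding dir_def by (rule someI[of _ u]) (simp add: assms(2))
  then have "\<forall>y\<in>tight v. y \<bullet> (dir v w - u) = 0" by (simp add: inner_diff_right assms(2))
  then show ?thesis using tight_separates[OF assms(1)] by force
qed

lemma vertex_dirs:
  assumes v: "v \<in> vertices"
  shows "\<exists>d :: 'n \<Rightarrow> real^'n. bij_betw d UNIV (tight v) \<and> (\<forall>i. dir v (d i) \<in> int_lattice) \<and>
    (\<forall>i j. d i \<bullet> dir v (d j) = (if i = j then 1 else 0)) \<and>
    (\<forall>x. x = (\<Sum>i\<in>UNIV. (d i \<bullet> x) *\<^sub>R dir v (d i))) \<and> (\<forall>x. x = (\<Sum>i\<in>UNIV. (x \<bullet> dir v (d i)) *\<^sub>R d i)) \<and>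
    (\<forall>i. \<exists>t>0. v + t *\<^sub>R dir v (d i) \<in> vertices)"
proof -
  obtain u d :: "'n \<Rightarrow> real^'n" where u': "\<forall>i. u i \<in> int_lattice" "\<forall>i. d i \<in> int_lattice"
    "\<forall>i j. d i \<bullet> u j = (if i = j then 1 else 0)"
    "\<forall>x. x = (\<Sum>i\<in>UNIV. (d i \<bullet> x) *\<^sub>R u i)" "\<forall>x. x = (\<Sum>i\<in>UNIV. (x \<bullet> u i) *\<^sub>R d i)"
    "tight v = range d" "\<forall>i. \<exists>t>0. v + t *\<^sub>R u i \<in> vertices"
    using vertex_basis[OF v] by (elim exE conjE) (rule that; assumption)
  note u = u'[rule_format]
  have inj: "inj d" by (rule injI) (metis u(3) zero_neq_one)
  have eq: "dir v (d i) = u i" for i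
    using inj by (intro dir_eqI v) (auto simp: u(3,6) inj_eq)
  show ?thesis
    unfolding bij_betw_def u(6) using inj by (intro exI[of _ d]) (simp only: eq u'(1,3,4,5,7) simp_thms)
qed

lemma card_tight:
  assumes "v \<in> vertices"
  shows "card (tight v) = CARD('n)"
proof -
  obtain d :: "'n \<Rightarrow> real^'n" where "bij_betw d UNIV (tight v)" using vertex_dirs[OF assms] by blast
  from bij_betw_same_card[OF this] show ?thesis by simp
qed

lemma tight_int: "w \<in> tight v \<Longrightarrow> w \<in> int_lattice" "w \<in> tight v \<Longrightarrow> w \<in> normals" "w \<in> tight v \<Longrightarrow> w \<bullet> v = - 1"
  by (auto simp: tight_def normal_int)

lemma dir_props:
  assumes v: "v \<in> vertices" "w \<in> tight v"
  shows "dir v w \<in> int_lattice" "y \<in> tight v \<Longrightarrow> y \<bullet> dir v w = (if y = w then 1 else 0)"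
    "\<exists>t>0. v + t *\<^sub>R dir v w \<in> vertices"
    "\<And>x. (\<forall>y\<in>tight v - {w}. y \<bullet> x = 0) \<Longrightarrow> x = (w \<bullet> x) *\<^sub>R dir v w"
proof -
  obtain d :: "'n \<Rightarrow> real^'n" where d': "bij_betw d UNIV (tight v)" "\<forall>i. dir v (d i) \<in> int_lattice"
    "\<forall>i j. d i \<bullet> dir v (d j) = (if i = j then 1 else 0)" "\<forall>i. \<exists>t>0. v + t *\<^sub>R dir v (d i) \<in> vertices"
    using vertex_dirs[OF v(1)] by (elim exE conjE) (rule that; assumption)
  note d = d'[rule_format]
  obtain j where j: "w = d j" using d(1) v(2) by (auto simp: bij_betw_def)
  show "dir v w \<in> int_lattice" "\<exists>t>0. v + t *\<^sub>R dir v w \<in> vertices" using d j by auto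
  show dual: "y \<bullet> dir v w = (if y = w then 1 else 0)" if "y \<in> tight v" for y
  proof -
    obtain i where "y = d i" using d(1) \<open>y \<in> tight v\<close> by (auto simp: bij_betw_def)
    then show ?thesis using d(1,3) j by (simp add: bij_betw_def inj_eq)
  qed
  fix x assume "\<forall>y\<in>tight v - {w}. y \<bullet> x = 0"
  then have "\<forall>y\<in>tight v. y \<bullet> (x - (w \<bullet> x) *\<^sub>R dir v w) = 0" by (auto simp: inner_diff_right dual)
  then show "x = (w \<bullet> x) *\<^sub>R dir v w" using tight_separates[OF v(1)] by force
qed

text \<open>The edge directions form an integer inverse of the matrix of tight normals.\<close>

lemma tight_unimodular:
  assumes v: "v \<in> vertices" and f: "bij_betw f UNIV (tight v)"
  shows "\<bar>det (\<chi> i. f i :: real^'n^'n)\<bar> = 1"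
proof -
  have fT: "f i \<in> tight v" for i using f by (auto simp: bij_betw_def)
  show ?thesis
  proof (rule det_int_inverse)
    show "(\<chi> i. f i) ** (\<chi> k i. dir v (f i) $ k) = mat 1"
    proof (simp only: vec_eq_iff matrix_matrix_mult_def mat_def vec_lambda_beta, intro allI)
      fix i j
      have "(\<Sum>k\<in>UNIV. f i $ k * dir v (f j) $ k) = f i \<bullet> dir v (f j)" by (simp add: inner_vec_def)
      also have "\<dots> = (if i = j then 1 else 0)"
        using dir_props(2)[OF v fT fT] f by (simp add: bij_betw_def inj_eq)
      finally show "(\<Sum>k\<in>UNIV. f i $ k * dir v (f j) $ k) = (if i = j then 1 else 0)" .
    qed
  next
    show "(\<chi> i. f i) $ i $ j \<in> \<int>" for i j using tight_int(1)[OF fT] by (simp add: int_lattice_def)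
    show "(\<chi> k i. dir v (f i) $ k) $ i $ j \<in> \<int>" for i j using dir_props(1)[OF v fT] by (simp add: int_lattice_def)
  qed
qed

text \<open>Pairings of normals with vertices are integers, so a value above -1 is at least
  0.\<close>

lemma beyond:
  assumes "v \<in> vertices" "w \<in> normals" "w \<notin> tight v"
  shows "0 \<le> w \<bullet> v"
proof -
  obtain k where k: "w \<bullet> v = of_int k"
    using int_lattice_inner[OF normal_int[OF assms(2)] vertex_int[OF assms(1)]] Ints_cases by metis
  then have "- 1 \<le> k" "k \<noteq> - 1" using P_ge[OF vertex_P[OF assms(1)] assms(2)] assms(2,3) by (auto simp: tight_def)
  then show ?thesis using k by simp
qed

lemma line_vertex:
  assumes "v \<in> vertices" "v + s *\<^sub>R u \<in> vertices" "0 < s" "v + t *\<^sub>R u \<in> P" "u \<noteq> 0"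
  shows "t \<le> s"
proof (rule ccontr)
  assume "\<not> t \<le> s"
  then have "u = 0"
    using assms vertex_P[OF assms(1)] by (intro extreme_point_no_step[of "v + s *\<^sub>R u" P "t - s" u s])
      (auto simp: vertices_def algebra_simps)
  then show False using assms(5) by simp
qed

end

context fano begin

section \<open>Neighbouring vertices and connectedness\<close>

lemma normals_bounded: "bounded {x. \<forall>w\<in>normals. - 1 \<le> w \<bullet> x}"
  using compact_imp_bounded[OF polytope_P(1)] P_eq by simp

text \<open>At the far end of the edge one normal is exchanged for \<open>x\<close>. The direction
  dual to \<open>x\<close> there is an integer multiple of the old direction, and the factor times
  the pairing of \<open>x\<close> with the old direction is 1. This pairing is negative because
  \<open>x\<close> falls from at least 0 to -1 along the edge, so both integers are -1.\<close>

lemma neighbor: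
  assumes v: "v \<in> vertices" and w: "w \<in> tight v"
  shows "\<exists>x\<in>normals. x \<notin> tight v \<and> x \<bullet> dir v w = - 1 \<and> v + (x \<bullet> v + 1) *\<^sub>R dir v w \<in> vertices \<and>
    tight (v + (x \<bullet> v + 1) *\<^sub>R dir v w) = insert x (tight v - {w}) \<and>
    dir (v + (x \<bullet> v + 1) *\<^sub>R dir v w) x = - dir v w \<and>
    (\<forall>y\<in>tight v - {w}. dir (v + (x \<bullet> v + 1) *\<^sub>R dir v w) y = dir v y + (x \<bullet> dir v y) *\<^sub>R dir v w)"
proof -
  let ?u = "dir v w"
  obtain t where t: "t > 0" "v + t *\<^sub>R ?u \<in> vertices" using dir_props(3)[OF v w] by blast
  let ?v = "v + t *\<^sub>R ?u"
  have sub: "tight v - {w} \<subseteq> tight ?v"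
    using dir_props(2)[OF v w] by (auto simp: tight_def inner_add_right)
  have w_out: "w \<notin> tight ?v"
    using dir_props(2)[OF v w w] w t by (auto simp: tight_def inner_add_right)
  have fin: "finite (tight y)" for y using polytope_Q(3) by (simp add: tight_def)
  have "card (tight v - {w}) < card (tight ?v)"
    using card_tight[OF v] card_tight[OF t(2)] w fin by (simp add: card_Diff_singleton)
  then obtain x where x: "x \<in> tight ?v" "x \<notin> tight v - {w}"
    by (metis card_mono fin finite_Diff not_less subsetI)
  have tight': "tight ?v = insert x (tight v - {w})"
  proof (rule card_subset_eq[symmetric])
    show "insert x (tight v - {w}) \<subseteq> tight ?v" using x sub by auto
    show "card (insert x (tight v - {w})) = card (tight ?v)"
      using card_tight[OF v] card_tight[OF t(2)] w fin x by (simp add: card_Diff_singleton)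
  qed (rule fin)
  have xv: "x \<notin> tight v" using x w_out by auto
  have xn: "x \<in> normals" using x(1) by (rule tight_int(2))
  let ?u' = "dir ?v x"
  have u': "?u' = (w \<bullet> ?u') *\<^sub>R ?u"
  proof (rule dir_props(4)[OF v w], intro ballI)
    fix y assume "y \<in> tight v - {w}"
    then show "y \<bullet> ?u' = 0" using dir_props(2)[OF t(2) x(1)] sub x(2) by auto
  qed
  obtain a b where ab: "w \<bullet> ?u' = of_int a" "x \<bullet> ?u = of_int b"
    using int_lattice_inner dir_props(1)[OF v w] dir_props(1)[OF t(2) x(1)] tight_int(1)[OF w] normal_int[OF xn] Ints_cases
    by metis
  have "x \<bullet> ?u' = 1" using dir_props(2)[OF t(2) x(1) x(1)] by simp
  then have "of_int (a * b) = (1::real)" using arg_cong[OF u', of "\<lambda>z. x \<bullet> z"] by (simp add: ab)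
  then have "a * b = 1" by (metis of_int_eq_1_iff)
  moreover have "x \<bullet> v + t * (x \<bullet> ?u) = - 1" using tight_int(3)[OF x(1)] by (simp add: inner_add_right)
  then have "t * of_int b < 0" using beyond[OF v xn xv] by (simp add: ab)
  then have "b < 0" using t(1) by (simp add: mult_less_0_iff)
  ultimately have "b = - 1" "a = - 1" by (auto simp: zmult_eq_1_iff)
  then have xu: "x \<bullet> ?u = - 1" "?u' = - ?u" using ab u' by auto
  then have t_eq: "t = x \<bullet> v + 1" using \<open>x \<bullet> v + t * (x \<bullet> ?u) = - 1\<close> by simp
  have "dir ?v y = dir v y + (x \<bullet> dir v y) *\<^sub>R ?u" if y: "y \<in> tight v - {w}" for y
  proof (rule dir_eqI[OF t(2)])
    fix z assume z: "z \<in> tight ?v"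
    show "z \<bullet> (dir v y + (x \<bullet> dir v y) *\<^sub>R ?u) = (if z = y then 1 else 0)"
    proof (cases "z = x")
      case True
      then show ?thesis using xu y xv by (auto simp: inner_add_right)
    next
      case False
      then have "z \<in> tight v" "z \<noteq> w" using z unfolding tight' by auto
      then show ?thesis using dir_props(2)[OF v w] dir_props(2)[OF v, of y] y by (simp add: inner_add_right)
    qed
  qed
  then show ?thesis using xn xv xu t(2) tight' unfolding t_eq by blast
qed

lemma edge_line:
  assumes v: "v \<in> vertices" "w \<in> tight v" and v': "v' \<in> vertices" "v' \<noteq> v" "tight v - {w} \<subseteq> tight v'"
  shows "\<exists>s>0. v' = v + s *\<^sub>R dir v w"
proof -
  have "v' - v = (w \<bullet> (v' - v)) *\<^sub>R dir v w"
    using v'(3) by (intro dir_props(4) v) (auto simp: inner_diff_right tight_def)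
  then have eq: "v' = v + (w \<bullet> (v' - v)) *\<^sub>R dir v w" by (simp add: algebra_simps)
  have "w \<bullet> (v' - v) \<ge> 0"
    using P_ge[OF vertex_P[OF v'(1)] tight_int(2)[OF v(2)]] tight_int(3)[OF v(2)] by (simp add: inner_diff_right)
  moreover have "w \<bullet> (v' - v) \<noteq> 0" using eq v'(2) by auto
  ultimately show ?thesis using eq by (intro exI[of _ "w \<bullet> (v' - v)"]) simp
qed

lemma edge_unique:
  assumes v: "v \<in> vertices" "w \<in> tight v"
    and v1: "v1 \<in> vertices" "v1 \<noteq> v" "tight v - {w} \<subseteq> tight v1"
    and v2: "v2 \<in> vertices" "v2 \<noteq> v" "tight v - {w} \<subseteq> tight v2"
  shows "v1 = v2"
proof -
  obtain s t where s: "s > 0" "v1 = v + s *\<^sub>R dir v w" "t > 0" "v2 = v + t *\<^sub>R dir v w"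
    using edge_line[OF v v1] edge_line[OF v v2] by blast
  have "dir v w \<noteq> 0" using dir_props(2)[OF v v(2)] by auto
  then have "s \<le> t" "t \<le> s" using line_vertex[OF v(1)] s v1(1) v2(1) vertex_P by metis+
  then show ?thesis using s by simp
qed

text \<open>The argument of the simplex method: for a missing vertex \<open>p\<close>, the sum of
  the normals tight at \<open>p\<close> is minimized at \<open>p\<close> alone. At its minimizer
  over \<open>S\<close> some edge direction decreases it, and the member of \<open>S\<close> on that
  edge contradicts minimality.\<close>

lemma vertices_connected:
  assumes S: "S \<subseteq> vertices" "S \<noteq> {}"
    and step: "\<And>v w. v \<in> S \<Longrightarrow> w \<in> tight v \<Longrightarrow> \<exists>v'\<in>S. v' \<noteq> v \<and> tight v - {w} \<subseteq> tight v'"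
  shows "S = vertices"
proof (rule ccontr)
  assume "S \<noteq> vertices"
  then obtain p where p: "p \<in> vertices" "p \<notin> S" using S(1) by blast
  define c where "c = (\<Sum>w\<in>tight p. w)"
  have finp: "finite (tight p)" using polytope_Q(3) by (simp add: tight_def)
  have c: "c \<bullet> p < c \<bullet> v" if "v \<in> vertices" "v \<noteq> p" for v
  proof -
    have ge: "\<forall>w\<in>tight p. 0 \<le> w \<bullet> (v - p)"
    proof
      fix w assume w: "w \<in> tight p"
      then have "- 1 \<le> w \<bullet> v" by (intro P_ge[OF vertex_P[OF that(1)]] tight_int(2))
      then show "0 \<le> w \<bullet> (v - p)" using tight_int(3)[OF w] by (simp add: inner_diff_right)
    qed
    have "\<not> (\<forall>w\<in>tight p. w \<bullet> (v - p) = 0)" using tight_separates[OF p(1), of "v - p"] that(2) by auto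
    then have "0 < (\<Sum>w\<in>tight p. w \<bullet> (v - p))"
      using ge finp by (metis (no_types, lifting) order_le_less sum_nonneg sum_nonneg_eq_0_iff)
    then show ?thesis by (simp add: c_def inner_sum_left inner_diff_right sum_subtractf)
  qed
  have finS: "finite S" using S(1) polytope_P(3) finite_subset by blast
  obtain v where v: "v \<in> S" "\<And>v'. v' \<in> S \<Longrightarrow> c \<bullet> v \<le> c \<bullet> v'"
    using ex_min_if_finite[of "(\<lambda>v. c \<bullet> v) ` S"] finS S(2) by (force simp: not_less)
  have vv: "v \<in> vertices" "v \<noteq> p" using v(1) S(1) p(2) by auto
  obtain d :: "'n \<Rightarrow> real^'n" where d: "bij_betw d UNIV (tight v)"
    "\<forall>x. x = (\<Sum>i\<in>UNIV. (d i \<bullet> x) *\<^sub>R dir v (d i))"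
    using vertex_dirs[OF vv(1)] by (elim exE conjE) (rule that; assumption)
  have "c \<bullet> (p - v) = (\<Sum>i\<in>UNIV. (d i \<bullet> (p - v)) * (c \<bullet> dir v (d i)))"
    by (subst d(2)[rule_format, of "p - v"]) (simp add: inner_sum_right)
  moreover have "c \<bullet> (p - v) < 0" using c[OF vv] by (simp add: inner_diff_right)
  ultimately obtain i where i: "(d i \<bullet> (p - v)) * (c \<bullet> dir v (d i)) < 0"
    by (metis (no_types, lifting) not_less sum_nonneg)
  have dT: "d i \<in> tight v" using d(1) by (auto simp: bij_betw_def)
  have "0 \<le> d i \<bullet> (p - v)"
    using P_ge[OF vertex_P[OF p(1)] tight_int(2)[OF dT]] tight_int(3)[OF dT] by (simp add: inner_diff_right)
  then have neg: "c \<bullet> dir v (d i) < 0" using i by (simp add: mult_less_0_iff)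
  obtain v' where v': "v' \<in> S" "v' \<noteq> v" "tight v - {d i} \<subseteq> tight v'" using step[OF v(1) dT] by blast
  obtain s where "s > 0" "v' = v + s *\<^sub>R dir v (d i)" using edge_line[OF vv(1) dT] v' S(1) by blast
  then have "c \<bullet> v' < c \<bullet> v" using neg by (simp add: inner_add_right mult_pos_neg)
  then show False using v(2)[OF v'(1)] by simp
qed

text \<open>As \<open>P\<close> is bounded, the dual polytope contains a segment with midpoint
  0.\<close>

lemma zero_not_normal: "0 \<notin> normals"
proof
  assume "0 \<in> normals"
  then have ext: "0 extreme_point_of dual_polytope P" by (simp add: normals_def)
  obtain B where B: "B > 0" "\<And>x. x \<in> P \<Longrightarrow> norm x \<le> B"
    using compact_imp_bounded[OF polytope_P(1)] unfolding bounded_pos by blast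
  define y :: "real^'n" where "y = (1 / B) *\<^sub>R axis undefined 1"
  have "\<bar>x \<bullet> y\<bar> \<le> 1" if "x \<in> P" for x
  proof -
    have "\<bar>x \<bullet> y\<bar> \<le> norm x * norm y" by (rule Cauchy_Schwarz_ineq2)
    also have "\<dots> \<le> 1" using B(2)[OF that] B(1) by (simp add: y_def)
    finally show ?thesis .
  qed
  then have "0 + 1 *\<^sub>R y \<in> dual_polytope P" "0 - 1 *\<^sub>R y \<in> dual_polytope P"
    unfolding dual_polytope_def by (auto simp: abs_le_iff)
  from extreme_point_no_step[OF ext this] have "y = 0" by simp
  then show False using B(1) by (auto simp: y_def)
qed

lemma vertices_nonempty: "vertices \<noteq> {}"
  using polytope_P(5) zero_interior interior_subset by fastforce

lemma special_vertex: "\<exists>v\<in>vertices. \<forall>w\<in>tight v. 0 \<le> (\<Sum>x\<in>normals. x \<bullet> dir v w)"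
proof -
  define s where "s = (\<Sum>x\<in>normals. x)"
  obtain v where v: "v \<in> vertices" "\<And>v'. v' \<in> vertices \<Longrightarrow> s \<bullet> v \<le> s \<bullet> v'"
    using ex_min_if_finite[of "(\<lambda>v. s \<bullet> v) ` vertices"] polytope_P(3) vertices_nonempty by (force simp: not_less)
  have "0 \<le> s \<bullet> dir v w" if w: "w \<in> tight v" for w
  proof -
    obtain t where "t > 0" "v + t *\<^sub>R dir v w \<in> vertices" using dir_props(3)[OF v(1) w] by blast
    then have "0 \<le> t * (s \<bullet> dir v w)" using v(2) by (force simp: inner_add_right)
    then show ?thesis using \<open>t > 0\<close> by (simp add: zero_le_mult_iff)
  qed
  then show ?thesis using v(1) unfolding s_def inner_sum_left by blast
qed

lemma simple: "simple_polytope normals vertices"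
proof
  show "finite normals" by (rule polytope_Q(3))
  show "bounded {x. \<forall>w\<in>normals. - 1 \<le> w \<bullet> x}" by (rule normals_bounded)
  show "- 1 \<le> w \<bullet> v" if "v \<in> vertices" "w \<in> normals" for v w using that vertex_P P_ge by blast
  show "\<exists>v\<in>vertices. \<forall>w\<in>S. w \<bullet> v = - 1" if "S \<subseteq> normals" "\<forall>w\<in>normals. - 1 \<le> w \<bullet> x" "\<forall>w\<in>S. w \<bullet> x = - 1" for S x
    using face_has_vertex[OF that(1) _ that(3)] that(2) P_eq by blast
  show "card {w\<in>normals. w \<bullet> v = - 1} = CARD('n)" if "v \<in> vertices" for v
    using card_tight[OF that] by (simp add: tight_def)
  show "\<bar>det (\<chi> i. f i :: real^'n^'n)\<bar> = 1" if "v \<in> vertices" "bij_betw f UNIV {w\<in>normals. w \<bullet> v = - 1}" for v f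
    using tight_unimodular that by (simp add: tight_def)
  show "\<exists>v'\<in>vertices. w \<bullet> v' \<noteq> - 1 \<and> (\<forall>w'\<in>normals - {w}. w' \<bullet> v = - 1 \<longrightarrow> w' \<bullet> v' = - 1)"
    if v: "v \<in> vertices" "w \<in> normals" "w \<bullet> v = - 1" for v w
  proof -
    have w: "w \<in> tight v" using v by (simp add: tight_def)
    obtain x where x: "x \<notin> tight v" "v + (x \<bullet> v + 1) *\<^sub>R dir v w \<in> vertices"
      "tight (v + (x \<bullet> v + 1) *\<^sub>R dir v w) = insert x (tight v - {w})"
      using neighbor[OF v(1) w] by blast
    have "w \<notin> tight (v + (x \<bullet> v + 1) *\<^sub>R dir v w)" using x w by auto
    moreover have "\<forall>w'\<in>normals - {w}. w' \<bullet> v = - 1 \<longrightarrow> w' \<in> tight (v + (x \<bullet> v + 1) *\<^sub>R dir v w)"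
      unfolding x(3) by (simp add: tight_def)
    ultimately show ?thesis using x(2) v(2) by (intro bexI[OF _ x(2)]) (auto simp: tight_def)
  qed
qed

end

lemma sorted_enum:
  fixes f :: "'a \<Rightarrow> int list"
  assumes "finite S"
  obtains xs where "distinct xs" "set xs = S" "sorted (map f xs)"
proof -
  obtain ys where ys: "distinct ys" "set ys = S" using finite_distinct_list[OF assms] by blast
  show ?thesis by (rule that[of "sort_key f ys"]) (use ys in \<open>auto simp: distinct_sort\<close>)
qed

lemma weight_map: "weight (map f [0..<n]) = (\<Sum>k<n. (10 + f k) * (f k * f k))"
proof -
  have "weight (map f xs) = (\<Sum>k\<leftarrow>xs. (10 + f k) * (f k * f k))" for xs
    by (induction xs) auto
  then show ?thesis by (simp add: interv_sum_list_conv_sum_set_nat atLeast0LessThan)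
qed

section \<open>Integer coordinates\<close>

text \<open>The list \<open>ds\<close> enumerates the normals of the special vertex. Its order is
  left open, so that it can be sorted later.\<close>

locale fano_coords = fano P for P :: "(real^'n::finite) set" +
  fixes v0 :: "real^'n" and ds :: "(real^'n) list" and n :: nat
  assumes v0: "v0 \<in> vertices" "\<forall>w\<in>tight v0. 0 \<le> (\<Sum>x\<in>normals. x \<bullet> dir v0 w)"
    and ds: "distinct ds" "set ds = tight v0"
    and n: "n = CARD('n)"
begin

definition us :: "nat \<Rightarrow> real^'n" where
  "us k = dir v0 (ds ! k)"

text \<open>Coordinates of a normal in the basis \<open>ds\<close>. On lattice vectors the inner
  products are already integers, and the floor is a mere change of type; the same holds for
  \<open>M\<close>, which gives the coordinates of a point in the dual basis
  \<open>us\<close>.\<close>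

definition L :: "real^'n \<Rightarrow> int list" where
  "L w = map (\<lambda>k. \<lfloor>w \<bullet> us k\<rfloor>) [0..<n]"

definition M :: "real^'n \<Rightarrow> int list" where
  "M x = map (\<lambda>k. \<lfloor>ds ! k \<bullet> x\<rfloor>) [0..<n]"

definition Y :: "int list \<Rightarrow> real^'n" where
  "Y l = (\<Sum>k<n. of_int (l ! k) *\<^sub>R ds ! k)"

definition X :: "int list \<Rightarrow> real^'n" where
  "X l = (\<Sum>k<n. of_int (l ! k) *\<^sub>R us k)"

lemma length_ds: "length ds = n"
  using ds card_tight[OF v0(1)] n distinct_card by metis

lemma n_pos: "0 < n"
  by (simp add: n)

lemma ds_tight: "k < n \<Longrightarrow> ds ! k \<in> tight v0"
  using ds(2) length_ds nth_mem by metis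

lemma ds_us: "i < n \<Longrightarrow> j < n \<Longrightarrow> ds ! i \<bullet> us j = (if i = j then 1 else 0)"
  unfolding us_def by (simp add: dir_props(2)[OF v0(1) ds_tight ds_tight] nth_eq_iff_index_eq[OF ds(1)] length_ds)

lemma us_int: "k < n \<Longrightarrow> us k \<in> int_lattice"
  unfolding us_def by (rule dir_props(1)[OF v0(1) ds_tight])

lemma expand_us: "x = (\<Sum>k<n. (ds ! k \<bullet> x) *\<^sub>R us k)"
proof -
  have "y \<bullet> (x - (\<Sum>k<n. (ds ! k \<bullet> x) *\<^sub>R us k)) = 0" if "y \<in> tight v0" for y
  proof -
    have "y \<in> set ds" using that ds(2) by simp
    then obtain i where "i < n" "y = ds ! i" unfolding in_set_conv_nth length_ds by blast
    then show ?thesis by (simp add: inner_diff_right inner_sum_right ds_us if_distrib cong: if_cong)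
  qed
  then have "x - (\<Sum>k<n. (ds ! k \<bullet> x) *\<^sub>R us k) = 0" by (intro tight_separates[OF v0(1)]) blast
  then show ?thesis by simp
qed

lemma expand_ds: "w = (\<Sum>k<n. (w \<bullet> us k) *\<^sub>R ds ! k)"
proof -
  define z where "z = w - (\<Sum>k<n. (w \<bullet> us k) *\<^sub>R ds ! k)"
  have "z \<bullet> us j = 0" if "j < n" for j
    using that by (simp add: z_def inner_diff_left inner_sum_left ds_us if_distrib cong: if_cong)
  then have "(\<Sum>k<n. (ds ! k \<bullet> z) * (z \<bullet> us k)) = 0" by (intro sum.neutral) simp
  moreover have "z \<bullet> z = (\<Sum>k<n. (ds ! k \<bullet> z) * (z \<bullet> us k))"
    by (subst (2) expand_us[of z]) (simp only: inner_sum_right inner_scaleR_right)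
  ultimately have "z = 0" by (simp only: inner_eq_zero_iff)
  then show ?thesis unfolding z_def by (rule eq_iff_diff_eq_0[THEN iffD2])
qed

lemma floor_int: "x \<in> int_lattice \<Longrightarrow> y \<in> int_lattice \<Longrightarrow> of_int \<lfloor>x \<bullet> y\<rfloor> = x \<bullet> y"
  using int_lattice_inner[of x y] by simp

lemma length_L [simp]: "length (L w) = n" and length_M [simp]: "length (M x) = n"
  by (simp_all add: L_def M_def)

lemma nth_L: "w \<in> int_lattice \<Longrightarrow> k < n \<Longrightarrow> of_int (L w ! k) = w \<bullet> us k"
  using floor_int[OF _ us_int] by (simp add: L_def)

lemma nth_M: "x \<in> int_lattice \<Longrightarrow> k < n \<Longrightarrow> of_int (M x ! k) = ds ! k \<bullet> x"
  using floor_int[OF tight_int(1)[OF ds_tight]] by (simp add: M_def)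

lemma Y_L: "w \<in> int_lattice \<Longrightarrow> Y (L w) = w"
  unfolding Y_def by (subst (2) expand_ds[of w]) (simp add: nth_L)

lemma X_M: "x \<in> int_lattice \<Longrightarrow> X (M x) = x"
  unfolding X_def by (subst (2) expand_us[of x]) (simp add: nth_M)

lemma inner_Y_X: "length a = n \<Longrightarrow> length b = n \<Longrightarrow> Y a \<bullet> X b = of_int (dot a b)"
  by (simp add: Y_def X_def inner_sum_left inner_sum_right ds_us dot_sum if_distrib mult.commute cong: if_cong)

lemma dot_L_M: "w \<in> int_lattice \<Longrightarrow> x \<in> int_lattice \<Longrightarrow> of_int (dot (L w) (M x)) = w \<bullet> x"
  using inner_Y_X[of "L w" "M x"] by (simp add: Y_L X_M)

lemma M_axpy: "x \<in> int_lattice \<Longrightarrow> y \<in> int_lattice \<Longrightarrow> axpy c (M x) (M y) = M (y + of_int c *\<^sub>R x)"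
proof (rule nth_equalityI)
  assume xy: "x \<in> int_lattice" "y \<in> int_lattice"
  have sum_int: "y + of_int c *\<^sub>R x \<in> int_lattice" by (intro int_lattice_combine xy) simp
  fix k assume "k < length (axpy c (M x) (M y))"
  then have k: "k < n" by simp
  have "of_int (axpy c (M x) (M y) ! k) = (of_int (M (y + of_int c *\<^sub>R x) ! k) :: real)"
    using xy k nth_M[OF sum_int k] by (simp add: nth_axpy nth_M inner_add_right)
  then show "axpy c (M x) (M y) ! k = M (y + of_int c *\<^sub>R x) ! k" by simp
qed simp

lemma M_vneg: "x \<in> int_lattice \<Longrightarrow> vneg (M x) = M (- x)"
proof -
  assume x: "x \<in> int_lattice"
  have vneg: "vneg l = map uminus l" for l by (induction l) auto
  have "of_int (vneg (M x) ! k) = (of_int (M (- x) ! k) :: real)" if "k < n" for k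
    using x that int_lattice_combine(3)[OF x] by (simp add: vneg nth_M)
  then have "vneg (M x) ! k = M (- x) ! k" if "k < n" for k using that by (metis of_int_eq_iff)
  then show ?thesis by (intro nth_equalityI) (simp_all add: vneg)
qed

section \<open>The fan of a Fano polytope\<close>

definition VL :: "int list set" where "VL = L ` normals"
definition SL :: "int list set" where "SL = M ` vertices"
definition TL :: "int list \<Rightarrow> int list set" where "TL v = {w \<in> VL. dot w v = - 1}"
definition UL :: "int list \<Rightarrow> int list \<Rightarrow> int list" where "UL v w = M (dir (X v) (Y w))"

lemma inj_L: "inj_on L int_lattice"
  by (metis Y_L inj_onI)

lemma dot_eq: "w \<in> normals \<Longrightarrow> v \<in> vertices \<Longrightarrow> dot (L w) (M v) = - 1 \<longleftrightarrow> w \<bullet> v = - 1"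
proof -
  assume "w \<in> normals" "v \<in> vertices"
  then have "w \<bullet> v = of_int (dot (L w) (M v))" using dot_L_M normal_int vertex_int by simp
  then show ?thesis by (metis of_int_eq_iff of_int_minus of_int_1)
qed

lemma TL_M: "v \<in> vertices \<Longrightarrow> TL (M v) = L ` tight v"
  using dot_eq unfolding TL_def VL_def tight_def by auto

lemma UL_M: "v \<in> vertices \<Longrightarrow> w \<in> tight v \<Longrightarrow> UL (M v) (L w) = M (dir v w)"
  by (simp add: UL_def X_M Y_L vertex_int tight_int(1))

lemma L_eq: "w \<in> int_lattice \<Longrightarrow> w' \<in> int_lattice \<Longrightarrow> L w = L w' \<longleftrightarrow> w = w'"
  using inj_L by (auto dest: inj_onD)

lemma L_Diff: "v \<in> vertices \<Longrightarrow> w \<in> tight v \<Longrightarrow> L ` tight v - {L w} = L ` (tight v - {w})"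
  using inj_on_image_set_diff[OF inj_L, of "tight v" "{w}"] tight_int(1) by auto

lemma nbr_M:
  assumes "v \<in> vertices" "w \<in> tight v" "x \<in> normals"
  shows "nbr (M v) (UL (M v) (L w)) (L x) = M (v + (x \<bullet> v + 1) *\<^sub>R dir v w)"
  using dot_L_M[OF normal_int[OF assms(3)] vertex_int[OF assms(1)]]
  by (simp add: nbr_def UL_M[OF assms(1,2)] M_axpy[OF dir_props(1)[OF assms(1,2)] vertex_int[OF assms(1)]])

lemma neighbor_L:
  assumes v: "v \<in> vertices" "w \<in> tight v"
  shows "\<exists>x\<in>normals. dot (L x) (UL (M v) (L w)) = - 1 \<and> nbr (M v) (UL (M v) (L w)) (L x) \<in> SL \<and>
        TL (nbr (M v) (UL (M v) (L w)) (L x)) = insert (L x) (TL (M v) - {L w}) \<and>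
        UL (nbr (M v) (UL (M v) (L w)) (L x)) (L x) = vneg (UL (M v) (L w)) \<and>
        (\<forall>y\<in>TL (M v) - {L w}. UL (nbr (M v) (UL (M v) (L w)) (L x)) y =
          axpy (dot (L x) (UL (M v) y)) (UL (M v) (L w)) (UL (M v) y))"
proof -
  obtain x where x: "x \<in> normals" "x \<notin> tight v" "x \<bullet> dir v w = - 1" "v + (x \<bullet> v + 1) *\<^sub>R dir v w \<in> vertices"
    "tight (v + (x \<bullet> v + 1) *\<^sub>R dir v w) = insert x (tight v - {w})"
    "dir (v + (x \<bullet> v + 1) *\<^sub>R dir v w) x = - dir v w"
    "\<forall>y\<in>tight v - {w}. dir (v + (x \<bullet> v + 1) *\<^sub>R dir v w) y = dir v y + (x \<bullet> dir v y) *\<^sub>R dir v w"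
    using neighbor[OF v] by blast
  let ?v = "v + (x \<bullet> v + 1) *\<^sub>R dir v w"
  note xi = normal_int[OF x(1)] and di = dir_props(1)[OF v]
  have nbr: "nbr (M v) (UL (M v) (L w)) (L x) = M ?v" by (rule nbr_M[OF v x(1)])
  have "of_int (dot (L x) (M (dir v w))) = (of_int (- 1) :: real)" using dot_L_M[OF xi di] x(3) by simp
  then have 1: "dot (L x) (UL (M v) (L w)) = - 1" unfolding UL_M[OF v] of_int_eq_iff .
  have 2: "M ?v \<in> SL" using x(4) by (auto simp: SL_def)
  have 3: "TL (M ?v) = insert (L x) (TL (M v) - {L w})"
    unfolding TL_M[OF x(4)] TL_M[OF v(1)] L_Diff[OF v] x(5) by simp
  have 4: "UL (M ?v) (L x) = vneg (UL (M v) (L w))"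
    using x(4,5) by (simp add: UL_M UL_M[OF v] M_vneg[OF di] x(6))
  have 5: "UL (M ?v) y = axpy (dot (L x) (UL (M v) y)) (UL (M v) (L w)) (UL (M v) y)" if y: "y \<in> TL (M v) - {L w}" for y
  proof -
    obtain y' where y': "y = L y'" "y' \<in> tight v - {w}" using y unfolding TL_M[OF v(1)] L_Diff[OF v] by blast
    then have yt: "y' \<in> tight v" "y' \<in> tight ?v" unfolding x(5) by auto
    have "of_int (dot (L x) (M (dir v y'))) = x \<bullet> dir v y'" by (rule dot_L_M[OF xi dir_props(1)[OF v(1) yt(1)]])
    then show ?thesis
      unfolding y'(1) UL_M[OF v(1) yt(1)] UL_M[OF x(4) yt(2)] UL_M[OF v] M_axpy[OF di dir_props(1)[OF v(1) yt(1)]]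
      using x(7) y'(2) by simp
  qed
  show ?thesis
    by (rule bexI[OF _ x(1)], unfold nbr, intro conjI ballI 1 2 3 4 5)
qed

sublocale F: fan n VL SL UL TL
proof
  show "TL v = {w \<in> VL. dot w v = - 1}" for v by (rule TL_def)
  show "finite VL" using polytope_Q(3) by (simp add: VL_def)
  show "length w = n" if "w \<in> VL" for w using that by (auto simp: VL_def)
  show "0 \<le> dot w v" if "v \<in> SL" "w \<in> VL" "w \<notin> TL v" for v w
  proof -
    obtain v' w' where vw: "v' \<in> vertices" "v = M v'" "w' \<in> normals" "w = L w'" using \<open>v \<in> SL\<close> \<open>w \<in> VL\<close> unfolding SL_def VL_def by blast
    then have "w' \<notin> tight v'" using \<open>w \<notin> TL v\<close> TL_M by auto
    then have "0 \<le> w' \<bullet> v'" using beyond vw by blast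
    then have "0 \<le> (of_int (dot w v) :: real)" using dot_L_M[OF normal_int vertex_int] vw by simp
    then show ?thesis by simp
  qed
  show "card (TL v) = n" if "v \<in> SL" for v
  proof -
    obtain v' where v': "v' \<in> vertices" "v = M v'" using \<open>v \<in> SL\<close> unfolding SL_def by blast
    have "inj_on L (tight v')" using inj_L tight_int(1) by (metis inj_on_subset subsetI)
    then show ?thesis unfolding v'(2) TL_M[OF v'(1)] by (simp only: card_image card_tight[OF v'(1)] n)
  qed
  show "dot y (UL v w) = (if y = w then 1 else 0)" if "v \<in> SL" "w \<in> TL v" "y \<in> TL v" for v w y
  proof -
    obtain v' where v': "v' \<in> vertices" "v = M v'" using \<open>v \<in> SL\<close> unfolding SL_def by blast
    obtain w' y' where wy: "w' \<in> tight v'" "w = L w'" "y' \<in> tight v'" "y = L y'"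
      using \<open>w \<in> TL v\<close> \<open>y \<in> TL v\<close> unfolding v'(2) TL_M[OF v'(1)] by blast
    have "of_int (dot y (UL v w)) = y' \<bullet> dir v' w'"
      unfolding v'(2) wy UL_M[OF v'(1) wy(1)] by (rule dot_L_M[OF tight_int(1)[OF wy(3)] dir_props(1)[OF v'(1) wy(1)]])
    also have "\<dots> = of_int (if y = w then 1 else 0)"
      using dir_props(2)[OF v'(1) wy(1,3)] L_eq tight_int(1) wy by simp
    finally show ?thesis by (simp only: of_int_eq_iff)
  qed
  show "\<exists>x\<in>VL. dot x (UL v w) = - 1 \<and> nbr v (UL v w) x \<in> SL \<and> TL (nbr v (UL v w) x) = insert x (TL v - {w}) \<and>
        UL (nbr v (UL v w) x) x = vneg (UL v w) \<and>
        (\<forall>y\<in>TL v - {w}. UL (nbr v (UL v w) x) y = axpy (dot x (UL v y)) (UL v w) (UL v y))"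
    if "v \<in> SL" "w \<in> TL v" for v w
  proof -
    obtain v' where v': "v' \<in> vertices" "v = M v'" using \<open>v \<in> SL\<close> unfolding SL_def by blast
    obtain w' where w': "w' \<in> tight v'" "w = L w'" using \<open>w \<in> TL v\<close> unfolding v'(2) TL_M[OF v'(1)] by blast
    show ?thesis using neighbor_L[OF v'(1) w'(1)] unfolding v'(2) w'(2) VL_def bex_simps(7) .
  qed
  show "v1 = v2" if H: "v \<in> SL" "v1 \<in> SL" "v2 \<in> SL" "w \<in> TL v" "v1 \<noteq> v" "v2 \<noteq> v" "TL v - {w} \<subseteq> TL v1" "TL v - {w} \<subseteq> TL v2"
    for v v1 v2 w
  proof -
    obtain p p1 p2 where p: "p \<in> vertices" "v = M p" "p1 \<in> vertices" "v1 = M p1" "p2 \<in> vertices" "v2 = M p2"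
      using H(1-3) unfolding SL_def by blast
    obtain w' where w': "w' \<in> tight p" "w = L w'" using H(4) unfolding p(2) TL_M[OF p(1)] by blast
    have sub: "tight p - {w'} \<subseteq> tight q" if q: "q \<in> vertices" "TL v - {w} \<subseteq> TL (M q)" for q
    proof
      fix y assume y: "y \<in> tight p - {w'}"
      then have "L y \<in> L ` tight q" using q unfolding p(2) w'(2) TL_M[OF p(1)] TL_M[OF q(1)] L_Diff[OF p(1) w'(1)] by blast
      then obtain z where "z \<in> tight q" "L y = L z" by blast
      then show "y \<in> tight q" using L_eq tight_int(1) y by (metis DiffE)
    qed
    have ne: "p1 \<noteq> p" "p2 \<noteq> p" using H(5)[unfolded p(2,4)] H(6)[unfolded p(2,6)] by (auto simp only:)
    have "p1 = p2"
      by (rule edge_unique[OF p(1) w'(1) p(3) ne(1) sub[OF p(3) H(7)[unfolded p(4)]] p(5) ne(2) sub[OF p(5) H(8)[unfolded p(6)]]])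
    then show ?thesis unfolding p(4,6) by (rule arg_cong)
  qed
  show "S = SL" if S: "S \<subseteq> SL" "S \<noteq> {}" and step: "\<And>v w. v \<in> S \<Longrightarrow> w \<in> TL v \<Longrightarrow> \<exists>v'\<in>S. v' \<noteq> v \<and> TL v - {w} \<subseteq> TL v'" for S
  proof -
    define S' where "S' = {v\<in>vertices. M v \<in> S}"
    have S_eq: "S = M ` S'"
    proof (intro equalityI subsetI)
      fix v assume "v \<in> S"
      moreover from this obtain p where "p \<in> vertices" "v = M p" using S(1) unfolding SL_def by auto
      ultimately show "v \<in> M ` S'" by (simp add: S'_def)
    qed (auto simp: S'_def)
    have vertices: "S' = vertices"
    proof (rule vertices_connected)
      show "S' \<subseteq> vertices" by (auto simp: S'_def)
      show "S' \<noteq> {}" using S(2) by (metis S_eq image_empty)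
      fix v w assume v: "v \<in> S'" "w \<in> tight v"
      then have vv: "v \<in> vertices" "M v \<in> S" by (auto simp: S'_def)
      have "L w \<in> TL (M v)" using v(2) TL_M[OF vv(1)] by blast
      then obtain v' where v': "v' \<in> S" "v' \<noteq> M v" "TL (M v) - {L w} \<subseteq> TL v'" using step[OF vv(2)] by blast
      have "v' \<in> M ` S'" using v'(1) by (simp only: S_eq[symmetric])
      then obtain q where q: "q \<in> S'" "v' = M q" by (elim imageE)
      then have qv: "q \<in> vertices" by (simp add: S'_def)
      have "tight v - {w} \<subseteq> tight q"
      proof
        fix y assume y: "y \<in> tight v - {w}"
        then have "L y \<in> L ` tight q" using v'(3) unfolding q(2) TL_M[OF vv(1)] TL_M[OF qv] L_Diff[OF vv(1) v(2)] by blast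
        then obtain z where "z \<in> tight q" "L y = L z" by blast
        then show "y \<in> tight q" using L_eq tight_int(1) y by (metis DiffE)
      qed
      moreover have "q \<noteq> v" using v'(2) unfolding q(2) by blast
      ultimately show "\<exists>v'\<in>S'. v' \<noteq> v \<and> tight v - {w} \<subseteq> tight v'" by (intro bexI[OF _ q(1)] conjI)
    qed
    show ?thesis unfolding SL_def vertices[symmetric] by (rule S_eq)
  qed
qed

lemma Y_VL: "Y ` VL = normals"
  unfolding VL_def image_image using Y_L normal_int by simp

lemma X_SL: "X ` SL = vertices"
  unfolding SL_def image_image using X_M vertex_int by simp

sublocale G: fan_model n VL SL UL TL X Y "\<lambda>k x. ds ! k \<bullet> x"
proof (intro fan_model.intro fan_model_axioms.intro)
  show "fan n VL SL UL TL" by (rule F.fan_axioms)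
  show "simple_polytope (Y ` VL) (X ` SL)" unfolding Y_VL X_SL by (rule simple)
  show "n = CARD('n)" by (rule n)
  show "inj_on Y VL" unfolding VL_def by (intro inj_onI) (auto simp: Y_L normal_int)
  show "Y w \<bullet> X v = of_int (dot w v)" if "w \<in> VL" "v \<in> SL" for w v
    using that by (intro inner_Y_X) (auto simp: VL_def SL_def)
  show "length v = n" if "v \<in> SL" for v using that by (auto simp: SL_def)
  show "ds ! i \<bullet> X v = of_int (v ! i)" if "v \<in> SL" "i < n" for v i
    using that by (auto simp: SL_def X_M vertex_int nth_M)
  show "affine_fun (\<lambda>x. ds ! i \<bullet> x)" for i by simp
qed

lemma M_v0: "M v0 = origin n"
  unfolding M_def origin_def
proof (intro map_cong refl)
  fix k assume "k \<in> set [0..<n]"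
  then have "ds ! k \<bullet> v0 = of_int (- 1)" using tight_int(3)[OF ds_tight] by simp
  then show "\<lfloor>ds ! k \<bullet> v0\<rfloor> = - 1" by (simp only: floor_of_int)
qed

lemma L_ds: "k < n \<Longrightarrow> L (ds ! k) = unit n k"
  unfolding L_def unit_def by (intro map_cong) (auto simp: ds_us)

lemma M_us: "k < n \<Longrightarrow> M (us k) = unit n k"
  unfolding M_def unit_def by (intro map_cong) (auto simp: ds_us)

end

section \<open>Extremal potentials and Ding stability\<close>

lemma linear_inj_surj_prod:
  fixes f :: "(real^'n) \<times> real \<Rightarrow> (real^'n) \<times> real"
  assumes "linear f" "\<And>p. f p = 0 \<Longrightarrow> p = 0"
  shows "bij f"
proof -
  have "inj f" using assms(2) by (auto simp: linear_injective_0[OF assms(1)])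
  then show ?thesis using linear_injective_imp_surjective[OF assms(1)] by (simp add: bij_def)
qed

lemma continuous_on_Max:
  fixes L :: "('a::topological_space \<Rightarrow> real) set"
  assumes "finite L" "L \<noteq> {}" "\<And>l. l \<in> L \<Longrightarrow> continuous_on S l"
  shows "continuous_on S (\<lambda>x. Max ((\<lambda>l. l x) ` L))"
  using assms
proof (induction rule: finite_ne_induct)
  case (insert l L)
  then have "(\<lambda>x. Max ((\<lambda>l. l x) ` insert l L)) = (\<lambda>x. max (l x) (Max ((\<lambda>l. l x) ` L)))" by auto
  then show ?case using insert by (auto intro!: continuous_on_max)
qed simp

lemma rational_affine_imp_affine: "rational_affine_fun l \<Longrightarrow> affine_fun l"
  unfolding rational_affine_fun_def affine_fun_def by blast

section \<open>Extremal potential and stability on a convex body\<close>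

locale convex_body =
  fixes P :: "(real^'n::finite) set"
  assumes compact: "compact P" and convex: "convex P" and interior: "0 \<in> interior P"
begin

lemma zero_P: "0 \<in> P"
  using interior interior_subset by blast

lemma int: "continuous_on P h \<Longrightarrow> (LINT x:P|lborel. h x) = integral P h" for h :: "real^'n \<Rightarrow> real"
  using LINT_eq_integral(1)[OF compact] .

lemma integrable: "continuous_on P h \<Longrightarrow> h integrable_on P" for h :: "real^'n \<Rightarrow> real"
  using LINT_eq_integral(3)[OF compact] .

lemma vol: "vol P = integral P (\<lambda>x. 1)" "0 < vol P"
proof -
  have "P \<in> lmeasurable" by (rule lmeasurable_compact[OF compact])
  moreover have "measure lborel P = measure lebesgue P" using compact by (simp add: borel_compact)
  ultimately show "vol P = integral P (\<lambda>x. 1)" by (simp add: vol_def lmeasure_integral)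
  moreover have "0 < integral P (\<lambda>x. 1 :: real)"
    by (rule integral_pos_interior[OF compact _ _ interior]) simp_all
  ultimately show "0 < vol P" by simp
qed

lemma affine_zero_interior:
  assumes "\<And>x. x \<in> interior P \<Longrightarrow> z \<bullet> x + t = 0"
  shows "z = 0 \<and> t = (0::real)"
proof -
  have t: "t = 0" using assms[OF interior] by simp
  obtain e where e: "e > 0" "ball 0 e \<subseteq> interior P"
    using interior open_contains_ball_eq[OF open_interior] by blast
  have "z = 0"
  proof (rule ccontr)
    assume z: "z \<noteq> 0"
    have "(e / (2 * norm z)) *\<^sub>R z \<in> interior P" using e z by (intro subsetD[OF e(2)]) simp
    then have "z \<bullet> ((e / (2 * norm z)) *\<^sub>R z) = 0" using assms t by fastforce
    then show False using z e(1) by simp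
  qed
  then show ?thesis using t by simp
qed

text \<open>The map from the coefficients of an affine function to its moments is linear, and
  injective because a function with vanishing moments is orthogonal to itself. In equal finite
  dimensions it is bijective, and the complement of the extremal potential to 1 is the preimage of
  (0, \<open>vol P\<close>).\<close>

lemma extremal:
  "\<exists>z t. extremal_potential P = (\<lambda>x. 1 - (z \<bullet> x + t)) \<and> integral P (\<lambda>x. z \<bullet> x + t) = vol P \<and>
    (\<forall>i. integral P (\<lambda>x. x $ i * (z \<bullet> x + t)) = 0)"
proof -
  define F where "F p = ((\<chi> i. integral P (\<lambda>x. x $ i * (fst p \<bullet> x + snd p))), integral P (\<lambda>x. fst p \<bullet> x + snd p))"
    for p :: "(real^'n) \<times> real"
  have c: "continuous_on P (\<lambda>x. x $ i * (z \<bullet> x + t))" "continuous_on P (\<lambda>x. z \<bullet> x + t)" for i z t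
    by (intro continuous_intros)+
  have add: "integral P (\<lambda>x. h x * ((z + z') \<bullet> x + (t + t'))) = integral P (\<lambda>x. h x * (z \<bullet> x + t)) + integral P (\<lambda>x. h x * (z' \<bullet> x + t'))"
    if "continuous_on P h" for h z z' t t'
    using integral_add[of "\<lambda>x. h x * (z \<bullet> x + t)" P "\<lambda>x. h x * (z' \<bullet> x + t')"] that
    by (simp add: integrable continuous_intros inner_add_left algebra_simps)
  have scale: "integral P (\<lambda>x. h x * ((s *\<^sub>R z) \<bullet> x + s * t)) = s * integral P (\<lambda>x. h x * (z \<bullet> x + t))" for h z s t
    using integral_mult_right[of P s "\<lambda>x. h x * (z \<bullet> x + t)"] by (simp add: algebra_simps)
  have "linear F"
  proof (rule linearI)
    show "F (p + q) = F p + F q" for p q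
      using add[of "\<lambda>x. 1" "fst p" "fst q" "snd p" "snd q"] add[of "\<lambda>x. x $ _" "fst p" "fst q" "snd p" "snd q"]
      by (simp add: F_def prod_eq_iff vec_eq_iff continuous_intros)
    show "F (s *\<^sub>R p) = s *\<^sub>R F p" for s p
      using scale[of "\<lambda>x. 1" s "fst p" "snd p"] scale[of "\<lambda>x. x $ _" s "fst p" "snd p"]
      by (simp add: F_def prod_eq_iff vec_eq_iff)
  qed
  moreover have "p = 0" if p: "F p = 0" for p
  proof -
    obtain z t where zt: "p = (z, t)" by fastforce
    have i: "integral P (\<lambda>x. x $ i * (z \<bullet> x + t)) = 0" "integral P (\<lambda>x. z \<bullet> x + t) = 0" for i
      using p by (simp_all add: F_def zt prod_eq_iff vec_eq_iff)
    have "(z \<bullet> x + t) * g = (\<Sum>i\<in>UNIV. z $ i * (x $ i * g)) + t * g" for x g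
      by (simp add: inner_vec_def sum_distrib_right distrib_right mult.assoc)
    then have "integral P (\<lambda>x. (z \<bullet> x + t) * (z \<bullet> x + t)) =
        integral P (\<lambda>x. (\<Sum>i\<in>UNIV. z $ i * (x $ i * (z \<bullet> x + t))) + t * (z \<bullet> x + t))" by (simp only:)
    also have "\<dots> = (\<Sum>i\<in>UNIV. z $ i * integral P (\<lambda>x. x $ i * (z \<bullet> x + t))) + t * integral P (\<lambda>x. z \<bullet> x + t)"
      by (subst integral_add) (simp_all add: integrable c integral_sum integrable_sum integrable_on_mult_right continuous_intros)
    finally have zero: "integral P (\<lambda>x. (z \<bullet> x + t) * (z \<bullet> x + t)) = 0" by (simp add: i)
    have "z \<bullet> x + t = 0" if x: "x \<in> interior P" for x
    proof (rule ccontr)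
      assume "z \<bullet> x + t \<noteq> 0"
      then have "0 < (z \<bullet> x + t) * (z \<bullet> x + t)" by (auto simp: zero_less_mult_iff linorder_neq_iff)
      then have "0 < integral P (\<lambda>x. (z \<bullet> x + t) * (z \<bullet> x + t))"
        by (intro integral_pos_interior[OF compact _ _ x]) (auto intro!: continuous_intros)
      then show False using zero by simp
    qed
    then show ?thesis using affine_zero_interior[of z t] by (simp add: zt zero_prod_def)
  qed
  ultimately have bij: "bij F" by (rule linear_inj_surj_prod)
  then obtain z t where zt: "F (z, t) = (0, vol P)" by (metis bij_pointE surj_pair)
  have eqs: "integral P (\<lambda>x. z \<bullet> x + t) = vol P" "integral P (\<lambda>x. x $ i * (z \<bullet> x + t)) = 0" for i
    using zt by (simp_all add: F_def vec_eq_iff)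
  have "extremal_potential P = (\<lambda>x. 1 - (z \<bullet> x + t))"
    unfolding extremal_potential_def
  proof (rule the_equality)
    have "integral P (\<lambda>x. 1 - (z \<bullet> x + t)) = 0"
      using integral_diff[OF integrable integrable, of "\<lambda>x. 1" "\<lambda>x. z \<bullet> x + t"] eqs(1) c vol(1) by simp
    moreover have "affine_fun (\<lambda>x. 1 - (z \<bullet> x + t))"
      by (rule affine_funI[of _ "- z" "1 - t"]) simp
    ultimately show "affine_fun (\<lambda>x. 1 - (z \<bullet> x + t)) \<and> (LINT x:P|lborel. 1 - (z \<bullet> x + t)) = 0 \<and>
        (\<forall>i. (LINT x:P|lborel. x $ i * (1 - (1 - (z \<bullet> x + t)))) = 0)"
      using eqs(2) by (simp add: int continuous_intros)
  next
    fix th assume th: "affine_fun th \<and> (LINT x:P|lborel. th x) = 0 \<and> (\<forall>i. (LINT x:P|lborel. x $ i * (1 - th x)) = 0)"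
    then obtain a b where ab: "th = (\<lambda>x. a \<bullet> x + b)" by (auto simp: affine_fun_def)
    have e: "(- a) \<bullet> x + (1 - b) = 1 - th x" for x by (simp add: ab)
    have ct: "continuous_on P th" unfolding ab by (intro continuous_intros)
    have "integral P (\<lambda>x. 1 - th x) = vol P"
      using integral_diff[OF integrable integrable, of "\<lambda>x. 1" th] th vol(1) ct by (simp add: int)
    moreover have "integral P (\<lambda>x. x $ i * (1 - th x)) = 0" for i
      using th ct by (simp add: int continuous_intros)
    ultimately have "F (- a, 1 - b) = (0, vol P)" unfolding F_def fst_conv snd_conv e by (simp add: vec_eq_iff)
    then have "(- a, 1 - b) = (z, t)" using zt bij by (metis bij_is_inj injD)
    then show "th = (\<lambda>x. 1 - (z \<bullet> x + t))" by (auto simp: ab)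
  qed
  then show ?thesis using eqs by blast
qed

definition weight_fun :: "real^'n \<Rightarrow> real" where
  "weight_fun x = 1 - extremal_potential P x"

lemma weight_fun:
  obtains z t where "weight_fun = (\<lambda>x. z \<bullet> x + t)" "integral P weight_fun = vol P"
    "\<And>i. integral P (\<lambda>x. x $ i * weight_fun x) = 0"
proof -
  obtain z t where zt: "extremal_potential P = (\<lambda>x. 1 - (z \<bullet> x + t))" "integral P (\<lambda>x. z \<bullet> x + t) = vol P"
    "\<forall>i. integral P (\<lambda>x. x $ i * (z \<bullet> x + t)) = 0"
    using extremal by blast
  have "weight_fun = (\<lambda>x. z \<bullet> x + t)" by (simp add: fun_eq_iff weight_fun_def zt(1))
  then show ?thesis using that[of z t] zt by simp
qed

lemma weight_affine: "affine_fun weight_fun"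
  using weight_fun by (metis affine_fun_def)

lemma continuous_weight: "continuous_on S weight_fun"
  by (rule affine_fun_continuous[OF weight_affine])

lemma mabuchi: "\<exists>v\<in>P. mabuchi_constant P = 1 - weight_fun v \<and> (\<forall>x\<in>P. weight_fun v \<le> weight_fun x)"
proof -
  obtain v where v: "v \<in> P" "\<forall>x\<in>P. weight_fun v \<le> weight_fun x"
    using continuous_attains_inf[OF compact _ continuous_weight] zero_P by blast
  have "mabuchi_constant P = extremal_potential P v"
    unfolding mabuchi_constant_def
    by (rule cSup_eq_maximum) (use v in \<open>auto simp: weight_fun_def\<close>)
  then show ?thesis using v by (intro bexI[of _ v]) (auto simp: weight_fun_def)
qed

text \<open>The conditions that define the extremal potential say precisely that averaging against
  the weight evaluates affine functions at 0.\<close>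

lemma integral_affine_weight:
  assumes "affine_fun l"
  shows "integral P (\<lambda>x. l x * weight_fun x) = l 0 * vol P"
proof -
  obtain a b where l: "l = (\<lambda>x. a \<bullet> x + b)" using assms by (auto simp: affine_fun_def)
  obtain z t where w: "weight_fun = (\<lambda>x. z \<bullet> x + t)" "integral P weight_fun = vol P"
    "\<And>i. integral P (\<lambda>x. x $ i * weight_fun x) = 0" by (rule weight_fun) blast
  have "l x * g = (\<Sum>i\<in>UNIV. a $ i * (x $ i * g)) + b * g" for x g
    by (simp add: l inner_vec_def sum_distrib_right distrib_right mult.assoc)
  then have "integral P (\<lambda>x. l x * weight_fun x) =
      integral P (\<lambda>x. (\<Sum>i\<in>UNIV. a $ i * (x $ i * weight_fun x)) + b * weight_fun x)" by (simp only:)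
  also have "\<dots> = (\<Sum>i\<in>UNIV. a $ i * integral P (\<lambda>x. x $ i * weight_fun x)) + b * integral P weight_fun"
    by (subst integral_add) (simp_all add: integrable integral_sum integrable_sum integrable_on_mult_right
        continuous_on_mult continuous_weight continuous_intros)
  finally show ?thesis by (simp add: w(2,3) l)
qed

lemma D_eq: "continuous_on P f \<Longrightarrow> D_NA P f = - f 0 + 1 / vol P * integral P (\<lambda>x. f x * weight_fun x)"
  by (simp add: D_NA_def flip: weight_fun_def) (simp add: int continuous_on_mult continuous_weight)

lemma PL_continuous:
  assumes "rational_PL_convex P f"
  shows "continuous_on P f"
proof -
  obtain L where L: "finite L" "L \<noteq> {}" "\<forall>l\<in>L. rational_affine_fun l" "\<forall>x\<in>P. f x = Max ((\<lambda>l. l x) ` L)"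
    using assms by (auto simp: rational_PL_convex_def)
  have "continuous_on P (\<lambda>x. Max ((\<lambda>l. l x) ` L))"
    using L(1,2,3) by (intro continuous_on_Max affine_fun_continuous rational_affine_imp_affine) auto
  then show ?thesis using L(4) by (simp cong: continuous_on_cong)
qed

text \<open>One of the finitely many affine pieces attains the maximum at 0.\<close>

lemma PL_support:
  assumes "rational_PL_convex P f"
  obtains l where "affine_fun l" "l 0 = f 0" "\<And>x. x \<in> P \<Longrightarrow> l x \<le> f x"
proof -
  obtain L where L: "finite L" "L \<noteq> {}" "\<forall>l\<in>L. rational_affine_fun l" "\<forall>x\<in>P. f x = Max ((\<lambda>l. l x) ` L)"
    using assms by (auto simp: rational_PL_convex_def)
  have "f 0 \<in> (\<lambda>l. l 0) ` L" using L zero_P Max_in[of "(\<lambda>l. l 0) ` L"] by simp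
  then obtain l where l: "l \<in> L" "l 0 = f 0" by auto
  moreover have "l x \<le> f x" if "x \<in> P" for x using L(1,4) l(1) that by simp
  moreover have "affine_fun l" using L(3) l(1) rational_affine_imp_affine by blast
  ultimately show ?thesis using that by blast
qed

lemma D_shift:
  assumes f: "continuous_on P f" and l: "affine_fun l" "l 0 = f 0"
  shows "D_NA P f = 1 / vol P * integral P (\<lambda>x. (f x - l x) * weight_fun x)"
proof -
  have "integral P (\<lambda>x. f x * weight_fun x - l x * weight_fun x) = integral P (\<lambda>x. f x * weight_fun x) - l 0 * vol P"
    unfolding integral_affine_weight[OF l(1), symmetric]
    by (intro integral_diff integrable continuous_on_mult f continuous_weight affine_fun_continuous l)
  then show ?thesis using vol(2) by (simp add: D_eq[OF f] l(2) left_diff_distrib diff_divide_distrib)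
qed

lemma average_ge_inf:
  fixes h :: "real^'n \<Rightarrow> real"
  assumes "continuous_on P h"
  shows "0 \<le> 1 / vol P * (LINT x:P|lborel. h x) - (INF x\<in>P. h x)"
proof -
  have bdd: "bdd_below (h ` P)"
    by (rule bounded_imp_bdd_below[OF compact_imp_bounded[OF compact_continuous_image[OF assms compact]]])
  have "integral P (\<lambda>x. (INF x\<in>P. h x) * 1) \<le> integral P h"
    by (intro integral_le integrable assms continuous_intros) (simp add: cINF_lower[OF bdd])
  then have "(INF x\<in>P. h x) * vol P \<le> integral P h" unfolding vol(1) integral_mult_right[symmetric] .
  then show ?thesis using vol(2) by (simp add: int[OF assms] pos_le_divide_eq)
qed

lemma J_nonneg:
  assumes "continuous_on P f"
  shows "0 \<le> J_NA P f"
  unfolding J_NA_def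
proof (rule cINF_greatest)
  show "{l. affine_fun l} \<noteq> ({} :: (real^'n \<Rightarrow> real) set)" using affine_fun_const[of 0] by blast
  fix l :: "real^'n \<Rightarrow> real" assume "l \<in> {l. affine_fun l}"
  then show "0 \<le> 1 / vol P * (LINT x:P|lborel. f x + l x) - (INF x\<in>P. f x + l x)"
    by (intro average_ge_inf continuous_on_add[OF assms affine_fun_continuous]) simp
qed

text \<open>The choice of - l in the infimum makes the minimum over \<open>P\<close> equal to 0,
  attained at the origin.\<close>

lemma J_le:
  assumes f: "continuous_on P f" and l: "affine_fun l" "l 0 = f 0" "\<And>x. x \<in> P \<Longrightarrow> l x \<le> f x"
  shows "J_NA P f \<le> 1 / vol P * integral P (\<lambda>x. f x - l x)"
proof -
  let ?J = "\<lambda>l. 1 / vol P * (LINT x:P|lborel. f x + l x) - (INF x\<in>P. f x + l x)"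
  have "bdd_below (?J ` {l. affine_fun l})"
    by (intro bdd_belowI2[of _ 0] average_ge_inf continuous_on_add[OF f affine_fun_continuous]) simp
  moreover have neg: "affine_fun (\<lambda>x. - l x)" using affine_fun_cmult[OF l(1), of "- 1"] by simp
  ultimately have "J_NA P f \<le> ?J (\<lambda>x. - l x)" unfolding J_NA_def by (intro cINF_lower) auto
  also have "(INF x\<in>P. f x + - l x) = 0"
    by (rule cInf_eq_minimum) (use zero_P l(2,3) in \<open>auto intro!: image_eqI[of _ _ 0]\<close>)
  also have "(LINT x:P|lborel. f x + - l x) = integral P (\<lambda>x. f x - l x)"
    using f affine_fun_continuous[OF l(1)] by (simp add: int continuous_on_diff)
  finally show ?thesis by simp
qed

lemma rational_near:
  fixes z :: "real^'n"
  assumes "0 < e"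
  shows "\<exists>a. (\<forall>i. a $ i \<in> \<rat>) \<and> (\<forall>x\<in>P. \<bar>(a - z) \<bullet> x\<bar> \<le> e)"
proof -
  obtain B where B: "B > 0" "\<And>x. x \<in> P \<Longrightarrow> norm x \<le> B"
    using compact_imp_bounded[OF compact] unfolding bounded_pos by blast
  define d where "d = e / (real CARD('n) * B)"
  have d: "0 < d" using assms B(1) by (simp add: d_def)
  have "\<exists>q\<in>\<rat>. z $ i < q \<and> q < z $ i + d" for i
    using Rats_dense_in_real[of "z $ i" "z $ i + d"] d by auto
  then obtain q where q: "\<And>i. q i \<in> \<rat>" "\<And>i. z $ i < q i" "\<And>i. q i < z $ i + d" by metis
  have "\<bar>((\<chi> i. q i) - z) \<bullet> x\<bar> \<le> e" if x: "x \<in> P" for x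
  proof -
    have "\<bar>((\<chi> i. q i) - z) \<bullet> x\<bar> \<le> (\<Sum>i\<in>UNIV. \<bar>(q i - z $ i) * x $ i\<bar>)"
      unfolding inner_vec_def by (simp add: sum_abs)
    also have "\<dots> \<le> (\<Sum>i\<in>(UNIV :: 'n set). d * B)"
    proof (rule sum_mono)
      fix i
      have "\<bar>q i - z $ i\<bar> \<le> d" using q(2,3)[of i] by linarith
      moreover have "\<bar>x $ i\<bar> \<le> B" using component_le_norm_cart[of x i] B(2)[OF x] by linarith
      ultimately show "\<bar>(q i - z $ i) * x $ i\<bar> \<le> d * B" unfolding abs_mult using d by (intro mult_mono) auto
    qed
    also have "\<dots> = e" using B(1) by (simp add: d_def)
    finally show ?thesis .
  qed
  then show ?thesis using q(1) by (intro exI[of _ "\<chi> i. q i"]) simp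
qed

text \<open>If the weight g were negative somewhere, the integral of max 0 (- g) against g would be
  minus the integral of its square, hence negative. The value at 0 does not interfere, because g is
  nonnegative there. A rational approximation that still vanishes at 0 preserves the sign and
  contradicts semistability.\<close>

lemma semistable_nonneg:
  assumes semi: "relatively_Ding_semistable P" and v: "v \<in> P"
  shows "0 \<le> weight_fun v"
proof (rule ccontr)
  assume neg: "\<not> 0 \<le> weight_fun v"
  obtain z t where w: "weight_fun = (\<lambda>x. z \<bullet> x + t)" "integral P weight_fun = vol P"
    "\<And>i. integral P (\<lambda>x. x $ i * weight_fun x) = 0" by (rule weight_fun) blast
  let ?g = weight_fun
  have cg: "continuous_on S ?g" for S by (rule continuous_weight)
  have "0 \<le> integral P (\<lambda>x. ?g x * ?g x)" by (intro integral_nonneg integrable continuous_on_mult cg) simp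
  \<comment> \<open>The weight is itself affine, so the integral of its square is its value
    \<open>t\<close> at 0 times the volume.\<close>
  then have "0 \<le> t * vol P" using integral_affine_weight[OF weight_affine] by (simp add: w)
  then have t: "0 \<le> t" using vol(2) by (simp add: zero_le_mult_iff)
  let ?f0 = "\<lambda>x. max 0 (- ?g x)"
  have cf0: "continuous_on S ?f0" for S by (intro continuous_intros cg)
  have I0: "0 < integral P (\<lambda>x. ?f0 x * ?f0 x)"
  proof (rule ccontr)
    assume "\<not> ?thesis"
    moreover have "0 < integral P (\<lambda>x. ?f0 x * ?f0 x)" if x: "x \<in> interior P" "?f0 x \<noteq> 0" for x
    proof -
      have "0 < ?f0 x * ?f0 x" using x(2) by (simp only: zero_less_mult_iff linorder_neq_iff) blast
      then show ?thesis by (intro integral_pos_interior[OF compact continuous_on_mult[OF cf0 cf0] _ x(1)]) simp_all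
    qed
    ultimately have zero: "?f0 x = 0" if "x \<in> interior P" for x using that by blast
    \<comment> \<open>The point \<open>v\<close> may lie on the boundary. Since \<open>P\<close> is
      the closure of its interior, vanishing in the interior would carry over to
      \<open>v\<close>.\<close>
    have "closed {x \<in> P. ?f0 x = 0}"
      using continuous_closed_preimage_constant[OF cf0 compact_imp_closed[OF compact]] .
    moreover have "interior P \<subseteq> {x \<in> P. ?f0 x = 0}" using zero interior_subset by blast
    ultimately have "closure (interior P) \<subseteq> {x \<in> P. ?f0 x = 0}" by (rule closure_minimal[rotated])
    then have "P \<subseteq> {x \<in> P. ?f0 x = 0}"
      using convex_closure_interior[OF convex] interior closure_subset by blast
    then show False using v neg by force
  qed
  define N where "N = integral P (\<lambda>x. \<bar>?g x\<bar>)"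
  have N: "0 \<le> N" unfolding N_def by (intro integral_nonneg integrable continuous_intros cg) simp
  \<comment> \<open>An approximation within 2 e of \<open>?f0\<close> changes the integral against
    the weight by at most 2 e N; with this choice the change stays below the integral of the square
    of \<open>?f0\<close>.\<close>
  define e where "e = integral P (\<lambda>x. ?f0 x * ?f0 x) / (2 * (2 * (N + 1)))"
  have e: "0 < e" using I0 N by (simp add: e_def)
  obtain a where a: "\<forall>i. a $ i \<in> \<rat>" "\<forall>x\<in>P. \<bar>(a - (- z)) \<bullet> x\<bar> \<le> e" using rational_near[OF e] by blast
  \<comment> \<open>The constant term is approximated from below, so that the value of
    \<open>q\<close> at 0 is negative and that of \<open>f\<close> is 0.\<close>
  obtain b where b: "b \<in> \<rat>" "- t - e < b" "b < - t" using Rats_dense_in_real[of "- t - e" "- t"] e by auto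
  define q where "q x = a \<bullet> x + b" for x
  define f where "f x = max 0 (q x)" for x
  have qr: "rational_affine_fun q" unfolding rational_affine_fun_def q_def[abs_def] using a(1) b(1) by blast
  have zr: "rational_affine_fun (\<lambda>x::real^'n. 0)" unfolding rational_affine_fun_def by (intro exI[of _ 0]) simp
  have fr: "rational_PL_convex P f"
    unfolding rational_PL_convex_def
  proof
    show "convex_on P f"
    proof (rule convex_onI[OF _ convex])
      fix s :: real and x y assume s: "0 < s" "s < 1"
      have "q ((1 - s) *\<^sub>R x + s *\<^sub>R y) = (1 - s) * q x + s * q y"
        by (simp add: q_def inner_add_right algebra_simps)
      also have "\<dots> \<le> (1 - s) * f x + s * f y"
        using s by (intro add_mono mult_left_mono) (auto simp: f_def)
      finally show "f ((1 - s) *\<^sub>R x + s *\<^sub>R y) \<le> (1 - s) * f x + s * f y"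
        using s unfolding f_def[of "(1 - s) *\<^sub>R x + s *\<^sub>R y"] by (simp add: f_def)
    qed
    show "\<exists>L. finite L \<and> L \<noteq> {} \<and> (\<forall>l\<in>L. rational_affine_fun l) \<and> (\<forall>x\<in>P. f x = Max ((\<lambda>l. l x) ` L))"
      using qr zr by (intro exI[of _ "{\<lambda>x. 0, q}"]) (simp add: f_def)
  qed
  have cf: "continuous_on P f" by (rule PL_continuous[OF fr])
  have near: "\<bar>f x - ?f0 x\<bar> \<le> 2 * e" if "x \<in> P" for x
  proof -
    have "q x + ?g x = (a - (- z)) \<bullet> x + (b + t)" by (simp add: q_def w inner_add_left)
    then have "\<bar>q x + ?g x\<bar> \<le> 2 * e" using bspec[OF a(2) that] b(2,3) by linarith
    then show ?thesis unfolding f_def by linarith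
  qed
  have "f 0 = 0" using b(3) t by (simp add: f_def q_def)
  then have "0 \<le> integral P (\<lambda>x. f x * ?g x)"
    using semi fr vol(2) unfolding relatively_Ding_semistable_def by (fastforce simp: D_eq[OF cf] zero_le_divide_iff)
  also have "\<dots> \<le> integral P (\<lambda>x. (2 * e) * \<bar>?g x\<bar> - ?f0 x * ?f0 x)"
  proof (intro integral_le integrable continuous_intros cf cg)
    fix x assume x: "x \<in> P"
    have "?f0 x * ?g x = - (?f0 x * ?f0 x)" by (simp add: max_def)
    moreover have "(f x - ?f0 x) * ?g x \<le> \<bar>f x - ?f0 x\<bar> * \<bar>?g x\<bar>" by (metis abs_ge_self abs_mult)
    moreover have "\<bar>f x - ?f0 x\<bar> * \<bar>?g x\<bar> \<le> (2 * e) * \<bar>?g x\<bar>" using near[OF x] by (intro mult_right_mono) auto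
    ultimately show "f x * ?g x \<le> (2 * e) * \<bar>?g x\<bar> - ?f0 x * ?f0 x" by (simp add: left_diff_distrib)
  qed
  also have "\<dots> = integral P (\<lambda>x. (2 * e) * \<bar>?g x\<bar>) - integral P (\<lambda>x. ?f0 x * ?f0 x)"
    by (intro integral_diff integrable continuous_intros cg)
  also have "integral P (\<lambda>x. (2 * e) * \<bar>?g x\<bar>) = (2 * e) * N"
    unfolding N_def by (rule integral_mult_right)
  finally have "integral P (\<lambda>x. ?f0 x * ?f0 x) \<le> (2 * e) * N" by simp
  also have "\<dots> < (2 * e) * (N + 1) * 2" using e N by (simp add: algebra_simps add_pos_nonneg)
  also have "\<dots> = integral P (\<lambda>x. ?f0 x * ?f0 x)" using N by (simp add: e_def field_simps)
  finally show False by simp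
qed

lemma semistable_mabuchi_pos:
  assumes "relatively_Ding_semistable P" "mabuchi_constant P \<noteq> 1"
  shows "\<exists>e>0. \<forall>x\<in>P. e \<le> weight_fun x"
proof -
  obtain v where v: "v \<in> P" "mabuchi_constant P = 1 - weight_fun v" "\<forall>x\<in>P. weight_fun v \<le> weight_fun x"
    using mabuchi by blast
  then have "0 < weight_fun v" using semistable_nonneg[OF assms(1) v(1)] assms(2) by auto
  then show ?thesis using v(3) by blast
qed

text \<open>For an affine function \<open>l\<close> that supports \<open>f\<close> at 0, D is the
  average of f - l against the weight, and J is at most the plain average of f - l. A lower bound of
  the weight therefore serves as the constant.\<close>

lemma positive_uniform:
  assumes e: "0 < e" "\<forall>x\<in>P. e \<le> weight_fun x"
  shows "uniformly_relatively_Ding_stable P"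
  unfolding uniformly_relatively_Ding_stable_def
proof (intro exI[of _ e] conjI allI impI)
  fix f assume f: "rational_PL_convex P f"
  have cf: "continuous_on P f" by (rule PL_continuous[OF f])
  obtain l where l: "affine_fun l" "l 0 = f 0" "\<And>x. x \<in> P \<Longrightarrow> l x \<le> f x" using PL_support[OF f] by blast
  have cl: "continuous_on P l" by (rule affine_fun_continuous[OF l(1)])
  have "e * J_NA P f \<le> e * (1 / vol P * integral P (\<lambda>x. f x - l x))"
    using e(1) by (intro mult_left_mono J_le[OF cf l]) simp_all
  also have "\<dots> = 1 / vol P * integral P (\<lambda>x. e * (f x - l x))" by simp
  also have "\<dots> \<le> 1 / vol P * integral P (\<lambda>x. (f x - l x) * weight_fun x)"
  proof (intro mult_left_mono integral_le integrable continuous_intros cf cl continuous_weight)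
    fix x assume x: "x \<in> P"
    show "e * (f x - l x) \<le> (f x - l x) * weight_fun x"
      using mult_right_mono[of e "weight_fun x" "f x - l x"] e(2) l(3)[OF x] x by (simp add: mult.commute)
  qed (use vol(2) in simp)
  also have "\<dots> = D_NA P f" by (rule D_shift[OF cf l(1,2), symmetric])
  finally show "e * J_NA P f \<le> D_NA P f" .
qed (rule e(1))

lemma uniform_semistable:
  assumes "uniformly_relatively_Ding_stable P"
  shows "relatively_Ding_semistable P"
  unfolding relatively_Ding_semistable_def
proof (intro allI impI)
  fix f assume f: "rational_PL_convex P f"
  obtain d where d: "d > 0" "d * J_NA P f \<le> D_NA P f"
    using assms f unfolding uniformly_relatively_Ding_stable_def by blast
  have "0 \<le> d * J_NA P f" using d(1) J_nonneg[OF PL_continuous[OF f]] by simp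
  with d(2) show "0 \<le> D_NA P f" by linarith
qed

text \<open>The integrand in \<open>D_shift\<close> is nonnegative, so a vanishing integral makes
  \<open>f\<close> agree with its supporting function in the interior and, by continuity, on all of
  \<open>P\<close>.\<close>

lemma D_zero_iff:
  assumes e: "0 < e" "\<forall>x\<in>P. e \<le> weight_fun x" and f: "rational_PL_convex P f"
  shows "D_NA P f = 0 \<longleftrightarrow> affine_fun_on P f"
proof
  have cf: "continuous_on P f" by (rule PL_continuous[OF f])
  {
    assume D: "D_NA P f = 0"
    obtain l where l: "affine_fun l" "l 0 = f 0" "\<And>x. x \<in> P \<Longrightarrow> l x \<le> f x" using PL_support[OF f] by blast
    have cfl: "continuous_on P (\<lambda>x. f x - l x)" by (intro continuous_on_diff cf affine_fun_continuous l)
    have I: "integral P (\<lambda>x. (f x - l x) * weight_fun x) = 0"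
      using D vol(2) unfolding D_shift[OF cf l(1,2)] by simp
    have zero: "f x - l x = 0" if x: "x \<in> interior P" for x
    proof (rule ccontr)
      assume "f x - l x \<noteq> 0"
      moreover have xP: "x \<in> P" using x interior_subset by blast
      ultimately have "0 < (f x - l x) * weight_fun x" using l(3)[OF xP] e by (intro mult_pos_pos) force+
      moreover have "0 \<le> (f y - l y) * weight_fun y" if "y \<in> P" for y
        using l(3)[OF that] e that by (intro mult_nonneg_nonneg) force+
      ultimately have "0 < integral P (\<lambda>x. (f x - l x) * weight_fun x)"
        by (intro integral_pos_interior[OF compact _ _ x] continuous_on_mult cfl continuous_weight)
      then show False using I by simp
    qed
    have "closed {x \<in> P. f x - l x = 0}"
      using continuous_closed_preimage_constant[OF cfl compact_imp_closed[OF compact]] .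
    moreover have "interior P \<subseteq> {x \<in> P. f x - l x = 0}" using zero interior_subset by blast
    ultimately have "closure (interior P) \<subseteq> {x \<in> P. f x - l x = 0}" by (rule closure_minimal[rotated])
    then have "P \<subseteq> {x \<in> P. f x - l x = 0}"
      using convex_closure_interior[OF convex] interior closure_subset by blast
    then show "affine_fun_on P f" unfolding affine_fun_on_def using l(1) by (intro exI[of _ l]) auto
  next
    assume "affine_fun_on P f"
    then obtain l where l: "affine_fun l" "\<forall>x\<in>P. f x = l x" by (auto simp: affine_fun_on_def)
    have "integral P (\<lambda>x. (f x - l x) * weight_fun x) = integral P (\<lambda>x. 0)"
      by (rule integral_cong) (simp add: l(2))
    then show "D_NA P f = 0" using l zero_P by (simp add: D_shift[OF cf l(1)])
  }
qed

lemma stable_iff_uniform: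
  assumes "mabuchi_constant P \<noteq> 1"
  shows "relatively_Ding_stable P \<longleftrightarrow> uniformly_relatively_Ding_stable P"
  unfolding relatively_Ding_stable_def
  using semistable_mabuchi_pos[OF _ assms] positive_uniform uniform_semistable D_zero_iff by metis

end

section \<open>Execution of the search\<close>

lemma level_checks_1: "list_all (level_check 1) (all_levels 1)"
  by code_simp

lemma level_checks_2: "list_all (level_check 2) (all_levels 2)"
  by code_simp

lemma level_checks_3: "list_all (level_check 3) (all_levels 3)"
  by code_simp

text \<open>Written out so that dimension four can be divided into independent computations.\<close>

lemma all_levels_4: "all_levels 4 =
   [[0, 0, 0, 0], [0, 0, 0, 1], [0, 0, 0, 2], [0, 0, 0, 3], [0, 0, 0, 4], [0, 0, 1, 1],
    [0, 0, 1, 2], [0, 0, 1, 3], [0, 0, 2, 2], [0, 0, 3, 3], [0, 0, 4, 4], [0, 1, 1, 1],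
    [0, 1, 1, 2], [0, 1, 1, 3], [0, 1, 2, 2], [0, 1, 3, 3], [0, 2, 2, 2], [0, 3, 3, 3],
    [0, 4, 4, 4], [1, 1, 1, 1], [1, 1, 1, 2], [1, 1, 1, 3], [1, 1, 2, 2], [1, 1, 3, 3],
    [1, 2, 2, 2], [1, 3, 3, 3], [2, 2, 2, 2], [3, 3, 3, 3], [4, 4, 4, 4]]"
  by code_simp

lemma level_check_0000: "level_check 4 [0, 0, 0, 0]"
  by code_simp

lemma level_check_0001: "level_check 4 [0, 0, 0, 1]"
  by code_simp

lemma level_check_0011: "level_check 4 [0, 0, 1, 1]"
  by code_simp

lemma level_check_0002: "level_check 4 [0, 0, 0, 2]"
  by code_simp

lemma level_check_0012: "level_check 4 [0, 0, 1, 2]"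
  by code_simp

lemma level_check_0022: "level_check 4 [0, 0, 2, 2]"
  by code_simp

lemma level_check_0003: "level_check 4 [0, 0, 0, 3]"
  by code_simp

lemma level_check_0111: "level_check 4 [0, 1, 1, 1]"
  by code_simp

lemma level_checks_4_a:
  "list_all (level_check 4)
   [[0, 0, 0, 4], [0, 0, 3, 3], [0, 1, 1, 2], [0, 1, 2, 2], [0, 2, 2, 2], [0, 4, 4, 4],
    [1, 1, 1, 2], [1, 1, 2, 2], [1, 2, 2, 2], [2, 2, 2, 2], [4, 4, 4, 4]]"
  by code_simp

lemma level_checks_4_b:
  "list_all (level_check 4)
   [[0, 0, 1, 3], [0, 0, 4, 4], [0, 1, 1, 3], [0, 1, 3, 3], [0, 3, 3, 3], [1, 1, 1, 1],
    [1, 1, 1, 3], [1, 1, 3, 3], [1, 3, 3, 3], [3, 3, 3, 3]]"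
  by code_simp

lemma level_checks_4: "list_all (level_check 4) (all_levels 4)"
  using level_check_0000 level_check_0001 level_check_0011 level_check_0002 level_check_0012 level_check_0022 level_check_0003 level_check_0111
    level_checks_4_a level_checks_4_b
  unfolding all_levels_4 by (simp only: list.pred_inject simp_thms)

section \<open>The Mabuchi constant of a Fano polytope\<close>

context fano begin

definition opp :: "real^'n \<Rightarrow> real^'n \<Rightarrow> real^'n" where
  "opp v w = (SOME x. x \<in> normals \<and> x \<bullet> dir v w = - 1 \<and> v + (x \<bullet> v + 1) *\<^sub>R dir v w \<in> vertices \<and>
    tight (v + (x \<bullet> v + 1) *\<^sub>R dir v w) = insert x (tight v - {w}))"

lemma opp:
  assumes "v \<in> vertices" "w \<in> tight v"
  shows "opp v w \<in> normals" "opp v w \<bullet> dir v w = - 1" "v + (opp v w \<bullet> v + 1) *\<^sub>R dir v w \<in> vertices"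
    "tight (v + (opp v w \<bullet> v + 1) *\<^sub>R dir v w) = insert (opp v w) (tight v - {w})"
proof -
  have "\<exists>x. x \<in> normals \<and> x \<bullet> dir v w = - 1 \<and> v + (x \<bullet> v + 1) *\<^sub>R dir v w \<in> vertices \<and>
    tight (v + (x \<bullet> v + 1) *\<^sub>R dir v w) = insert x (tight v - {w})"
    using neighbor[OF assms] by blast
  from someI_ex[OF this, folded opp_def]
  show "opp v w \<in> normals" "opp v w \<bullet> dir v w = - 1" "v + (opp v w \<bullet> v + 1) *\<^sub>R dir v w \<in> vertices"
    "tight (v + (opp v w \<bullet> v + 1) *\<^sub>R dir v w) = insert (opp v w) (tight v - {w})" by blast+
qed

text \<open>The four sorting keys of an edge, phrased without coordinates so that they do not depend
  on the enumeration that they are to sort. Keys are compared lexicographically; column sums and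
  total sums are to be nonincreasing, hence their signs.\<close>

definition edge_key :: "real^'n \<Rightarrow> real^'n \<Rightarrow> int list" where
  "edge_key v w = [- (\<Sum>y\<in>tight v. \<lfloor>opp v w \<bullet> dir v y\<rfloor>),
    (\<Sum>y\<in>tight v. (10 + \<lfloor>opp v w \<bullet> dir v y\<rfloor>) * (\<lfloor>opp v w \<bullet> dir v y\<rfloor> * \<lfloor>opp v w \<bullet> dir v y\<rfloor>)),
    - (\<Sum>y\<in>tight v. (\<lfloor>opp v y \<bullet> dir v w\<rfloor> + 3) * \<lfloor>opp v y \<bullet> dir v w\<rfloor>),
    - (\<Sum>x\<in>normals. \<lfloor>x \<bullet> dir v w\<rfloor>)]"

sublocale convex_body P
  using polytope_P(1,2) zero_interior by unfold_locales

end

context fano_coords begin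

definition nb :: "nat \<Rightarrow> int list" where
  "nb i = L (opp v0 (ds ! i))"

lemma sum_ds: "(\<Sum>k<n. h (ds ! k)) = (\<Sum>y\<in>tight v0. h y)"
  using sum.reindex_bij_betw[OF bij_betw_nth[OF ds(1), of "{..<n}" "tight v0"], of h] ds(2) length_ds by simp

lemma edge_key_nb:
  assumes "i < n"
  shows "edge_key v0 (ds ! i) = [- sum_list (nb i), weight (nb i), - col_sum n nb i, - (\<Sum>w\<in>VL. w ! i)]"
proof -
  have "sum_list (nb i) = (\<Sum>y\<in>tight v0. \<lfloor>opp v0 (ds ! i) \<bullet> dir v0 y\<rfloor>)"
    by (simp add: nb_def L_def us_def interv_sum_list_conv_sum_set_nat atLeast0LessThan sum_ds[symmetric])
  moreover have "weight (nb i) = (\<Sum>y\<in>tight v0. (10 + \<lfloor>opp v0 (ds ! i) \<bullet> dir v0 y\<rfloor>) *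
      (\<lfloor>opp v0 (ds ! i) \<bullet> dir v0 y\<rfloor> * \<lfloor>opp v0 (ds ! i) \<bullet> dir v0 y\<rfloor>))"
    by (simp add: nb_def L_def us_def weight_map sum_ds[symmetric])
  moreover have "col_sum n nb i = (\<Sum>y\<in>tight v0. (\<lfloor>opp v0 y \<bullet> dir v0 (ds ! i)\<rfloor> + 3) * \<lfloor>opp v0 y \<bullet> dir v0 (ds ! i)\<rfloor>)"
    using assms by (simp add: nb_def L_def us_def col_sum_def sum_ds[symmetric])
  moreover have "(\<Sum>w\<in>VL. w ! i) = (\<Sum>x\<in>normals. \<lfloor>x \<bullet> dir v0 (ds ! i)\<rfloor>)"
    unfolding VL_def using assms normal_int
    by (subst sum.reindex[OF inj_on_subset[OF inj_L]]) (auto simp: L_def us_def)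
  ultimately show ?thesis by (simp add: edge_key_def)
qed

lemma star:
  assumes "sorted (map (edge_key v0) ds)"
  shows "star_fan n VL SL UL TL nb"
proof (intro star_fan.intro star_fan_axioms.intro)
  show "fan n VL SL UL TL" by (rule F.fan_axioms)
  show "0 < n" by (rule n_pos)
  have L0: "L 0 = map (\<lambda>i. 0) [0..<n]" by (simp add: L_def)
  show "map (\<lambda>i. 0) [0..<n] \<notin> VL"
  proof
    assume "map (\<lambda>i. 0) [0..<n] \<in> VL"
    then obtain w where w: "w \<in> normals" "L w = L 0" unfolding VL_def L0 by auto
    have "(0 :: real^'n) \<in> int_lattice" by (simp add: int_lattice_def)
    then have "w = 0" using w L_eq normal_int by blast
    then show False using w(1) zero_not_normal by simp
  qed
  show "origin n \<in> SL" unfolding SL_def M_v0[symmetric] using v0(1) by blast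
  show T0: "TL (origin n) = unit n ` {..<n}"
  proof -
    have "TL (origin n) = L ` set ds" unfolding M_v0[symmetric] TL_M[OF v0(1)] ds(2) ..
    also have "\<dots> = (\<lambda>k. L (ds ! k)) ` {..<n}" unfolding set_conv_nth length_ds by auto
    also have "\<dots> = unit n ` {..<n}" by (intro image_cong) (auto simp: L_ds)
    finally show ?thesis .
  qed
  show "UL (origin n) (unit n i) = unit n i" if "i < n" for i
    using UL_M[OF v0(1) ds_tight[OF that]] that by (simp add: M_v0 L_ds M_us flip: us_def)
  show "0 \<le> (\<Sum>w\<in>VL. w ! i)" if i: "i < n" for i
  proof -
    have "of_int (\<Sum>w\<in>VL. w ! i) = (\<Sum>x\<in>normals. x \<bullet> us i)"
      unfolding VL_def using i normal_int
      by (subst sum.reindex[OF inj_on_subset[OF inj_L]]) (auto simp: nth_L)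
    then have "0 \<le> (of_int (\<Sum>w\<in>VL. w ! i) :: real)" using v0(2) ds_tight[OF i] by (simp add: us_def)
    then show ?thesis by (simp only: of_int_0_le_iff)
  qed
  note opp0 = opp[OF v0(1) ds_tight]
  show "nb i \<in> VL" if "i < n" for i using opp0(1)[OF that] by (simp add: nb_def VL_def)
  show "nb i ! i = - 1" if "i < n" for i
  proof -
    have "of_int (nb i ! i) = (of_int (- 1) :: real)"
      using nth_L[OF normal_int[OF opp0(1)[OF that]] that] opp0(2)[OF that] by (simp add: nb_def us_def)
    then show ?thesis by (simp only: of_int_eq_iff)
  qed
  have nbr: "nbr (origin n) (unit n i) (nb i) = M (v0 + (opp v0 (ds ! i) \<bullet> v0 + 1) *\<^sub>R dir v0 (ds ! i))" if "i < n" for i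
    using nbr_M[OF v0(1) ds_tight[OF that] opp0(1)[OF that]] UL_M[OF v0(1) ds_tight[OF that]] that
    by (simp add: M_v0 L_ds M_us nb_def flip: us_def)
  show "nbr (origin n) (unit n i) (nb i) \<in> SL" if "i < n" for i
    unfolding nbr[OF that] SL_def using opp0(3)[OF that] by blast
  show "TL (nbr (origin n) (unit n i) (nb i)) = insert (nb i) (TL (origin n) - {unit n i})" if i: "i < n" for i
  proof -
    have "TL (origin n) - {unit n i} = L ` (tight v0 - {ds ! i})"
      using L_Diff[OF v0(1) ds_tight[OF i]] TL_M[OF v0(1)] by (simp add: M_v0 L_ds i)
    then show ?thesis unfolding nbr[OF i] TL_M[OF opp0(3)[OF i]] opp0(4)[OF i] by (simp only: image_insert nb_def)
  qed
  have key: "edge_key v0 (ds ! i) \<le> edge_key v0 (ds ! Suc i)" if "Suc i < n" for i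
    using sorted_nth_mono[OF assms, of i "Suc i"] that length_ds by simp
  have key': "[- sum_list (nb i), weight (nb i), - col_sum n nb i, - (\<Sum>w\<in>VL. w ! i)] \<le>
    [- sum_list (nb (Suc i)), weight (nb (Suc i)), - col_sum n nb (Suc i), - (\<Sum>w\<in>VL. w ! Suc i)]" if "Suc i < n" for i
    using key[OF that] edge_key_nb[of i] edge_key_nb[of "Suc i"] that by simp
  show "sum_list (nb (Suc i)) \<le> sum_list (nb i)" if "Suc i < n" for i
    using key'[OF that] by auto
  show "weight (nb i) \<le> weight (nb (Suc i))" if "Suc i < n" "sum_list (nb (Suc i)) = sum_list (nb i)" for i
    using key'[OF that(1)] that(2) by auto
  show "col_sum n nb (Suc i) \<le> col_sum n nb i"
    if "Suc i < n" "sum_list (nb (Suc i)) = sum_list (nb i)" "weight (nb i) = weight (nb (Suc i))" for i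
    using key'[OF that(1)] that(2,3) by auto
  show "(\<Sum>w\<in>VL. w ! Suc i) \<le> (\<Sum>w\<in>VL. w ! i)"
    if "Suc i < n" "sum_list (nb (Suc i)) = sum_list (nb i)" "weight (nb i) = weight (nb (Suc i))"
      "col_sum n nb (Suc i) = col_sum n nb i" for i
    using key'[OF that(1)] that(2-4) by auto
qed

text \<open>For the constant 1 the minimum of g is 0, and an affine function attains its minimum at
  a vertex. In the coordinates of the special vertex the coefficients of g would then all vanish,
  although its integral is the volume.\<close>

lemma mabuchi_not_1:
  assumes sorted: "sorted (map (edge_key v0) ds)" and check: "\<And>ks. ks \<in> set (all_levels n) \<Longrightarrow> level_check n ks"
  shows "mabuchi_constant P \<noteq> 1"
proof
  assume one: "mabuchi_constant P = 1"
  interpret S: star_fan n VL SL UL TL nb by (rule star[OF sorted])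
  obtain W fs where W: "naming W" "snd ` set W \<subseteq> VL" "\<forall>(l, v) \<in> set fs. named W l (TL v)" "snd ` set fs = SL"
    "moment_check n W (homogenize fs)"
    using S.level_check_sound[OF check[OF S.lev_all_levels]] by blast
  obtain z t where w: "weight_fun = (\<lambda>x. z \<bullet> x + t)" "integral P weight_fun = vol P" by (rule weight_fun) blast
  obtain v where v: "v \<in> P" "mabuchi_constant P = 1 - weight_fun v" "\<forall>x\<in>P. weight_fun v \<le> weight_fun x"
    using mabuchi by blast
  have v_zero: "weight_fun v = 0" using v(2) one by simp
  obtain p where p: "p \<in> vertices" "\<And>p'. p' \<in> vertices \<Longrightarrow> weight_fun p \<le> weight_fun p'"
    using ex_min_if_finite[of "weight_fun ` vertices"] polytope_P(3) vertices_nonempty by (force simp: not_less)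
  have "convex hull vertices \<subseteq> {x. z \<bullet> p \<le> z \<bullet> x}"
    using p(2) by (intro hull_minimal convex_halfspace_ge[of _ z, simplified]) (auto simp: w(1))
  then have "weight_fun p \<le> weight_fun v" using v(1) polytope_P(5) by (auto simp: w(1))
  then have p_zero: "weight_fun p = 0" using v(3) vertex_P[OF p(1)] v_zero by force
  define zl where "zl = map (\<lambda>k. z \<bullet> us k) [0..<n] @ [t]"
  have hval: "G.hval zl x = weight_fun x" for x
  proof -
    have "G.hval zl x = (\<Sum>k<n. (ds ! k \<bullet> x) * (z \<bullet> us k)) + t"
      by (simp add: G.hval_def G.hcoord_def zl_def nth_append)
    also have "(\<Sum>k<n. (ds ! k \<bullet> x) * (z \<bullet> us k)) = z \<bullet> x"
      by (subst (2) expand_us[of x]) (simp add: inner_sum_right)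
    finally show ?thesis by (simp add: w(1))
  qed
  have "{x. \<forall>w\<in>VL. - 1 \<le> Y w \<bullet> x} = {x. \<forall>w\<in>Y ` VL. - 1 \<le> w \<bullet> x}" by simp
  also have "\<dots> = P" unfolding Y_VL by (rule P_eq[symmetric])
  finally have set_P: "{x. \<forall>w\<in>VL. - 1 \<le> Y w \<bullet> x} = P" .
  have "\<forall>a\<in>set zl. a = 0"
  proof (rule G.moment_check_sound[OF W])
    show "length zl = Suc n" by (simp add: zl_def)
    show "M p \<in> SL" using p(1) by (simp add: SL_def)
    show "G.hval zl (X (M p)) = 0" unfolding hval X_M[OF vertex_int[OF p(1)]] by (rule p_zero)
    show "integral {x. \<forall>w\<in>VL. - 1 \<le> Y w \<bullet> x} (\<lambda>x. ds ! i \<bullet> x * G.hval zl x) = 0" for i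
      unfolding set_P hval using integral_affine_weight[of "\<lambda>x. ds ! i \<bullet> x"] by simp
  qed
  then have "t = 0" "\<And>k. k < n \<Longrightarrow> z \<bullet> us k = 0" by (auto simp: zl_def)
  moreover from this(2) have "z = 0" by (subst expand_ds[of z]) simp
  ultimately have "vol P = 0" using w by simp
  then show False using vol(2) by simp
qed

end

lemma fano_mabuchi_not_1:
  fixes P :: "(real^'n::finite) set"
  assumes "fano_polytope P" "\<And>ks. ks \<in> set (all_levels CARD('n)) \<Longrightarrow> level_check CARD('n) ks"
  shows "mabuchi_constant P \<noteq> 1"
proof -
  interpret fano P by unfold_locales (rule assms(1))
  obtain v0 where v0: "v0 \<in> vertices" "\<forall>w\<in>tight v0. 0 \<le> (\<Sum>x\<in>normals. x \<bullet> dir v0 w)" using special_vertex by blast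
  have "finite (tight v0)" using polytope_Q(3) by (simp add: tight_def)
  then obtain ds where ds': "distinct ds" "set ds = tight v0" "sorted (map (edge_key v0) ds)" by (rule sorted_enum)
  interpret fano_coords P v0 ds "CARD('n)" by unfold_locales (use v0 ds' in auto)
  show ?thesis by (rule mabuchi_not_1[OF ds'(3) assms(2)])
qed

theorem corollary1p4:
  assumes "CARD('n::finite) \<le> 4"
  shows "\<not> (\<exists>P :: (real ^ 'n) set. fano_polytope P \<and> mabuchi_constant P = 1) \<and>
    (\<forall>P :: (real ^ 'n) set. fano_polytope P \<longrightarrow>
      (relatively_Ding_stable P \<longleftrightarrow> uniformly_relatively_Ding_stable P))"
proof -
  let ?n = "CARD('n)"
  have "?n = 1 \<or> ?n = 2 \<or> ?n = 3 \<or> ?n = 4"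
    using assms zero_less_card_finite[where 'a='n] by linarith
  then have "list_all (level_check ?n) (all_levels ?n)"
    using level_checks_1 level_checks_2 level_checks_3 level_checks_4 by metis
  then have not_1: "mabuchi_constant P \<noteq> 1" if "fano_polytope P" for P :: "(real ^ 'n) set"
    using that by (intro fano_mabuchi_not_1) (simp_all add: list_all_iff)
  moreover have "relatively_Ding_stable P \<longleftrightarrow> uniformly_relatively_Ding_stable P"
    if P: "fano_polytope P" for P :: "(real ^ 'n) set"
  proof -
    interpret fano P by unfold_locales (rule P)
    show ?thesis by (rule stable_iff_uniform[OF not_1[OF P]])
  qed
  ultimately show ?thesis by blast
qed

end
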